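(* Let $\mathbf{Q}=(Q_m)_{m\ge0}$ be a strictly increasing sequence of positive real numbers with $Q_0>1$, $Q_m\to\infty$ and $\inf_{m\ge0}Q_{m+1}/Q_m^{\tau}>0$ for some $\tau>1$. Let $\mathcal{C}\subset\mathbb{R}^2$ be a regular $C^2$ curve such that the set $\{z\in\mathcal{C}:\kappa(z)\ne0\}$ is absolutely winning on $\mathcal{C}$. Put $$E=\Big\{(x,y)\in\mathbb{R}^2:\ \limsup_{Q\to+\infty}\ Q\cdot\min_{1\le q\le Q}\langle qx\rangle\langle qy\rangle>0\Big\},\qquad E_{\mathbf{Q}}=\Big\{(x,y)\in\mathbb{R}^2:\ \liminf_{m\to+\infty}\ Q_m\cdot\min_{1\le q\le Q_m}\langle qx\rangle\langle qy\rangle>0\Big\}.$$ Then the sets $E\cap\mathcal{C}$ and $E_{\mathbf{Q}}\cap\mathcal{C}$ are absolutely winning on $\mathcal{C}$. In particular, their intersection with every nonempty open arc of $\mathcal{C}$ has Hausdorff dimension one.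
   Context: For $x\in\mathbb{R}$, $\langle x\rangle$ denotes the distance from $x$ to the nearest integer; $q$ ranges over positive integers. A regular $C^2$ curve $\mathcal{C}\subset\mathbb{R}^2$ is a one-dimensional embedded $C^2$ submanifold; $\kappa(z)$ is its curvature at $z\in\mathcal{C}$. Hyperplane absolute winning (HAW). Let $U\subset\mathbb{R}^d$ be open, $S\subset\mathbb{R}^d$, $\beta\in(0,1/3)$. For an affine hyperplane $L\subset\mathbb{R}^d$ and $r>0$ put $L^{(r)}=\{z\in\mathbb{R}^d:\mathrm{dist}(z,L)\le r\}$. Bob first chooses a closed ball $B_0\subset U$ of radius $\rho_0>0$. After Bob chooses a closed ball $B_n$ of radius $\rho_n$, Alice chooses $L_n^{(r_n)}$ with $r_n\le\beta\rho_n$, and then Bob chooses a closed ball $B_{n+1}\subset B_n\setminus L_n^{(r_n)}$ of radius $\rho_{n+1}\ge\beta\rho_n$. Alice wins by default if at any time Bob has no legal move, or if $\rho_n\not\to0$; otherwise Alice wins iff $\bigcap_nB_n\cap S\ne\varnothing$. $S$ is HAW on $U$ if for every $\beta\in(0,1/3)$ Alice has a winning strategy. A subset $S$ of a $d$-dimensional $C^1$ manifold $M$ with $C^1$ atlas $\{(U_\alpha,\varphi_\alpha)\}$ is HAW on $M$ if $\varphi_\alpha(S\cap U_\alpha)$ is HAW on $\varphi_\alpha(U_\alpha)$ for each $\alpha$ (this is independent of the atlas). On a one-dimensional manifold (where affine hyperplanes of the chart space $\mathbb{R}$ are points), "absolutely winning" is equivalent to HAW. *)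

theory Defs
  imports "HOL-Analysis.Analysis"
begin

section \<open>The hyperplane absolute game\<close>

definition affine_hyperplane :: "'a::euclidean_space set \<Rightarrow> bool" where
  "affine_hyperplane L \<longleftrightarrow> (\<exists>a b. a \<noteq> 0 \<and> L = {x. a \<bullet> x = b})"

definition hyperplane_nbhd :: "'a::euclidean_space set \<Rightarrow> real \<Rightarrow> 'a set" where
  "hyperplane_nbhd L r = {z. infdist z L \<le> r}"

text \<open>A closed ball is a pair (centre, radius). A strategy of Alice maps the nonempty list
  of the balls chosen by Bob so far, oldest first, to her next pair (hyperplane, radius).\<close>

type_synonym 'a alice_strategy = "('a \<times> real) list \<Rightarrow> 'a set \<times> real"

definition legal_strategy :: "real \<Rightarrow> 'a::euclidean_space alice_strategy \<Rightarrow> bool" where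
  "legal_strategy \<beta> \<sigma> \<longleftrightarrow>
    (\<forall>h. h \<noteq> [] \<and> 0 < snd (last h) \<longrightarrow>
      affine_hyperplane (fst (\<sigma> h)) \<and> 0 < snd (\<sigma> h) \<and> snd (\<sigma> h) \<le> \<beta> * snd (last h))"

definition play_against ::
    "'a::euclidean_space set \<Rightarrow> real \<Rightarrow> 'a alice_strategy \<Rightarrow> (nat \<Rightarrow> 'a \<times> real) \<Rightarrow> bool" where
  "play_against U \<beta> \<sigma> B \<longleftrightarrow>
    0 < snd (B 0) \<and> cball (fst (B 0)) (snd (B 0)) \<subseteq> U \<and>
    (\<forall>n. let (L, r) = \<sigma> (map B [0..<Suc n]) in
       \<beta> * snd (B n) \<le> snd (B (Suc n)) \<and>
       cball (fst (B (Suc n))) (snd (B (Suc n)))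
         \<subseteq> cball (fst (B n)) (snd (B n)) - hyperplane_nbhd L r)"

text \<open>Plays are infinite, so a position in which Bob has no legal move starts no play at all;
  this is the rule that Alice wins by default there.\<close>

definition winning_strategy ::
    "'a::euclidean_space set \<Rightarrow> 'a set \<Rightarrow> real \<Rightarrow> 'a alice_strategy \<Rightarrow> bool" where
  "winning_strategy U S \<beta> \<sigma> \<longleftrightarrow>
    (\<forall>B. play_against U \<beta> \<sigma> B \<longrightarrow> (\<lambda>n. snd (B n)) \<longlonglongrightarrow> 0 \<longrightarrow>
      (\<Inter>n. cball (fst (B n)) (snd (B n))) \<inter> S \<noteq> {})"

definition HAW_on :: "'a::euclidean_space set \<Rightarrow> 'a set \<Rightarrow> bool" where
  "HAW_on U S \<longleftrightarrow>
    (\<forall>\<beta>. 0 < \<beta> \<and> \<beta> < 1/3 \<longrightarrow> (\<exists>\<sigma>. legal_strategy \<beta> \<sigma> \<and> winning_strategy U S \<beta> \<sigma>))"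

section \<open>Curves in the plane\<close>

text \<open>The product norm on \<^typ>\<open>real \<times> real\<close> is the Euclidean one. A local parametrization is
  a \<open>C\<^sup>1\<close> immersion of an open subset of the line that is a homeomorphism onto a relatively
  open subset of the curve.\<close>

definition local_param ::
    "(real \<times> real) set \<Rightarrow> real set \<Rightarrow> (real \<Rightarrow> real \<times> real) \<Rightarrow> bool" where
  "local_param C I \<gamma> \<longleftrightarrow>
    open I \<and> openin (top_of_set C) (\<gamma> ` I) \<and> (\<exists>\<phi>. homeomorphism I (\<gamma> ` I) \<gamma> \<phi>) \<and>
    \<gamma> C1_differentiable_on I \<and> (\<forall>t\<in>I. vector_derivative \<gamma> (at t) \<noteq> 0)"

definition C2_local_param ::
    "(real \<times> real) set \<Rightarrow> real set \<Rightarrow> (real \<Rightarrow> real \<times> real) \<Rightarrow> bool" where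
  "C2_local_param C I \<gamma> \<longleftrightarrow>
    local_param C I \<gamma> \<and> (\<lambda>t. vector_derivative \<gamma> (at t)) C1_differentiable_on I"

definition regular_C2_curve :: "(real \<times> real) set \<Rightarrow> bool" where
  "regular_C2_curve C \<longleftrightarrow> (\<forall>z\<in>C. \<exists>I \<gamma>. C2_local_param C I \<gamma> \<and> z \<in> \<gamma> ` I)"

definition param_curvature :: "(real \<Rightarrow> real \<times> real) \<Rightarrow> real \<Rightarrow> real" where
  "param_curvature \<gamma> t =
    (let v = vector_derivative \<gamma> (at t);
         a = vector_derivative (\<lambda>s. vector_derivative \<gamma> (at s)) (at t)
     in \<bar>fst v * snd a - snd v * fst a\<bar> / norm v ^ 3)"

text \<open>Unsigned curvature; for a point of a regular \<open>C\<^sup>2\<close> curve the number described here exists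
  and is unique, because \<^const>\<open>param_curvature\<close> is invariant under reparametrization.\<close>

definition curvature :: "(real \<times> real) set \<Rightarrow> real \<times> real \<Rightarrow> real" where
  "curvature C z =
    (THE k. \<exists>I \<gamma> t. C2_local_param C I \<gamma> \<and> t \<in> I \<and> \<gamma> t = z \<and> k = param_curvature \<gamma> t)"

text \<open>The charts of the maximal \<open>C\<^sup>1\<close> atlas of the curve are the inverses of its local
  parametrizations.\<close>

definition C1_chart ::
    "(real \<times> real) set \<Rightarrow> (real \<times> real) set \<Rightarrow> (real \<times> real \<Rightarrow> real) \<Rightarrow> bool" where
  "C1_chart C U \<phi> \<longleftrightarrow>
    (\<exists>\<gamma>. homeomorphism U (\<phi> ` U) \<phi> \<gamma> \<and> local_param C (\<phi> ` U) \<gamma>)"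

definition absolutely_winning_on :: "(real \<times> real) set \<Rightarrow> (real \<times> real) set \<Rightarrow> bool" where
  "absolutely_winning_on C S \<longleftrightarrow> (\<forall>U \<phi>. C1_chart C U \<phi> \<longrightarrow> HAW_on (\<phi> ` U) (\<phi> ` (S \<inter> U)))"

definition open_arc :: "(real \<times> real) set \<Rightarrow> (real \<times> real) set \<Rightarrow> bool" where
  "open_arc C A \<longleftrightarrow> openin (top_of_set C) A \<and> A homeomorphic {0<..<1::real}"

section \<open>Hausdorff dimension\<close>

definition hausdorff_premeasure :: "real \<Rightarrow> real \<Rightarrow> 'a::metric_space set \<Rightarrow> ennreal" where
  "hausdorff_premeasure s \<delta> A =
    (INF U\<in>{U :: nat \<Rightarrow> 'a set. A \<subseteq> (\<Union>i. U i) \<and> (\<forall>i. bounded (U i) \<and> diameter (U i) \<le> \<delta>)}.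
      \<Sum>i. ennreal (diameter (U i) powr s))"

definition hausdorff_measure :: "real \<Rightarrow> 'a::metric_space set \<Rightarrow> ennreal" where
  "hausdorff_measure s A = (SUP \<delta>\<in>{0<..}. hausdorff_premeasure s \<delta> A)"

text \<open>Only positive exponents are used, so the value of \<open>0 powr 0\<close> plays no role.\<close>

definition hausdorff_dim :: "'a::metric_space set \<Rightarrow> ereal" where
  "hausdorff_dim A = (INF s\<in>{s. 0 < s \<and> hausdorff_measure s A = 0}. ereal s)"

section \<open>The Diophantine sets\<close>

definition dist_int :: "real \<Rightarrow> real" where
  "dist_int x = infdist x \<int>"

definition min_product :: "real \<times> real \<Rightarrow> real \<Rightarrow> real" where
  "min_product z Q =
    Min ((\<lambda>q::nat. dist_int (real q * fst z) * dist_int (real q * snd z))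
          ` {q. 1 \<le> q \<and> real q \<le> Q})"

definition E_set :: "(real \<times> real) set" where
  "E_set = {z. 0 < Limsup at_top (\<lambda>Q::real. ereal (Q * min_product z Q))}"

definition E_seq_set :: "(nat \<Rightarrow> real) \<Rightarrow> (real \<times> real) set" where
  "E_seq_set Q = {z. 0 < liminf (\<lambda>m. ereal (Q m * min_product z (Q m)))}"

end

theory Submission
  imports Defs
begin

text \<open>
  The proof plays a one-dimensional game in the parameter of the curve. Since \<open>Q m\<close> tends to
  infinity, a positive lower limit along \<open>Q\<close> forces a positive upper limit over all real \<open>Q\<close>, so
  every strategy for \<^const>\<open>E_seq_set\<close> is also one for \<^const>\<open>E_set\<close>.

  Alice first follows the strategy that leads to a point \<open>t0\<close> of nonzero curvature. Once
  Bob's ball is close to \<open>t0\<close> she removes \<open>t0\<close> itself, and on the next ball both coordinates of the velocity and the curvature stay away from zero: up to signs, one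
  coordinate \<open>X\<close> and the slope \<open>\<Phi>\<close> of the other coordinate \<open>Y\<close> against \<open>X\<close> are increasing and
  bi-Lipschitz (\<open>convex_arcs_near_curved_point\<close>), and this holds with either coordinate as \<open>X\<close>.

  A line with integer coefficients is a form \<open>F = a X + b Y + d\<close>; its rate of
  change along the arc is \<open>G = a + b \<Phi>\<close> times that of \<open>X\<close>. If some \<open>q \<le> Q m\<close> makes the product of the two
  distances smaller than \<open>\<delta> / Q m\<close>, a pigeonhole argument turns the rational point with denominator
  \<open>q\<close> into a line through it with \<open>\<bar>G\<bar> max 1 \<bar>b\<bar> \<le> 2 q\<close> and \<open>\<bar>F\<bar>\<close> at most a constant times
  \<open>sqrt (\<delta> / (q Q m))\<close> (\<open>product_ge_of_repelled\<close>). So it suffices that the parameter stays away from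
  all integer lines. For lines of size \<open>\<bar>G\<bar> max 1 \<bar>b\<bar>\<close> about \<open>2 ^ l\<close> the distance that is needed
  is smaller than \<open>2 ^ - l\<close> by a power of \<open>2 ^ l / Q m\<close>, where \<open>Q m\<close> is the first member of the
  sequence above \<open>2 ^ l\<close>. This gain is what the hypothesis on \<open>Q\<close> provides: as \<open>Q\<close> grows faster than
  every exponential, a fixed root \<open>\<sigma> l\<close> of the gain at scale \<open>l\<close> has powers with bounded sums over the
  ranges \<open>L \<le> l \<le> 3 L + A\<close> (\<open>exists_profile\<close>).

  The dangerous parameters form three families. \<open>near j\<close>: a line that is almost tangent at
  the parameter. Three such lines at well separated points would have a determinant strictly
  between \<open>0\<close> and \<open>1\<close>, which is impossible for integers (\<open>no_three_separated_tangents\<close>).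
  \<open>single i j\<close>: a transversal line comes too close. \<open>pair i j\<close>: two independent lines come close at
  once, which puts the parameter near a rational point; Alice's earlier moves force the denominator
  of that point to be large, and all the pairs in one ball share the same rational point
  (\<open>pair_denominator\<close>, \<open>pair_sparse\<close>). Outside the pairs, the lines that are responsible for
  \<open>single i j\<close> in one ball are proportional, so that \<open>single i j\<close> is short as well.

  Thus every family meets a ball of its own scale in at most two short intervals
  (\<open>danger_system\<close>). Alice gives an interval of length \<open>\<lambda>\<close> the weight \<open>\<lambda> powr g\<close> and always
  removes a neighbourhood of the weighted median of the intervals that still meet Bob's ball. This
  halves the weight that is present, which balances the intervals that are added when the scale
  shrinks, and in the end no interval survives (\<open>wins_from_danger_system\<close>).

  In a winning set Bob can run through a Cantor scheme with \<open>N\<close> children per ball and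
  contraction about \<open>1 / N\<close>, which yields subsets of dimension arbitrarily close to one
  (\<open>hausdorff_dim_winning_on_arc\<close>).
\<close>

section \<open>Positions of the game that Alice wins\<close>

text \<open>The strategy sees only the history that starts at the ball \<open>b\<close>. The playground is the whole line
  because all later balls lie in \<open>b\<close> anyway.\<close>

definition wins_from :: "real \<Rightarrow> real set \<Rightarrow> real \<times> real \<Rightarrow> bool" where
  "wins_from \<beta> S b \<longleftrightarrow>
    (\<exists>\<sigma>. legal_strategy \<beta> \<sigma> \<and>
      (\<forall>B. B 0 = b \<longrightarrow> play_against UNIV \<beta> \<sigma> B \<longrightarrow> (\<lambda>n. snd (B n)) \<longlonglongrightarrow> 0 \<longrightarrow>
        (\<Inter>n. cball (fst (B n)) (snd (B n))) \<inter> S \<noteq> {}))"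

lemma affine_hyperplane_real:
  fixes L :: "real set"
  shows "affine_hyperplane L \<longleftrightarrow> (\<exists>c. L = {c})"
proof
  assume "affine_hyperplane L"
  then obtain a b where "a \<noteq> 0" "L = {x. a * x = b}"
    unfolding affine_hyperplane_def by auto
  then have "L = {b / a}" by (auto simp: field_simps)
  then show "\<exists>c. L = {c}" ..
next
  assume "\<exists>c. L = {c}"
  then obtain c where "L = {c}" ..
  then have "(1::real) \<noteq> 0 \<and> L = {x. 1 \<bullet> x = c}" by auto
  then show "affine_hyperplane L"
    unfolding affine_hyperplane_def by blast
qed

lemma hyperplane_nbhd_singleton: "hyperplane_nbhd {c} r = cball c r"
  by (auto simp: hyperplane_nbhd_def infdist_singleton dist_commute)

lemma play_step:
  assumes "play_against U \<beta> \<sigma> B"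
  shows "\<beta> * snd (B n) \<le> snd (B (Suc n))"
    and "cball (fst (B (Suc n))) (snd (B (Suc n))) \<subseteq> cball (fst (B n)) (snd (B n))"
    and "cball (fst (B (Suc n))) (snd (B (Suc n)))
      \<inter> hyperplane_nbhd (fst (\<sigma> (map B [0..<Suc n]))) (snd (\<sigma> (map B [0..<Suc n]))) = {}"
  using assms unfolding play_against_def by (auto simp: Let_def split_beta dest!: spec[of _ n])

lemma play_pos:
  assumes "play_against U \<beta> \<sigma> B" "0 < \<beta>"
  shows "0 < snd (B n)"
proof (induction n)
  case 0
  then show ?case using assms by (simp add: play_against_def)
next
  case (Suc n)
  then have "0 < \<beta> * snd (B n)" using assms by simp
  then show ?case using play_step(1)[OF assms(1), of n] by linarith
qed

lemma play_antimono:
  assumes "play_against U \<beta> \<sigma> B" "m \<le> n"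
  shows "cball (fst (B n)) (snd (B n)) \<subseteq> cball (fst (B m)) (snd (B m))"
  using assms(2) by (induction rule: dec_induct) (use play_step(2)[OF assms(1)] in blast)+

lemma cball_subset_radius:
  fixes c c' :: real
  assumes "cball c r \<subseteq> cball c' r'" "0 < r"
  shows "r \<le> r'"
proof -
  have "r + dist c c' \<le> r'"
    using assms by (simp add: cball_subset_cball_iff)
  then show ?thesis using zero_le_dist[of c c'] by linarith
qed

lemma play_radius_antimono:
  fixes B :: "nat \<Rightarrow> real \<times> real"
  assumes "play_against U \<beta> \<sigma> B" "0 < \<beta>" "m \<le> n"
  shows "snd (B n) \<le> snd (B m)"
  using cball_subset_radius[OF play_antimono[OF assms(1,3)] play_pos[OF assms(1,2)]] .

lemma play_against_shift:
  assumes "play_against U \<beta> \<sigma> B" "0 < \<beta>"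
    and "\<And>k. \<sigma>' (map (\<lambda>i. B (n + i)) [0..<Suc k]) = \<sigma> (map B [0..<Suc (n + k)])"
  shows "play_against UNIV \<beta> \<sigma>' (\<lambda>i. B (n + i))"
  unfolding play_against_def
proof (intro conjI allI)
  show "0 < snd (B (n + 0))" using play_pos[OF assms(1,2)] .
  fix k
  obtain L r where Lr: "\<sigma> (map B [0..<Suc (n + k)]) = (L, r)" by fastforce
  have e: "\<sigma>' (map (\<lambda>i. B (n + i)) [0..<Suc k]) = (L, r)"
    using assms(3)[of k] Lr by (rule trans)
  have "cball (fst (B (Suc (n + k)))) (snd (B (Suc (n + k)))) \<inter> hyperplane_nbhd L r = {}"
    using play_step(3)[OF assms(1), of "n + k"] unfolding Lr fst_conv snd_conv .
  then have "cball (fst (B (Suc (n + k)))) (snd (B (Suc (n + k))))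
      \<subseteq> cball (fst (B (n + k))) (snd (B (n + k))) - hyperplane_nbhd L r"
    using play_step(2)[OF assms(1), of "n + k"] by blast
  then show "let (L, r) = \<sigma>' (map (\<lambda>i. B (n + i)) [0..<Suc k])
         in \<beta> * snd (B (n + k)) \<le> snd (B (n + Suc k)) \<and>
            cball (fst (B (n + Suc k))) (snd (B (n + Suc k)))
            \<subseteq> cball (fst (B (n + k))) (snd (B (n + k))) - hyperplane_nbhd L r"
    unfolding e Let_def prod.case add_Suc_right
    by (rule conjI[OF play_step(1)[OF assms(1), of "n + k"]])
qed (rule subset_UNIV)

lemma legal_strategyD:
  assumes "legal_strategy \<beta> \<sigma>" "h \<noteq> []" "0 < snd (last h)"
  shows "affine_hyperplane (fst (\<sigma> h)) \<and> 0 < snd (\<sigma> h) \<and> snd (\<sigma> h) \<le> \<beta> * snd (last h)"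
  using assms unfolding legal_strategy_def by blast

text \<open>Alice follows \<open>\<sigma>\<close> until the current ball is one from which she wins, and then follows the
  strategy of the first such ball, applied to the history from that ball on. A play that misses \<open>S\<close>
  can therefore never have reached such a ball, and is a play against \<open>\<sigma>\<close>.\<close>

lemma strategy_switch:
  assumes "legal_strategy \<beta> \<sigma>" "0 < \<beta>"
  obtains \<tau> where "legal_strategy \<beta> \<tau>"
    and "\<And>U B. play_against U \<beta> \<tau> B \<Longrightarrow> (\<lambda>n. snd (B n)) \<longlonglongrightarrow> 0 \<Longrightarrow>
      (\<Inter>n. cball (fst (B n)) (snd (B n))) \<inter> S = {} \<Longrightarrow>
      play_against U \<beta> \<sigma> B \<and> (\<forall>n. \<not> wins_from \<beta> S (B n))"
proof -
  define good where "good = wins_from \<beta> S"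
  obtain sg where sg: "\<And>b. good b \<Longrightarrow> legal_strategy \<beta> (sg b)"
    "\<And>b B. good b \<Longrightarrow> B 0 = b \<Longrightarrow> play_against UNIV \<beta> (sg b) B \<Longrightarrow>
      (\<lambda>n. snd (B n)) \<longlonglongrightarrow> 0 \<Longrightarrow> (\<Inter>n. cball (fst (B n)) (snd (B n))) \<inter> S \<noteq> {}"
  proof -
    have "\<forall>b. \<exists>\<sigma>. good b \<longrightarrow> legal_strategy \<beta> \<sigma> \<and>
      (\<forall>B. B 0 = b \<longrightarrow> play_against UNIV \<beta> \<sigma> B \<longrightarrow> (\<lambda>n. snd (B n)) \<longlonglongrightarrow> 0 \<longrightarrow>
        (\<Inter>n. cball (fst (B n)) (snd (B n))) \<inter> S \<noteq> {})"
      unfolding good_def wins_from_def by blast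
    then have "\<exists>sg. \<forall>b. good b \<longrightarrow> legal_strategy \<beta> (sg b) \<and>
      (\<forall>B. B 0 = b \<longrightarrow> play_against UNIV \<beta> (sg b) B \<longrightarrow> (\<lambda>n. snd (B n)) \<longlonglongrightarrow> 0 \<longrightarrow>
        (\<Inter>n. cball (fst (B n)) (snd (B n))) \<inter> S \<noteq> {})"
      by (rule choice)
    then show ?thesis using that by blast
  qed
  define fst_good where "fst_good h = (LEAST n. n < length h \<and> good (h ! n))" for h
  define \<tau> where "\<tau> h = (if \<exists>n<length h. good (h ! n)
    then sg (h ! fst_good h) (drop (fst_good h) h) else \<sigma> h)" for h
  have fg: "fst_good h < length h \<and> good (h ! fst_good h)" if "\<exists>n<length h. good (h ! n)" for h
    using that unfolding fst_good_def by (metis (mono_tags, lifting) LeastI_ex)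
  have "legal_strategy \<beta> \<tau>"
    unfolding legal_strategy_def
  proof (intro allI impI)
    fix h :: "(real \<times> real) list" assume h: "h \<noteq> [] \<and> 0 < snd (last h)"
    show "affine_hyperplane (fst (\<tau> h)) \<and> 0 < snd (\<tau> h) \<and> snd (\<tau> h) \<le> \<beta> * snd (last h)"
    proof (cases "\<exists>n<length h. good (h ! n)")
      case True
      note f = fg[OF True]
      have "drop (fst_good h) h \<noteq> []" "last (drop (fst_good h) h) = last h"
        using f by (auto simp: last_drop)
      moreover have e: "\<tau> h = sg (h ! fst_good h) (drop (fst_good h) h)"
        unfolding \<tau>_def using True by (rule if_P)
      moreover have "legal_strategy \<beta> (sg (h ! fst_good h))"
        using sg(1) f by blast
      ultimately show ?thesis
        using h legal_strategyD[of \<beta> "sg (h ! fst_good h)" "drop (fst_good h) h"] by simp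
    next
      case False
      then have "\<tau> h = \<sigma> h" unfolding \<tau>_def by (rule if_not_P)
      then show ?thesis using legal_strategyD[OF assms(1)] h by simp
    qed
  qed
  moreover
  have "play_against U \<beta> \<sigma> B \<and> (\<forall>n. \<not> good (B n))"
    if play: "play_against U \<beta> \<tau> B" and lim: "(\<lambda>n. snd (B n)) \<longlonglongrightarrow> 0"
      and out: "(\<Inter>n. cball (fst (B n)) (snd (B n))) \<inter> S = {}" for U B
  proof (cases "\<exists>n. good (B n)")
    case False
    then have "\<tau> (map B [0..<Suc n]) = \<sigma> (map B [0..<Suc n])" for n
      unfolding \<tau>_def by (auto simp del: upt_Suc)
    then have "play_against U \<beta> \<sigma> B"
      using play unfolding play_against_def by presburger
    then show ?thesis using False by blast
  next
    case True
    define n where "n = (LEAST n. good (B n))"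
    have gn: "good (B n)" unfolding n_def using True by (metis LeastI)
    have fgn: "fst_good (map B [0..<Suc (n + k)]) = n" for k
      unfolding fst_good_def
    proof (rule Least_equality)
      show "n < length (map B [0..<Suc (n + k)]) \<and> good (map B [0..<Suc (n + k)] ! n)"
        using gn by (auto simp del: upt_Suc)
      fix y assume "y < length (map B [0..<Suc (n + k)]) \<and> good (map B [0..<Suc (n + k)] ! y)"
      then have "good (B y)" by (auto simp del: upt_Suc)
      then show "n \<le> y" unfolding n_def by (rule Least_le)
    qed
    have "\<tau> (map B [0..<Suc (n + k)]) = sg (B n) (map (\<lambda>i. B (n + i)) [0..<Suc k])" for k
    proof -
      have "\<exists>i<length (map B [0..<Suc (n + k)]). good (map B [0..<Suc (n + k)] ! i)"
        by (rule exI[of _ n]) (use gn in \<open>auto simp del: upt_Suc\<close>)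
      moreover have "drop n (map B [0..<Suc (n + k)]) = map (\<lambda>i. B (n + i)) [0..<Suc k]"
        by (rule nth_equalityI) (auto simp del: upt_Suc)
      moreover have "map B [0..<Suc (n + k)] ! n = B n" by (auto simp del: upt_Suc)
      moreover from calculation(1) have
        "\<tau> (map B [0..<Suc (n + k)]) = sg (map B [0..<Suc (n + k)] ! fst_good (map B [0..<Suc (n + k)]))
          (drop (fst_good (map B [0..<Suc (n + k)])) (map B [0..<Suc (n + k)]))"
        unfolding \<tau>_def by (rule if_P)
      ultimately show ?thesis unfolding fgn by (simp only:)
    qed
    then have "play_against UNIV \<beta> (sg (B n)) (\<lambda>i. B (n + i))"
      using play_against_shift[OF play assms(2), of "sg (B n)" n] by simp
    moreover have "(\<lambda>i. snd (B (n + i))) \<longlonglongrightarrow> 0"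
      using LIMSEQ_ignore_initial_segment[OF lim, of n] by (simp add: add.commute)
    ultimately have meets: "(\<Inter>i. cball (fst (B (n + i))) (snd (B (n + i)))) \<inter> S \<noteq> {}"
      using sg(2)[OF gn, of "\<lambda>i. B (n + i)"] by simp
    have nested: "(\<Inter>i. cball (fst (B (n + i))) (snd (B (n + i))))
        \<subseteq> (\<Inter>n. cball (fst (B n)) (snd (B n)))"
    proof (rule INT_greatest)
      fix m
      have "(\<Inter>i. cball (fst (B (n + i))) (snd (B (n + i)))) \<subseteq> cball (fst (B (n + m))) (snd (B (n + m)))"
        by (rule INT_lower) simp
      also have "\<dots> \<subseteq> cball (fst (B m)) (snd (B m))" by (rule play_antimono[OF play]) simp
      finally show "(\<Inter>i. cball (fst (B (n + i))) (snd (B (n + i)))) \<subseteq> cball (fst (B m)) (snd (B m))" .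
    qed
    from Int_mono[OF nested order_refl, of S] have False
      unfolding out using meets by simp
    then show ?thesis ..
  qed
  ultimately show ?thesis using that[of \<tau>] unfolding good_def by simp
qed

lemma wins_from_reach:
  assumes "legal_strategy \<beta> \<sigma>" "0 < \<beta>"
    and "\<And>B. B 0 = b \<Longrightarrow> play_against UNIV \<beta> \<sigma> B \<Longrightarrow> (\<lambda>n. snd (B n)) \<longlonglongrightarrow> 0 \<Longrightarrow>
      \<exists>n. wins_from \<beta> S (B n)"
  shows "wins_from \<beta> S b"
proof (rule strategy_switch[OF assms(1,2), of S])
  fix \<tau> assume "legal_strategy \<beta> \<tau>" and \<tau>: "\<And>U B. play_against U \<beta> \<tau> B \<Longrightarrow>
      (\<lambda>n. snd (B n)) \<longlonglongrightarrow> 0 \<Longrightarrow> (\<Inter>n. cball (fst (B n)) (snd (B n))) \<inter> S = {} \<Longrightarrow>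
      play_against U \<beta> \<sigma> B \<and> (\<forall>n. \<not> wins_from \<beta> S (B n))"
  show ?thesis
    unfolding wins_from_def[of \<beta> S b]
  proof (intro exI[of _ \<tau>] conjI allI impI notI)
    fix B assume B: "B 0 = b" "play_against UNIV \<beta> \<tau> B" "(\<lambda>n. snd (B n)) \<longlonglongrightarrow> 0"
      "(\<Inter>n. cball (fst (B n)) (snd (B n))) \<inter> S = {}"
    show False using \<tau>[OF B(2-4)] assms(3)[OF B(1) _ B(3)] by simp
  qed fact
qed

lemma winning_strategy_reach:
  assumes "legal_strategy \<beta> \<sigma>" "0 < \<beta>"
    and "\<And>B. play_against U \<beta> \<sigma> B \<Longrightarrow> (\<lambda>n. snd (B n)) \<longlonglongrightarrow> 0 \<Longrightarrow> \<exists>n. wins_from \<beta> S (B n)"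
  shows "\<exists>\<sigma>. legal_strategy \<beta> \<sigma> \<and> winning_strategy U S \<beta> \<sigma>"
proof (rule strategy_switch[OF assms(1,2), of S])
  fix \<tau> assume "legal_strategy \<beta> \<tau>" and \<tau>: "\<And>U B. play_against U \<beta> \<tau> B \<Longrightarrow>
      (\<lambda>n. snd (B n)) \<longlonglongrightarrow> 0 \<Longrightarrow> (\<Inter>n. cball (fst (B n)) (snd (B n))) \<inter> S = {} \<Longrightarrow>
      play_against U \<beta> \<sigma> B \<and> (\<forall>n. \<not> wins_from \<beta> S (B n))"
  show ?thesis
    unfolding winning_strategy_def
  proof (intro exI[of _ \<tau>] conjI allI impI notI)
    fix B assume B: "play_against U \<beta> \<tau> B" "(\<lambda>n. snd (B n)) \<longlonglongrightarrow> 0"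
      "(\<Inter>n. cball (fst (B n)) (snd (B n))) \<inter> S = {}"
    show False using \<tau>[OF B] assms(3)[OF _ B(2)] by simp
  qed fact
qed

lemma wins_from_mono:
  assumes "wins_from \<beta> S b" "S \<inter> cball (fst b) (snd b) \<subseteq> S'"
  shows "wins_from \<beta> S' b"
proof -
  obtain \<sigma> where "legal_strategy \<beta> \<sigma>" and
    *: "\<And>B. B 0 = b \<Longrightarrow> play_against UNIV \<beta> \<sigma> B \<Longrightarrow> (\<lambda>n. snd (B n)) \<longlonglongrightarrow> 0 \<Longrightarrow>
        (\<Inter>n. cball (fst (B n)) (snd (B n))) \<inter> S \<noteq> {}"
    using assms(1) unfolding wins_from_def by auto
  moreover have "(\<Inter>n. cball (fst (B n)) (snd (B n))) \<inter> S' \<noteq> {}"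
    if B: "B 0 = b" "play_against UNIV \<beta> \<sigma> B" "(\<lambda>n. snd (B n)) \<longlonglongrightarrow> 0" for B
  proof -
    obtain x where x: "x \<in> (\<Inter>n. cball (fst (B n)) (snd (B n)))" "x \<in> S"
      using *[OF B] by auto
    then have "x \<in> cball (fst b) (snd b)" using B(1) by (metis INT_E UNIV_I)
    then have "x \<in> S'" using x(2) assms(2) by auto
    then show ?thesis using x(1) by blast
  qed
  ultimately show ?thesis
    unfolding wins_from_def by (intro exI[of _ \<sigma>] conjI allI impI) simp_all
qed

text \<open>One move suffices to get rid of a point: Alice removes a neighbourhood of \<open>t\<close>.\<close>

lemma wins_from_delete_point:
  assumes "0 < \<beta>" "\<beta> < 1"
    and "\<And>c \<rho>. 0 < \<rho> \<Longrightarrow> cball c \<rho> \<subseteq> cball c0 r0 - {t} \<Longrightarrow> wins_from \<beta> S (c, \<rho>)"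
  shows "wins_from \<beta> S (c0, r0)"
proof (rule wins_from_reach)
  show "legal_strategy \<beta> (\<lambda>h. ({t}, \<beta> * snd (last h)))"
    using assms by (auto simp: legal_strategy_def affine_hyperplane_real)
  fix B assume B: "B 0 = (c0, r0)"
    and play: "play_against UNIV \<beta> (\<lambda>h. ({t}, \<beta> * snd (last h))) B"
  have "0 < r0" using play_pos[OF play assms(1), of 0] B by simp
  have pos: "0 < snd (B 1)" using play_pos[OF play assms(1), of 1] .
  have "cball (fst (B 1)) (snd (B 1)) \<subseteq> cball c0 r0"
    using play_step(2)[OF play, of 0] B by simp
  moreover have "t \<notin> cball (fst (B 1)) (snd (B 1))"
  proof
    assume "t \<in> cball (fst (B 1)) (snd (B 1))"
    moreover have "t \<in> cball t (\<beta> * r0)" using \<open>0 < r0\<close> assms by simp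
    moreover have "cball (fst (B 1)) (snd (B 1)) \<inter> cball t (\<beta> * r0) = {}"
      using play_step(3)[OF play, of 0] B by (simp add: hyperplane_nbhd_singleton)
    ultimately show False by blast
  qed
  ultimately have "wins_from \<beta> S (fst (B 1), snd (B 1))"
    by (intro assms(3)[OF pos]) auto
  then show "\<exists>n. wins_from \<beta> S (B n)" by (intro exI[of _ 1]) simp
qed fact

section \<open>A potential strategy against sparse families of sets\<close>

lemma weighted_median:
  fixes p :: "'a \<Rightarrow> real" and w :: "'a \<Rightarrow> real"
  assumes "finite T" and w: "\<And>x. x \<in> T \<Longrightarrow> 0 \<le> w x"
  shows "\<exists>c. sum w {x \<in> T. p x < c} \<le> sum w T / 2 \<and> sum w {x \<in> T. c < p x} \<le> sum w T / 2"
proof (cases "T = {}")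
  case False
  define A where "A = {x \<in> T. sum w T / 2 \<le> sum w {y \<in> T. p y \<le> p x}}"
  have "finite A" using assms unfolding A_def by auto
  have nn: "0 \<le> sum w T" using w by (rule sum_nonneg)
  obtain xm where "xm \<in> T" "p xm = Max (p ` T)"
  proof -
    have "Max (p ` T) \<in> p ` T" using False assms(1) by (intro Max_in) auto
    then show ?thesis using that by force
  qed
  then have "{y \<in> T. p y \<le> p xm} = T" using assms(1) by auto
  then have "xm \<in> A" unfolding A_def using \<open>xm \<in> T\<close> nn by simp
  define c where "c = Min (p ` A)"
  obtain x0 where x0: "x0 \<in> A" "p x0 = c"
  proof -
    have "Min (p ` A) \<in> p ` A" using \<open>finite A\<close> \<open>xm \<in> A\<close> by (intro Min_in) auto
    then show ?thesis using that unfolding c_def by force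
  qed
  have "sum w {x \<in> T. p x < c} \<le> sum w T / 2"
  proof (cases "{x \<in> T. p x < c} = {}")
    case True
    then show ?thesis using nn by (simp only: sum.empty)
  next
    case F: False
    let ?D = "{x \<in> T. p x < c}"
    obtain x1 where x1: "x1 \<in> ?D" "p x1 = Max (p ` ?D)"
    proof -
      have "Max (p ` ?D) \<in> p ` ?D" using F assms(1) by (intro Max_in) auto
      then show ?thesis using that by force
    qed
    have "{y \<in> T. p y \<le> p x1} = ?D"
      using x1 assms(1) by (auto intro!: Max_ge)
    moreover have "x1 \<notin> A"
    proof
      assume "x1 \<in> A"
      then have "Min (p ` A) \<le> p x1" using \<open>finite A\<close> by (intro Min_le) auto
      then show False using x1(1) unfolding c_def by auto
    qed
    ultimately show ?thesis using x1(1) unfolding A_def by auto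
  qed
  moreover have "sum w {x \<in> T. c < p x} \<le> sum w T / 2"
  proof -
    have "sum w T = sum w {x \<in> T. p x \<le> c} + sum w {x \<in> T. c < p x}"
      using assms(1) by (subst sum.union_disjoint[symmetric]) (auto intro!: sum.cong)
    then show ?thesis using x0 unfolding A_def by auto
  qed
  ultimately show ?thesis by blast
qed auto

lemma cover_by_two_balls:
  fixes A :: "real set"
  assumes "\<And>x y z. x \<in> A \<Longrightarrow> y \<in> A \<Longrightarrow> z \<in> A \<Longrightarrow>
    dist x y \<le> d \<or> dist x z \<le> d \<or> dist y z \<le> d"
  shows "\<exists>c::bool \<Rightarrow> real. A \<subseteq> (\<Union>k. cball (c k) d)"
proof (cases "\<exists>x\<in>A. \<exists>y\<in>A. \<not> dist x y \<le> d")
  case True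
  then obtain x y where xy: "x \<in> A" "y \<in> A" "\<not> dist x y \<le> d" by auto
  have "A \<subseteq> (\<Union>k. cball (if k then x else y) d)"
  proof
    fix z assume "z \<in> A"
    then have "z \<in> cball x d \<or> z \<in> cball y d" using assms[OF xy(1,2), of z] xy(3) by auto
    then show "z \<in> (\<Union>k. cball (if k then x else y) d)" by (auto simp: UNIV_bool)
  qed
  then show ?thesis by (rule exI[of _ "\<lambda>k. if k then x else y"])
next
  case False
  show ?thesis
  proof (cases "A = {}")
    case False
    then obtain x where "x \<in> A" by auto
    with \<open>\<not> (\<exists>x\<in>A. \<exists>y\<in>A. \<not> dist x y \<le> d)\<close> have "A \<subseteq> (\<Union>k::bool. cball x d)" by auto
    then show ?thesis by (rule exI[of _ "\<lambda>_. x"])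
  qed auto
qed

text \<open>The set \<open>X i\<close> is to be avoided and becomes relevant when Bob's radius is comparable with
  \<open>rad i\<close>. At that scale it is covered by two balls whose radius is \<open>eps i\<close> times Bob's radius;
  the covering is phrased through three points of \<open>X i\<close>. The covering property of \<open>X i\<close> may use that
  Bob's ball already avoids every \<open>X i'\<close> whose covering balls had radius above \<open>rad i\<close>. The number
  \<open>\<eta>\<close> bounds the load of one scale.\<close>

definition danger_system :: "real \<Rightarrow> real \<Rightarrow> real \<Rightarrow> real \<Rightarrow> real \<Rightarrow>
    ('i \<Rightarrow> real set) \<Rightarrow> ('i \<Rightarrow> real) \<Rightarrow> ('i \<Rightarrow> real) \<Rightarrow> bool" where
  "danger_system \<beta> g \<eta> c0 r0 X rad eps \<longleftrightarrow>
    (\<forall>i. 0 < rad i \<and> rad i < r0 \<and> 0 < eps i) \<and>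
    (\<forall>\<rho>>0. finite {i. \<rho> \<le> rad i \<and> rad i \<le> \<rho> / \<beta>} \<and>
      (\<Sum>i | \<rho> \<le> rad i \<and> rad i \<le> \<rho> / \<beta>. eps i powr g) \<le> \<eta>) \<and>
    (\<forall>c \<rho> i. cball c \<rho> \<subseteq> cball c0 r0 \<longrightarrow> 0 < \<rho> \<longrightarrow> \<beta> * rad i \<le> \<rho> \<longrightarrow> \<rho> \<le> rad i \<longrightarrow>
      (\<forall>i'. rad i < eps i' * rad i' \<longrightarrow> X i' \<inter> cball c \<rho> = {}) \<longrightarrow>
      (\<forall>x\<in>X i \<inter> cball c \<rho>. \<forall>y\<in>X i \<inter> cball c \<rho>. \<forall>z\<in>X i \<inter> cball c \<rho>.
        dist x y \<le> eps i * \<rho> \<or> dist x z \<le> eps i * \<rho> \<or> dist y z \<le> eps i * \<rho>))"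

text \<open>Sparseness of each family uses only the history of that family, so that two systems may be
  played at the same time; only the loads add up.\<close>

lemma danger_system_Plus:
  assumes "danger_system \<beta> g \<eta> c0 r0 X1 rad1 eps1" "danger_system \<beta> g \<eta>' c0 r0 X2 rad2 eps2"
  shows "danger_system \<beta> g (\<eta> + \<eta>') c0 r0 (case_sum X1 X2) (case_sum rad1 rad2) (case_sum eps1 eps2)"
  unfolding danger_system_def
proof (intro conjI)
  show "\<forall>i. 0 < case_sum rad1 rad2 i \<and> case_sum rad1 rad2 i < r0 \<and> 0 < case_sum eps1 eps2 i"
    using assms unfolding danger_system_def by (auto split: sum.split)
  show "\<forall>\<rho>>0. finite {i. \<rho> \<le> case_sum rad1 rad2 i \<and> case_sum rad1 rad2 i \<le> \<rho> / \<beta>} \<and>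
      (\<Sum>i | \<rho> \<le> case_sum rad1 rad2 i \<and> case_sum rad1 rad2 i \<le> \<rho> / \<beta>. case_sum eps1 eps2 i powr g) \<le> \<eta> + \<eta>'"
  proof (intro allI impI)
    fix \<rho> :: real assume \<rho>: "0 < \<rho>"
    define W1 where "W1 = {i. \<rho> \<le> rad1 i \<and> rad1 i \<le> \<rho> / \<beta>}"
    define W2 where "W2 = {i. \<rho> \<le> rad2 i \<and> rad2 i \<le> \<rho> / \<beta>}"
    have f: "finite W1" "finite W2" and s: "(\<Sum>i\<in>W1. eps1 i powr g) \<le> \<eta>" "(\<Sum>i\<in>W2. eps2 i powr g) \<le> \<eta>'"
      using assms \<rho> unfolding danger_system_def W1_def W2_def by auto
    have e: "{i. \<rho> \<le> case_sum rad1 rad2 i \<and> case_sum rad1 rad2 i \<le> \<rho> / \<beta>} = W1 <+> W2"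
      unfolding W1_def W2_def
      by (rule set_eqI, rename_tac i, case_tac i) auto
    show "finite {i. \<rho> \<le> case_sum rad1 rad2 i \<and> case_sum rad1 rad2 i \<le> \<rho> / \<beta>} \<and>
      (\<Sum>i | \<rho> \<le> case_sum rad1 rad2 i \<and> case_sum rad1 rad2 i \<le> \<rho> / \<beta>. case_sum eps1 eps2 i powr g) \<le> \<eta> + \<eta>'"
      unfolding e using f s by (simp add: sum.Plus)
  qed
  show "\<forall>c \<rho> i. cball c \<rho> \<subseteq> cball c0 r0 \<longrightarrow> 0 < \<rho> \<longrightarrow> \<beta> * case_sum rad1 rad2 i \<le> \<rho> \<longrightarrow> \<rho> \<le> case_sum rad1 rad2 i \<longrightarrow>
      (\<forall>i'. case_sum rad1 rad2 i < case_sum eps1 eps2 i' * case_sum rad1 rad2 i' \<longrightarrow> case_sum X1 X2 i' \<inter> cball c \<rho> = {}) \<longrightarrow>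
      (\<forall>x\<in>case_sum X1 X2 i \<inter> cball c \<rho>. \<forall>y\<in>case_sum X1 X2 i \<inter> cball c \<rho>. \<forall>z\<in>case_sum X1 X2 i \<inter> cball c \<rho>.
        dist x y \<le> case_sum eps1 eps2 i * \<rho> \<or> dist x z \<le> case_sum eps1 eps2 i * \<rho> \<or> dist y z \<le> case_sum eps1 eps2 i * \<rho>)"
  proof (intro allI impI)
    fix c \<rho> i
    assume a: "cball c \<rho> \<subseteq> cball c0 r0" "0 < \<rho>" "\<beta> * case_sum rad1 rad2 i \<le> \<rho>" "\<rho> \<le> case_sum rad1 rad2 i"
      and h: "\<forall>i'. case_sum rad1 rad2 i < case_sum eps1 eps2 i' * case_sum rad1 rad2 i' \<longrightarrow> case_sum X1 X2 i' \<inter> cball c \<rho> = {}"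
    show "\<forall>x\<in>case_sum X1 X2 i \<inter> cball c \<rho>. \<forall>y\<in>case_sum X1 X2 i \<inter> cball c \<rho>. \<forall>z\<in>case_sum X1 X2 i \<inter> cball c \<rho>.
        dist x y \<le> case_sum eps1 eps2 i * \<rho> \<or> dist x z \<le> case_sum eps1 eps2 i * \<rho> \<or> dist y z \<le> case_sum eps1 eps2 i * \<rho>"
    proof (cases i)
      case (Inl k)
      have "\<forall>i'. rad1 k < eps1 i' * rad1 i' \<longrightarrow> X1 i' \<inter> cball c \<rho> = {}"
        using h[unfolded Inl] by (metis sum.case(1))
      then show ?thesis using assms(1) a unfolding danger_system_def Inl sum.case by blast
    next
      case (Inr k)
      have "\<forall>i'. rad2 k < eps2 i' * rad2 i' \<longrightarrow> X2 i' \<inter> cball c \<rho> = {}"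
        using h[unfolded Inr] by (metis sum.case(2))
      then show ?thesis using assms(2) a unfolding danger_system_def Inr sum.case by blast
    qed
  qed
qed

text \<open>A task is a covering ball of some \<open>X i\<close>, taken at the first turn \<open>j\<close> at which Bob's radius
  \<open>\<rho> j\<close> is at most \<open>rad i\<close>; its radius is \<open>eps i * \<rho> j\<close> and its weight is the \<open>g\<close>-th power
  of that. The invariant is that the tasks alive at turn \<open>n\<close> have total weight at most
  \<open>2/3 * \<rho> n powr g\<close>. Since \<open>\<beta> powr g = 2/3\<close>, the bound equals \<open>(\<beta> * \<rho> n) powr g\<close>, so every live task
  has radius at most \<open>\<beta> * \<rho> n\<close>. Removing the ball of radius \<open>\<beta> * \<rho> n\<close> around the weighted median of
  the centres then leaves Bob on one side of it and kills all tasks on the other side, half of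
  the weight. The new tasks contribute at most \<open>2 * \<eta> * \<rho> (Suc n) powr g\<close>, where
  \<open>\<eta> = 1/12\<close>. As the old bound \<open>2/3 * \<rho> n powr g\<close> is at most \<open>\<rho> (Suc n) powr g\<close>, the induction closes
  with \<open>1/2 + 1/6 = 2/3\<close>. In the limit every task is dead, because its radius is fixed and \<open>\<rho> n\<close>
  tends to zero.\<close>

theorem wins_from_danger_system:
  fixes X :: "'i \<Rightarrow> real set" and rad eps :: "'i \<Rightarrow> real"
  assumes \<beta>: "0 < \<beta>" "\<beta> < 1" and g: "0 < g" "\<beta> powr g = 2/3" and r0: "0 < r0"
    and sys: "danger_system \<beta> g (1 / 12) c0 r0 X rad eps"
  shows "wins_from \<beta> (- (\<Union>i. X i)) (c0, r0)"
proof -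
  have eps: "\<And>i. 0 < eps i" "\<And>i. rad i < r0" and rad: "\<And>i. 0 < rad i"
    and fin: "\<And>\<rho>. 0 < \<rho> \<Longrightarrow> finite {i. \<rho> \<le> rad i \<and> rad i \<le> \<rho> / \<beta>}"
    and sum: "\<And>\<rho>. 0 < \<rho> \<Longrightarrow> (\<Sum>i | \<rho> \<le> rad i \<and> rad i \<le> \<rho> / \<beta>. eps i powr g) \<le> 1/12"
    using sys unfolding danger_system_def by auto
  have cover: "dist x y \<le> eps i * \<rho> \<or> dist x z \<le> eps i * \<rho> \<or> dist y z \<le> eps i * \<rho>"
    if "cball c \<rho> \<subseteq> cball c0 r0" "0 < \<rho>" "\<beta> * rad i \<le> \<rho>" "\<rho> \<le> rad i"
      "\<And>i'. rad i < eps i' * rad i' \<Longrightarrow> X i' \<inter> cball c \<rho> = {}"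
      "x \<in> X i \<inter> cball c \<rho>" "y \<in> X i \<inter> cball c \<rho>" "z \<in> X i \<inter> cball c \<rho>" for c \<rho> i x y z
    using sys that unfolding danger_system_def by blast
  define sparse where "sparse c \<rho> i \<longleftrightarrow> (\<forall>x\<in>X i \<inter> cball c \<rho>. \<forall>y\<in>X i \<inter> cball c \<rho>. \<forall>z\<in>X i \<inter> cball c \<rho>.
    dist x y \<le> eps i * \<rho> \<or> dist x z \<le> eps i * \<rho> \<or> dist y z \<le> eps i * \<rho>)" for c \<rho> i
  have "\<exists>cc::bool \<Rightarrow> real. sparse c \<rho> i \<longrightarrow> X i \<inter> cball c \<rho> \<subseteq> (\<Union>k. cball (cc k) (eps i * \<rho>))" for c \<rho> i
    using cover_by_two_balls[of "X i \<inter> cball c \<rho>" "eps i * \<rho>"] unfolding sparse_def by blast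
  then obtain cen :: "real \<Rightarrow> real \<Rightarrow> 'i \<Rightarrow> bool \<Rightarrow> real" where
    cen: "\<And>c \<rho> i. sparse c \<rho> i \<Longrightarrow> X i \<inter> cball c \<rho> \<subseteq> (\<Union>k. cball (cen c \<rho> i k) (eps i * \<rho>))"
    by metis
  \<comment> \<open>The Boolean \<open>k\<close> tells the two covering balls of \<open>X i\<close> apart. Centres and radii are functions of
    the history alone, so that they define a strategy.\<close>
  define tasks where "tasks b n = {(j, i, k::bool). 0 < j \<and> j \<le> n \<and> snd (b j) \<le> rad i \<and>
    rad i < snd (b (j - 1))}" for b :: "nat \<Rightarrow> real \<times> real" and n
  define ce where "ce b x = (case x of (j, i, k) \<Rightarrow> cen (fst (b j)) (snd (b j)) i k)"
    for b :: "nat \<Rightarrow> real \<times> real" and x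
  define le where "le b x = (case x of (j, i, k::bool) \<Rightarrow> eps i * snd (b j))"
    for b :: "nat \<Rightarrow> real \<times> real" and x
  define alive where "alive b n = {x \<in> tasks b n.
    cball (ce b x) (le b x) \<inter> cball (fst (b n)) (snd (b n)) \<noteq> {}}" for b n
  define w where "w b x = le b x powr g" for b x
  define med where "med b n = (SOME c. sum (w b) {x \<in> alive b n. ce b x < c} \<le> sum (w b) (alive b n) / 2 \<and>
    sum (w b) {x \<in> alive b n. c < ce b x} \<le> sum (w b) (alive b n) / 2)" for b n
  define \<sigma> :: "real alice_strategy" where
    "\<sigma> h = ({med (\<lambda>j. h ! j) (length h - 1)}, \<beta> * snd (last h))" for h
  have \<sigma>_play: "\<sigma> (map B [0..<Suc n]) = ({med B n}, \<beta> * snd (B n))" for B n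
  proof -
    let ?h = "map B [0..<Suc n]"
    have nth: "?h ! j = B j" if "j \<le> n" for j
      using that by (subst nth_map) (auto simp del: upt_Suc)
    have t: "tasks (\<lambda>j. ?h ! j) n = tasks B n"
      unfolding tasks_def by (auto simp: nth simp del: upt_Suc)
    have e: "ce (\<lambda>j. ?h ! j) x = ce B x" "le (\<lambda>j. ?h ! j) x = le B x" if "x \<in> tasks B n" for x
      using that unfolding ce_def le_def tasks_def by (auto simp: nth simp del: upt_Suc split: prod.splits)
    have a: "alive (\<lambda>j. ?h ! j) n = alive B n"
      unfolding alive_def t using e nth[of n] by (auto simp del: upt_Suc)
    have sub: "alive B n \<subseteq> tasks B n" unfolding alive_def by auto
    have s: "sum (w (\<lambda>j. ?h ! j)) T = sum (w B) T" if "T \<subseteq> alive B n" for T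
      by (rule sum.cong) (use that sub e in \<open>auto simp: w_def\<close>)
    have f: "{x \<in> alive B n. ce (\<lambda>j. ?h ! j) x < c} = {x \<in> alive B n. ce B x < c}"
      "{x \<in> alive B n. c < ce (\<lambda>j. ?h ! j) x} = {x \<in> alive B n. c < ce B x}" for c
      using sub e by auto
    have "med (\<lambda>j. ?h ! j) n = med B n"
      unfolding med_def a f using s[of "alive B n"] s[of "{x \<in> alive B n. ce B x < _}"]
        s[of "{x \<in> alive B n. _ < ce B x}"] by (auto simp del: upt_Suc)
    then show ?thesis unfolding \<sigma>_def by (simp add: last_map)
  qed
  have "legal_strategy \<beta> \<sigma>"
    unfolding legal_strategy_def \<sigma>_def affine_hyperplane_real fst_conv snd_conv
    using \<beta> by simp
  moreover have "(\<Inter>n. cball (fst (B n)) (snd (B n))) \<inter> - (\<Union>i. X i) \<noteq> {}"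
    if B0: "B 0 = (c0, r0)" and play: "play_against UNIV \<beta> \<sigma> B" and lim: "(\<lambda>n. snd (B n)) \<longlonglongrightarrow> 0" for B
  proof -
    note pos = play_pos[OF play \<beta>(1)]
    note mono = play_radius_antimono[OF play \<beta>(1)]
    note step = play_step(1)[OF play]
    define \<rho> where "\<rho> n = snd (B n)" for n
    define ball where "ball n = cball (fst (B n)) (snd (B n))" for n
    define W where "W n = {i. \<rho> n \<le> rad i \<and> rad i \<le> \<rho> n / \<beta>}" for n
    have \<rho>pos: "0 < \<rho> n" for n using pos unfolding \<rho>_def .
    have ballmono: "ball n \<subseteq> ball m" if "m \<le> n" for m n
      unfolding ball_def using play_antimono[OF play that] .
    have newW: "i \<in> W n" if "\<rho> n \<le> rad i" "rad i < \<rho> (n - 1)" "0 < n" for i n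
    proof -
      have "\<beta> * \<rho> (n - 1) \<le> \<rho> n" using step[of "n - 1"] that(3) unfolding \<rho>_def by simp
      then have "\<rho> (n - 1) \<le> \<rho> n / \<beta>" using \<beta> by (simp add: field_simps)
      then show ?thesis using that unfolding W_def by auto
    qed
    have finW: "finite (W n)" for n unfolding W_def using fin[OF \<rho>pos] .
    have tasks_sub: "tasks B n \<subseteq> (SIGMA j:{0..n}. W j \<times> UNIV)" for n
      using newW unfolding tasks_def \<rho>_def by auto
    have fin_alive: "finite (alive B n)" for n
      by (rule finite_subset[of _ "SIGMA j:{0..n}. W j \<times> UNIV"])
        (use tasks_sub[of n] finW in \<open>auto simp: alive_def\<close>)
    have wnn: "0 \<le> w B x" for x unfolding w_def by simp
    have med: "sum (w B) {x \<in> alive B n. ce B x < med B n} \<le> sum (w B) (alive B n) / 2 \<and>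
      sum (w B) {x \<in> alive B n. med B n < ce B x} \<le> sum (w B) (alive B n) / 2" for n
      unfolding med_def by (rule someI_ex) (rule weighted_median[OF fin_alive wnn])
    define \<Phi> where "\<Phi> n = sum (w B) (alive B n)" for n
    have \<beta>\<rho>: "(\<beta> * \<rho> n) powr g = 2/3 * \<rho> n powr g" for n
      using g(2) \<beta>(1) \<rho>pos[of n] by (simp add: powr_mult)
    have le_pos: "0 < le B x" for x
      unfolding le_def using eps(1) pos by (auto split: prod.splits)
    \<comment> \<open>One weight is at most the total weight, and \<open>(\<beta> * \<rho> n) powr g = 2/3 * \<rho> n powr g\<close>.\<close>
    have short: "le B x \<le> \<beta> * \<rho> n" if "\<Phi> n \<le> 2/3 * \<rho> n powr g" "x \<in> alive B n" for n x
    proof (rule ccontr)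
      assume "\<not> ?thesis"
      then have "(\<beta> * \<rho> n) powr g < le B x powr g"
        using g(1) \<beta>(1) \<rho>pos[of n] by (intro powr_less_mono2) auto
      also have "\<dots> = w B x" unfolding w_def ..
      also have "\<dots> \<le> \<Phi> n"
        unfolding \<Phi>_def using that(2) wnn fin_alive by (intro member_le_sum) auto
      finally show False using that(1) \<beta>\<rho>[of n] by simp
    qed
    have \<Phi>: "\<Phi> n \<le> 2/3 * \<rho> n powr g" for n
    proof (induction n)
      case 0
      have "alive B 0 = {}" unfolding alive_def tasks_def by auto
      then show ?case unfolding \<Phi>_def by simp
    next
      case (Suc n)
      define N where "N = {Suc n} \<times> W (Suc n) \<times> (UNIV :: bool set)"
      define Old where "Old = alive B (Suc n) - N"
      have finN: "finite N" unfolding N_def using finW by auto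
      have "sum (w B) N = (\<Sum>i\<in>W (Suc n). \<Sum>k\<in>(UNIV::bool set). w B (Suc n, i, k))"
      proof -
        have "N = Pair (Suc n) ` (W (Suc n) \<times> UNIV)" unfolding N_def by auto
        then have "sum (w B) N = (\<Sum>x\<in>W (Suc n) \<times> UNIV. w B (Suc n, x))"
          by (simp add: sum.reindex inj_on_def)
        also have "\<dots> = (\<Sum>i\<in>W (Suc n). \<Sum>k\<in>UNIV. w B (Suc n, i, k))"
          by (simp add: sum.cartesian_product')
        finally show ?thesis .
      qed
      also have "\<dots> = (\<Sum>i\<in>W (Suc n). 2 * (eps i powr g * \<rho> (Suc n) powr g))"
        by (rule sum.cong) (use eps \<rho>pos[of "Suc n"] in \<open>auto simp: w_def le_def UNIV_bool powr_mult \<rho>_def less_imp_le\<close>)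
      also have "\<dots> = 2 * \<rho> (Suc n) powr g * (\<Sum>i\<in>W (Suc n). eps i powr g)"
        by (simp add: sum_distrib_left mult_ac)
      also have "\<dots> \<le> 2 * \<rho> (Suc n) powr g * (1/12)"
        unfolding W_def using sum[OF \<rho>pos[of "Suc n"]] by (intro mult_left_mono) auto
      finally have new: "sum (w B) N \<le> \<rho> (Suc n) powr g / 6" by simp
      have Old_alive: "x \<in> alive B n" if "x \<in> Old" for x
      proof -
        obtain j i k where x: "x = (j, i, k)" by (cases x)
        have xt: "x \<in> tasks B (Suc n)" "cball (ce B x) (le B x) \<inter> ball (Suc n) \<noteq> {}" "x \<notin> N"
          using that unfolding Old_def alive_def ball_def by auto
        then have "j \<noteq> Suc n"
          using newW[of "Suc n" i] unfolding x N_def tasks_def \<rho>_def by auto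
        then have "x \<in> tasks B n" using xt(1) unfolding x tasks_def by auto
        moreover have "cball (ce B x) (le B x) \<inter> ball n \<noteq> {}"
          using xt(2) ballmono[of n "Suc n"] by auto
        ultimately show ?thesis unfolding alive_def ball_def by auto
      qed
      have avoid: "ball (Suc n) \<inter> cball (med B n) (\<beta> * \<rho> n) = {}"
        using play_step(3)[OF play, of n] unfolding \<sigma>_play ball_def \<rho>_def
        by (simp add: hyperplane_nbhd_singleton)
      \<comment> \<open>The ball is connected and misses the removed interval.\<close>
      have side: "(\<forall>y\<in>ball (Suc n). med B n + \<beta> * \<rho> n < y) \<or> (\<forall>y\<in>ball (Suc n). y < med B n - \<beta> * \<rho> n)"
      proof (rule ccontr)
        assume "\<not> ?thesis"
        then obtain y z where yz: "y \<in> ball (Suc n)" "y \<le> med B n + \<beta> * \<rho> n"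
          "z \<in> ball (Suc n)" "med B n - \<beta> * \<rho> n \<le> z" by force
        moreover have "y \<notin> cball (med B n) (\<beta> * \<rho> n)" "z \<notin> cball (med B n) (\<beta> * \<rho> n)"
          using avoid yz by auto
        ultimately have lt: "y < med B n - \<beta> * \<rho> n" "med B n + \<beta> * \<rho> n < z"
          by (auto simp: dist_real_def abs_le_iff)
        have "0 < \<beta> * \<rho> n" using \<beta> \<rho>pos by simp
        then have "med B n \<in> {y..z}" using lt by auto
        also have "{y..z} \<subseteq> ball (Suc n)"
          using yz(1,3) unfolding ball_def by (auto simp: dist_real_def abs_le_iff)
        finally show False using avoid \<open>0 < \<beta> * \<rho> n\<close> by auto
      qed
      have half: "sum (w B) Old \<le> \<Phi> n / 2"
        using side
      proof
        assume r: "\<forall>y\<in>ball (Suc n). med B n + \<beta> * \<rho> n < y"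
        have "Old \<subseteq> {x \<in> alive B n. med B n < ce B x}"
        proof
          fix x assume x: "x \<in> Old"
          then obtain y where y: "y \<in> cball (ce B x) (le B x)" "y \<in> ball (Suc n)"
            unfolding Old_def alive_def ball_def by auto
          have "le B x \<le> \<beta> * \<rho> n" using short[OF Suc Old_alive[OF x]] .
          then have "med B n < ce B x"
            using y r by (auto simp: dist_real_def abs_le_iff)
          then show "x \<in> {x \<in> alive B n. med B n < ce B x}" using Old_alive[OF x] by simp
        qed
        then have "sum (w B) Old \<le> sum (w B) {x \<in> alive B n. med B n < ce B x}"
          using fin_alive wnn by (intro sum_mono2) auto
        then show ?thesis using med[of n] unfolding \<Phi>_def by linarith
      next
        assume r: "\<forall>y\<in>ball (Suc n). y < med B n - \<beta> * \<rho> n"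
        have "Old \<subseteq> {x \<in> alive B n. ce B x < med B n}"
        proof
          fix x assume x: "x \<in> Old"
          then obtain y where y: "y \<in> cball (ce B x) (le B x)" "y \<in> ball (Suc n)"
            unfolding Old_def alive_def ball_def by auto
          have "le B x \<le> \<beta> * \<rho> n" using short[OF Suc Old_alive[OF x]] .
          then have "ce B x < med B n"
            using y r by (auto simp: dist_real_def abs_le_iff)
          then show "x \<in> {x \<in> alive B n. ce B x < med B n}" using Old_alive[OF x] by simp
        qed
        then have "sum (w B) Old \<le> sum (w B) {x \<in> alive B n. ce B x < med B n}"
          using fin_alive wnn by (intro sum_mono2) auto
        then show ?thesis using med[of n] unfolding \<Phi>_def by linarith
      qed
      have "\<Phi> (Suc n) \<le> sum (w B) (Old \<union> N)"
        unfolding \<Phi>_def by (rule sum_mono2) (use fin_alive finN wnn in \<open>auto simp: Old_def\<close>)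
      also have "\<dots> = sum (w B) Old + sum (w B) N"
        by (rule sum.union_disjoint) (use fin_alive finN in \<open>auto simp: Old_def\<close>)
      finally have "\<Phi> (Suc n) \<le> \<Phi> n / 2 + \<rho> (Suc n) powr g / 6" using half new by linarith
      moreover have "2/3 * \<rho> n powr g \<le> \<rho> (Suc n) powr g"
        unfolding \<beta>\<rho>[symmetric] using step[of n] g(1) \<beta>(1) \<rho>pos[of n]
        by (intro powr_mono2) (auto simp: \<rho>_def)
      ultimately show ?case using Suc by linarith
    qed
    have covered: "X i \<inter> ball n \<subseteq> (\<Union>k. cball (ce B (m, i, k)) (le B (m, i, k)))"
      if "0 < m" "m \<le> n" "\<rho> m \<le> rad i" "rad i < \<rho> (m - 1)"
        and sp: "sparse (fst (B m)) (snd (B m)) i" for m n i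
    proof -
      have "X i \<inter> ball m \<subseteq> (\<Union>k. cball (ce B (m, i, k)) (le B (m, i, k)))"
        using cen[OF sp] unfolding ball_def ce_def le_def by simp
      then show ?thesis using ballmono[OF that(2)] by blast
    qed
    have dead: "X i \<inter> ball n = {}"
      if mn: "0 < m" "m \<le> n" "\<rho> m \<le> rad i" "rad i < \<rho> (m - 1)"
        and sp: "sparse (fst (B m)) (snd (B m)) i" and small: "\<beta> * \<rho> n < eps i * \<rho> m" for m n i
    proof (rule ccontr)
      assume "X i \<inter> ball n \<noteq> {}"
      then obtain t k where t: "t \<in> ball n" "t \<in> cball (ce B (m, i, k)) (le B (m, i, k))"
        using covered[OF mn sp] by blast
      have "(m, i, k) \<in> alive B n"
        using t mn unfolding alive_def tasks_def ball_def \<rho>_def by auto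
      from short[OF \<Phi> this] small show False unfolding le_def \<rho>_def by simp
    qed
    have first: "\<exists>m>0. m \<le> n \<and> \<rho> m \<le> rad i \<and> rad i < \<rho> (m - 1)" if "\<rho> n \<le> rad i" for n i
    proof -
      define m where "m = (LEAST m. \<rho> m \<le> rad i)"
      have m: "\<rho> m \<le> rad i" unfolding m_def using that by (rule LeastI)
      have "m \<le> n" unfolding m_def using that by (rule Least_le)
      moreover have "\<not> \<rho> 0 \<le> rad i" using eps(2)[of i] B0 unfolding \<rho>_def by simp
      then have "0 < m" using m by (cases m) auto
      moreover have "\<not> \<rho> (m - 1) \<le> rad i"
        using not_less_Least[of "m - 1" "\<lambda>m. \<rho> m \<le> rad i"] \<open>0 < m\<close> unfolding m_def by simp
      ultimately show ?thesis using m by (intro exI[of _ m]) auto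
    qed
    \<comment> \<open>A single term of a window sum is at most \<open>1/12 < \<beta> powr g\<close>.\<close>
    have eps_small: "eps i \<le> \<beta>" for i
    proof (rule ccontr)
      assume "\<not> ?thesis"
      then have "\<beta> powr g < eps i powr g" using g \<beta> by (intro powr_less_mono2) auto
      also have "\<dots> \<le> (\<Sum>i' | rad i \<le> rad i' \<and> rad i' \<le> rad i / \<beta>. eps i' powr g)"
        using fin[OF rad[of i]] rad[of i] \<beta> by (intro member_le_sum) (auto simp: field_simps)
      also have "\<dots> \<le> 1/12" by (rule sum[OF rad])
      finally show False using g by simp
    qed
    \<comment> \<open>The history condition of a danger system holds by induction on the turn: each \<open>X i'\<close> with
      large covering balls appeared at an earlier turn and is dead by now.\<close>
    have sparse: "sparse (fst (B n)) (snd (B n)) i"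
      if "0 < n" "\<rho> n \<le> rad i" "rad i < \<rho> (n - 1)" for n i
      using that
    proof (induction n arbitrary: i rule: less_induct)
      case (less n)
      have sub: "cball (fst (B n)) (snd (B n)) \<subseteq> cball c0 r0"
        using play_antimono[OF play, of 0 n] B0 by simp
      have W: "i \<in> W n" using newW less.prems by auto
      then have 1: "\<beta> * rad i \<le> snd (B n)" "snd (B n) \<le> rad i"
        unfolding W_def \<rho>_def using \<beta> by (auto simp: field_simps)
      have 2: "X i' \<inter> cball (fst (B n)) (snd (B n)) = {}" if i': "rad i < eps i' * rad i'" for i'
      proof -
        have "eps i' * rad i' \<le> 1 * rad i'"
          using eps_small[of i'] \<beta> rad[of i'] by (intro mult_right_mono) auto
        then have gt: "rad i < rad i'" using i' by simp
        then obtain m where m: "0 < m" "m \<le> n" "\<rho> m \<le> rad i'" "rad i' < \<rho> (m - 1)"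
          using first[of n i'] less.prems by fastforce
        have "i' \<in> W m" using newW m by blast
        then have "\<beta> * rad i' \<le> \<rho> m" unfolding W_def using \<beta> by (auto simp: field_simps)
        then have "\<beta> * (eps i' * rad i') \<le> eps i' * \<rho> m"
          using eps(1)[of i'] by (simp add: mult.left_commute)
        moreover have "\<beta> * \<rho> n < \<beta> * (eps i' * rad i')"
          using i' less.prems \<beta> by simp
        ultimately have small: "\<beta> * \<rho> n < eps i' * \<rho> m" by linarith
        have "m \<noteq> n"
        proof
          assume "m = n"
          then have "\<beta> < eps i'" using small \<rho>pos[of n] by simp
          then show False using eps_small[of i'] by simp
        qed
        then have "sparse (fst (B m)) (snd (B m)) i'" using less.IH[of m i'] m by simp
        then show ?thesis using dead[OF m _ small] unfolding ball_def by simp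
      qed
      show ?case
        unfolding sparse_def using cover[OF sub pos 1 2] by blast
    qed
    have gone: "\<exists>n. X i \<inter> ball n = {}" for i
    proof -
      have "\<exists>n. \<rho> n < rad i"
        using order_tendstoD(2)[OF lim rad[of i]] unfolding \<rho>_def eventually_sequentially by auto
      then obtain n0 where "\<rho> n0 \<le> rad i" using less_imp_le by blast
      then obtain m where m: "0 < m" "m \<le> n0" "\<rho> m \<le> rad i" "rad i < \<rho> (m - 1)" using first by blast
      have "0 < eps i * \<rho> m" using eps(1) \<rho>pos by simp
      then have "eventually (\<lambda>n. \<rho> n < eps i * \<rho> m) sequentially"
        using order_tendstoD(2)[OF lim] unfolding \<rho>_def by auto
      then have "eventually (\<lambda>n. \<rho> n < eps i * \<rho> m \<and> m \<le> n) sequentially"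
        using eventually_ge_at_top[of m] by (rule eventually_conj)
      then obtain n where n: "\<rho> n < eps i * \<rho> m" "m \<le> n" by (auto simp: eventually_sequentially)
      have "\<beta> * \<rho> n \<le> 1 * \<rho> n" using \<beta> \<rho>pos[of n] by (intro mult_right_mono) auto
      then have "\<beta> * \<rho> n < eps i * \<rho> m" using n by simp
      then show ?thesis using dead[OF m(1) n(2) m(3,4) sparse[OF m(1,3,4)]] by blast
    qed
    have "compact (ball n)" for n unfolding ball_def by simp
    moreover have "ball n \<noteq> {}" for n unfolding ball_def using pos[of n] by (simp add: less_imp_le)
    ultimately have "(\<Inter>n. ball n) \<noteq> {}"
      by (intro compact_nest) (use ballmono in auto)
    then obtain t where "t \<in> (\<Inter>n. ball n)" by blast
    moreover from this have "t \<notin> (\<Union>i. X i)" using gone by blast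
    ultimately show ?thesis unfolding ball_def by blast
  qed
  ultimately show ?thesis
    unfolding wins_from_def by (intro exI[of _ \<sigma>] conjI allI impI) simp_all
qed

section \<open>Gains from a sparse sequence of denominators\<close>

text \<open>The gain at scale \<open>l\<close> is \<open>\<sigma> l ^ 208\<close>, where \<open>208 = 16 * 13\<close>: the estimates for distances to
  lines lose thirteen powers of \<open>\<sigma> l\<close>, and this loss has to be as weak as a sixteenth root of the gain.
  The second clause says that \<open>\<sigma> l ^ 208 / 2 ^ l\<close> decreases, so that \<open>\<sigma>\<close> cannot drop abruptly towards smaller \<open>l\<close>. All scales that are handled
  within one turn of the game lie between some \<open>L\<close> and \<open>3 L + A\<close>, which explains the range of the
  sum.\<close>

definition slow_profile :: "real \<Rightarrow> (nat \<Rightarrow> real) \<Rightarrow> bool" where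
  "slow_profile g \<sigma> \<longleftrightarrow>
    (\<forall>l. 0 < \<sigma> l \<and> \<sigma> l \<le> 1 \<and> 1 \<le> \<sigma> l ^ 208 * 2 ^ l) \<and>
    (\<forall>l0 l. l0 \<le> l \<longrightarrow> \<sigma> l ^ 208 * 2 ^ l0 \<le> \<sigma> l0 ^ 208 * 2 ^ l) \<and>
    (\<forall>A. \<exists>N. \<forall>L. (\<Sum>l=L..3 * L + A. \<sigma> l powr g) \<le> N)"

text \<open>The terms decay geometrically below the largest one, which is at most one.\<close>

lemma sum_dyadic_powr_le:
  fixes B \<delta> :: real
  assumes D: "finite D" and B: "\<And>l. l \<in> D \<Longrightarrow> (2::real) ^ l \<le> B" and \<delta>: "0 < \<delta>"
  shows "(\<Sum>l\<in>D. (2 ^ l / B) powr \<delta>) \<le> 1 / (1 - 2 powr - \<delta>)"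
proof -
  define r where "r = (2::real) powr - \<delta>"
  have r: "0 < r" "r < 1" unfolding r_def using \<delta> powr_less_mono[of "- \<delta>" 0 2] by auto
  show ?thesis
  proof (cases "D = {}")
    case False
    define m where "m = Max D"
    have m: "m \<in> D" "\<And>l. l \<in> D \<Longrightarrow> l \<le> m" unfolding m_def using D False by auto
    have B0: "0 < B" using B[OF m(1)] by (smt (verit) zero_less_power)
    have "(2 ^ l / B) powr \<delta> \<le> r ^ (m - l)" if "l \<in> D" for l
    proof -
      have "2 ^ l / B \<le> 2 ^ l / 2 ^ m" using B[OF m(1)] B0 by (intro divide_left_mono) auto
      also have "\<dots> = 2 powr (- real (m - l))"
      proof -
        have "(2::real) ^ m = 2 ^ (m - l) * 2 ^ l" using m(2)[OF that] by (simp flip: power_add)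
        then show ?thesis by (simp add: powr_minus powr_realpow divide_inverse)
      qed
      finally have "(2 ^ l / B) powr \<delta> \<le> (2 powr (- real (m - l))) powr \<delta>"
        using B0 \<delta> by (intro powr_mono2) auto
      also have "\<dots> = r powr (real (m - l))" unfolding r_def by (simp add: powr_powr mult.commute)
      also have "\<dots> = r ^ (m - l)" using r by (simp add: powr_realpow)
      finally show ?thesis .
    qed
    then have "(\<Sum>l\<in>D. (2 ^ l / B) powr \<delta>) \<le> (\<Sum>l\<in>D. r ^ (m - l))" by (rule sum_mono)
    also have "\<dots> = (\<Sum>k\<in>(\<lambda>l. m - l) ` D. r ^ k)"
    proof -
      have "inj_on (\<lambda>l. m - l) D" using m(2) by (intro inj_onI) (metis diff_diff_cancel)
      then show ?thesis by (simp add: sum.reindex)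
    qed
    also have "\<dots> \<le> (\<Sum>k. r ^ k)"
      using D r by (intro sum_le_suminf) (auto intro: summable_geometric)
    also have "\<dots> = 1 / (1 - r)" using r by (simp add: suminf_geometric)
    finally show ?thesis unfolding r_def .
  next
    case True
    then show ?thesis using r unfolding r_def by simp
  qed
qed

text \<open>Lowering the exponent from \<open>\<tau>\<close> to \<open>\<theta> = (1 + \<tau>) / 2\<close> absorbs every constant for large \<open>m\<close>.\<close>

lemma sparse_sequence_growth:
  fixes Q :: "nat \<Rightarrow> real"
  assumes pos: "\<And>m. 0 < Q m" and lim: "filterlim Q at_top sequentially"
    and inf: "\<exists>\<tau>>1. 0 < (INF m. Q (Suc m) / Q m powr \<tau>)" and C: "0 < C"
  obtains m0 \<theta> where "1 < \<theta>" "\<And>m. m0 \<le> m \<Longrightarrow> 2 \<le> C * Q m"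
    "\<And>m. m0 \<le> m \<Longrightarrow> (C * Q m) powr \<theta> \<le> C * Q (Suc m)" "\<And>m. m0 \<le> m \<Longrightarrow> 1 \<le> Q m"
proof -
  obtain \<tau> where \<tau>: "1 < \<tau>" "0 < (INF m. Q (Suc m) / Q m powr \<tau>)" using inf by blast
  define c where "c = (INF m. Q (Suc m) / Q m powr \<tau>)"
  have c: "0 < c" "c \<le> Q (Suc m) / Q m powr \<tau>" for m
  proof -
    show "0 < c" unfolding c_def by (rule \<tau>(2))
    have "bdd_below (range (\<lambda>m. Q (Suc m) / Q m powr \<tau>))"
      using pos by (intro bdd_belowI[of _ 0]) (auto simp: less_imp_le)
    then show "c \<le> Q (Suc m) / Q m powr \<tau>" unfolding c_def by (rule cINF_lower) simp
  qed
  define \<theta> where "\<theta> = (1 + \<tau>) / 2"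
  define e where "e = (\<tau> - 1) / 2"
  have e: "0 < e" "\<tau> = \<theta> + e" "1 < \<theta>" unfolding e_def \<theta>_def using \<tau> by (simp_all add: field_simps)
  define K where "K = C * c * C powr - \<tau>"
  have K: "0 < K" unfolding K_def using C c by simp
  define R where "R = max 2 ((1 / K) powr (1 / e))"
  have "eventually (\<lambda>m. max (R / C) 1 \<le> Q m) sequentially" using lim unfolding filterlim_at_top by blast
  then obtain m0 where m0: "\<And>m. m0 \<le> m \<Longrightarrow> max (R / C) 1 \<le> Q m" by (auto simp: eventually_sequentially)
  have big: "R \<le> C * Q m" if "m0 \<le> m" for m using m0[OF that] C by (simp add: field_simps)
  show ?thesis
  proof (rule that[OF e(3)])
    fix m assume m: "m0 \<le> m"
    show "2 \<le> C * Q m" using big[OF m] unfolding R_def by simp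
    show "1 \<le> Q m" using m0[OF m] by simp
    define x where "x = C * Q m"
    have x: "0 < x" "R \<le> x" unfolding x_def using big[OF m] pos C by auto
    have "1 / K = ((1 / K) powr (1 / e)) powr e" using e K by (simp add: powr_powr)
    also have "\<dots> \<le> x powr e" using x e K unfolding R_def by (intro powr_mono2) auto
    finally have "1 \<le> K * x powr e" using K by (simp add: field_simps)
    then have "x powr \<theta> * 1 \<le> x powr \<theta> * (K * x powr e)" by (intro mult_left_mono) auto
    also have "\<dots> = K * x powr \<tau>" unfolding e(2) powr_add by (simp add: mult_ac)
    also have "\<dots> = C * (c * Q m powr \<tau>)"
      unfolding K_def x_def using C pos[of m] by (simp add: powr_mult powr_minus field_simps)
    also have "\<dots> \<le> C * Q (Suc m)"
      using c(2)[of m] C pos[of m] by (intro mult_left_mono) (simp_all add: field_simps)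
    finally show "(C * Q m) powr \<theta> \<le> C * Q (Suc m)" unfolding x_def by simp
  qed
qed

text \<open>The gain \<open>\<sigma> l ^ 208\<close> is \<open>2 ^ l\<close> divided by the first \<open>C * Q m\<close> that is at least \<open>2 ^ l\<close>, or
  \<open>1 / 2 ^ l\<close> if this is larger. Between two consecutive members of the sequence the quotients form a
  geometric progression with values at most one, hence their powers have bounded sums, and by the growth of \<open>Q\<close> a range from \<open>L\<close> to \<open>3 L + A\<close>
  contains a bounded number of members.\<close>

theorem exists_profile:
  fixes Q :: "nat \<Rightarrow> real"
  assumes mono: "strict_mono Q" and pos: "\<And>m. 0 < Q m" and lim: "filterlim Q at_top sequentially"
    and inf: "\<exists>\<tau>>1. 0 < (INF m. Q (Suc m) / Q m powr \<tau>)" and C: "0 < C"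
  obtains \<sigma> :: "nat \<Rightarrow> real" and m0 :: nat
  where "\<And>g. 0 < g \<Longrightarrow> slow_profile g \<sigma>"
    "\<And>m l. m0 \<le> m \<Longrightarrow> 2 ^ l \<le> C * Q m \<Longrightarrow> 2 ^ l \<le> \<sigma> l ^ 208 * (C * Q m)"
    "\<And>m. m0 \<le> m \<Longrightarrow> 1 \<le> Q m"
proof -
  obtain m0 \<theta> where \<theta>: "1 < \<theta>" and m0: "\<And>m. m0 \<le> m \<Longrightarrow> 2 \<le> C * Q m"
    "\<And>m. m0 \<le> m \<Longrightarrow> (C * Q m) powr \<theta> \<le> C * Q (Suc m)" "\<And>m. m0 \<le> m \<Longrightarrow> 1 \<le> Q m"
    using sparse_sequence_growth[OF pos lim inf C] by metis
  define R where "R m = C * Q (m0 + m)" for m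
  have R2: "2 \<le> R m" for m unfolding R_def using m0(1) by simp
  have Rstep: "R m powr \<theta> \<le> R (Suc m)" for m unfolding R_def using m0(2)[of "m0 + m"] by simp
  have Rmono: "R m \<le> R n" if "m \<le> n" for m n
    unfolding R_def using that C mono by (simp add: strict_mono_less_eq)
  have Riter: "R m powr (\<theta> ^ k) \<le> R (m + k)" for m k
  proof (induction k)
    case 0
    then show ?case using R2[of m] by simp
  next
    case (Suc k)
    have "R m powr (\<theta> ^ Suc k) = (R m powr (\<theta> ^ k)) powr \<theta>" by (simp add: powr_powr mult.commute)
    also have "\<dots> \<le> R (m + k) powr \<theta>" using Suc \<theta> by (intro powr_mono2) auto
    also have "\<dots> \<le> R (m + Suc k)" using Rstep[of "m + k"] by simp
    finally show ?case .
  qed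
  have exR: "\<exists>m. x \<le> R m" for x
  proof -
    have "eventually (\<lambda>m. x / C \<le> Q m) sequentially" using lim unfolding filterlim_at_top by blast
    then obtain n where "\<And>m. n \<le> m \<Longrightarrow> x / C \<le> Q m" by (auto simp: eventually_sequentially)
    then have "x \<le> R n" unfolding R_def using C by (simp add: field_simps)
    then show ?thesis ..
  qed
  \<comment> \<open>The index of the first member above \<open>2 ^ l\<close>.\<close>
  define idx where "idx l = (LEAST m. (2::real) ^ l \<le> R m)" for l :: nat
  have idx: "2 ^ l \<le> R (idx l)" for l unfolding idx_def using exR by (rule LeastI_ex)
  have idx_le: "idx l \<le> m" if "2 ^ l \<le> R m" for l m unfolding idx_def using that by (rule Least_le)
  have idx_less: "R m < 2 ^ l" if "m < idx l" for l m using idx_le[of l m] that by force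
  have idx_mono: "idx l0 \<le> idx l" if "l0 \<le> l" for l0 l
    using idx[of l] that by (intro idx_le) (auto intro: order_trans[OF power_increasing])
  define \<phi> where "\<phi> l = max (2 ^ l / R (idx l)) (1 / 2 ^ l)" for l
  have Rpos: "0 < R m" for m using R2[of m] by simp
  have \<phi>: "0 < \<phi> l" "\<phi> l \<le> 1" "1 \<le> \<phi> l * 2 ^ l" for l
  proof -
    show "0 < \<phi> l" unfolding \<phi>_def by (rule less_max_iff_disj[THEN iffD2]) simp
    show "\<phi> l \<le> 1" unfolding \<phi>_def using idx[of l] Rpos[of "idx l"] by simp
    have "1 / 2 ^ l * 2 ^ l \<le> \<phi> l * 2 ^ l" unfolding \<phi>_def by (intro mult_right_mono) auto
    then show "1 \<le> \<phi> l * 2 ^ l" by simp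
  qed
  have \<phi>_decay: "\<phi> l * 2 ^ l0 \<le> \<phi> l0 * 2 ^ l" if "l0 \<le> l" for l0 l
  proof -
    have "2 ^ l / R (idx l) \<le> 2 ^ l / R (idx l0)"
      using Rmono[OF idx_mono[OF that]] Rpos by (intro divide_left_mono) auto
    then have "2 ^ l / R (idx l) * 2 ^ l0 \<le> 2 ^ l / R (idx l0) * 2 ^ l0" by (intro mult_right_mono) auto
    also have "\<dots> = 2 ^ l0 / R (idx l0) * 2 ^ l" by simp
    also have "\<dots> \<le> \<phi> l0 * 2 ^ l" unfolding \<phi>_def by (intro mult_right_mono) auto
    finally have 1: "2 ^ l / R (idx l) * 2 ^ l0 \<le> \<phi> l0 * 2 ^ l" .
    have "(2::real) ^ l0 * 2 ^ l0 \<le> 2 ^ l * 2 ^ l" using that by (intro mult_mono power_increasing) auto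
    then have "1 / 2 ^ l * 2 ^ l0 \<le> 1 / 2 ^ l0 * (2::real) ^ l" by (simp add: field_simps)
    also have "\<dots> \<le> \<phi> l0 * 2 ^ l" unfolding \<phi>_def by (intro mult_right_mono) auto
    finally have 2: "1 / 2 ^ l * 2 ^ l0 \<le> \<phi> l0 * 2 ^ l" .
    show ?thesis using 1 2 unfolding \<phi>_def[of l] by (simp add: max_def)
  qed
  define \<sigma> where "\<sigma> l = \<phi> l powr (1 / 208)" for l
  have \<sigma>\<phi>: "\<sigma> l ^ 208 = \<phi> l" for l
    unfolding \<sigma>_def using \<phi>(1)[of l] by (simp add: powr_realpow[symmetric] powr_powr)
  have \<sigma>1: "0 < \<sigma> l" for l unfolding \<sigma>_def using \<phi>(1)[of l] by simp
  have \<sigma>2: "\<sigma> l \<le> 1" for l unfolding \<sigma>_def using \<phi>(1,2)[of l] powr_mono2[of "1 / 208" "\<phi> l" 1] by simp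
  have \<sigma>3: "1 \<le> \<sigma> l ^ 208 * 2 ^ l" for l unfolding \<sigma>\<phi> by (rule \<phi>(3))
  have \<sigma>4: "\<sigma> l ^ 208 * 2 ^ l0 \<le> \<sigma> l0 ^ 208 * 2 ^ l" if "l0 \<le> l" for l0 l unfolding \<sigma>\<phi> using \<phi>_decay[OF that] .
  have summ: "\<exists>N. \<forall>L. (\<Sum>l=L..3 * L + A. \<sigma> l powr g) \<le> N" if g: "0 < g" for g :: real and A :: nat
  proof -
    define \<delta> where "\<delta> = g / 208"
    have \<delta>: "0 < \<delta>" unfolding \<delta>_def using g by simp
    define H where "H = 1 / (1 - 2 powr - \<delta>)"
    have H: "0 \<le> H" using sum_dyadic_powr_le[of "{}" 1, OF _ _ \<delta>] unfolding H_def by simp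
    \<comment> \<open>After \<open>K0\<close> steps the sequence has been raised to a power above \<open>3 + A\<close>, beyond the range.\<close>
    obtain K0 where K0: "3 + real A < \<theta> ^ K0" using real_arch_pow[OF \<theta>] by blast
    have \<sigma>g: "\<sigma> l powr g \<le> (2 ^ l / R (idx l)) powr \<delta> + (1 / 2 ^ l) powr \<delta>" for l
    proof -
      have "\<sigma> l powr g = \<phi> l powr \<delta>" unfolding \<sigma>_def \<delta>_def by (simp add: powr_powr)
      also have "\<dots> \<le> (2 ^ l / R (idx l)) powr \<delta> + (1 / 2 ^ l) powr \<delta>" unfolding \<phi>_def max_def by simp
      finally show ?thesis .
    qed
    have second: "(\<Sum>l=a..b. (1 / 2 ^ l) powr \<delta>) \<le> H" for a b :: nat
    proof -
      have "(\<Sum>l=a..b. (1 / 2 ^ l) powr \<delta>) = (\<Sum>k\<in>(\<lambda>l. b - l) ` {a..b}. (2 ^ k / 2 ^ b) powr \<delta>)"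
      proof (subst sum.reindex)
        show "inj_on (\<lambda>l. b - l) {a..b}" by (auto simp: inj_on_def)
        show "(\<Sum>l = a..b. (1 / 2 ^ l) powr \<delta>) = sum ((\<lambda>k. (2 ^ k / 2 ^ b) powr \<delta>) \<circ> (\<lambda>l. b - l)) {a..b}"
          by (rule sum.cong) (auto simp: power_diff)
      qed
      also have "\<dots> \<le> H" unfolding H_def using \<delta> by (intro sum_dyadic_powr_le) (auto intro: power_increasing)
      finally show ?thesis .
    qed
    have first: "(\<Sum>l=L..3 * L + A. (2 ^ l / R (idx l)) powr \<delta>) \<le> real (K0 + 2) * H + (real A + 1)" for L
    proof (cases "L = 0")
      case True
      have le1: "(2 ^ l / R (idx l)) powr \<delta> \<le> 1" for l
        using idx[of l] Rpos[of "idx l"] \<delta> by (intro powr_le1) auto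
      have "(\<Sum>l=L..3 * L + A. (2 ^ l / R (idx l)) powr \<delta>) \<le> (\<Sum>l=L..3 * L + A. 1)"
        by (rule sum_mono) (rule le1)
      also have "\<dots> = real A + 1" using True by simp
      finally show ?thesis using H by (simp add: add_increasing)
    next
      case False
      define I where "I = {idx L..idx L + K0}"
      have sub: "idx ` {L..3 * L + A} \<subseteq> I"
      proof
        fix m assume "m \<in> idx ` {L..3 * L + A}"
        then obtain l where l: "L \<le> l" "l \<le> 3 * L + A" "m = idx l" by auto
        have "idx l \<le> idx L + K0"
        proof (rule ccontr)
          assume "\<not> ?thesis"
          then have "R (idx L + K0) < 2 ^ l" by (intro idx_less) simp
          also have "(2::real) ^ l \<le> 2 ^ (3 * L + A)" using l by (intro power_increasing) auto
          also have "\<dots> = 2 powr (3 * real L + real A)" by (simp add: powr_realpow[symmetric])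
          finally have 1: "R (idx L + K0) < 2 powr (3 * real L + real A)" .
          have "2 powr (real L * \<theta> ^ K0) = (2 ^ L) powr (\<theta> ^ K0)" by (simp add: powr_powr powr_realpow[symmetric])
          also have "\<dots> \<le> R (idx L) powr (\<theta> ^ K0)" using idx[of L] \<theta> by (intro powr_mono2) auto
          also have "\<dots> \<le> R (idx L + K0)" by (rule Riter)
          finally have "2 powr (real L * \<theta> ^ K0) < 2 powr (3 * real L + real A)" using 1 by (rule le_less_trans)
          then have "real L * \<theta> ^ K0 < 3 * real L + real A" by simp
          moreover have "real L * (3 + real A) \<le> real L * \<theta> ^ K0" using K0 by (intro mult_left_mono) auto
          moreover have "1 * real A \<le> real L * real A" using False by (intro mult_right_mono) auto
          ultimately show False by (simp add: algebra_simps)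
        qed
        then show "m \<in> I" unfolding I_def l(3) using idx_mono[OF l(1)] by simp
      qed
      have "(\<Sum>l=L..3 * L + A. (2 ^ l / R (idx l)) powr \<delta>)
          = (\<Sum>m\<in>I. \<Sum>l\<in>{l \<in> {L..3 * L + A}. idx l = m}. (2 ^ l / R (idx l)) powr \<delta>)"
        using sub by (intro sum.group[symmetric]) (auto simp: I_def)
      also have "\<dots> \<le> (\<Sum>m\<in>I. H)"
      proof (rule sum_mono)
        fix m
        have "(\<Sum>l\<in>{l \<in> {L..3 * L + A}. idx l = m}. (2 ^ l / R (idx l)) powr \<delta>)
          = (\<Sum>l\<in>{l \<in> {L..3 * L + A}. idx l = m}. (2 ^ l / R m) powr \<delta>)" by (rule sum.cong) auto
        also have "\<dots> \<le> H" unfolding H_def using idx \<delta> by (intro sum_dyadic_powr_le) auto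
        finally show "(\<Sum>l\<in>{l \<in> {L..3 * L + A}. idx l = m}. (2 ^ l / R (idx l)) powr \<delta>) \<le> H" .
      qed
      also have "\<dots> = real (K0 + 1) * H" unfolding I_def by simp
      also have "\<dots> \<le> real (K0 + 2) * H + (real A + 1)" using H by (simp add: algebra_simps)
      finally show ?thesis .
    qed
    have "(\<Sum>l=L..3 * L + A. \<sigma> l powr g) \<le> real (K0 + 2) * H + (real A + 1) + H" for L
    proof -
      have "(\<Sum>l=L..3 * L + A. \<sigma> l powr g) \<le> (\<Sum>l=L..3 * L + A. (2 ^ l / R (idx l)) powr \<delta> + (1 / 2 ^ l) powr \<delta>)"
        by (rule sum_mono) (rule \<sigma>g)
      then show ?thesis using first[of L] second[of L "3 * L + A"] by (simp add: sum.distrib)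
    qed
    then show ?thesis by blast
  qed
  show ?thesis
  proof (rule that)
    show "slow_profile g \<sigma>" if "0 < g" for g
      unfolding slow_profile_def using \<sigma>1 \<sigma>2 \<sigma>3 \<sigma>4 summ[OF that] by blast
    show "2 ^ l \<le> \<sigma> l ^ 208 * (C * Q m)" if "m0 \<le> m" "2 ^ l \<le> C * Q m" for m l
    proof -
      have m: "R (m - m0) = C * Q m" unfolding R_def using that by simp
      then have "idx l \<le> m - m0" using that by (intro idx_le) simp
      then have "R (idx l) \<le> C * Q m" using Rmono m by metis
      have "2 ^ l = 2 ^ l / R (idx l) * R (idx l)" using Rpos[of "idx l"] by simp
      also have "\<dots> \<le> \<phi> l * (C * Q m)"
        using \<open>R (idx l) \<le> C * Q m\<close> Rpos[of "idx l"] \<phi>(1)[of l] unfolding \<phi>_def by (intro mult_mono) auto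
      finally show ?thesis unfolding \<sigma>\<phi> .
    qed
    show "1 \<le> Q m" if "m0 \<le> m" for m using m0(3)[OF that] .
  qed
qed

section \<open>Integer lines along a convex arc\<close>

lemma abs_mult_mono:
  fixes x y :: real
  assumes "\<bar>x\<bar> \<le> a" "\<bar>y\<bar> \<le> b"
  shows "\<bar>x * y\<bar> \<le> a * b"
  unfolding abs_mult using assms by (intro mult_mono) auto

text \<open>Dirichlet's pigeonhole principle. The pairs \<open>(a, b)\<close> range over \<open>N + 1\<close> values of \<open>b\<close> and, for each
  of them, over the \<open>R\<close> consecutive values of \<open>a\<close> for which \<open>a + b \<phi>\<close> lies between \<open>0\<close> and \<open>R\<close>.
  There are more of them than classes modulo \<open>q\<close> combined with the intervals of length \<open>A\<close> that cover
  this range, so two of them agree, and their difference is the combination.\<close>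

lemma exists_small_combination:
  fixes q P1 P2 :: int and \<phi> A B :: real
  assumes q: "q \<noteq> 0" and A: "0 < A" and B: "1 \<le> B" and AB: "2 * \<bar>of_int q\<bar> \<le> A * B"
  shows "\<exists>a b :: int. (a \<noteq> 0 \<or> b \<noteq> 0) \<and> \<bar>of_int b\<bar> \<le> B \<and> \<bar>of_int a + of_int b * \<phi>\<bar> \<le> A
    \<and> q dvd a * P1 + b * P2"
proof -
  define N where "N = nat \<lfloor>B\<rfloor>"
  define R where "R = nat \<lceil>A\<rceil>"
  have N: "B < real N + 1" "real N \<le> B" unfolding N_def using B by linarith+
  have R: "A \<le> real R" unfolding R_def using A by linarith
  define fa where "fa x = (case x of (b, r) \<Rightarrow> \<lceil>- (real b * \<phi>)\<rceil> + int r)" for x :: "nat \<times> nat"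
  define h where "h x = ((fa x * P1 + int (fst x) * P2) mod \<bar>q\<bar>,
    \<lfloor>(of_int (fa x) + real (fst x) * \<phi>) / A\<rfloor>)" for x
  define D where "D = {0..N} \<times> {0..<R}"
  have G: "real r \<le> of_int (fa (b, r)) + real b * \<phi>" "of_int (fa (b, r)) + real b * \<phi> < real r + 1" for b r
    unfolding fa_def by (simp_all, linarith+)
  have img: "h ` D \<subseteq> {0..<\<bar>q\<bar>} \<times> {0..\<lfloor>real R / A\<rfloor>}"
  proof (rule image_subsetI)
    fix x assume "x \<in> D"
    then obtain b r where x: "x = (b, r)" "r < R" unfolding D_def by auto
    have "0 \<le> (of_int (fa x) + real b * \<phi>) / A" using G(1)[of r b] A x by simp
    moreover have "(of_int (fa x) + real b * \<phi>) / A \<le> real R / A"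
      using G(2)[where r=r and b=b] A x by (intro divide_right_mono) (auto intro: order_trans[OF less_imp_le])
    ultimately show "h x \<in> {0..<\<bar>q\<bar>} \<times> {0..\<lfloor>real R / A\<rfloor>}"
      using q x unfolding h_def by (auto intro: floor_mono)
  qed
  have "real (card (h ` D)) \<le> real (card ({0..<\<bar>q\<bar>} \<times> {0..\<lfloor>real R / A\<rfloor>}))"
    using img by (intro of_nat_mono card_mono) auto
  also have "\<dots> = of_int \<bar>q\<bar> * of_int (\<lfloor>real R / A\<rfloor> + 1)"
    using A by (simp add: card_cartesian_product)
  also have "\<dots> \<le> of_int \<bar>q\<bar> * (real R / A + real R / A)"
  proof (rule mult_left_mono)
    have "1 \<le> real R / A" using R A by simp
    then show "of_int (\<lfloor>real R / A\<rfloor> + 1) \<le> real R / A + real R / A" by linarith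
  qed simp
  also have "\<dots> = 2 * \<bar>of_int q\<bar> * real R / A" by simp
  also have "\<dots> \<le> A * B * real R / A"
    using AB A by (intro divide_right_mono mult_right_mono) auto
  also have "\<dots> = B * real R" using A by simp
  also have "\<dots> < (real N + 1) * real R"
    using N R A by (intro mult_strict_right_mono) auto
  also have "\<dots> = real (card D)" unfolding D_def by (simp add: algebra_simps)
  finally have "card (h ` D) < card D" by simp
  then have "\<not> inj_on h D" by (rule pigeonhole)
  then obtain x y where xy: "x \<in> D" "y \<in> D" "h x = h y" "x \<noteq> y" unfolding inj_on_def by auto
  define a b where "a = fa x - fa y" "b = int (fst x) - int (fst y)"
  have "a \<noteq> 0 \<or> b \<noteq> 0"
    using xy(4) unfolding a_b_def fa_def by (cases x; cases y) auto
  moreover have "\<bar>of_int b\<bar> \<le> B"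
    using xy(1,2) N unfolding a_b_def D_def by (auto simp: abs_le_iff)
  moreover have "\<bar>of_int a + of_int b * \<phi>\<bar> \<le> A"
  proof -
    let ?u = "(of_int (fa x) + real (fst x) * \<phi>) / A" and ?v = "(of_int (fa y) + real (fst y) * \<phi>) / A"
    have "\<lfloor>?u\<rfloor> = \<lfloor>?v\<rfloor>" using xy(3) unfolding h_def by simp
    then have "\<bar>?u - ?v\<bar> \<le> 1" by linarith
    moreover have "of_int a + of_int b * \<phi> = (?u - ?v) * A"
      using A unfolding a_b_def by (simp add: algebra_simps diff_divide_distrib add_divide_distrib)
    ultimately show ?thesis using A by (simp add: abs_mult)
  qed
  moreover have "q dvd a * P1 + b * P2"
  proof -
    have "(fa x * P1 + int (fst x) * P2) mod \<bar>q\<bar> = (fa y * P1 + int (fst y) * P2) mod \<bar>q\<bar>"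
      using xy(3) unfolding h_def by simp
    then have "\<bar>q\<bar> dvd (fa x * P1 + int (fst x) * P2) - (fa y * P1 + int (fst y) * P2)"
      by (simp add: mod_eq_dvd_iff)
    also have "\<dots> = a * P1 + b * P2" unfolding a_b_def by (simp add: algebra_simps)
    finally show ?thesis by simp
  qed
  ultimately show ?thesis by blast
qed

text \<open>The slope \<open>\<Phi>\<close> enters through the mean value property only, since \<open>Y\<close> is in general no more than
  continuously differentiable in the given parameter. Signs are normalized such that \<open>X\<close> and \<open>\<Phi>\<close>
  increase.\<close>

locale convex_arc =
  fixes X Y \<Phi> :: "real \<Rightarrow> real" and M c0 r0 :: real
  assumes M: "1 \<le> M" and r0: "0 < r0"
    and X_incr: "\<And>s t. s \<in> cball c0 r0 \<Longrightarrow> t \<in> cball c0 r0 \<Longrightarrow> s \<le> t \<Longrightarrow>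
      (t - s) / M \<le> X t - X s \<and> X t - X s \<le> M * (t - s)"
    and \<Phi>_incr: "\<And>s t. s \<in> cball c0 r0 \<Longrightarrow> t \<in> cball c0 r0 \<Longrightarrow> s \<le> t \<Longrightarrow>
      (t - s) / M \<le> \<Phi> t - \<Phi> s \<and> \<Phi> t - \<Phi> s \<le> M * (t - s)"
    and \<Phi>_bound: "\<And>t. t \<in> cball c0 r0 \<Longrightarrow> \<bar>\<Phi> t\<bar> \<le> M"
    and secant: "\<And>s t. s \<in> cball c0 r0 \<Longrightarrow> t \<in> cball c0 r0 \<Longrightarrow> s \<le> t \<Longrightarrow>
      \<exists>\<xi>\<in>{s..t}. Y t - Y s = \<Phi> \<xi> * (X t - X s)"
begin

text \<open>The line \<open>a x + b y + d = 0\<close>, evaluated on the arc.\<close>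

definition F :: "int \<Rightarrow> int \<Rightarrow> int \<Rightarrow> real \<Rightarrow> real" where
  "F a b d t = of_int a * X t + of_int b * Y t + of_int d"

text \<open>The derivative of the line with respect to \<open>X\<close>. It is small where the line is nearly tangent.\<close>

definition G :: "int \<Rightarrow> int \<Rightarrow> real \<Rightarrow> real" where
  "G a b t = of_int a + of_int b * \<Phi> t"

lemma between_in_ball:
  "s \<in> cball c0 r0 \<Longrightarrow> t \<in> cball c0 r0 \<Longrightarrow> s \<le> u \<Longrightarrow> u \<le> t \<Longrightarrow> u \<in> cball c0 r0"
  by (auto simp: dist_real_def abs_le_iff)

lemma F_secant:
  assumes "s \<in> cball c0 r0" "t \<in> cball c0 r0" "s \<le> t"
  obtains \<xi> where "\<xi> \<in> {s..t}" "\<xi> \<in> cball c0 r0" "F a b d t - F a b d s = G a b \<xi> * (X t - X s)"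
proof -
  obtain \<xi> where \<xi>: "\<xi> \<in> {s..t}" "Y t - Y s = \<Phi> \<xi> * (X t - X s)" using secant[OF assms] by blast
  have "F a b d t - F a b d s = of_int a * (X t - X s) + of_int b * (Y t - Y s)"
    unfolding F_def by (simp add: algebra_simps)
  also have "\<dots> = G a b \<xi> * (X t - X s)" unfolding \<xi>(2) G_def by (simp add: algebra_simps)
  finally show ?thesis using that[OF \<xi>(1) between_in_ball[OF assms(1,2)]] \<xi>(1) by simp
qed

lemma X_dist:
  assumes "s \<in> cball c0 r0" "t \<in> cball c0 r0"
  shows "\<bar>X t - X s\<bar> \<le> M * dist s t" "dist s t \<le> M * \<bar>X t - X s\<bar>"
proof -
  have *: "\<bar>X t - X s\<bar> \<le> M * \<bar>t - s\<bar> \<and> \<bar>t - s\<bar> \<le> M * \<bar>X t - X s\<bar>"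
    if "s \<in> cball c0 r0" "t \<in> cball c0 r0" "s \<le> t" for s t
  proof -
    note X = X_incr[OF that]
    have "0 \<le> (t - s) / M" using M that(3) by simp
    then have "0 \<le> X t - X s" using X by linarith
    moreover have "t - s \<le> M * (X t - X s)" using X M by (simp add: field_simps)
    ultimately show ?thesis using X that(3) by simp
  qed
  show "\<bar>X t - X s\<bar> \<le> M * dist s t" "dist s t \<le> M * \<bar>X t - X s\<bar>"
    using *[OF assms] *[OF assms(2,1)] by (cases "s \<le> t"; simp add: dist_real_def abs_minus_commute)+
qed

lemma G_dist:
  assumes "s \<in> cball c0 r0" "t \<in> cball c0 r0"
  shows "\<bar>G a b t - G a b s\<bar> \<le> \<bar>of_int b\<bar> * (M * dist s t)"
proof -
  have *: "\<bar>\<Phi> t - \<Phi> s\<bar> \<le> M * \<bar>t - s\<bar>" if "s \<in> cball c0 r0" "t \<in> cball c0 r0" "s \<le> t" for s t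
  proof -
    have "0 \<le> (t - s) / M" using M that(3) by simp
    then show ?thesis using \<Phi>_incr[OF that] that(3) by simp
  qed
  have "\<bar>\<Phi> t - \<Phi> s\<bar> \<le> M * dist s t"
    using *[OF assms] *[OF assms(2,1)] by (cases "s \<le> t"; simp add: dist_real_def abs_minus_commute)
  then have "\<bar>of_int b * (\<Phi> t - \<Phi> s)\<bar> \<le> \<bar>of_int b\<bar> * (M * dist s t)"
    by (simp add: abs_mult mult_left_mono)
  then show ?thesis unfolding G_def by (simp add: algebra_simps)
qed

lemma F_secant_dist:
  assumes "s \<in> cball c0 r0" "t \<in> cball c0 r0"
  obtains \<xi> where "\<xi> \<in> cball c0 r0" "dist s \<xi> \<le> dist s t" "F a b d t - F a b d s = G a b \<xi> * (X t - X s)"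
proof (cases "s \<le> t")
  case True
  obtain \<xi> where "\<xi> \<in> {s..t}" "\<xi> \<in> cball c0 r0" "F a b d t - F a b d s = G a b \<xi> * (X t - X s)"
    using F_secant[OF assms True] by metis
  then show ?thesis using that[of \<xi>] by (auto simp: dist_real_def)
next
  case False
  then have "t \<le> s" by simp
  obtain \<xi> where "\<xi> \<in> {t..s}" "\<xi> \<in> cball c0 r0" "F a b d s - F a b d t = G a b \<xi> * (X s - X t)"
    using F_secant[OF assms(2,1) \<open>t \<le> s\<close>] by metis
  then show ?thesis using that[of \<xi>] by (auto simp: dist_real_def algebra_simps)
qed

lemma F_dist:
  assumes "s \<in> cball c0 r0" "t \<in> cball c0 r0"
    and "\<And>\<xi>. \<xi> \<in> cball c0 r0 \<Longrightarrow> dist s \<xi> \<le> dist s t \<Longrightarrow> \<bar>G a b \<xi>\<bar> \<le> g"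
  shows "\<bar>F a b d t - F a b d s\<bar> \<le> g * (M * dist s t)"
proof -
  obtain \<xi> where \<xi>: "\<xi> \<in> cball c0 r0" "dist s \<xi> \<le> dist s t"
    "F a b d t - F a b d s = G a b \<xi> * (X t - X s)"
    using F_secant_dist[OF assms(1,2)] by metis
  show ?thesis unfolding \<xi>(3)
    using assms(3)[OF \<xi>(1,2)] X_dist(1)[OF assms(1,2)] by (intro abs_mult_mono)
qed

text \<open>The determinant of three lines, rewritten by column operations in terms of the values \<open>F\<close>, the
  slopes \<open>G\<close> and the coefficients \<open>b\<close> at one point \<open>t\<close>. It is an integer, so that smallness of the
  right-hand side at a single point forces it to vanish.\<close>

lemma det_identity:
  "of_int (a3 * (b1 * d2 - b2 * d1) + b3 * (d1 * a2 - d2 * a1) + d3 * (a1 * b2 - a2 * b1)) =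
    F a1 b1 d1 t * (G a2 b2 t * of_int b3 - G a3 b3 t * of_int b2)
    - G a1 b1 t * (F a2 b2 d2 t * of_int b3 - F a3 b3 d3 t * of_int b2)
    + of_int b1 * (F a2 b2 d2 t * G a3 b3 t - F a3 b3 d3 t * G a2 b2 t)"
  unfolding F_def G_def by (simp add: algebra_simps)

text \<open>Evaluate the determinant at the middle point \<open>t2\<close>. As the arc is convex, the tangents at \<open>t1\<close> and
  \<open>t3\<close> pass \<open>t2\<close> on the same side, at a distance comparable with the square of the separation, and
  with slopes of opposite signs. Hence the main term \<open>b2 * (f1 * g3 + g1 * f3)\<close> is a sum of two
  positive terms; it dominates the contribution of the line at \<open>t2\<close>, which is controlled by \<open>\<tau>\<close> and
  \<open>cF\<close>. On the other hand the upper bound on \<open>t3 - t1\<close> keeps the determinant below one.\<close>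

lemma no_three_separated_tangents:
  fixes B d \<tau> cF c3 :: real
  assumes t: "t1 \<in> cball c0 r0" "t3 \<in> cball c0 r0" "t1 + d \<le> t2" "t2 + d \<le> t3"
    and len: "(t3 - t1) * B \<le> 2 * c3" and c3: "8 * M * c3 \<le> 1"
    and B: "0 < B" and d: "0 < d" and pos: "0 \<le> \<tau>" "0 \<le> cF"
    and \<tau>: "4608 * M ^ 5 * \<tau> \<le> B * d" and cF: "1536 * M ^ 4 * cF \<le> (B * d) ^ 2"
    and b1: "B / 2 \<le> of_int b1" "of_int b1 \<le> B" and b2: "B / 2 \<le> of_int b2" "of_int b2 \<le> B"
    and b3: "B / 2 \<le> of_int b3" "of_int b3 \<le> B"
    and G: "\<bar>G a1 b1 t1\<bar> \<le> \<tau>" "\<bar>G a2 b2 t2\<bar> \<le> \<tau>" "\<bar>G a3 b3 t3\<bar> \<le> \<tau>"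
    and F: "\<bar>F a1 b1 d1 t1\<bar> \<le> cF / B" "\<bar>F a2 b2 d2 t2\<bar> \<le> cF / B" "\<bar>F a3 b3 d3 t3\<bar> \<le> cF / B"
  shows False
proof -
  define D1 D3 where "D1 = t2 - t1" "D3 = t3 - t2"
  have D: "d \<le> D1" "d \<le> D3" using t unfolding D1_D3_def by auto
  have t2: "t2 \<in> cball c0 r0" using between_in_ball[OF t(1,2)] t(3,4) d by auto
  have Mp: "1 \<le> M ^ n" for n using M by (rule one_le_power)
  have M1: "0 < M" using M by simp
  have \<tau>': "\<tau> * M ^ n \<le> B * d / 4608" if "n \<le> 5" for n
  proof -
    have "\<tau> * M ^ n \<le> \<tau> * M ^ 5" using pos M that by (intro mult_left_mono power_increasing) auto
    then show ?thesis using \<tau> by (simp add: mult_ac)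
  qed
  have cF': "cF * M ^ n \<le> (B * d) ^ 2 / 1536" if "n \<le> 4" for n
  proof -
    have "cF * M ^ n \<le> cF * M ^ 4" using pos M that by (intro mult_left_mono power_increasing) auto
    then show ?thesis using cF by (simp add: mult_ac)
  qed
  \<comment> \<open>The estimates for the tangent at \<open>t1\<close>, seen from \<open>t2\<close>; those at \<open>t3\<close> are their mirror image.\<close>
  have side: "B * D / (4 * M) \<le> g \<and> g \<le> 2 * B * M * D \<and>
      B * D\<^sup>2 / (32 * M\<^sup>2) \<le> f \<and> f \<le> 3 * B * M\<^sup>2 * D\<^sup>2"
    if D: "d \<le> D" and g: "- \<tau> + B / 2 * (D / M) \<le> g" "g \<le> \<tau> + B * (M * D)"
      and f: "f \<ge> (- \<tau> + B / 2 * (D / 2 / M)) * (D / 2 / M) - \<tau> * (M * (D / 2)) - cF / B"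
        "f \<le> cF / B + 2 * B * M * D * (M * D)" for D g f
  proof -
    have D0: "0 < D" using D d by simp
    have BD: "B * d \<le> B * D" using D B by simp
    have BD0: "0 < B * d" "0 < B * D" using B d D0 by simp_all
    have h: "\<tau> * M ^ n \<le> B * D / 4608" if "n \<le> 5" for n using \<tau>'[OF that] BD BD0 by linarith
    have k1: "\<tau> * M ^ 3 \<le> B * D / 128" using h[of 3] BD0 by linarith
    define N where "N = B * D / M"
    have N0: "0 < N" unfolding N_def using BD0 M1 by simp
    have \<tau>N: "\<tau> \<le> N / 4608" using h[of 1] M1 unfolding N_def by (simp add: field_simps)
    have N4: "B * D / (4 * M) = N / 4" "B / 2 * (D / M) = N / 2" unfolding N_def by simp_all
    have 1: "B * D / (4 * M) \<le> g" using g(1) \<tau>N N0 unfolding N4 by linarith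
    have "\<tau> * M ^ 0 \<le> B * D" using h[of 0] BD0 by linarith
    then have "\<tau> \<le> B * D" by simp
    also have "\<dots> \<le> B * (M * D)" using B D0 M by simp
    finally have 2: "g \<le> 2 * B * M * D" using g by simp
    have cB: "cF / B * M\<^sup>2 \<le> B * D\<^sup>2 / 128"
    proof -
      have "(B * d)\<^sup>2 \<le> (B * D)\<^sup>2" using BD BD0 by (intro power_mono) auto
      moreover have "0 \<le> (B * D)\<^sup>2" by simp
      ultimately have "cF * M\<^sup>2 \<le> (B * D)\<^sup>2 / 128" using cF'[of 2] by linarith
      then show ?thesis using B by (simp add: field_simps power2_eq_square)
    qed
    have NN: "B / 2 * (D / 2 / M) = N / 4" unfolding N_def by simp
    have "7 * N / 64 \<le> - \<tau> + B / 2 * (D / 2 / M)" unfolding NN using \<tau>N N0 by linarith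
    then have "7 * N / 64 * (D / 2 / M) \<le> (- \<tau> + B / 2 * (D / 2 / M)) * (D / 2 / M)"
      using D0 M1 by (intro mult_right_mono) auto
    then have m: "7 * B * D\<^sup>2 / (128 * M\<^sup>2) \<le> (- \<tau> + B / 2 * (D / 2 / M)) * (D / 2 / M)"
      unfolding N_def by (simp add: field_simps power2_eq_square)
    have e1: "\<tau> * (M * (D / 2)) \<le> B * D\<^sup>2 / (256 * M\<^sup>2)"
    proof -
      have "\<tau> * M ^ 3 * D \<le> B * D / 128 * D" using k1 D0 by (intro mult_right_mono) auto
      then show ?thesis using M1 by (simp add: field_simps power2_eq_square power3_eq_cube)
    qed
    have e2: "cF / B \<le> B * D\<^sup>2 / (128 * M\<^sup>2)"
      using cB M1 B by (simp add: field_simps)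
    define Z where "Z = B * D\<^sup>2 / (256 * M\<^sup>2)"
    have "0 \<le> Z" unfolding Z_def using B by simp
    moreover have "14 * Z \<le> (- \<tau> + B / 2 * (D / 2 / M)) * (D / 2 / M)" "\<tau> * (M * (D / 2)) \<le> Z" "cF / B \<le> 2 * Z"
      using m e1 e2 unfolding Z_def by (simp_all add: field_simps)
    ultimately have "8 * Z \<le> f" using f(1) by linarith
    then have 3: "B * D\<^sup>2 / (32 * M\<^sup>2) \<le> f" unfolding Z_def by simp
    have "cF / B \<le> B * D\<^sup>2 * M\<^sup>2"
    proof -
      have "cF / B \<le> cF / B * M\<^sup>2" using mult_left_mono[OF Mp[of 2], of "cF / B"] pos B by simp
      also have "\<dots> \<le> B * D\<^sup>2 * 1"
      proof -
        have "0 \<le> B * D\<^sup>2" using B by simp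
        then show ?thesis using cB by linarith
      qed
      also have "\<dots> \<le> B * D\<^sup>2 * M\<^sup>2" using B Mp[of 2] by (intro mult_left_mono) auto
      finally show ?thesis .
    qed
    then have 4: "f \<le> 3 * B * M\<^sup>2 * D\<^sup>2" using f(2) by (simp add: power2_eq_square algebra_simps)
    show ?thesis using 1 2 3 4 by simp
  qed
  define g1 f1 g3 f3 g2 f2 where "g1 = G a1 b1 t2" "f1 = F a1 b1 d1 t2" "g3 = - G a3 b3 t2" "f3 = F a3 b3 d3 t2"
    "g2 = G a2 b2 t2" "f2 = F a2 b2 d2 t2"
  have s1: "B * D1 / (4 * M) \<le> g1 \<and> g1 \<le> 2 * B * M * D1 \<and>
      B * D1\<^sup>2 / (32 * M\<^sup>2) \<le> f1 \<and> f1 \<le> 3 * B * M\<^sup>2 * D1\<^sup>2"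
  proof (rule side[OF D(1)])
    have Gb: "G a1 b1 t = G a1 b1 t1 + of_int b1 * (\<Phi> t - \<Phi> t1)" for t unfolding G_def by (simp add: algebra_simps)
    have Glow: "- \<tau> + B / 2 * (u / M) \<le> G a1 b1 t" if "t1 + u \<le> t" "t \<le> t2" "0 \<le> u" for t u
    proof -
      have "t \<in> cball c0 r0" using between_in_ball[OF t(1) t2] that by simp
      then have "(t - t1) / M \<le> \<Phi> t - \<Phi> t1" using \<Phi>_incr[OF t(1), of t] that by simp
      moreover have "u / M \<le> (t - t1) / M" using that M1 by (intro divide_right_mono) auto
      ultimately have "u / M \<le> \<Phi> t - \<Phi> t1" by linarith
      moreover have "0 \<le> u / M" using that M1 by simp
      ultimately have "B / 2 * (u / M) \<le> of_int b1 * (\<Phi> t - \<Phi> t1)" using b1 B by (intro mult_mono) auto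
      then show ?thesis unfolding Gb[of t] using G(1) by (auto simp: abs_le_iff)
    qed
    have Gup: "G a1 b1 t \<le> \<tau> + B * (M * D1)" if "t1 \<le> t" "t \<le> t2" for t
    proof -
      have tb: "t \<in> cball c0 r0" using between_in_ball[OF t(1) t2] that by simp
      have "M * (t - t1) \<le> M * D1" using that M1 unfolding D1_D3_def by (intro mult_left_mono) auto
      then have "\<Phi> t - \<Phi> t1 \<le> M * D1" using \<Phi>_incr[OF t(1) tb that(1)] by linarith
      moreover have "0 \<le> (t - t1) / M" using that M1 by simp
      then have "0 \<le> \<Phi> t - \<Phi> t1" using \<Phi>_incr[OF t(1) tb that(1)] by linarith
      ultimately have "of_int b1 * (\<Phi> t - \<Phi> t1) \<le> B * (M * D1)" using b1 B by (intro mult_mono) auto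
      then show ?thesis unfolding Gb[of t] using G(1) by (auto simp: abs_le_iff)
    qed
    show "- \<tau> + B / 2 * (D1 / M) \<le> g1" unfolding g1_f1_g3_f3_g2_f2_def
      using Glow[of D1 t2] D d unfolding D1_D3_def by auto
    show "g1 \<le> \<tau> + B * (M * D1)" unfolding g1_f1_g3_f3_g2_f2_def
      using Gup[of t2] D d unfolding D1_D3_def by auto
    \<comment> \<open>Up to the midpoint \<open>F\<close> cannot decrease by more than \<open>\<tau>\<close> allows; beyond it the slope is
      of the order of the separation and \<open>F\<close> grows.\<close>
    define m where "m = t1 + D1 / 2"
    have m12: "t1 \<le> m" "m \<le> t2"
      unfolding m_def D1_D3_def using t(3) d by (simp_all add: field_simps)
    note m = m12 between_in_ball[OF t(1) t2 m12]
    obtain \<xi> where \<xi>: "\<xi> \<in> {m..t2}" "f1 - F a1 b1 d1 m = G a1 b1 \<xi> * (X t2 - X m)"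
      unfolding g1_f1_g3_f3_g2_f2_def using F_secant[OF m(3) t2 m(2)] by metis
    obtain \<eta> where \<eta>: "\<eta> \<in> {t1..m}" "F a1 b1 d1 m - F a1 b1 d1 t1 = G a1 b1 \<eta> * (X m - X t1)"
      using F_secant[OF t(1) m(3) m(1)] by metis
    have X1: "D1 / 2 / M \<le> X t2 - X m" "X t2 - X m \<le> M * (D1 / 2)"
      using X_incr[OF m(3) t2 m(2)] unfolding m_def D1_D3_def by (simp_all add: field_simps)
    have X2: "D1 / 2 / M \<le> X m - X t1" "X m - X t1 \<le> M * (D1 / 2)"
      using X_incr[OF t(1) m(3) m(1)] unfolding m_def by (simp_all add: field_simps)
    have D1p: "0 < D1" using D d by simp
    have nn: "0 \<le> D1 / 2 / M" using D1p M1 by simp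
    have p: "0 \<le> - \<tau> + B / 2 * (D1 / 2 / M)"
    proof -
      have "\<tau> * M ^ 1 \<le> B * D1 / 4" using \<tau>'[of 1] mult_left_mono[OF D(1), of B] mult_pos_pos[OF B d] B by linarith
      then show ?thesis using M1 by (simp add: field_simps)
    qed
    have "(- \<tau> + B / 2 * (D1 / 2 / M)) * (D1 / 2 / M) \<le> G a1 b1 \<xi> * (X t2 - X m)"
      using Glow[of "D1 / 2" \<xi>] \<xi>(1) X1 nn p D1p unfolding m_def by (intro mult_mono) auto
    moreover have "- (\<tau> * (M * (D1 / 2))) \<le> G a1 b1 \<eta> * (X m - X t1)"
    proof -
      have "- G a1 b1 \<eta> \<le> \<tau>" using Glow[of 0 \<eta>] \<eta>(1) m(2) by auto
      then have "- G a1 b1 \<eta> * (X m - X t1) \<le> \<tau> * (M * (D1 / 2))"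
        using X2 nn pos M1 D1p by (smt (verit) mult_mono mult_nonneg_nonneg mult_right_mono)
      then show ?thesis by simp
    qed
    ultimately show "f1 \<ge> (- \<tau> + B / 2 * (D1 / 2 / M)) * (D1 / 2 / M) - \<tau> * (M * (D1 / 2)) - cF / B"
      using \<xi>(2) \<eta>(2) F(1) by (auto simp: abs_le_iff)
    obtain \<zeta> where \<zeta>: "\<zeta> \<in> {t1..t2}" "f1 - F a1 b1 d1 t1 = G a1 b1 \<zeta> * (X t2 - X t1)"
      unfolding g1_f1_g3_f3_g2_f2_def using F_secant[OF t(1) t2] D d unfolding D1_D3_def by (metis diff_ge_0_iff_ge less_imp_le order_trans)
    have X3: "0 \<le> X t2 - X t1" "X t2 - X t1 \<le> M * D1" using X1 X2 nn by (simp_all add: field_simps)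
    have "G a1 b1 \<zeta> \<le> 2 * B * M * D1"
    proof -
      have "\<tau> * M ^ 0 \<le> B * D1" using \<tau>'[of 0] mult_left_mono[OF D(1), of B] mult_pos_pos[OF B d] B by linarith
        then have "\<tau> \<le> B * D1" by simp
      also have "\<dots> \<le> B * (M * D1)" using B D1p M by simp
      finally show ?thesis using Gup[of \<zeta>] \<zeta>(1) by simp
    qed
    then have "G a1 b1 \<zeta> * (X t2 - X t1) \<le> 2 * B * M * D1 * (M * D1)"
      using X3 B M1 D1p by (intro order_trans[OF mult_right_mono mult_left_mono]) auto
    then show "f1 \<le> cF / B + 2 * B * M * D1 * (M * D1)" using \<zeta>(2) F(1) by (auto simp: abs_le_iff)
  qed
  have s3: "B * D3 / (4 * M) \<le> g3 \<and> g3 \<le> 2 * B * M * D3 \<and>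
      B * D3\<^sup>2 / (32 * M\<^sup>2) \<le> f3 \<and> f3 \<le> 3 * B * M\<^sup>2 * D3\<^sup>2"
  proof (rule side[OF D(2)])
    have Gb: "- G a3 b3 t = - G a3 b3 t3 + of_int b3 * (\<Phi> t3 - \<Phi> t)" for t unfolding G_def by (simp add: algebra_simps)
    have Glow: "- \<tau> + B / 2 * (u / M) \<le> - G a3 b3 t" if "t + u \<le> t3" "t2 \<le> t" "0 \<le> u" for t u
    proof -
      have "t \<in> cball c0 r0" using between_in_ball[OF t2 t(2)] that by simp
      then have "(t3 - t) / M \<le> \<Phi> t3 - \<Phi> t" using \<Phi>_incr[OF _ t(2), of t] that by simp
      moreover have "u / M \<le> (t3 - t) / M" using that M1 by (intro divide_right_mono) auto
      ultimately have "u / M \<le> \<Phi> t3 - \<Phi> t" by linarith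
      moreover have "0 \<le> u / M" using that M1 by simp
      ultimately have "B / 2 * (u / M) \<le> of_int b3 * (\<Phi> t3 - \<Phi> t)" using b3 B by (intro mult_mono) auto
      then show ?thesis unfolding Gb[of t] using G(3) by (auto simp: abs_le_iff)
    qed
    have Gup: "- G a3 b3 t \<le> \<tau> + B * (M * D3)" if "t2 \<le> t" "t \<le> t3" for t
    proof -
      have tb: "t \<in> cball c0 r0" using between_in_ball[OF t2 t(2)] that by simp
      have "M * (t3 - t) \<le> M * D3" using that M1 unfolding D1_D3_def by (intro mult_left_mono) auto
      then have "\<Phi> t3 - \<Phi> t \<le> M * D3" using \<Phi>_incr[OF tb t(2) that(2)] by linarith
      moreover have "0 \<le> (t3 - t) / M" using that M1 by simp
      then have "0 \<le> \<Phi> t3 - \<Phi> t" using \<Phi>_incr[OF tb t(2) that(2)] by linarith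
      ultimately have "of_int b3 * (\<Phi> t3 - \<Phi> t) \<le> B * (M * D3)" using b3 B by (intro mult_mono) auto
      then show ?thesis unfolding Gb[of t] using G(3) by (auto simp: abs_le_iff)
    qed
    show "- \<tau> + B / 2 * (D3 / M) \<le> g3" unfolding g1_f1_g3_f3_g2_f2_def
      using Glow[of t2 D3] D d unfolding D1_D3_def by auto
    show "g3 \<le> \<tau> + B * (M * D3)" unfolding g1_f1_g3_f3_g2_f2_def
      using Gup[of t2] D d unfolding D1_D3_def by auto
    define m where "m = t3 - D3 / 2"
    have m12: "t2 \<le> m" "m \<le> t3"
      unfolding m_def D1_D3_def using t(4) d by (simp_all add: field_simps)
    note m = m12 between_in_ball[OF t2 t(2) m12]
    obtain \<xi> where \<xi>: "\<xi> \<in> {t2..m}" "F a3 b3 d3 m - f3 = G a3 b3 \<xi> * (X m - X t2)"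
      unfolding g1_f1_g3_f3_g2_f2_def using F_secant[OF t2 m(3) m(1)] by metis
    obtain \<eta> where \<eta>: "\<eta> \<in> {m..t3}" "F a3 b3 d3 t3 - F a3 b3 d3 m = G a3 b3 \<eta> * (X t3 - X m)"
      using F_secant[OF m(3) t(2) m(2)] by metis
    have X1: "D3 / 2 / M \<le> X m - X t2" "X m - X t2 \<le> M * (D3 / 2)"
      using X_incr[OF t2 m(3) m(1)] unfolding m_def D1_D3_def by (simp_all add: field_simps)
    have X2: "D3 / 2 / M \<le> X t3 - X m" "X t3 - X m \<le> M * (D3 / 2)"
      using X_incr[OF m(3) t(2) m(2)] unfolding m_def by (simp_all add: field_simps)
    have D3p: "0 < D3" using D d by simp
    have nn: "0 \<le> D3 / 2 / M" using D3p M1 by simp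
    have p: "0 \<le> - \<tau> + B / 2 * (D3 / 2 / M)"
    proof -
      have "\<tau> * M ^ 1 \<le> B * D3 / 4" using \<tau>'[of 1] mult_left_mono[OF D(2), of B] mult_pos_pos[OF B d] B by linarith
      then show ?thesis using M1 by (simp add: field_simps)
    qed
    have "(- \<tau> + B / 2 * (D3 / 2 / M)) * (D3 / 2 / M) \<le> - G a3 b3 \<xi> * (X m - X t2)"
      using Glow[of \<xi> "D3 / 2"] \<xi>(1) X1 nn p D3p unfolding m_def by (intro mult_mono) auto
    moreover have "- (\<tau> * (M * (D3 / 2))) \<le> - G a3 b3 \<eta> * (X t3 - X m)"
    proof -
      have "G a3 b3 \<eta> \<le> \<tau>" using Glow[of \<eta> 0] \<eta>(1) m(1) by auto
      then have "G a3 b3 \<eta> * (X t3 - X m) \<le> \<tau> * (M * (D3 / 2))"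
        using X2 nn pos M1 D3p by (smt (verit) mult_mono mult_nonneg_nonneg mult_right_mono)
      then show ?thesis by simp
    qed
    ultimately show "f3 \<ge> (- \<tau> + B / 2 * (D3 / 2 / M)) * (D3 / 2 / M) - \<tau> * (M * (D3 / 2)) - cF / B"
      using \<xi>(2) \<eta>(2) F(3) by (auto simp: abs_le_iff)
    obtain \<zeta> where \<zeta>: "\<zeta> \<in> {t2..t3}" "F a3 b3 d3 t3 - f3 = G a3 b3 \<zeta> * (X t3 - X t2)"
      unfolding g1_f1_g3_f3_g2_f2_def using F_secant[OF t2 t(2)] D d unfolding D1_D3_def by (metis diff_ge_0_iff_ge less_imp_le order_trans)
    have X3: "0 \<le> X t3 - X t2" "X t3 - X t2 \<le> M * D3" using X1 X2 nn by (simp_all add: field_simps)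
    have "- G a3 b3 \<zeta> \<le> 2 * B * M * D3"
    proof -
      have "\<tau> * M ^ 0 \<le> B * D3" using \<tau>'[of 0] mult_left_mono[OF D(2), of B] mult_pos_pos[OF B d] B by linarith
        then have "\<tau> \<le> B * D3" by simp
      also have "\<dots> \<le> B * (M * D3)" using B D3p M by simp
      finally show ?thesis using Gup[of \<zeta>] \<zeta>(1) by simp
    qed
    then have "- G a3 b3 \<zeta> * (X t3 - X t2) \<le> 2 * B * M * D3 * (M * D3)"
      using X3 B M1 D3p by (intro order_trans[OF mult_right_mono mult_left_mono]) auto
    then show "f3 \<le> cF / B + 2 * B * M * D3 * (M * D3)" using \<zeta>(2) F(3) by (auto simp: abs_le_iff)
  qed
  define K where "K = a3 * (b1 * d2 - b2 * d1) + b3 * (d1 * a2 - d2 * a1) + d3 * (a1 * b2 - a2 * b1)"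
  define main where "main = of_int b2 * (f1 * g3 + g1 * f3)"
  define err where "err = g2 * (f1 * of_int b3 - f3 * of_int b1) - f2 * (of_int b1 * g3 + g1 * of_int b3)"
  have K: "of_int K = main + err"
    unfolding K_def det_identity[where t=t2] main_def err_def g1_f1_g3_f3_g2_f2_def by (simp add: algebra_simps)
  have Dp: "0 < D1" "0 < D3" using D d by auto
  define S where "S = D1 + D3"
  have S: "2 * d \<le> S" "D1 \<le> S" "D3 \<le> S" "0 < S" using D Dp unfolding S_def by auto
  have DD: "d * S / 2 \<le> D1 * D3"
  proof -
    have "d * D3 \<le> D1 * D3" "d * D1 \<le> D3 * D1" using D Dp by (auto intro: mult_right_mono)
    then show ?thesis unfolding S_def by (simp add: algebra_simps)
  qed
  define E where "E = B ^ 3 * d * S\<^sup>2 / (512 * M ^ 3)"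
  have E0: "0 < E" unfolding E_def using B d S M1 by simp
  have low0: "0 \<le> B * D1 / (4 * M)" "0 \<le> B * D3 / (4 * M)"
    "0 \<le> B * D1\<^sup>2 / (32 * M\<^sup>2)" "0 \<le> B * D3\<^sup>2 / (32 * M\<^sup>2)"
    using B Dp M1 by simp_all
  have fpos: "0 \<le> f1" "0 \<le> f3" "0 \<le> g1" "0 \<le> g3"
    using s1 s3 low0 by linarith+
  have low: "E \<le> main"
  proof -
    have "B * D1\<^sup>2 / (32 * M\<^sup>2) * (B * D3 / (4 * M)) \<le> f1 * g3"
      using s1 s3 by (intro mult_mono fpos low0) auto
    moreover have "B * D1 / (4 * M) * (B * D3\<^sup>2 / (32 * M\<^sup>2)) \<le> g1 * f3"
      using s1 s3 by (intro mult_mono fpos low0) auto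
    moreover have "B * B * (D1 * D3) * S / (128 * M ^ 3) =
      B * D1\<^sup>2 / (32 * M\<^sup>2) * (B * D3 / (4 * M)) + B * D1 / (4 * M) * (B * D3\<^sup>2 / (32 * M\<^sup>2))"
      unfolding S_def using M1 by (simp add: field_simps power2_eq_square power3_eq_cube)
    ultimately have "B * B * (D1 * D3) * S / (128 * M ^ 3) \<le> f1 * g3 + g1 * f3" by linarith
    moreover have "B * B * (d * S / 2) * S / (128 * M ^ 3) \<le> B * B * (D1 * D3) * S / (128 * M ^ 3)"
      using DD B S M1 by (intro divide_right_mono mult_right_mono mult_left_mono) auto
    ultimately have "B * B * (d * S / 2) * S / (128 * M ^ 3) \<le> f1 * g3 + g1 * f3" by linarith
    then have "B / 2 * (B * B * (d * S / 2) * S / (128 * M ^ 3)) \<le> main"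
      unfolding main_def using b2 B d S M1 by (intro mult_mono) auto
    then show ?thesis unfolding E_def by (simp add: power2_eq_square power3_eq_cube mult_ac)
  qed
  have err: "\<bar>err\<bar> \<le> 2 / 3 * E"
  proof -
    have BM: "0 \<le> 3 * B * M\<^sup>2" using B by simp
    have "D1\<^sup>2 \<le> S\<^sup>2" "D3\<^sup>2 \<le> S\<^sup>2" using S Dp by (auto intro: power_mono)
    then have fS: "f1 \<le> 3 * B * M\<^sup>2 * S\<^sup>2" "f3 \<le> 3 * B * M\<^sup>2 * S\<^sup>2"
      using s1 s3 BM mult_left_mono[of _ "S\<^sup>2" "3 * B * M\<^sup>2"] by (meson order_trans)+
    have bpos: "0 \<le> real_of_int b1" "0 \<le> real_of_int b3" using b1 b3 B by linarith+
    have "f1 * of_int b3 \<le> 3 * B * M\<^sup>2 * S\<^sup>2 * B" "f3 * of_int b1 \<le> 3 * B * M\<^sup>2 * S\<^sup>2 * B"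
      using fS fpos b1 b3 bpos by (intro mult_mono; linarith)+
    moreover have "0 \<le> f1 * of_int b3" "0 \<le> f3 * of_int b1" using fpos bpos by simp_all
    ultimately have "\<bar>f1 * of_int b3 - f3 * of_int b1\<bar> \<le> 3 * B * M\<^sup>2 * S\<^sup>2 * B" by linarith
    then have e1: "\<bar>g2 * (f1 * of_int b3 - f3 * of_int b1)\<bar> \<le> \<tau> * (3 * B * M\<^sup>2 * S\<^sup>2 * B)"
      using G(2) unfolding g1_f1_g3_f3_g2_f2_def by (intro abs_mult_mono)
    have e1': "\<tau> * (3 * B * M\<^sup>2 * S\<^sup>2 * B) \<le> E / 3"
    proof -
      have "\<tau> * M ^ 5 * (3 * B\<^sup>2 * S\<^sup>2) \<le> B * d / 4608 * (3 * B\<^sup>2 * S\<^sup>2)"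
        using \<tau>'[of 5] by (intro mult_right_mono) auto
      then show ?thesis unfolding E_def using M1 B d
        by (simp add: field_simps power2_eq_square power3_eq_cube eval_nat_numeral)
    qed
    have "g1 \<le> 2 * B * M * D1" "g3 \<le> 2 * B * M * D3" using s1 s3 by auto
    moreover have "0 \<le> 2 * B * M * D1" "0 \<le> 2 * B * M * D3" using B M1 Dp by simp_all
    ultimately have "of_int b1 * g3 + g1 * of_int b3 \<le> B * (2 * B * M * D3) + 2 * B * M * D1 * B"
      using fpos b1 b3 B bpos by (intro add_mono mult_mono; linarith)
    also have "\<dots> = 2 * B\<^sup>2 * M * S" unfolding S_def by (simp add: algebra_simps power2_eq_square)
    finally have "of_int b1 * g3 + g1 * of_int b3 \<le> 2 * B\<^sup>2 * M * S" .
    moreover have "0 \<le> of_int b1 * g3 + g1 * of_int b3" using fpos bpos by simp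
    ultimately have "\<bar>of_int b1 * g3 + g1 * of_int b3\<bar> \<le> 2 * B\<^sup>2 * M * S" by linarith
    then have e2: "\<bar>f2 * (of_int b1 * g3 + g1 * of_int b3)\<bar> \<le> cF / B * (2 * B\<^sup>2 * M * S)"
      using F(2) unfolding g1_f1_g3_f3_g2_f2_def by (intro abs_mult_mono)
    have e2': "cF / B * (2 * B\<^sup>2 * M * S) \<le> E / 3"
    proof -
      have "cF * M ^ 4 * (2 * B * S) \<le> (B * d)\<^sup>2 / 1536 * (2 * B * S)"
        using cF'[of 4] B S by (intro mult_right_mono) auto
      also have "\<dots> = B ^ 3 * d * (2 * d) * S / 1536" by (simp add: power2_eq_square power3_eq_cube)
      also have "\<dots> \<le> B ^ 3 * d * S * S / 1536"
        using S B d by (intro divide_right_mono mult_right_mono mult_left_mono) auto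
      finally show ?thesis unfolding E_def using M1 B d
        by (simp add: field_simps power2_eq_square power3_eq_cube eval_nat_numeral)
    qed
    show ?thesis using e1 e2 e1' e2' unfolding err_def by linarith
  qed
  have "0 < (of_int K :: real)" using K low err E0 by (auto simp: abs_le_iff)
  moreover have "(of_int K :: real) < 1"
  proof -
    have BS: "B * S \<le> 2 * c3" using len unfolding S_def D1_D3_def by (simp add: algebra_simps)
    have c3': "0 < c3" using BS B S by (smt (verit) mult_pos_pos)
    have up: "0 \<le> 2 * B * M * D1" "0 \<le> 3 * B * M\<^sup>2 * D1\<^sup>2" using B M1 Dp by simp_all
    have "f1 * g3 \<le> 3 * B * M\<^sup>2 * D1\<^sup>2 * (2 * B * M * D3)"
      using s1 s3 by (intro mult_mono fpos up) auto
    moreover have "g1 * f3 \<le> 2 * B * M * D1 * (3 * B * M\<^sup>2 * D3\<^sup>2)"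
      using s1 s3 by (intro mult_mono fpos up) auto
    ultimately have "f1 * g3 + g1 * f3 \<le> 6 * B\<^sup>2 * M ^ 3 * (D1 * D3 * S)"
      unfolding S_def by (simp add: algebra_simps power2_eq_square power3_eq_cube)
    also have "\<dots> \<le> 6 * B\<^sup>2 * M ^ 3 * (S * S * S)"
      using S Dp M1 B by (intro mult_left_mono mult_right_mono mult_mono) auto
    finally have "main \<le> B * (6 * B\<^sup>2 * M ^ 3 * (S * S * S))"
      unfolding main_def using fpos b2 B by (intro mult_mono) auto
    also have "\<dots> = 6 * M ^ 3 * (B * S) ^ 3" by (simp add: power2_eq_square power3_eq_cube mult_ac)
    also have "\<dots> \<le> 6 * M ^ 3 * (2 * c3) ^ 3"
      using BS B S M1 by (intro mult_left_mono power_mono) auto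
    also have "\<dots> = 48 / 512 * (8 * M * c3) ^ 3" by (simp add: power3_eq_cube mult_ac)
    also have "\<dots> \<le> 48 / 512 * 1 ^ 3"
      using c3 c3' M1 by (intro mult_left_mono power_mono) auto
    finally have "main \<le> 48 / 512" by simp
    then show ?thesis using K low err by (auto simp: abs_le_iff)
  qed
  ultimately have "0 < K" "K < 1" by simp_all
  then show False by linarith
qed

end

section \<open>The three families of dangerous parameters\<close>

lemma dyadic_above:
  fixes x :: real
  assumes "0 < \<tau>" "\<tau> < x"
  shows "\<exists>i::nat. \<tau> * 2 ^ i / 2 \<le> x \<and> x \<le> \<tau> * 2 ^ i"
proof -
  define i where "i = (LEAST i::nat. x \<le> \<tau> * 2 ^ i)"
  obtain n :: nat where "x / \<tau> < 2 ^ n" using real_arch_pow[of 2 "x / \<tau>"] by auto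
  then have ex: "x \<le> \<tau> * 2 ^ n" using assms by (simp add: field_simps)
  have i: "x \<le> \<tau> * 2 ^ i" unfolding i_def using ex by (rule LeastI)
  have "i \<noteq> 0" using i assms by (cases i) auto
  then obtain k where k: "i = Suc k" by (cases i) auto
  have "\<not> x \<le> \<tau> * 2 ^ k" using not_less_Least[of k "\<lambda>i. x \<le> \<tau> * 2 ^ i"] k unfolding i_def by auto
  then show ?thesis using i k by (intro exI[of _ i]) auto
qed

lemma dyadic_max:
  fixes b :: int
  obtains j :: nat where "\<bar>of_int b\<bar> \<le> (2::real) ^ j" "(2::real) ^ j \<le> 2 * max 1 \<bar>of_int b\<bar>"
proof (cases "\<bar>b\<bar> \<le> 1")
  case True
  then show ?thesis using that[of 0] by auto
next
  case False
  then have "(1::real) < \<bar>of_int b\<bar>" by linarith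
  from dyadic_above[OF zero_less_one this]
  obtain i :: nat where "(1::real) * 2 ^ i / 2 \<le> \<bar>of_int b\<bar>" "\<bar>of_int b\<bar> \<le> (1::real) * 2 ^ i" by blast
  then show ?thesis using that[of i] by auto
qed

text \<open>Here \<open>s l\<close> is the profile, scaled by a small constant so that \<open>s l \<le> \<delta>\<close>. The constants \<open>c3\<close>
  and \<open>eT\<close> come first; \<open>\<tau>\<close> and \<open>cF\<close> are small in terms of them, and \<open>\<delta>\<close> in terms of all the others.\<close>

locale arc_game = convex_arc +
  fixes s :: "nat \<Rightarrow> real" and \<beta> \<tau> c3 cF eT \<delta> :: real
  assumes \<beta>: "0 < \<beta>" "\<beta> < 1"
    and s_pos: "\<And>l. 0 < s l" and s_le: "\<And>l. s l \<le> \<delta>"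
    and s_decay: "\<And>l0 l. l0 \<le> l \<Longrightarrow> s l ^ 208 * 2 ^ l0 \<le> s l0 ^ 208 * 2 ^ l"
    and \<tau>: "0 < \<tau>" "\<tau> < 1" and c3: "0 < c3" "8 * M * c3 \<le> 1" and eT: "0 < eT" and cF: "0 < cF"
    and \<tau>_small: "4608 * M ^ 5 * \<tau> \<le> eT * \<beta> * c3"
    and cF_small: "1536 * M ^ 4 * cF \<le> (eT * \<beta> * c3)\<^sup>2"
    and \<delta>: "160 * M\<^sup>2 * \<delta> \<le> \<beta>" "300 * M * \<delta> \<le> 1" "2 * M * \<delta> \<le> \<tau> ^ 3" "34 * \<delta> \<le> cF * \<tau>"
      "5 * \<delta> \<le> eT * c3 * \<tau>\<^sup>2" "3 * (4096 * M)\<^sup>2 * \<delta> \<le> 1"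
begin

text \<open>Slopes above \<open>\<tau>\<close> are sorted by the dyadic range \<open>al i / 2 \<le> \<bar>G\<bar> \<le> al i\<close>, and coefficients by
  \<open>\<bar>b\<bar> \<le> 2 ^ j\<close>. Then \<open>al (i + j)\<close> is the size of the product.\<close>

definition al :: "nat \<Rightarrow> real" where "al i = \<tau> * 2 ^ i"

definition near :: "nat \<Rightarrow> real set" where
  "near j = {t. \<exists>a b d. 2 ^ j / 2 \<le> \<bar>real_of_int b\<bar> \<and> \<bar>real_of_int b\<bar> \<le> 2 ^ j \<and> \<bar>G a b t\<bar> \<le> \<tau> \<and> \<bar>F a b d t\<bar> \<le> cF / 2 ^ j}"

text \<open>By Minkowski's theorem integer lines with these upper bounds on \<open>b\<close> and \<open>G\<close> exist with \<open>\<bar>F\<bar>\<close> about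
  \<open>1 / al (i + j)\<close> at every point; the power of \<open>s (i + j)\<close> is the gain over this.\<close>

definition single :: "nat \<Rightarrow> nat \<Rightarrow> real set" where
  "single i j = {t. \<exists>a b d. \<bar>real_of_int b\<bar> \<le> 2 ^ j \<and> al i / 2 \<le> \<bar>G a b t\<bar> \<and> \<bar>G a b t\<bar> \<le> al i \<and>
    \<bar>F a b d t\<bar> \<le> s (i + j) ^ 13 / al (i + j)}"

text \<open>A weaker closeness than in \<open>single\<close>, with exponent \<open>11\<close> instead of \<open>13\<close>: a line that is close in the
  sense of \<open>single i j\<close> at one point of a ball of radius \<open>r_single i j\<close> is a \<open>close_line\<close> at all of its
  points.\<close>

definition close_line :: "nat \<Rightarrow> nat \<Rightarrow> real \<Rightarrow> int \<Rightarrow> int \<Rightarrow> int \<Rightarrow> bool" where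
  "close_line i j t a b d \<longleftrightarrow> \<bar>real_of_int b\<bar> \<le> 2 ^ j \<and> \<bar>G a b t\<bar> \<le> 2 * al i \<and>
    \<bar>F a b d t\<bar> \<le> s (i + j) ^ 11 / al (i + j)"

text \<open>The three integers are the cross product of the two lines, that is, the projective coordinates
  of their intersection.\<close>

definition pair :: "nat \<Rightarrow> nat \<Rightarrow> real set" where
  "pair i j = {t. \<exists>a1 b1 d1 a2 b2 d2. close_line i j t a1 b1 d1 \<and> close_line i j t a2 b2 d2 \<and>
    \<not> (b1 * d2 - b2 * d1 = 0 \<and> d1 * a2 - d2 * a1 = 0 \<and> a1 * b2 - a2 * b1 = 0)}"

definition r_near :: "nat \<Rightarrow> real" where "r_near j = c3 / 2 ^ j"
definition r_pair :: "nat \<Rightarrow> nat \<Rightarrow> real" where "r_pair i j = s (i + j) / (al i * al (i + j))"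
definition r_single :: "nat \<Rightarrow> nat \<Rightarrow> real" where
  "r_single i j = s (i + j) ^ 11 / (8 * M * (al i * al (i + j)))"

lemma al_pos: "0 < al i" unfolding al_def using \<tau> by simp

lemma al_ge: "\<tau> \<le> al i" unfolding al_def using \<tau> by simp

lemma al_add: "al (i + j) = al i * 2 ^ j" unfolding al_def by (simp add: power_add)

lemma s_small: "s l \<le> 1 / 300" "s l \<le> \<tau> ^ 3" "160 * M\<^sup>2 * s l \<le> \<beta>" "2 * M * s l \<le> \<tau> ^ 3" "126 * M * s l < 1"
  "34 * s l \<le> cF * \<tau>" "5 * s l \<le> eT * c3 * \<tau>\<^sup>2" "3 * (4096 * M)\<^sup>2 * s l \<le> 1" "4 * M * s l \<le> \<beta>"
proof -
  have m: "K * s l \<le> K * \<delta>" if "0 \<le> K" for K using s_le that by (rule mult_left_mono)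
  have M0: "0 \<le> M" "0 \<le> M\<^sup>2" "M \<le> M\<^sup>2" using M by (auto simp: power2_eq_square)
  have Ms: "s l \<le> M * s l" using M s_pos[of l] by simp
  have Ms2: "M * s l \<le> M\<^sup>2 * s l" using M0(3) s_pos[of l] by (simp add: mult_right_mono)
  show "160 * M\<^sup>2 * s l \<le> \<beta>" using m[of "160 * M\<^sup>2"] \<delta> M0 by simp
  then show "4 * M * s l \<le> \<beta>" using Ms2 s_pos[of l] Ms by linarith
  show 2: "2 * M * s l \<le> \<tau> ^ 3" using m[of "2 * M"] \<delta> M0 by simp
  show "s l \<le> \<tau> ^ 3" using 2 Ms s_pos[of l] by linarith
  have "300 * M * s l \<le> 1" using m[of "300 * M"] \<delta> M0 by simp
  then show "s l \<le> 1 / 300" "126 * M * s l < 1" using Ms s_pos[of l] by linarith+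
  show "34 * s l \<le> cF * \<tau>" using m[of 34] \<delta> by simp
  show "5 * s l \<le> eT * c3 * \<tau>\<^sup>2" using m[of 5] \<delta> by simp
  show "3 * (4096 * M)\<^sup>2 * s l \<le> 1" using m[of "3 * (4096 * M)\<^sup>2"] \<delta> by simp
qed

lemma s_power_le: "1 \<le> n \<Longrightarrow> s l ^ n \<le> s l"
  using power_decreasing[of 1 n "s l"] s_pos[of l] s_small(1)[of l] by simp

text \<open>Lines may be multiplied by \<open>-1\<close>.\<close>

lemma near_positiveE:
  assumes "t \<in> near j"
  obtains a b d where "2 ^ j / 2 \<le> real_of_int b" "real_of_int b \<le> 2 ^ j" "\<bar>G a b t\<bar> \<le> \<tau>" "\<bar>F a b d t\<bar> \<le> cF / 2 ^ j"
proof -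
  obtain a b d where abd: "2 ^ j / 2 \<le> \<bar>real_of_int b\<bar>" "\<bar>real_of_int b\<bar> \<le> 2 ^ j" "\<bar>G a b t\<bar> \<le> \<tau>" "\<bar>F a b d t\<bar> \<le> cF / 2 ^ j"
    using assms unfolding near_def by auto
  have n: "G (- a) (- b) t = - G a b t" "F (- a) (- b) (- d) t = - F a b d t"
    unfolding G_def F_def by simp_all
  show ?thesis
  proof (cases "0 \<le> b")
    case True
    then show ?thesis using that[of b a d] abd by simp
  next
    case False
    then show ?thesis using that[of "- b" "- a" "- d"] abd by (simp add: n)
  qed
qed

lemma near_sparse_ordered:
  assumes sub: "cball c \<rho> \<subseteq> cball c0 r0" and \<rho>: "\<beta> * r_near j \<le> \<rho>" "\<rho> \<le> r_near j"
    and t: "t1 \<in> near j" "t2 \<in> near j" "t3 \<in> near j" "t1 \<in> cball c \<rho>" "t3 \<in> cball c \<rho>"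
    and far: "t1 + eT * \<rho> \<le> t2" "t2 + eT * \<rho> \<le> t3"
  shows False
proof -
  obtain a1 b1 d1 where 1: "2 ^ j / 2 \<le> real_of_int b1" "real_of_int b1 \<le> 2 ^ j" "\<bar>G a1 b1 t1\<bar> \<le> \<tau>" "\<bar>F a1 b1 d1 t1\<bar> \<le> cF / 2 ^ j"
    using near_positiveE[OF t(1)] by metis
  obtain a2 b2 d2 where 2: "2 ^ j / 2 \<le> real_of_int b2" "real_of_int b2 \<le> 2 ^ j" "\<bar>G a2 b2 t2\<bar> \<le> \<tau>" "\<bar>F a2 b2 d2 t2\<bar> \<le> cF / 2 ^ j"
    using near_positiveE[OF t(2)] by metis
  obtain a3 b3 d3 where 3: "2 ^ j / 2 \<le> real_of_int b3" "real_of_int b3 \<le> 2 ^ j" "\<bar>G a3 b3 t3\<bar> \<le> \<tau>" "\<bar>F a3 b3 d3 t3\<bar> \<le> cF / 2 ^ j"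
    using near_positiveE[OF t(3)] by metis
  have B: "0 < (2::real) ^ j" by simp
  have \<rho>2: "\<beta> * c3 \<le> 2 ^ j * \<rho>" "2 ^ j * \<rho> \<le> c3" using \<rho> unfolding r_near_def by (simp_all add: field_simps)
  have "0 < \<beta> * c3" using \<beta> c3 by simp
  then have "0 < \<rho>" using \<rho>2(1) B by (smt (verit) mult_nonneg_nonpos)
  have lb: "eT * \<beta> * c3 \<le> 2 ^ j * (eT * \<rho>)" using mult_left_mono[OF \<rho>2(1), of eT] eT by (simp add: mult_ac)
  have "t3 - t1 \<le> 2 * \<rho>" using t(4,5) by (auto simp: dist_real_def abs_le_iff)
  then have "(t3 - t1) * 2 ^ j \<le> 2 * \<rho> * 2 ^ j" by (intro mult_right_mono) auto
  moreover have "2 * \<rho> * 2 ^ j = 2 * (2 ^ j * \<rho>)" by simp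
  ultimately have len: "(t3 - t1) * 2 ^ j \<le> 2 * c3" using \<rho>2 by linarith
  have nn: "0 \<le> eT * \<beta> * c3" using eT \<beta> c3 by simp
  have sq: "(eT * \<beta> * c3)\<^sup>2 \<le> (2 ^ j * (eT * \<rho>))\<^sup>2" using lb nn by (intro power_mono) auto
  have tJ: "t1 \<in> cball c0 r0" "t3 \<in> cball c0 r0" using sub t by blast+
  show False
    using no_three_separated_tangents[OF tJ far len c3(2) B _ _ _ _ _ 1(1,2) 2(1,2) 3(1,2) 1(3) 2(3) 3(3) 1(4) 2(4) 3(4)]
      \<tau>(1) cF eT \<open>0 < \<rho>\<close> order_trans[OF \<tau>_small lb] order_trans[OF cF_small sq] by simp
qed

lemma near_sparse:
  assumes sub: "cball c \<rho> \<subseteq> cball c0 r0" and \<rho>: "\<beta> * r_near j \<le> \<rho>" "\<rho> \<le> r_near j"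
    and "x \<in> near j \<inter> cball c \<rho>" "y \<in> near j \<inter> cball c \<rho>" "z \<in> near j \<inter> cball c \<rho>"
  shows "dist x y \<le> eT * \<rho> \<or> dist x z \<le> eT * \<rho> \<or> dist y z \<le> eT * \<rho>"
proof (rule ccontr)
  assume neg: "\<not> ?thesis"
  have o: False if "t1 \<in> {x,y,z}" "t2 \<in> {x,y,z}" "t3 \<in> {x,y,z}" "t1 + eT * \<rho> \<le> t2" "t2 + eT * \<rho> \<le> t3" for t1 t2 t3
    by (rule near_sparse_ordered[OF sub \<rho>, of t1 t2 t3]) (use that assms(4-6) in auto)
  show False
    using neg o[of x y z] o[of x z y] o[of y x z] o[of y z x] o[of z x y] o[of z y x]
    by (auto simp: dist_real_def abs_le_iff)
qed

text \<open>Since the ball avoids \<open>pair i j\<close>, the lines that belong to two of its points are proportional. So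
  the line of \<open>x\<close> is also small at \<open>y\<close>, while its slope is at least \<open>al i / 4\<close> in between; this
  bounds the distance of \<open>x\<close> and \<open>y\<close>.\<close>

lemma single_sparse:
  assumes sub: "cball c \<rho> \<subseteq> cball c0 r0" and \<rho>: "\<beta> * r_single i j \<le> \<rho>" "\<rho> \<le> r_single i j"
    and hist: "pair i j \<inter> cball c \<rho> = {}"
    and x: "x \<in> single i j" "x \<in> cball c \<rho>" and y: "y \<in> single i j" "y \<in> cball c \<rho>"
  shows "dist x y \<le> s (i + j) * \<rho>"
proof -
  define S p \<alpha> where "S = s (i + j)" "p = al (i + j)" "\<alpha> = al i"
  note defs = S_p_\<alpha>_def
  have pos: "0 < S" "0 < p" "0 < \<alpha>" "0 < M" using s_pos al_pos M unfolding defs by auto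
  have p: "p = \<alpha> * 2 ^ j" unfolding defs by (rule al_add)
  obtain a1 b1 d1 where 1: "\<bar>real_of_int b1\<bar> \<le> 2 ^ j" "\<alpha> / 2 \<le> \<bar>G a1 b1 x\<bar>" "\<bar>G a1 b1 x\<bar> \<le> \<alpha>" "\<bar>F a1 b1 d1 x\<bar> \<le> S ^ 13 / p"
    using x(1) unfolding single_def defs by auto
  obtain a2 b2 d2 where 2: "\<bar>real_of_int b2\<bar> \<le> 2 ^ j" "\<alpha> / 2 \<le> \<bar>G a2 b2 y\<bar>" "\<bar>G a2 b2 y\<bar> \<le> \<alpha>" "\<bar>F a2 b2 d2 y\<bar> \<le> S ^ 13 / p"
    using y(1) unfolding single_def defs by auto
  have xJ: "x \<in> cball c0 r0" and yJ: "y \<in> cball c0 r0" using sub x y by auto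
  have "dist x y \<le> 2 * \<rho>" using x(2) y(2) by (auto simp: dist_real_def abs_le_iff)
  also have "\<dots> \<le> 2 * r_single i j" using \<rho> by simp
  also have "\<dots> = S ^ 11 / (4 * M * (\<alpha> * p))" unfolding r_single_def defs by simp
  finally have dxy: "dist x y \<le> S ^ 11 / (4 * M * (\<alpha> * p))" .
  have S11: "S ^ 11 \<le> \<alpha> ^ 3"
  proof -
    have "S ^ 11 \<le> S" using s_power_le unfolding defs by simp
    also have "\<dots> \<le> \<tau> ^ 3" using s_small(2) unfolding defs .
    also have "\<dots> \<le> \<alpha> ^ 3" using al_ge \<tau> unfolding defs by (intro power_mono) auto
    finally show ?thesis .
  qed
  have Gvar: "\<bar>G a b u - G a b t\<bar> \<le> \<alpha> / 4"
    if "t \<in> cball c0 r0" "u \<in> cball c0 r0" "dist t u \<le> dist x y" "\<bar>real_of_int b\<bar> \<le> 2 ^ j" for a b t u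
  proof -
    have "\<bar>G a b u - G a b t\<bar> \<le> \<bar>real_of_int b\<bar> * (M * dist t u)" using G_dist[OF that(1,2)] .
    also have "\<dots> \<le> 2 ^ j * (M * (S ^ 11 / (4 * M * (\<alpha> * p))))"
      using that(3,4) dxy pos by (intro mult_mono mult_left_mono) auto
    also have "\<dots> = S ^ 11 / (4 * \<alpha>\<^sup>2)" unfolding p using pos by (simp add: field_simps power2_eq_square)
    also have "\<dots> \<le> \<alpha> ^ 3 / (4 * \<alpha>\<^sup>2)" using S11 by (intro divide_right_mono) auto
    also have "\<dots> = \<alpha> / 4" using pos by (simp add: power2_eq_square power3_eq_cube)
    finally show ?thesis .
  qed
  have G2: "\<bar>G a2 b2 u\<bar> \<le> 2 * \<alpha>" if "u \<in> cball c0 r0" "dist y u \<le> dist y x" for u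
  proof -
    have "dist y u \<le> dist x y" using that(2) by (simp add: dist_commute)
    then have "\<bar>G a2 b2 u - G a2 b2 y\<bar> \<le> \<alpha> / 4" using Gvar[OF yJ that(1) _ 2(1)] by blast
    then show ?thesis using 2(3) pos by linarith
  qed
  have "\<bar>F a2 b2 d2 x - F a2 b2 d2 y\<bar> \<le> 2 * \<alpha> * (M * dist y x)"
    by (rule F_dist[OF yJ xJ G2])
  also have "\<dots> \<le> 2 * \<alpha> * (M * (S ^ 11 / (4 * M * (\<alpha> * p))))"
    using dxy pos by (intro mult_left_mono) (auto simp: dist_commute)
  also have "\<dots> = S ^ 11 / p / 2" using pos by (simp add: field_simps)
  finally have Fd: "\<bar>F a2 b2 d2 x - F a2 b2 d2 y\<bar> \<le> S ^ 11 / p / 2" .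
  have S13: "S ^ 13 / p \<le> S ^ 11 / p / 2"
  proof -
    have "S * S \<le> 1 / 2 * 1" using s_small(1)[of "i + j"] pos unfolding defs by (intro mult_mono) auto
    then have "S ^ 11 * (S * S) \<le> S ^ 11 * (1 / 2)" using pos by (intro mult_left_mono) auto
    then have "S ^ 13 \<le> S ^ 11 / 2" by (simp add: eval_nat_numeral)
    then show ?thesis using pos by (simp add: field_simps)
  qed
  have S13': "S ^ 13 / p \<le> S ^ 11 / p"
  proof -
    have half: "0 \<le> z \<Longrightarrow> z / 2 \<le> z" for z :: real by simp
    have "0 \<le> S ^ 11 / p" using pos by simp
    from half[OF this] have "S ^ 11 / p / 2 \<le> S ^ 11 / p" .
    then show ?thesis using S13 by (rule order_trans[rotated])
  qed
  have c2: "close_line i j x a2 b2 d2"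
    unfolding close_line_def defs[symmetric]
    using 2(1) G2[OF xJ] Fd 2(4) S13 by (auto simp: abs_le_iff)
  have c1: "close_line i j x a1 b1 d1"
    unfolding close_line_def defs[symmetric] using 1 S13' pos by auto
  have "x \<notin> pair i j" using hist x(2) by auto
  then have "b1 * d2 - b2 * d1 = 0 \<and> d1 * a2 - d2 * a1 = 0 \<and> a1 * b2 - a2 * b1 = 0"
    using c1 c2 unfolding pair_def mem_Collect_eq by metis
  then have par: "b1 * d2 - b2 * d1 = 0" "d1 * a2 - d2 * a1 = 0" "a1 * b2 - a2 * b1 = 0" by auto
  have "F a1 b1 d1 y * G a2 b2 y - F a2 b2 d2 y * G a1 b1 y =
    of_int (a1 * b2 - a2 * b1) * (X y * \<Phi> y - Y y) + of_int (d1 * a2 - d2 * a1) - of_int (b1 * d2 - b2 * d1) * \<Phi> y"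
    unfolding F_def G_def by (simp add: algebra_simps)
  also have "\<dots> = 0" unfolding par by simp
  finally have propo: "\<bar>F a1 b1 d1 y\<bar> * \<bar>G a2 b2 y\<bar> = \<bar>F a2 b2 d2 y\<bar> * \<bar>G a1 b1 y\<bar>"
    by (simp add: abs_mult[symmetric])
  have G1y: "\<bar>G a1 b1 y\<bar> \<le> 2 * \<alpha>" using Gvar[OF xJ yJ order_refl 1(1), of a1] 1(3) pos by linarith
  have "\<bar>F a1 b1 d1 y\<bar> * (\<alpha> / 2) \<le> \<bar>F a1 b1 d1 y\<bar> * \<bar>G a2 b2 y\<bar>" using 2(2) by (intro mult_left_mono) auto
  also have "\<dots> \<le> S ^ 13 / p * (2 * \<alpha>)" unfolding propo using 2(4) G1y pos by (intro mult_mono) auto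
  finally have F1y: "\<bar>F a1 b1 d1 y\<bar> \<le> 4 * (S ^ 13 / p)" using pos by (simp add: field_simps)
  obtain \<xi> where \<xi>: "\<xi> \<in> cball c0 r0" "dist x \<xi> \<le> dist x y" "F a1 b1 d1 y - F a1 b1 d1 x = G a1 b1 \<xi> * (X y - X x)"
    using F_secant_dist[OF xJ yJ] by metis
  have "\<alpha> / 4 \<le> \<bar>G a1 b1 \<xi>\<bar>" using Gvar[OF xJ \<xi>(1,2) 1(1), of a1] 1(2) by (auto simp: abs_if split: if_splits)
  then have "\<alpha> / 4 * \<bar>X y - X x\<bar> \<le> \<bar>G a1 b1 \<xi>\<bar> * \<bar>X y - X x\<bar>" by (intro mult_right_mono) auto
  also have "\<dots> = \<bar>F a1 b1 d1 y - F a1 b1 d1 x\<bar>" unfolding \<xi>(3) by (simp add: abs_mult)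
  also have "\<dots> \<le> 5 * (S ^ 13 / p)" using F1y 1(4) by (auto simp: abs_le_iff)
  finally have "\<bar>X y - X x\<bar> \<le> 20 * S ^ 13 / (\<alpha> * p)" using pos by (simp add: field_simps)
  then have "M * \<bar>X y - X x\<bar> \<le> M * (20 * S ^ 13 / (\<alpha> * p))" using pos by (intro mult_left_mono) auto
  then have "dist x y \<le> M * (20 * S ^ 13 / (\<alpha> * p))" using X_dist(2)[OF xJ yJ] by linarith
  also have "\<dots> = 160 * M\<^sup>2 * S * (S ^ 12 / (8 * M * (\<alpha> * p)))"
    using pos by (simp add: field_simps power2_eq_square eval_nat_numeral)
  also have "\<dots> \<le> \<beta> * (S ^ 12 / (8 * M * (\<alpha> * p)))"
    using s_small(3)[of "i + j"] pos unfolding defs[symmetric] by (intro mult_right_mono) auto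
  also have "\<dots> = S * (\<beta> * r_single i j)" unfolding r_single_def defs[symmetric] by (simp add: eval_nat_numeral)
  also have "\<dots> \<le> S * \<rho>" using \<rho> pos by (intro mult_left_mono) auto
  finally show ?thesis unfolding defs .
qed

text \<open>The part of the history that is available when \<open>pair i j\<close> becomes relevant.\<close>

definition clean :: "nat \<Rightarrow> nat \<Rightarrow> real \<Rightarrow> bool" where
  "clean i j t \<longleftrightarrow> (\<forall>j0. r_pair i j < eT * r_near j0 \<longrightarrow> t \<notin> near j0) \<and>
    (\<forall>i0 j0. r_pair i j < s (i0 + j0) * r_single i0 j0 \<longrightarrow> t \<notin> single i0 j0)"

text \<open>Here \<open>\<omega>\<close> measures how much shorter the line is than those of index \<open>(i, j)\<close>. If the line is nearly
  tangent, it would put \<open>t\<close> into some \<open>near j0\<close>. Otherwise it has indices \<open>(i0, j0)\<close> with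
  \<open>i0 + j0 < i + j\<close>, and would put \<open>t\<close> into \<open>single i0 j0\<close>; the thirteenth power of the profile drops
  at most by the sixteenth root of \<open>2 ^ (i0 + j0) / 2 ^ (i + j)\<close>, and hence the closeness required
  there follows from the assumed one. In both cases the scale is large enough to be part of the
  history.\<close>

lemma clean_point_excludes_short_line:
  assumes cl: "clean i j t" and \<omega>: "0 < \<omega>" "\<omega>\<^sup>2 \<le> 2 * s (i + j) ^ 8"
    and nz: "a0 \<noteq> 0 \<or> b0 \<noteq> 0"
    and b0: "\<bar>real_of_int b0\<bar> \<le> \<omega> * 2 ^ j" and G0: "\<bar>G a0 b0 t\<bar> \<le> \<omega> * al i"
    and prod: "\<bar>G a0 b0 t\<bar> * max 1 \<bar>real_of_int b0\<bar> \<le> \<omega>\<^sup>2 * al (i + j)"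
    and F0: "\<bar>F a0 b0 d0 t\<bar> \<le> 16 * s (i + j) ^ 11 / (\<omega> * al (i + j))"
  shows False
proof -
  define S p \<alpha> where "S = s (i + j)" "p = al (i + j)" "\<alpha> = al i"
  note defs = S_p_\<alpha>_def
  have pos: "0 < S" "0 < p" "0 < \<alpha>" "0 < M" using s_pos al_pos M unfolding defs by auto
  have p: "p = \<alpha> * 2 ^ j" unfolding defs by (rule al_add)
  have S1: "S \<le> 1 / 300" using s_small(1) unfolding defs .
  have "\<omega>\<^sup>2 \<le> 2 * S" using \<omega>(2) s_power_le[of 8 "i + j"] unfolding defs by simp
  then have "\<omega>\<^sup>2 \<le> 1\<^sup>2" using S1 by simp
  then have \<omega>1: "\<omega> \<le> 1" by (rule power2_le_imp_le) simp
  have rp: "r_pair i j = S / (\<alpha> * p)" unfolding r_pair_def defs ..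
  obtain j0 where j0: "\<bar>real_of_int b0\<bar> \<le> 2 ^ j0" "2 ^ j0 \<le> 2 * max 1 \<bar>real_of_int b0\<bar>"
    using dyadic_max by blast
  show False
  proof (cases "\<bar>G a0 b0 t\<bar> \<le> \<tau>")
    case True
    have "b0 \<noteq> 0"
    proof
      assume "b0 = 0"
      then have "\<bar>real_of_int a0\<bar> < 1" using True \<tau> unfolding G_def by simp
      then show False using nz \<open>b0 = 0\<close> by linarith
    qed
    then have m: "max 1 \<bar>real_of_int b0\<bar> = \<bar>real_of_int b0\<bar>" by linarith
    have j0\<omega>: "2 ^ j0 \<le> 2 * (\<omega> * 2 ^ j)" using j0(2) b0 unfolding m by linarith
    have "r_pair i j < eT * r_near j0"
    proof -
      have "\<omega> * 2 ^ j \<le> 1 * 2 ^ j" using \<omega>1 by (intro mult_right_mono) auto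
      then have "(2::real) ^ j0 \<le> 2 * (1 * 2 ^ j)" using j0\<omega> by linarith
      then have "S * 2 ^ j0 \<le> S * (2 * 2 ^ j)" using pos by (intro mult_left_mono) auto
      also have "\<dots> = 2 * S * 2 ^ j" by simp
      also have "\<dots> < eT * c3 * \<tau>\<^sup>2 * 2 ^ j"
        using s_small(7)[of "i + j"] pos unfolding defs[symmetric] by (intro mult_strict_right_mono) auto
      also have "\<dots> \<le> eT * c3 * \<alpha>\<^sup>2 * 2 ^ j"
        using al_ge[of i] \<tau> eT c3 unfolding defs by (intro mult_right_mono mult_left_mono power_mono) auto
      also have "\<dots> = eT * c3 * (\<alpha> * p)" unfolding p by (simp add: power2_eq_square)
      finally show ?thesis unfolding rp r_near_def using pos by (simp add: field_simps)
    qed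
    then have "t \<notin> near j0" using cl unfolding clean_def by blast
    moreover have "2 ^ j0 / 2 \<le> \<bar>real_of_int b0\<bar>" using j0(2) unfolding m by simp
    ultimately have "cF / 2 ^ j0 < \<bar>F a0 b0 d0 t\<bar>"
      using j0(1) True unfolding near_def mem_Collect_eq by (metis not_le)
    also have "\<dots> \<le> 16 * S ^ 11 / (\<omega> * p)" using F0 unfolding defs .
    also have "\<dots> \<le> 16 * S / (\<omega> * p)"
      using s_power_le[of 11 "i + j"] pos \<omega> unfolding defs by (intro divide_right_mono) auto
    also have "\<dots> \<le> 16 * S / (\<tau> * (2 ^ j0 / 2))"
    proof (rule divide_left_mono)
      have "\<tau> * (2 ^ j0 / 2) \<le> \<alpha> * (\<omega> * 2 ^ j)" using al_ge[of i] \<tau> j0\<omega> unfolding defs by (intro mult_mono) auto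
      then show "\<tau> * (2 ^ j0 / 2) \<le> \<omega> * p" unfolding p by (simp add: mult_ac)
    qed (use pos \<omega> \<tau> in auto)
    finally have "cF * \<tau> < 32 * S" using \<tau> by (simp add: field_simps)
    then show False using s_small(6)[of "i + j"] pos unfolding defs by simp
  next
    case False
    then have "\<tau> < \<bar>G a0 b0 t\<bar>" by simp
    from dyadic_above[OF \<tau>(1) this] obtain i0 where i0: "al i0 / 2 \<le> \<bar>G a0 b0 t\<bar>" "\<bar>G a0 b0 t\<bar> \<le> al i0"
      unfolding al_def by auto
    define p0 where "p0 = al (i0 + j0)"
    define S0 where "S0 = s (i0 + j0)"
    have p0pos: "0 < p0" "0 < S0" unfolding p0_def S0_def using al_pos s_pos by auto
    have "p0 = al i0 * 2 ^ j0" unfolding p0_def by (rule al_add)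
    also have "\<dots> \<le> (2 * \<bar>G a0 b0 t\<bar>) * (2 * max 1 \<bar>real_of_int b0\<bar>)"
      using i0 j0 by (intro mult_mono) auto
    also have "\<dots> \<le> 4 * (\<omega>\<^sup>2 * p)" using prod unfolding defs by simp
    finally have p0: "p0 \<le> 4 * \<omega>\<^sup>2 * p" by simp
    have \<alpha>0: "al i0 \<le> 2 * \<omega> * \<alpha>" using i0 G0 unfolding defs by simp
    define x where "x = p0 / p"
    have x: "0 < x" "x \<le> 4 * \<omega>\<^sup>2" "p0 = x * p" unfolding x_def using p0 p0pos pos by (simp_all add: field_simps)
    have x8: "x \<le> 8 * S ^ 8" using x \<omega>(2) unfolding defs by simp
    have "8 * S ^ 8 \<le> 8 * S" using s_power_le[of 8 "i + j"] unfolding defs by simp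
    then have x1: "x < 1" using x8 S1 by simp
    then have "p0 < p" unfolding x(3) using pos by simp
    then have "(2::real) ^ (i0 + j0) < 2 ^ (i + j)" unfolding p0_def defs al_def using \<tau> by simp
    then have ll: "i0 + j0 < i + j" by (rule power_less_imp_less_exp[rotated]) simp
    have xp: "x = 2 ^ (i0 + j0) / 2 ^ (i + j)" unfolding x_def p0_def defs al_def using \<tau> by simp
    \<comment> \<open>All powers of \<open>S\<close> and \<open>\<omega>\<close> below are absorbed by powers of \<open>y\<close>, through \<open>y\<^sup>2 \<le> 2 * S\<close> and
      \<open>y ^ 8 \<le> 2 * \<omega>\<close>.\<close>
    define y where "y = x powr (1 / 16)"
    have y: "0 < y" "y ^ 16 = x" unfolding y_def using x(1) by (simp_all add: powr_realpow[symmetric] powr_powr)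
    have "y ^ 16 < 1 ^ 16" using y x1 by simp
    then have y1: "y < 1" by (rule power_less_imp_less_base) simp
    define r where "r = S0 / S"
    have r0: "0 < r" unfolding r_def using p0pos pos by simp
    have r: "x \<le> r ^ 208" unfolding r_def xp S0_def defs using s_decay[of "i0 + j0" "i + j"] ll s_pos[of "i + j"]
      by (simp add: field_simps power_divide)
    have "y ^ 16 \<le> (r ^ 13) ^ 16" unfolding y using r by (simp flip: power_mult)
    then have r13: "y \<le> r ^ 13" by (rule power_le_imp_le_base[of _ 15, simplified]) (use r0 in simp)
    have r12: "y \<le> r ^ 12"
    proof (cases "r \<le> 1")
      case True
      then have "r ^ 13 \<le> r ^ 12" using r0 by (intro power_decreasing) auto
      then show ?thesis using r13 by simp
    next
      case False
      then show ?thesis using y1 one_le_power[of r 12] by linarith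
    qed
    have S013: "S ^ 13 * y \<le> S0 ^ 13" "S ^ 12 * y \<le> S0 ^ 12"
      using r13 r12 pos unfolding r_def by (simp_all add: field_simps power_divide)
    have yS: "y\<^sup>2 \<le> 2 * S"
    proof -
      have "(y\<^sup>2) ^ 8 = x" using y(2) by (simp flip: power_mult)
      also have "\<dots> \<le> 256 * S ^ 8" using x8 zero_le_power[of S 8] pos by linarith
      also have "\<dots> = (2 * S) ^ 8" by (simp add: power_mult_distrib)
      finally show ?thesis by (rule power_le_imp_le_base[of _ 7, simplified]) (use pos in simp)
    qed
    have y8: "y ^ 8 \<le> 2 * \<omega>"
    proof -
      have "(y ^ 8)\<^sup>2 \<le> (2 * \<omega>)\<^sup>2" using x(2) y(2) by (simp add: power_mult_distrib flip: power_mult)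
      then show ?thesis by (rule power2_le_imp_le) (use \<omega> in simp)
    qed
    have F1: "\<bar>F a0 b0 d0 t\<bar> \<le> S0 ^ 13 / p0"
    proof -
      have "y ^ 6 = (y\<^sup>2) ^ 3" by (simp flip: power_mult)
      also have "\<dots> \<le> (2 * S) ^ 3" using yS by (intro power_mono) auto
      finally have y6: "y ^ 6 \<le> 8 * S ^ 3" by (simp add: power_mult_distrib)
      have "32 * y ^ 7 \<le> 32 * y ^ 6" using y y1 by (intro mult_left_mono power_decreasing) auto
      also have "\<dots> \<le> 256 * S * S\<^sup>2" using y6 by (simp add: eval_nat_numeral)
      also have "\<dots> \<le> 1 * S\<^sup>2" using S1 pos by (intro mult_right_mono) auto
      finally have y7: "32 * y ^ 7 \<le> S\<^sup>2" by simp
      have "16 * S ^ 11 * x = S ^ 11 * y * (y ^ 8 / 2) * (32 * y ^ 7)"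
        unfolding y(2)[symmetric] by (simp add: eval_nat_numeral)
      also have "\<dots> \<le> S ^ 11 * y * \<omega> * S\<^sup>2"
        using y8 y7 y \<omega> pos by (intro mult_mono mult_left_mono) auto
      also have "\<dots> = S ^ 13 * y * \<omega>" by (simp add: eval_nat_numeral)
      also have "\<dots> \<le> S0 ^ 13 * \<omega>" using S013 \<omega> by (intro mult_right_mono) auto
      finally have "16 * S ^ 11 / (\<omega> * p) \<le> S0 ^ 13 / p0"
        unfolding x(3) using \<omega> pos x(1) by (simp add: field_simps)
      then show ?thesis using F0 unfolding defs by simp
    qed
    have "r_pair i j < S0 * r_single i0 j0"
    proof -
      have \<omega>S: "\<omega> \<le> 2 * S ^ 4"
      proof (rule power2_le_imp_le)
        have "\<omega>\<^sup>2 \<le> 2 * S ^ 8" using \<omega> unfolding defs by simp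
        also have "\<dots> \<le> 4 * S ^ 8" using pos by simp
        also have "\<dots> = (2 * S ^ 4)\<^sup>2" by (simp add: power_mult_distrib flip: power_mult)
        finally show "\<omega>\<^sup>2 \<le> (2 * S ^ 4)\<^sup>2" .
      qed (use pos in simp)
      have "y ^ 14 = (y\<^sup>2) ^ 7" by (simp flip: power_mult)
      also have "\<dots> \<le> (2 * S) ^ 7" using yS by (intro power_mono) auto
      finally have y14: "y ^ 14 \<le> 128 * S ^ 7" by (simp add: power_mult_distrib)
      have yM: "4096 * M * y < 1"
      proof -
        have "(4096 * M * y)\<^sup>2 = (4096 * M)\<^sup>2 * y\<^sup>2" by (simp add: power_mult_distrib)
        also have "\<dots> \<le> (4096 * M)\<^sup>2 * (2 * S)" using yS by (intro mult_left_mono) auto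
        also have "\<dots> < 3 * (4096 * M)\<^sup>2 * S" using pos by simp
        also have "\<dots> \<le> 1\<^sup>2" using s_small(8)[of "i + j"] unfolding defs by simp
        finally show ?thesis by (rule power2_less_imp_less) simp
      qed
      have "S * (al i0 * p0) * (8 * M) \<le> S * ((2 * \<omega> * \<alpha>) * (y ^ 16 * p)) * (8 * M)"
        unfolding x(3) y(2) using \<alpha>0 pos x(1) by (intro mult_right_mono mult_left_mono) auto
      also have "\<dots> \<le> S * ((2 * (2 * S ^ 4) * \<alpha>) * (y ^ 16 * p)) * (8 * M)"
        using \<omega>S pos y by (intro mult_right_mono mult_left_mono) auto
      also have "\<dots> = 32 * M * S ^ 5 * (y * y) * y ^ 14 * (\<alpha> * p)" by (simp add: eval_nat_numeral)
      also have "\<dots> \<le> 32 * M * S ^ 5 * (y * y) * (128 * S ^ 7) * (\<alpha> * p)"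
        using y14 pos y by (intro mult_right_mono mult_left_mono) auto
      also have "\<dots> = (4096 * M * y) * (S ^ 12 * y * (\<alpha> * p))" by (simp add: eval_nat_numeral)
      also have "\<dots> < 1 * (S ^ 12 * y * (\<alpha> * p))"
        using yM pos y by (intro mult_strict_right_mono) auto
      finally have "S * (al i0 * p0) * (8 * M) < S ^ 12 * y * (\<alpha> * p)" by simp
      moreover have "S ^ 12 * y * (\<alpha> * p) \<le> S0 ^ 12 * (\<alpha> * p)"
        using S013 pos by (intro mult_right_mono) auto
      ultimately have "S * (al i0 * p0) * (8 * M) < S0 ^ 12 * (\<alpha> * p)" by linarith
      then show ?thesis
        unfolding rp r_single_def S0_def[symmetric] p0_def[symmetric] using pos al_pos[of i0] p0pos
        by (simp add: field_simps eval_nat_numeral)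
    qed
    then have "t \<notin> single i0 j0" using cl unfolding clean_def S0_def by blast
    then show False using F1 i0 j0 unfolding single_def p0_def S0_def by auto
  qed
qed

lemma sum_six_bound:
  fixes x1 x2 x3 x4 x5 x6 Z :: real
  assumes "\<bar>x1\<bar> \<le> Z" "\<bar>x2\<bar> \<le> Z" "\<bar>x3\<bar> \<le> Z" "\<bar>x4\<bar> \<le> Z" "\<bar>x5\<bar> \<le> Z" "\<bar>x6\<bar> \<le> Z"
  shows "\<bar>x1 - x2 - x3 + x4 + x5 - x6\<bar> \<le> 6 * Z"
  using assms unfolding abs_le_iff by linarith

text \<open>The two lines meet in a point with denominator \<open>q = a1 * b2 - a2 * b1\<close>, and the arc passes it at
  horizontal distance \<open>\<bar>u / q\<bar>\<close>, where \<open>u = q X - P1\<close> is small. If \<open>q\<close> were small, the pigeonhole principle would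
  produce a line through that rational point which is much shorter than the two given ones and still
  close to \<open>t\<close>; a clean point does not admit it.\<close>

lemma pair_denominator:
  assumes tJ: "t \<in> cball c0 r0" and cl: "clean i j t"
    and c1: "close_line i j t a1 b1 d1" and c2: "close_line i j t a2 b2 d2"
    and nz: "\<not> (b1 * d2 - b2 * d1 = 0 \<and> d1 * a2 - d2 * a1 = 0 \<and> a1 * b2 - a2 * b1 = 0)"
  shows "s (i + j) ^ 8 * al (i + j) \<le> \<bar>real_of_int (a1 * b2 - a2 * b1)\<bar>"
    and "a1 * b2 - a2 * b1 \<noteq> 0"
    and "\<bar>real_of_int (a1 * b2 - a2 * b1) * X t - real_of_int (b1 * d2 - b2 * d1)\<bar> \<le> 2 * s (i + j) ^ 11 / al i"
proof -
  define S p \<alpha> where "S = s (i + j)" "p = al (i + j)" "\<alpha> = al i"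
  note defs = S_p_\<alpha>_def
  have pos: "0 < S" "0 < p" "0 < \<alpha>" "0 < M" using s_pos al_pos M unfolding defs by auto
  have p: "p = \<alpha> * 2 ^ j" unfolding defs by (rule al_add)
  define P1 P2 q where "P1 = b1 * d2 - b2 * d1" "P2 = d1 * a2 - d2 * a1" "q = a1 * b2 - a2 * b1"
  note P = P1_P2_q_def
  define u W where "u = F a1 b1 d1 t * of_int b2 - F a2 b2 d2 t * of_int b1"
    "W = F a1 b1 d1 t * G a2 b2 t - F a2 b2 d2 t * G a1 b1 t"
  have u: "of_int q * X t - of_int P1 = u" unfolding u_W_def P F_def by (simp add: algebra_simps)
  have W: "W = of_int q * (X t * \<Phi> t - Y t) + of_int P2 - of_int P1 * \<Phi> t"
    unfolding u_W_def P F_def G_def by (simp add: algebra_simps)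
  note c = c1[unfolded close_line_def, folded defs] c2[unfolded close_line_def, folded defs]
  have c': "\<bar>real_of_int b1\<bar> \<le> 2 ^ j" "\<bar>G a1 b1 t\<bar> \<le> 2 * \<alpha>" "\<bar>F a1 b1 d1 t\<bar> \<le> S ^ 11 / p"
    "\<bar>real_of_int b2\<bar> \<le> 2 ^ j" "\<bar>G a2 b2 t\<bar> \<le> 2 * \<alpha>" "\<bar>F a2 b2 d2 t\<bar> \<le> S ^ 11 / p"
    using c by blast+
  have "\<bar>F a1 b1 d1 t * of_int b2\<bar> \<le> S ^ 11 / p * 2 ^ j" "\<bar>F a2 b2 d2 t * of_int b1\<bar> \<le> S ^ 11 / p * 2 ^ j"
    by (rule abs_mult_mono[OF c'(3,4)], rule abs_mult_mono[OF c'(6,1)])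
  then have "\<bar>u\<bar> \<le> 2 * (S ^ 11 / p * 2 ^ j)" unfolding u_W_def by linarith
  also have "\<dots> = 2 * S ^ 11 / \<alpha>" unfolding p using pos by (simp add: field_simps)
  finally have uB: "\<bar>u\<bar> \<le> 2 * S ^ 11 / \<alpha>" .
  have "\<bar>F a1 b1 d1 t * G a2 b2 t\<bar> \<le> S ^ 11 / p * (2 * \<alpha>)" "\<bar>F a2 b2 d2 t * G a1 b1 t\<bar> \<le> S ^ 11 / p * (2 * \<alpha>)"
    by (rule abs_mult_mono[OF c'(3,5)], rule abs_mult_mono[OF c'(6,2)])
  then have "\<bar>W\<bar> \<le> 2 * (S ^ 11 / p * (2 * \<alpha>))" unfolding u_W_def by linarith
  also have "\<dots> = 4 * S ^ 11 / 2 ^ j" unfolding p using pos by (simp add: field_simps)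
  finally have WB: "\<bar>W\<bar> \<le> 4 * S ^ 11 / 2 ^ j" .
  have S11: "S ^ 11 \<le> S" using s_power_le unfolding defs by simp
  have S1: "S \<le> 1 / 300" using s_small(1) unfolding defs .
  have "2 * S ^ 11 < \<alpha>"
  proof -
    have "2 * S \<le> 2 * M * S" using M pos by simp
    also have "\<dots> \<le> \<tau> ^ 3" using s_small(4) unfolding defs .
    also have "\<dots> < \<tau> ^ 1" using \<tau> by (intro power_strict_decreasing) auto
    also have "\<dots> \<le> \<alpha>" using al_ge unfolding defs by simp
    finally show ?thesis using S11 by linarith
  qed
  then have u1: "2 * S ^ 11 / \<alpha> < 1" using pos by simp
  have "4 * S ^ 11 / 2 ^ j \<le> 4 * S ^ 11 / 1" using pos by (intro divide_left_mono) auto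
  then have W1: "4 * S ^ 11 / 2 ^ j < 1" using S11 S1 by linarith
  have q0: "q \<noteq> 0"
  proof
    assume q: "q = 0"
    then have "\<bar>real_of_int P1\<bar> < 1" using u uB u1 by simp
    then have P1: "P1 = 0" by linarith
    then have "W = real_of_int P2" using W q by simp
    then have "\<bar>real_of_int P2\<bar> < 1" using le_less_trans[OF WB W1] by simp
    then have "P2 = 0" by linarith
    then show False using nz P1 q unfolding P by blast
  qed
  have low: "S ^ 8 * p \<le> \<bar>real_of_int q\<bar>"
  proof (rule ccontr)
    assume neg: "\<not> ?thesis"
    \<comment> \<open>The bounds \<open>\<omega> * \<alpha>\<close> for the slope and \<open>\<omega> * 2 ^ j\<close> for \<open>b\<close> have product \<open>2 * \<bar>q\<bar>\<close>, as the pigeonhole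
      principle requires.\<close>
    define \<omega> where "\<omega> = sqrt (2 * \<bar>real_of_int q\<bar> / p)"
    have qpos: "0 < \<bar>real_of_int q\<bar>" using q0 by simp
    have \<omega>: "0 < \<omega>" "\<omega>\<^sup>2 = 2 * \<bar>real_of_int q\<bar> / p" unfolding \<omega>_def using qpos pos by simp_all
    have q\<omega>: "2 * \<bar>real_of_int q\<bar> = \<omega>\<^sup>2 * p" unfolding \<omega>(2) using pos by simp
    have \<omega>2: "\<omega>\<^sup>2 \<le> 2 * s (i + j) ^ 8" unfolding \<omega>(2) defs[symmetric] using neg pos by (simp add: field_simps)
    show False
    proof (cases "1 \<le> \<omega> * 2 ^ j")
      case True
      have "2 * \<bar>real_of_int q\<bar> \<le> (\<omega> * \<alpha>) * (\<omega> * 2 ^ j)" unfolding q\<omega> p by (simp add: power2_eq_square)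
      then obtain a0 b0 where ab: "a0 \<noteq> 0 \<or> b0 \<noteq> 0" "\<bar>real_of_int b0\<bar> \<le> \<omega> * 2 ^ j"
        "\<bar>real_of_int a0 + real_of_int b0 * \<Phi> t\<bar> \<le> \<omega> * \<alpha>" "q dvd a0 * P1 + b0 * P2"
        using exists_small_combination[OF q0 _ True, of "\<omega> * \<alpha>" "\<Phi> t" P1 P2] \<omega> pos by auto
      obtain e where e: "a0 * P1 + b0 * P2 = q * e" using ab(4) by blast
      have G0: "\<bar>G a0 b0 t\<bar> \<le> \<omega> * \<alpha>" using ab(3) unfolding G_def .
      have "of_int q * F a0 b0 (- e) t = of_int a0 * (of_int q * X t) + of_int b0 * (of_int q * Y t) - of_int (q * e)"
        unfolding F_def by (simp add: algebra_simps)
      also have "\<dots> = G a0 b0 t * u - of_int b0 * W"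
        unfolding e[symmetric] W u[symmetric] G_def by (simp add: algebra_simps)
      finally have qF: "of_int q * F a0 b0 (- e) t = G a0 b0 t * u - of_int b0 * W" .
      have "\<bar>G a0 b0 t * u\<bar> \<le> \<omega> * \<alpha> * (2 * S ^ 11 / \<alpha>)" using G0 uB by (rule abs_mult_mono)
      moreover have "\<bar>of_int b0 * W\<bar> \<le> \<omega> * 2 ^ j * (4 * S ^ 11 / 2 ^ j)" using ab(2) WB by (rule abs_mult_mono)
      ultimately have "\<bar>of_int q * F a0 b0 (- e) t\<bar> \<le> \<omega> * \<alpha> * (2 * S ^ 11 / \<alpha>) + \<omega> * 2 ^ j * (4 * S ^ 11 / 2 ^ j)"
        unfolding qF by linarith
      also have "\<dots> = 6 * \<omega> * S ^ 11" using pos by simp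
      finally have "2 * \<bar>real_of_int q\<bar> * \<bar>F a0 b0 (- e) t\<bar> \<le> 12 * \<omega> * S ^ 11" by (simp add: abs_mult)
      then have "\<bar>F a0 b0 (- e) t\<bar> \<le> 12 * S ^ 11 / (\<omega> * p)"
        unfolding q\<omega> using \<omega>(1) pos by (simp add: field_simps power2_eq_square)
      also have "\<dots> \<le> 16 * S ^ 11 / (\<omega> * p)" using \<omega>(1) pos by (intro divide_right_mono) auto
      finally have F0: "\<bar>F a0 b0 (- e) t\<bar> \<le> 16 * S ^ 11 / (\<omega> * p)" .
      have "\<bar>G a0 b0 t\<bar> * max 1 \<bar>real_of_int b0\<bar> \<le> (\<omega> * \<alpha>) * (\<omega> * 2 ^ j)"
        using G0 ab(2) True by (intro mult_mono) auto
      then have "\<bar>G a0 b0 t\<bar> * max 1 \<bar>real_of_int b0\<bar> \<le> \<omega>\<^sup>2 * p" unfolding p by (simp add: power2_eq_square mult_ac)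
      then show False
        using clean_point_excludes_short_line[OF cl \<omega>(1) \<omega>2 ab(1,2)] G0 F0 unfolding defs by blast
    next
      \<comment> \<open>Only \<open>b = 0\<close> would remain, and the vertical line \<open>q x = P1\<close> serves.\<close>
      case False
      then have B1: "\<omega> * 2 ^ j \<le> 1" by simp
      have "\<bar>G q 0 t\<bar> \<le> \<omega> * \<alpha>"
      proof -
        have "2 * \<bar>real_of_int q\<bar> = \<omega> * \<alpha> * (\<omega> * 2 ^ j)" unfolding q\<omega> p by (simp add: power2_eq_square)
        also have "\<dots> \<le> \<omega> * \<alpha> * 1" using B1 \<omega>(1) pos by (intro mult_left_mono) auto
        finally show ?thesis unfolding G_def by simp
      qed
      moreover have "\<bar>G q 0 t\<bar> * max 1 \<bar>real_of_int 0\<bar> \<le> \<omega>\<^sup>2 * p"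
        unfolding q\<omega>[symmetric] G_def by simp
      moreover have "\<bar>F q 0 (- P1) t\<bar> \<le> 16 * S ^ 11 / (\<omega> * p)"
      proof -
        have "F q 0 (- P1) t = u" unfolding u[symmetric] F_def by simp
        moreover have "2 * S ^ 11 / \<alpha> \<le> 16 * S ^ 11 / (\<omega> * p)"
        proof -
          have "2 * S ^ 11 * (\<omega> * 2 ^ j) \<le> 16 * S ^ 11 * 1" using B1 pos \<omega>(1) by (intro mult_mono) auto
          then show ?thesis unfolding p using pos \<omega>(1) by (simp add: field_simps)
        qed
        ultimately show ?thesis using uB by simp
      qed
      ultimately show False
        using clean_point_excludes_short_line[OF cl \<omega>(1) \<omega>2, of q 0 "- P1"] q0 \<omega>(1) unfolding defs by simp
    qed
  qed
  show "s (i + j) ^ 8 * al (i + j) \<le> \<bar>real_of_int (a1 * b2 - a2 * b1)\<bar>"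
    using low unfolding defs P .
  show "a1 * b2 - a2 * b1 \<noteq> 0" using q0 unfolding P .
  show "\<bar>real_of_int (a1 * b2 - a2 * b1) * X t - real_of_int (b1 * d2 - b2 * d1)\<bar> \<le> 2 * s (i + j) ^ 11 / al i"
    using u uB unfolding P defs by simp
qed

text \<open>The lines at \<open>y\<close> are still close at \<open>x\<close>, so that their determinants with the two lines at \<open>x\<close> are
  integers of modulus less than one. Hence all four lines pass through one rational point, whose
  denominator is large by \<open>pair_denominator\<close>; and \<open>x\<close> and \<open>y\<close> are both close to it.\<close>

lemma pair_sparse:
  assumes sub: "cball c \<rho> \<subseteq> cball c0 r0" and \<rho>: "\<beta> * r_pair i j \<le> \<rho>" "\<rho> \<le> r_pair i j"
    and cl: "\<And>t. t \<in> cball c \<rho> \<Longrightarrow> clean i j t"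
    and x: "x \<in> pair i j" "x \<in> cball c \<rho>" and y: "y \<in> pair i j" "y \<in> cball c \<rho>"
  shows "dist x y \<le> s (i + j) * \<rho>"
proof -
  define S p \<alpha> where "S = s (i + j)" "p = al (i + j)" "\<alpha> = al i"
  note defs = S_p_\<alpha>_def
  have pos: "0 < S" "0 < p" "0 < \<alpha>" "0 < M" using s_pos al_pos M unfolding defs by auto
  have p: "p = \<alpha> * 2 ^ j" unfolding defs by (rule al_add)
  have xJ: "x \<in> cball c0 r0" and yJ: "y \<in> cball c0 r0" using sub x y by auto
  obtain a1 b1 d1 a2 b2 d2 where 12: "close_line i j x a1 b1 d1" "close_line i j x a2 b2 d2"
    and n12: "\<not> (b1 * d2 - b2 * d1 = 0 \<and> d1 * a2 - d2 * a1 = 0 \<and> a1 * b2 - a2 * b1 = 0)"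
    using x(1) unfolding pair_def mem_Collect_eq by blast
  obtain a3 b3 d3 a4 b4 d4 where 34: "close_line i j y a3 b3 d3" "close_line i j y a4 b4 d4"
    and n34: "\<not> (b3 * d4 - b4 * d3 = 0 \<and> d3 * a4 - d4 * a3 = 0 \<and> a3 * b4 - a4 * b3 = 0)"
    using y(1) unfolding pair_def mem_Collect_eq by blast
  have "dist x y \<le> 2 * \<rho>" using x(2) y(2) by (auto simp: dist_real_def abs_le_iff)
  also have "\<dots> \<le> 2 * r_pair i j" using \<rho> by simp
  also have "\<dots> = 2 * S / (\<alpha> * p)" unfolding r_pair_def defs by simp
  finally have dxy: "dist y x \<le> 2 * S / (\<alpha> * p)" by (simp add: dist_commute)
  have S11: "S ^ 11 \<le> S" using s_power_le unfolding defs by simp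
  have MS: "S \<le> M * S" using M pos by simp
  have moved: "\<bar>F a b d x\<bar> \<le> 7 * M * S / p \<and> \<bar>G a b x\<bar> \<le> 3 * \<alpha>"
    if L: "close_line i j y a b d" for a b d
  proof -
    note L' = L[unfolded close_line_def, folded defs]
    have Gu: "\<bar>G a b u\<bar> \<le> 3 * \<alpha>" if u: "u \<in> cball c0 r0" "dist y u \<le> dist y x" for u
    proof -
      have "\<bar>G a b u - G a b y\<bar> \<le> \<bar>real_of_int b\<bar> * (M * dist y u)" using G_dist[OF yJ u(1)] .
      also have "\<dots> \<le> 2 ^ j * (M * (2 * S / (\<alpha> * p)))"
        using u(2) dxy pos L' by (intro mult_mono mult_left_mono) auto
      also have "\<dots> = 2 * M * S / \<alpha>\<^sup>2" unfolding p using pos by (simp add: field_simps power2_eq_square)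
      also have "\<dots> \<le> \<alpha> ^ 3 / \<alpha>\<^sup>2"
      proof (rule divide_right_mono)
        have "2 * M * S \<le> \<tau> ^ 3" using s_small(4) unfolding defs .
        also have "\<dots> \<le> \<alpha> ^ 3" using al_ge \<tau> unfolding defs by (intro power_mono) auto
        finally show "2 * M * S \<le> \<alpha> ^ 3" .
      qed simp
      also have "\<dots> = \<alpha>" using pos by (simp add: power2_eq_square power3_eq_cube)
      finally show ?thesis using L' by linarith
    qed
    have "\<bar>F a b d x - F a b d y\<bar> \<le> 3 * \<alpha> * (M * dist y x)" by (rule F_dist[OF yJ xJ Gu])
    also have "\<dots> \<le> 3 * \<alpha> * (M * (2 * S / (\<alpha> * p)))" using dxy pos by (intro mult_left_mono) auto
    also have "\<dots> = 6 * (M * S / p)" using pos by (simp add: field_simps)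
    finally have "\<bar>F a b d x - F a b d y\<bar> \<le> 6 * (M * S / p)" .
    moreover have "S ^ 11 / p \<le> M * S / p" using order_trans[OF S11 MS] pos by (intro divide_right_mono) auto
    ultimately have "\<bar>F a b d x\<bar> \<le> 7 * (M * S / p)" using L' by linarith
    then show ?thesis using Gu[OF xJ] by simp
  qed
  have stay: "\<bar>F a b d x\<bar> \<le> 7 * M * S / p \<and> \<bar>G a b x\<bar> \<le> 3 * \<alpha>"
    if L: "close_line i j x a b d" for a b d
  proof -
    note L' = L[unfolded close_line_def, folded defs]
    have "M * S \<le> 7 * M * S" using pos by simp
    then have "S ^ 11 \<le> 7 * M * S" using S11 MS by linarith
    then have "S ^ 11 / p \<le> 7 * M * S / p" using pos by (intro divide_right_mono) auto
    then show ?thesis using L' pos by auto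
  qed
  \<comment> \<open>The bounds survive the passage from \<open>y\<close> to \<open>x\<close> with constants \<open>7 M\<close> and \<open>3\<close>, and the six terms of the
    determinant sum up to at most \<open>126 * M * S\<close>.\<close>
  have det0: "a * (b1 * d2 - b2 * d1) + b * (d1 * a2 - d2 * a1) + d * (a1 * b2 - a2 * b1) = 0"
    if L: "close_line i j y a b d" for a b d
  proof -
    let ?K = "a * (b1 * d2 - b2 * d1) + b * (d1 * a2 - d2 * a1) + d * (a1 * b2 - a2 * b1)"
    note c = stay[OF 12(1)] stay[OF 12(2)] moved[OF L]
    have bb: "\<bar>real_of_int b1\<bar> \<le> 2 ^ j" "\<bar>real_of_int b2\<bar> \<le> 2 ^ j" "\<bar>real_of_int b\<bar> \<le> 2 ^ j"
      using 12 L unfolding close_line_def by auto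
    define Z where "Z = 7 * M * S / p * (3 * \<alpha>) * 2 ^ j"
    have FG: "\<bar>F a b d x * (G a' b' x * of_int b'')\<bar> \<le> Z"
      if "\<bar>F a b d x\<bar> \<le> 7 * M * S / p" "\<bar>G a' b' x\<bar> \<le> 3 * \<alpha>" "\<bar>real_of_int b''\<bar> \<le> 2 ^ j" for a b d a' b' b''
      unfolding Z_def using abs_mult_mono[OF that(1) abs_mult_mono[OF that(2,3)]] by (simp add: mult_ac)
    have "real_of_int ?K = F a1 b1 d1 x * (G a2 b2 x * of_int b) - F a1 b1 d1 x * (G a b x * of_int b2)
      - F a2 b2 d2 x * (G a1 b1 x * of_int b) + F a b d x * (G a1 b1 x * of_int b2)
      + F a2 b2 d2 x * (G a b x * of_int b1) - F a b d x * (G a2 b2 x * of_int b1)"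
      (is "_ = ?R")
      unfolding det_identity[where t=x] by (simp add: algebra_simps)
    moreover have "\<bar>?R\<bar> \<le> 6 * Z"
      by (rule sum_six_bound; rule FG) (use c bb in auto)
    ultimately have "\<bar>real_of_int ?K\<bar> \<le> 6 * Z" by (simp only:)
    moreover have "6 * Z = 126 * M * S" unfolding Z_def p using pos by simp
    moreover have "126 * M * S < 1" using s_small(5) unfolding defs .
    ultimately have "\<bar>real_of_int ?K\<bar> < 1" by (simp only:)
    then show ?thesis by linarith
  qed
  define P1 q P1' q' where "P1 = b1 * d2 - b2 * d1" "q = a1 * b2 - a2 * b1" "P1' = b3 * d4 - b4 * d3" "q' = a3 * b4 - a4 * b3"
  note P = P1_q_P1'_q'_def
  have "q * P1' - P1 * q' = b3 * (a4 * P1 + b4 * (d1 * a2 - d2 * a1) + d4 * q) - b4 * (a3 * P1 + b3 * (d1 * a2 - d2 * a1) + d3 * q)"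
    unfolding P by (simp add: algebra_simps)
  also have "\<dots> = 0" using det0[OF 34(1)] det0[OF 34(2)] unfolding P by simp
  finally have par: "q * P1' = P1 * q'" by simp
  note d12 = pair_denominator[OF xJ cl[OF x(2)] 12 n12, folded P, folded defs]
  note d34 = pair_denominator[OF yJ cl[OF y(2)] 34 n34, folded P, folded defs]
  have near_pt: "\<bar>X t - of_int A / of_int m\<bar> \<le> 2 * S ^ 3 / (\<alpha> * p)"
    if "S ^ 8 * p \<le> \<bar>real_of_int m\<bar>" "m \<noteq> 0" "\<bar>of_int m * X t - of_int A\<bar> \<le> 2 * S ^ 11 / \<alpha>" for t and A m :: int
  proof -
    have "S ^ 8 * p * \<bar>X t - of_int A / of_int m\<bar> \<le> \<bar>real_of_int m\<bar> * \<bar>X t - of_int A / of_int m\<bar>"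
      using that(1) by (intro mult_right_mono) auto
    also have "\<dots> = \<bar>of_int m * X t - of_int A\<bar>" using that(2) by (simp add: abs_mult[symmetric] algebra_simps)
    also have "\<dots> \<le> 2 * S ^ 11 / \<alpha>" by (rule that(3))
    also have "\<dots> = S ^ 8 * p * (2 * S ^ 3 / (\<alpha> * p))" using pos by (simp add: field_simps eval_nat_numeral)
    finally show ?thesis by (rule mult_left_le_imp_le) (use pos in simp)
  qed
  have "real_of_int q * of_int P1' = of_int P1 * of_int q'" using par by (metis of_int_mult)
  then have eq: "real_of_int P1 / of_int q = of_int P1' / of_int q'" using d12(2) d34(2) by (simp add: field_simps)
  have "\<bar>X y - X x\<bar> \<le> 4 * S ^ 3 / (\<alpha> * p)"
    using near_pt[OF d12] near_pt[OF d34] unfolding eq by (simp add: abs_le_iff)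
  then have "M * \<bar>X y - X x\<bar> \<le> M * (4 * S ^ 3 / (\<alpha> * p))" using pos by (intro mult_left_mono) auto
  then have "dist x y \<le> M * (4 * S ^ 3 / (\<alpha> * p))" using X_dist(2)[OF xJ yJ] by linarith
  also have "\<dots> = 4 * M * S * (S * (S / (\<alpha> * p)))" using pos by (simp add: field_simps power3_eq_cube)
  also have "\<dots> \<le> \<beta> * (S * (S / (\<alpha> * p)))" using s_small(9)[of "i + j"] pos unfolding defs[symmetric] by (intro mult_right_mono) auto
  also have "\<dots> = S * (\<beta> * r_pair i j)" unfolding r_pair_def defs by simp
  also have "\<dots> \<le> S * \<rho>" using \<rho> pos by (intro mult_left_mono) auto
  finally show ?thesis unfolding defs .
qed

lemma form_bounds_outside_dangers:
  assumes "\<And>j. t \<notin> near j" "\<And>i j. t \<notin> single i j" "a \<noteq> 0 \<or> b \<noteq> 0"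
  shows "\<bar>G a b t\<bar> \<le> \<tau> \<Longrightarrow> b \<noteq> 0 \<and> cF < 2 * \<bar>real_of_int b\<bar> * \<bar>F a b d t\<bar>"
    and "\<tau> < \<bar>G a b t\<bar> \<Longrightarrow> \<exists>l. al l \<le> 4 * \<bar>G a b t\<bar> * max 1 \<bar>real_of_int b\<bar> \<and> s l ^ 13 < al l * \<bar>F a b d t\<bar>"
proof -
  obtain j where j: "\<bar>real_of_int b\<bar> \<le> 2 ^ j" "2 ^ j \<le> 2 * max 1 \<bar>real_of_int b\<bar>" using dyadic_max by blast
  show "b \<noteq> 0 \<and> cF < 2 * \<bar>real_of_int b\<bar> * \<bar>F a b d t\<bar>" if G: "\<bar>G a b t\<bar> \<le> \<tau>"
  proof
    show b0: "b \<noteq> 0"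
    proof
      assume "b = 0"
      then have "\<bar>real_of_int a\<bar> < 1" using G \<tau> unfolding G_def by simp
      then show False using assms(3) \<open>b = 0\<close> by linarith
    qed
    then have m: "max 1 \<bar>real_of_int b\<bar> = \<bar>real_of_int b\<bar>" by linarith
    then have "2 ^ j / 2 \<le> \<bar>real_of_int b\<bar>" using j by simp
    then have "cF / 2 ^ j < \<bar>F a b d t\<bar>"
      using assms(1)[of j] j(1) G unfolding near_def mem_Collect_eq by (metis not_le)
    then have "cF < 2 ^ j * \<bar>F a b d t\<bar>" by (simp add: field_simps)
    also have "\<dots> \<le> 2 * \<bar>real_of_int b\<bar> * \<bar>F a b d t\<bar>" using j(2) unfolding m by (intro mult_right_mono) auto
    finally show "cF < 2 * \<bar>real_of_int b\<bar> * \<bar>F a b d t\<bar>" .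
  qed
  show "\<exists>l. al l \<le> 4 * \<bar>G a b t\<bar> * max 1 \<bar>real_of_int b\<bar> \<and> s l ^ 13 < al l * \<bar>F a b d t\<bar>" if G: "\<tau> < \<bar>G a b t\<bar>"
  proof -
    obtain i where i: "al i / 2 \<le> \<bar>G a b t\<bar>" "\<bar>G a b t\<bar> \<le> al i"
      using dyadic_above[OF \<tau>(1) G] unfolding al_def by auto
    have "s (i + j) ^ 13 / al (i + j) < \<bar>F a b d t\<bar>"
      using assms(2)[of i j] i j(1) unfolding single_def mem_Collect_eq by (metis not_le)
    then have "s (i + j) ^ 13 < al (i + j) * \<bar>F a b d t\<bar>" using al_pos[of "i + j"] by (simp add: field_simps)
    moreover have "al (i + j) \<le> (2 * \<bar>G a b t\<bar>) * (2 * max 1 \<bar>real_of_int b\<bar>)"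
      unfolding al_add using i j by (intro mult_mono) auto
    ultimately show ?thesis by (intro exI[of _ "i + j"]) simp
  qed
qed

end

section \<open>The load of the dangerous parameters\<close>

text \<open>For indices in one window the sums \<open>i + j\<close> lie between some \<open>L\<close> and \<open>3 L + A\<close>, because
  \<open>2 ^ (i + j) \<le> 2 ^ i * 2 ^ (i + j) \<le> 2 ^ (2 * (i + j))\<close> and the profile is at least \<open>2 ^ - (i + j)\<close>; and
  for each value of \<open>i + j\<close> at most \<open>A + 1\<close> values of \<open>i\<close> occur.\<close>

lemma window_sum:
  fixes \<sigma> :: "nat \<Rightarrow> real" and K c \<beta> g \<rho> N :: real and A e :: nat
  assumes K: "0 < K" and c: "0 < c" and \<beta>: "0 < \<beta>" "\<beta> < 1" "1 / \<beta> \<le> 2 ^ A" and e: "1 \<le> e" "e \<le> 208"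
    and \<sigma>: "\<And>l. 0 < \<sigma> l" "\<And>l. \<sigma> l \<le> 1" "\<And>l. 1 \<le> \<sigma> l ^ 208 * 2 ^ l"
    and N: "\<And>L. (\<Sum>l=L..3 * L + A. \<sigma> l powr g) \<le> N" and \<rho>: "0 < \<rho>"
  defines "r \<equiv> \<lambda>(i, j). K * (c * \<sigma> (i + j)) ^ e / (2 ^ i * 2 ^ (i + j))"
  defines "W \<equiv> {x. \<rho> \<le> r x \<and> r x \<le> \<rho> / \<beta>}"
  shows "finite W" and "(\<Sum>(i, j)\<in>W. (c * \<sigma> (i + j)) powr g) \<le> (real A + 1) * (c powr g * N)"
proof -
  define f where "f x = (case x of (i, j) \<Rightarrow> i + j)" for x :: "nat \<times> nat"
  have up: "2 ^ i * 2 ^ (i + j) \<le> K * c ^ e * \<sigma> (i + j) ^ e / \<rho>" "\<beta> * (K * c ^ e * \<sigma> (i + j) ^ e / \<rho>) \<le> 2 ^ i * 2 ^ (i + j)"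
    if "(i, j) \<in> W" for i j
    using that \<rho> \<beta> unfolding W_def r_def by (simp_all add: field_simps power_mult_distrib)
  have \<sigma>e: "\<sigma> l ^ e \<le> 1" "1 \<le> \<sigma> l ^ e * 2 ^ l" for l
  proof -
    show "\<sigma> l ^ e \<le> 1" using \<sigma>(1,2)[of l] by (simp add: power_le_one)
    have "\<sigma> l ^ 208 \<le> \<sigma> l ^ e" using e \<sigma>(1,2)[of l] by (intro power_decreasing) auto
    then have "\<sigma> l ^ 208 * 2 ^ l \<le> \<sigma> l ^ e * 2 ^ l" by (intro mult_right_mono) auto
    then show "1 \<le> \<sigma> l ^ e * 2 ^ l" using \<sigma>(3)[of l] by linarith
  qed
  define T where "T = K * c ^ e / \<rho>"
  have T: "0 < T" unfolding T_def using K c \<rho> by simp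
  have hi: "2 ^ f x \<le> T" if "x \<in> W" for x
  proof -
    obtain i j where x: "x = (i, j)" by (cases x)
    have "2 ^ (i + j) \<le> 2 ^ i * (2::real) ^ (i + j)" by simp
    also have "\<dots> \<le> T * \<sigma> (i + j) ^ e" using up(1) that unfolding x T_def by simp
    also have "\<dots> \<le> T * 1" using \<sigma>e T by (intro mult_left_mono) auto
    finally show ?thesis unfolding f_def x by simp
  qed
  have lo: "\<beta> * T \<le> 2 ^ (3 * f x)" if "x \<in> W" for x
  proof -
    obtain i j where x: "x = (i, j)" by (cases x)
    have "\<beta> * T * 1 \<le> \<beta> * T * (\<sigma> (i + j) ^ e * 2 ^ (i + j))" using \<sigma>e(2) \<beta> T by (intro mult_left_mono) auto
    also have "\<dots> = \<beta> * (K * c ^ e * \<sigma> (i + j) ^ e / \<rho>) * 2 ^ (i + j)" unfolding T_def by simp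
    also have "\<dots> \<le> 2 ^ i * 2 ^ (i + j) * 2 ^ (i + j)" using up(2) that unfolding x by (intro mult_right_mono) auto
    also have "\<dots> \<le> 2 ^ (i + j) * 2 ^ (i + j) * 2 ^ (i + j)" by (intro mult_right_mono power_increasing) auto
    also have "\<dots> = 2 ^ (3 * f x)" unfolding f_def x by (simp add: power_mult[symmetric] power_add[symmetric] algebra_simps)
    finally show ?thesis by simp
  qed
  have range: "f x \<le> 3 * f y + A" if "x \<in> W" "y \<in> W" for x y
  proof -
    have "(2::real) ^ f x \<le> T" using hi that by simp
    also have "\<dots> = 1 / \<beta> * (\<beta> * T)" using \<beta> by simp
    also have "\<dots> \<le> 2 ^ A * 2 ^ (3 * f y)" using \<beta> T lo[OF that(2)] by (intro mult_mono) auto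
    finally have "(2::real) ^ f x \<le> 2 ^ (3 * f y + A)" by (simp add: power_add mult_ac)
    then show ?thesis by (rule power_le_imp_le_exp[rotated]) simp
  qed
  have i_range: "i' \<le> i + A" if "(i, j) \<in> W" "(i', j') \<in> W" "i + j = i' + j'" for i j i' j'
  proof -
    define V where "V = K * c ^ e * \<sigma> (i + j) ^ e / \<rho>"
    have "(2::real) ^ i' * 2 ^ (i + j) \<le> V" using up(1)[OF that(2)] that(3) unfolding V_def by simp
    also have "\<dots> = 1 / \<beta> * (\<beta> * V)" using \<beta> by simp
    also have "\<dots> \<le> 2 ^ A * (2 ^ i * 2 ^ (i + j))"
    proof (rule mult_mono)
      show "\<beta> * V \<le> 2 ^ i * 2 ^ (i + j)" using up(2)[OF that(1)] unfolding V_def .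
      show "0 \<le> \<beta> * V" using \<beta> K c \<rho> \<sigma>(1)[of "i + j"] unfolding V_def by simp
    qed (use \<beta> in auto)
    finally have "(2::real) ^ i' \<le> 2 ^ (i + A)" by (simp add: power_add mult_ac)
    then show ?thesis by (rule power_le_imp_le_exp[rotated]) simp
  qed
  show fin: "finite W"
  proof (cases "W = {}")
    case False
    then obtain y where y: "y \<in> W" by auto
    have "W \<subseteq> {0..3 * f y + A} \<times> {0..3 * f y + A}"
      using range[OF _ y] unfolding f_def by fastforce
    then show ?thesis by (rule finite_subset) simp
  qed simp
  show "(\<Sum>(i, j)\<in>W. (c * \<sigma> (i + j)) powr g) \<le> (real A + 1) * (c powr g * N)"
  proof (cases "W = {}")
    case True
    have "0 \<le> (\<Sum>l=0..3 * 0 + A. \<sigma> l powr g)" by (intro sum_nonneg) simp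
    then have "0 \<le> N" using N[of 0] by linarith
    then show ?thesis unfolding True by simp
  next
    case False
    define L where "L = Min (f ` W)"
    obtain y where y: "y \<in> W" "f y = L"
    proof -
      have "L \<in> f ` W" unfolding L_def using fin False by (intro Min_in) auto
      then show ?thesis using that by auto
    qed
    have sub: "f ` W \<subseteq> {L..3 * L + A}"
    proof
      fix l assume "l \<in> f ` W"
      then obtain x where x: "x \<in> W" "l = f x" by auto
      have "L \<le> l" unfolding L_def using x fin by (intro Min_le) auto
      then show "l \<in> {L..3 * L + A}" using range[OF x(1) y(1)] x(2) y(2) by simp
    qed
    have cnt: "card {x \<in> W. f x = l} \<le> A + 1" for l
    proof (cases "{x \<in> W. f x = l} = {}")
      case False
      define I where "I = fst ` {x \<in> W. f x = l}"
      have finI: "finite I" unfolding I_def using fin by simp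
      have neI: "I \<noteq> {}" unfolding I_def using False by simp
      have "inj_on fst {x \<in> W. f x = l}" unfolding inj_on_def f_def by auto
      then have "card {x \<in> W. f x = l} = card I" unfolding I_def by (simp add: card_image)
      also have "I \<subseteq> {Min I..Min I + A}"
      proof
        fix i' assume i': "i' \<in> I"
        have "Min I \<in> I" using finI neI by (rule Min_in)
        then obtain j where j: "(Min I, j) \<in> W" "Min I + j = l" unfolding I_def f_def by auto
        obtain j' where j': "(i', j') \<in> W" "i' + j' = l" using i' unfolding I_def f_def by auto
        show "i' \<in> {Min I..Min I + A}" using i_range[OF j(1) j'(1)] j(2) j'(2) Min_le[OF finI i'] by simp
      qed
      then have "card I \<le> card {Min I..Min I + A}" by (intro card_mono) auto
      finally show ?thesis by simp
    next
      case True
      then show ?thesis by (simp only: card.empty)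
    qed
    have "(\<Sum>(i, j)\<in>W. (c * \<sigma> (i + j)) powr g) = (\<Sum>x\<in>W. (c * \<sigma> (f x)) powr g)"
      unfolding f_def by (intro sum.cong) auto
    also have "\<dots> = (\<Sum>l=L..3 * L + A. \<Sum>x\<in>{x \<in> W. f x = l}. (c * \<sigma> (f x)) powr g)"
      using fin sub by (intro sum.group[symmetric]) auto
    also have "\<dots> = (\<Sum>l=L..3 * L + A. real (card {x \<in> W. f x = l}) * (c * \<sigma> l) powr g)"
      by (intro sum.cong) auto
    also have "\<dots> \<le> (\<Sum>l=L..3 * L + A. (real A + 1) * (c powr g * \<sigma> l powr g))"
    proof (rule sum_mono)
      fix l
      have "real (card {x \<in> W. f x = l}) \<le> real A + 1" using cnt[of l] by linarith
      moreover have "(c * \<sigma> l) powr g = c powr g * \<sigma> l powr g" using c \<sigma>(1)[of l] by (simp add: powr_mult)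
      ultimately show "real (card {x \<in> W. f x = l}) * (c * \<sigma> l) powr g \<le> (real A + 1) * (c powr g * \<sigma> l powr g)"
        by (simp add: mult_right_mono)
    qed
    also have "\<dots> = (real A + 1) * (c powr g * (\<Sum>l=L..3 * L + A. \<sigma> l powr g))" by (simp add: sum_distrib_left)
    also have "\<dots> \<le> (real A + 1) * (c powr g * N)" using N by (intro mult_left_mono) auto
    finally show ?thesis .
  qed
qed

datatype danger = Near nat | Pair nat nat | Single nat nat

lemma (in arc_game) is_danger_system:
  fixes \<sigma> :: "nat \<Rightarrow> real" and c g N :: real and A :: nat
  assumes s: "s = (\<lambda>l. c * \<sigma> l)" and c: "0 < c" and A: "1 / \<beta> \<le> 2 ^ A"
    and \<sigma>: "\<And>l. 0 < \<sigma> l" "\<And>l. \<sigma> l \<le> 1" "\<And>l. 1 \<le> \<sigma> l ^ 208 * 2 ^ l"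
    and N: "\<And>L. (\<Sum>l=L..3 * L + A. \<sigma> l powr g) \<le> N"
    and small: "(real A + 1) * (c powr g * N) \<le> 1 / 72" "(real A + 1) * eT powr g \<le> 1 / 72"
    and r0: "c3 < r0" "\<delta> < \<tau>\<^sup>2 * r0"
  shows "danger_system \<beta> g (1 / 24) c0 r0
    (case_danger near pair single) (case_danger r_near r_pair r_single)
    (case_danger (\<lambda>_. eT) (\<lambda>i j. s (i + j)) (\<lambda>i j. s (i + j)))"
  (is "danger_system \<beta> g _ c0 r0 ?X ?r ?e")
proof -
  have M0: "0 < M" using M by simp
  have e1: "s l ^ 11 / (8 * M * z) \<le> s l / z" if "0 < z" for l z
  proof -
    have "s l ^ 11 \<le> s l" using s_power_le by simp
    also have "\<dots> \<le> s l * (8 * M)" using s_pos[of l] M by simp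
    finally have "s l ^ 11 / (8 * M * z) \<le> s l * (8 * M) / (8 * M * z)" using M0 that by (intro divide_right_mono) auto
    then show ?thesis using M0 by simp
  qed
  have rp: "0 < r_pair i j" "r_pair i j < r0" for i j
  proof -
    show "0 < r_pair i j" unfolding r_pair_def using s_pos al_pos by simp
    have "\<tau>\<^sup>2 \<le> al i * al (i + j)" unfolding power2_eq_square using al_ge \<tau> al_pos by (intro mult_mono) (auto simp: less_imp_le)
    moreover have "s (i + j) < \<tau>\<^sup>2 * r0" using s_le[of "i + j"] r0 by simp
    moreover have "0 < r0" using r0 c3 by simp
    ultimately have "s (i + j) < al i * al (i + j) * r0" by (smt (verit) mult_right_mono)
    then show "r_pair i j < r0" unfolding r_pair_def using al_pos by (simp add: field_simps)
  qed
  have rs: "0 < r_single i j" "r_single i j < r0" for i j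
  proof -
    show "0 < r_single i j" unfolding r_single_def using s_pos al_pos M0 by simp
    have "r_single i j \<le> r_pair i j" unfolding r_single_def r_pair_def using e1 al_pos by simp
    then show "r_single i j < r0" using rp(2)[of i j] by simp
  qed
  have rn: "0 < r_near j" "r_near j < r0" for j
  proof -
    show "0 < r_near j" unfolding r_near_def using c3 by simp
    have "c3 / 2 ^ j \<le> c3 / 1" using c3 by (intro divide_left_mono) auto
    then show "r_near j < r0" unfolding r_near_def using r0 by simp
  qed
  have pos: "\<forall>i. 0 < ?r i \<and> ?r i < r0 \<and> 0 < ?e i"
    using rp rs rn eT s_pos by (auto split: danger.split)
  have sums: "finite {i. \<rho> \<le> ?r i \<and> ?r i \<le> \<rho> / \<beta>} \<and> (\<Sum>i | \<rho> \<le> ?r i \<and> ?r i \<le> \<rho> / \<beta>. ?e i powr g) \<le> 1 / 24"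
    if \<rho>: "0 < \<rho>" for \<rho>
  proof -
    define WN where "WN = {j. \<rho> \<le> r_near j \<and> r_near j \<le> \<rho> / \<beta>}"
    define WP where "WP = {x. \<rho> \<le> (case x of (i, j) \<Rightarrow> r_pair i j) \<and> (case x of (i, j) \<Rightarrow> r_pair i j) \<le> \<rho> / \<beta>}"
    define WS where "WS = {x. \<rho> \<le> (case x of (i, j) \<Rightarrow> r_single i j) \<and> (case x of (i, j) \<Rightarrow> r_single i j) \<le> \<rho> / \<beta>}"
    have sl: "s l = c * \<sigma> l" for l by (simp add: s)
    have rP: "(case x of (i, j) \<Rightarrow> r_pair i j) = (\<lambda>(i, j). (1 / \<tau>\<^sup>2) * (c * \<sigma> (i + j)) ^ 1 / (2 ^ i * 2 ^ (i + j))) x" for x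
      by (cases x) (simp add: r_pair_def al_def sl power2_eq_square mult_ac)
    have rS: "(case x of (i, j) \<Rightarrow> r_single i j) = (\<lambda>(i, j). (1 / (8 * M * \<tau>\<^sup>2)) * (c * \<sigma> (i + j)) ^ 11 / (2 ^ i * 2 ^ (i + j))) x" for x
      by (cases x) (simp add: r_single_def al_def sl power2_eq_square mult_ac)
    have KP: "0 < 1 / \<tau>\<^sup>2" and KS: "0 < 1 / (8 * M * \<tau>\<^sup>2)" using \<tau> M0 by auto
    have le: "(1::nat) \<le> 1" "(1::nat) \<le> 208" "(1::nat) \<le> 11" "(11::nat) \<le> 208" by simp_all
    have P: "finite WP" "(\<Sum>(i, j)\<in>WP. s (i + j) powr g) \<le> 1 / 72"
      unfolding WP_def rP sl
      by (rule window_sum(1)[OF KP c \<beta> A le(1,2) \<sigma> N \<rho>],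
        rule order_trans[OF window_sum(2)[OF KP c \<beta> A le(1,2) \<sigma> N \<rho>] small(1)])
    have S: "finite WS" "(\<Sum>(i, j)\<in>WS. s (i + j) powr g) \<le> 1 / 72"
      unfolding WS_def rS sl
      by (rule window_sum(1)[OF KS c \<beta> A le(3,4) \<sigma> N \<rho>],
        rule order_trans[OF window_sum(2)[OF KS c \<beta> A le(3,4) \<sigma> N \<rho>] small(1)])
    have Nn: "finite WN" "(\<Sum>j\<in>WN. eT powr g) \<le> 1 / 72"
    proof -
      have rg: "j' \<le> j + A" if "j \<in> WN" "j' \<in> WN" for j j'
      proof -
        have "c3 / 2 ^ j \<le> \<rho> / \<beta>" "\<rho> \<le> c3 / 2 ^ j'" using that unfolding WN_def r_near_def by auto
        then have "\<rho> * 2 ^ j' \<le> c3" "c3 \<le> \<rho> * (1 / \<beta>) * 2 ^ j" by (simp_all add: field_simps)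
        moreover have "\<rho> * (1 / \<beta>) * 2 ^ j \<le> \<rho> * 2 ^ A * 2 ^ j" using A \<rho> by (intro mult_right_mono mult_left_mono) auto
        ultimately have "\<rho> * 2 ^ j' \<le> \<rho> * 2 ^ (j + A)" by (simp add: power_add mult_ac)
        then have "(2::real) ^ j' \<le> 2 ^ (j + A)" using \<rho> by simp
        then show ?thesis by (rule power_le_imp_le_exp[rotated]) simp
      qed
      have "finite WN \<and> card WN \<le> A + 1"
      proof (cases "WN = {}")
        case False
        then obtain y where y: "y \<in> WN" by auto
        have "WN \<subseteq> {..y + A}" using rg[OF y] by auto
        then have fin: "finite WN" by (rule finite_subset) simp
        have "Min WN \<in> WN" using fin False by (rule Min_in)
        then have "WN \<subseteq> {Min WN..Min WN + A}" using rg Min_le[OF fin] by auto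
        then have "card WN \<le> card {Min WN..Min WN + A}" by (intro card_mono) auto
        then show ?thesis using fin by simp
      qed simp
      then show "finite WN" "(\<Sum>j\<in>WN. eT powr g) \<le> 1 / 72"
      proof -
        assume h: "finite WN \<and> card WN \<le> A + 1"
        show "finite WN" using h by simp
        have "real (card WN) * eT powr g \<le> (real A + 1) * eT powr g" using h by (intro mult_right_mono) auto
        then show "(\<Sum>j\<in>WN. eT powr g) \<le> 1 / 72" using small(2) by simp
      qed
    qed
    have split: "{i. \<rho> \<le> ?r i \<and> ?r i \<le> \<rho> / \<beta>} = Near ` WN \<union> (case_prod Pair ` WP \<union> case_prod Single ` WS)"
      unfolding WN_def WP_def WS_def by (rule set_eqI, rename_tac i, case_tac i) (auto simp: image_iff)
    have fins: "finite (Near ` WN)" "finite (case_prod Pair ` WP)" "finite (case_prod Single ` WS)"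
      using P S Nn by auto
    have "(\<Sum>i\<in>Near ` WN \<union> (case_prod Pair ` WP \<union> case_prod Single ` WS). ?e i powr g)
      = (\<Sum>i\<in>Near ` WN. ?e i powr g) + ((\<Sum>i\<in>case_prod Pair ` WP. ?e i powr g) + (\<Sum>i\<in>case_prod Single ` WS. ?e i powr g))"
      by (subst sum.union_disjoint sum.union_disjoint; use fins in auto)+
    also have "(\<Sum>i\<in>Near ` WN. ?e i powr g) = (\<Sum>j\<in>WN. eT powr g)"
      by (subst sum.reindex) (auto simp: inj_on_def)
    also have "(\<Sum>i\<in>case_prod Pair ` WP. ?e i powr g) = (\<Sum>(i, j)\<in>WP. s (i + j) powr g)"
      by (subst sum.reindex) (auto simp: inj_on_def intro: sum.cong)
    also have "(\<Sum>i\<in>case_prod Single ` WS. ?e i powr g) = (\<Sum>(i, j)\<in>WS. s (i + j) powr g)"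
      by (subst sum.reindex) (auto simp: inj_on_def intro: sum.cong)
    finally show ?thesis unfolding split using P S Nn fins by simp
  qed
  \<comment> \<open>Tangent lines are handled unconditionally, pairs use the earlier tangent and single lines, and
    single lines use the pair of the same index, whose scale is larger.\<close>
  have sparse: "dist x y \<le> ?e i * \<rho> \<or> dist x z \<le> ?e i * \<rho> \<or> dist y z \<le> ?e i * \<rho>"
    if sub: "cball c \<rho> \<subseteq> cball c0 r0" and \<rho>: "\<beta> * ?r i \<le> \<rho>" "\<rho> \<le> ?r i"
      and hist: "\<forall>i'. ?r i < ?e i' * ?r i' \<longrightarrow> ?X i' \<inter> cball c \<rho> = {}"
      and xyz: "x \<in> ?X i \<inter> cball c \<rho>" "y \<in> ?X i \<inter> cball c \<rho>" "z \<in> ?X i \<inter> cball c \<rho>" for c \<rho> i x y z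
  proof (cases i)
    case (Near j)
    then show ?thesis using near_sparse[OF sub, of j x y z] \<rho> xyz by simp
  next
    case (Pair i' j)
    have "clean i' j t" if "t \<in> cball c \<rho>" for t
      unfolding clean_def
    proof (intro conjI allI impI)
      fix j0 assume "r_pair i' j < eT * r_near j0"
      then show "t \<notin> near j0" using hist[rule_format, of "Near j0"] that unfolding Pair by auto
    next
      fix i0 j0 assume "r_pair i' j < s (i0 + j0) * r_single i0 j0"
      then show "t \<notin> single i0 j0" using hist[rule_format, of "Single i0 j0"] that unfolding Pair by auto
    qed
    then show ?thesis using pair_sparse[OF sub, of i' j x y] \<rho> xyz unfolding Pair by simp
  next
    case (Single i' j)
    have "r_single i' j < s (i' + j) * r_pair i' j"
    proof -
      have "s (i' + j) ^ 11 \<le> s (i' + j) ^ 2" using s_pos[of "i' + j"] s_small(1)[of "i' + j"] by (intro power_decreasing) auto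
      moreover have "0 < s (i' + j) ^ 2" using s_pos[of "i' + j"] by simp
      ultimately have "s (i' + j) ^ 11 < s (i' + j) ^ 2 * (8 * M)"
        using mult_strict_left_mono[of 1 "8 * M" "s (i' + j) ^ 2"] M by linarith
      then have "s (i' + j) ^ 11 / (8 * M * (al i' * al (i' + j))) < s (i' + j) ^ 2 * (8 * M) / (8 * M * (al i' * al (i' + j)))"
        using M0 al_pos by (intro divide_strict_right_mono) auto
      also have "\<dots> = s (i' + j) * (s (i' + j) / (al i' * al (i' + j)))" using M0 by (simp add: power2_eq_square)
      finally show ?thesis unfolding r_single_def r_pair_def .
    qed
    then have "pair i' j \<inter> cball c \<rho> = {}" using hist[rule_format, of "Pair i' j"] unfolding Single by simp
    then show ?thesis using single_sparse[OF sub, of i' j x y] \<rho> xyz unfolding Single by simp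
  qed
  show ?thesis
    unfolding danger_system_def
    by (intro conjI allI impI ballI pos sums) (use pos sums sparse in \<open>blast+\<close>)
qed

text \<open>Distances are measured separately for nearly tangent and for transversal lines. In the second case
  \<open>l\<close> is the scale of the line.\<close>

definition (in convex_arc) repels_lines :: "real \<Rightarrow> real \<Rightarrow> real \<Rightarrow> (nat \<Rightarrow> real) \<Rightarrow> real \<Rightarrow> bool" where
  "repels_lines \<tau> cF c \<sigma> t \<longleftrightarrow> (\<forall>a b d. a \<noteq> 0 \<or> b \<noteq> 0 \<longrightarrow>
    (\<bar>G a b t\<bar> \<le> \<tau> \<longrightarrow> b \<noteq> 0 \<and> cF < 2 * \<bar>real_of_int b\<bar> * \<bar>F a b d t\<bar>) \<and>
    (\<tau> < \<bar>G a b t\<bar> \<longrightarrow>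
      (\<exists>l. \<tau> * 2 ^ l \<le> 4 * \<bar>G a b t\<bar> * max 1 \<bar>real_of_int b\<bar> \<and> (c * \<sigma> l) ^ 13 < \<tau> * 2 ^ l * \<bar>F a b d t\<bar>)))"

text \<open>The constants \<open>\<tau>\<close> and \<open>cF\<close> come before the profile, since the profile that will be used is built
  from a constant that depends on \<open>\<tau>\<close>.\<close>

theorem (in convex_arc) exists_danger_system:
  fixes \<beta> g :: real
  assumes \<beta>: "0 < \<beta>" "\<beta> < 1" and g: "0 < g"
  obtains \<tau> cF
  where "0 < \<tau>" "\<tau> < 1" "0 < cF"
    and "\<And>\<sigma>. slow_profile g \<sigma> \<Longrightarrow> \<exists>(DX :: danger \<Rightarrow> real set) rad eps c. 0 < c \<and>
      danger_system \<beta> g (1 / 24) c0 r0 DX rad eps \<and> (\<forall>t. t \<notin> (\<Union>i. DX i) \<longrightarrow> repels_lines \<tau> cF c \<sigma> t)"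
proof -
  obtain A :: nat where "1 / \<beta> < 2 ^ A" using real_arch_pow[of 2 "1 / \<beta>"] by auto
  then have A: "1 / \<beta> \<le> 2 ^ A" by simp
  have M0: "0 < M" using M by simp
  have root: "\<exists>e>0. \<forall>x. 0 < x \<longrightarrow> x \<le> e \<longrightarrow> (real A + 1) * (x powr g * N) \<le> 1 / 72"
    if N1: "1 \<le> N" for N
  proof -
    define e where "e = (1 / (72 * (real A + 1) * N)) powr (1 / g)"
    have pos: "0 < 72 * (real A + 1) * N" using N1 by simp
    have eg: "e powr g = 1 / (72 * (real A + 1) * N)" unfolding e_def using g N1 by (simp add: powr_powr)
    have "(real A + 1) * (x powr g * N) \<le> 1 / 72" if "0 < x" "x \<le> e" for x
    proof -
      have "x powr g \<le> e powr g" using that g by (intro powr_mono2) auto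
      then have "(real A + 1) * (x powr g * N) \<le> (real A + 1) * (1 / (72 * (real A + 1) * N) * N)"
        unfolding eg using N1 by (intro mult_left_mono mult_right_mono) auto
      also have "\<dots> = (real A + 1) * N / (72 * ((real A + 1) * N))" by simp
      also have "\<dots> = 1 / 72"
      proof -
        have "(real A + 1) * N \<noteq> 0" using N1 by simp
        moreover have "z \<noteq> 0 \<Longrightarrow> z / (72 * z) = 1 / 72" for z :: real by simp
        ultimately show ?thesis by blast
      qed
      finally show ?thesis .
    qed
    moreover have "0 < 1 / (72 * (real A + 1) * N)" using pos by (rule divide_pos_pos[OF zero_less_one])
    then have "0 < e" unfolding e_def by (metis less_irrefl powr_gt_zero)
    ultimately show ?thesis by blast
  qed
  obtain eT where eT: "0 < eT" "\<And>x. 0 < x \<Longrightarrow> x \<le> eT \<Longrightarrow> (real A + 1) * (x powr g * 1) \<le> 1 / 72"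
    using root[of 1] by auto
  have eT2: "(real A + 1) * eT powr g \<le> 1 / 72" using eT(2)[of eT] eT(1) by simp
  define c3 where "c3 = min (1 / (8 * M)) (r0 / 2)"
  have c3: "0 < c3" "8 * M * c3 \<le> 1" "c3 < r0"
  proof -
    show "0 < c3" "c3 < r0" unfolding c3_def using M0 r0 by auto
    have "8 * M * c3 \<le> 8 * M * (1 / (8 * M))" unfolding c3_def using M0 by (intro mult_left_mono) auto
    then show "8 * M * c3 \<le> 1" using M0 by simp
  qed
  define D where "D = eT * \<beta> * c3"
  have D: "0 < D" unfolding D_def using eT \<beta> c3 by simp
  define \<tau> where "\<tau> = min (1 / 2) (D / (4608 * M ^ 5))"
  have \<tau>: "0 < \<tau>" "\<tau> < 1" unfolding \<tau>_def using D M0 by auto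
  have \<tau>D: "4608 * M ^ 5 * \<tau> \<le> D"
  proof -
    have "4608 * M ^ 5 * \<tau> \<le> 4608 * M ^ 5 * (D / (4608 * M ^ 5))" unfolding \<tau>_def using M0 by (intro mult_left_mono) auto
    then show ?thesis using M0 by simp
  qed
  define cF where "cF = D\<^sup>2 / (1536 * M ^ 4)"
  have cF: "0 < cF" "1536 * M ^ 4 * cF \<le> D\<^sup>2" unfolding cF_def using D M0 by auto
  have small: "\<exists>x>0. K * x \<le> y" if "0 < K" "0 < y" for K y :: real
    using that by (intro exI[of _ "y / K"]) simp
  have main: "\<exists>(DX :: danger \<Rightarrow> real set) rad eps c. 0 < c \<and>
      danger_system \<beta> g (1 / 24) c0 r0 DX rad eps \<and> (\<forall>t. t \<notin> (\<Union>i. DX i) \<longrightarrow> repels_lines \<tau> cF c \<sigma> t)"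
    if profile: "slow_profile g \<sigma>" for \<sigma>
  proof -
  have \<sigma>: "\<And>l. 0 < \<sigma> l" "\<And>l. \<sigma> l \<le> 1" "\<And>l. 1 \<le> \<sigma> l ^ 208 * 2 ^ l"
    and decay: "\<And>l0 l. l0 \<le> l \<Longrightarrow> \<sigma> l ^ 208 * 2 ^ l0 \<le> \<sigma> l0 ^ 208 * 2 ^ l"
    using profile unfolding slow_profile_def by blast+
  obtain N0 where N0: "\<And>L. (\<Sum>l=L..3 * L + A. \<sigma> l powr g) \<le> N0"
    using profile unfolding slow_profile_def by blast
  define N where "N = max 1 N0"
  have N: "(\<Sum>l=L..3 * L + A. \<sigma> l powr g) \<le> N" for L unfolding N_def using N0[of L] by simp
  have N1: "1 \<le> N" unfolding N_def by simp
  obtain e where e: "0 < e" "\<And>x. 0 < x \<Longrightarrow> x \<le> e \<Longrightarrow> (real A + 1) * (x powr g * N) \<le> 1 / 72"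
    using root[OF N1] by blast
  define bounds where "bounds = [(160 * M\<^sup>2, \<beta>), (300 * M, 1), (2 * M, \<tau> ^ 3), (34, cF * \<tau>),
    (5, eT * c3 * \<tau>\<^sup>2), (3 * (4096 * M)\<^sup>2, 1), (2, \<tau>\<^sup>2 * r0), (1, e)]"
  have bpos: "\<forall>(K, y)\<in>set bounds. 0 < K \<and> 0 < y"
    unfolding bounds_def using M0 \<beta> \<tau> cF eT c3 r0 e by simp
  \<comment> \<open>Each entry \<open>(K, y)\<close> stands for a requirement \<open>K * \<delta> \<le> y\<close>.\<close>
  define \<delta> where "\<delta> = Min ((\<lambda>(K, y). y / K) ` set bounds)"
  have le_bound: "K * \<delta> \<le> y" if "(K, y) \<in> set bounds" for K y
  proof -
    have "\<delta> \<le> y / K" unfolding \<delta>_def using that by (intro Min_le) (auto intro!: image_eqI[of _ _ "(K, y)"])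
    moreover have "0 < K" using bpos that by auto
    ultimately show ?thesis by (simp add: field_simps)
  qed
  have \<delta>0: "0 < \<delta>"
  proof -
    have "\<delta> \<in> (\<lambda>(K, y). y / K) ` set bounds" unfolding \<delta>_def by (rule Min_in) (auto simp: bounds_def)
    then show ?thesis using bpos by auto
  qed
  define c where "c = \<delta>"
  have ce: "c \<le> e" unfolding c_def using le_bound[of 1 e] unfolding bounds_def by simp
  note c3r = c3(3)
  interpret arc_game X Y \<Phi> M c0 r0 "\<lambda>l. c * \<sigma> l" \<beta> \<tau> c3 cF eT \<delta>
  proof
    show "0 < \<beta>" "\<beta> < 1" "0 < \<tau>" "\<tau> < 1" "0 < c3" "8 * M * c3 \<le> 1" "0 < eT" "0 < cF"
      using \<beta> \<tau> c3 eT cF by auto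
    show "0 < c * \<sigma> l" "c * \<sigma> l \<le> \<delta>" for l
      unfolding c_def using \<sigma>(1,2)[of l] \<delta>0 by (simp_all add: mult_left_le)
    show "(c * \<sigma> l) ^ 208 * 2 ^ l0 \<le> (c * \<sigma> l0) ^ 208 * 2 ^ l" if "l0 \<le> l" for l l0
      using mult_left_mono[OF decay[OF that], of "c ^ 208"] \<delta>0 unfolding c_def by (simp add: power_mult_distrib mult.assoc)
    show "4608 * M ^ 5 * \<tau> \<le> eT * \<beta> * c3" "1536 * M ^ 4 * cF \<le> (eT * \<beta> * c3)\<^sup>2"
      using \<tau>D cF unfolding D_def by auto
    show "160 * M\<^sup>2 * \<delta> \<le> \<beta>" "300 * M * \<delta> \<le> 1" "2 * M * \<delta> \<le> \<tau> ^ 3" "34 * \<delta> \<le> cF * \<tau>"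
      "5 * \<delta> \<le> eT * c3 * \<tau>\<^sup>2" "3 * (4096 * M)\<^sup>2 * \<delta> \<le> 1"
      by (rule le_bound; simp add: bounds_def)+
  qed
  have d2: "\<delta> < \<tau>\<^sup>2 * r0"
  proof -
    have "2 * \<delta> \<le> \<tau>\<^sup>2 * r0" by (rule le_bound) (simp add: bounds_def)
    then show ?thesis using \<delta>0 by simp
  qed
  have sys: "danger_system \<beta> g (1 / 24) c0 r0
    (case_danger near pair single) (case_danger r_near r_pair r_single)
    (case_danger (\<lambda>_. eT) (\<lambda>i j. c * \<sigma> (i + j)) (\<lambda>i j. c * \<sigma> (i + j)))"
    by (rule is_danger_system[OF refl _ A \<sigma> N _ eT2 c3r d2]) (use e(2)[OF _ ce] \<delta>0 in \<open>auto simp: c_def\<close>)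
  have av: "(\<forall>j. t \<notin> near j) \<and> (\<forall>i j. t \<notin> single i j)" if "t \<notin> (\<Union>i. case_danger near pair single i)" for t
  proof (intro conjI allI)
    fix j show "t \<notin> near j" using that by (auto dest: spec[of _ "Near j"])
  next
    fix i j show "t \<notin> single i j" using that by (auto dest: spec[of _ "Single i j"])
  qed
  have rep: "repels_lines \<tau> cF c \<sigma> t" if "t \<notin> (\<Union>i. case_danger near pair single i)" for t
    unfolding repels_lines_def using form_bounds_outside_dangers[of t] av[OF that] unfolding al_def by blast
  have c0: "0 < c" unfolding c_def by (rule \<delta>0)
  show ?thesis using sys rep c0 by blast
  qed
  show ?thesis by (rule that[OF \<tau> cF(1) main])
qed

section \<open>Curves near a point of nonzero curvature\<close>

definition cross2 :: "real \<times> real \<Rightarrow> real \<times> real \<Rightarrow> real" where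
  "cross2 u w = fst u * snd w - snd u * fst w"

lemma bounded_linear_cross2: "bounded_linear (cross2 u)"
  unfolding cross2_def by (intro bounded_linear_intros)

lemma has_vector_derivative_quotient:
  fixes \<gamma> :: "real \<Rightarrow> real \<times> real"
  assumes "(\<gamma> has_vector_derivative v) (at t)"
  shows "((\<lambda>s. (\<gamma> s - \<gamma> t) /\<^sub>R (s - t)) \<longlongrightarrow> v) (at t)"
proof -
  have "((\<lambda>s. (fst (\<gamma> s) - fst (\<gamma> t)) / (s - t)) \<longlongrightarrow> fst v) (at t)"
    using bounded_linear.has_vector_derivative[OF bounded_linear_fst assms]
    by (simp add: has_real_derivative_iff_has_vector_derivative[symmetric] has_field_derivative_iff)
  moreover have "((\<lambda>s. (snd (\<gamma> s) - snd (\<gamma> t)) / (s - t)) \<longlongrightarrow> snd v) (at t)"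
    using bounded_linear.has_vector_derivative[OF bounded_linear_snd assms]
    by (simp add: has_real_derivative_iff_has_vector_derivative[symmetric] has_field_derivative_iff)
  ultimately have "((\<lambda>s. ((fst (\<gamma> s) - fst (\<gamma> t)) / (s - t), (snd (\<gamma> s) - snd (\<gamma> t)) / (s - t))) \<longlongrightarrow> (fst v, snd v)) (at t)"
    by (rule tendsto_Pair)
  moreover have "(\<gamma> s - \<gamma> t) /\<^sub>R (s - t) = ((fst (\<gamma> s) - fst (\<gamma> t)) / (s - t), (snd (\<gamma> s) - snd (\<gamma> t)) / (s - t))" for s
    by (simp add: prod_eq_iff divide_inverse mult.commute)
  ultimately show ?thesis by simp
qed

lemma cross2_scaleR: "cross2 u (c *\<^sub>R x) = c * cross2 u x"
  unfolding cross2_def by (simp add: algebra_simps)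

lemma local_paramD:
  assumes "local_param C I \<gamma>"
  shows "open I" "continuous_on I \<gamma>" "inj_on \<gamma> I" "\<gamma> ` I \<subseteq> C"
    "\<And>t. t \<in> I \<Longrightarrow> (\<gamma> has_vector_derivative vector_derivative \<gamma> (at t)) (at t)"
    "continuous_on I (\<lambda>t. vector_derivative \<gamma> (at t))"
    "\<And>t. t \<in> I \<Longrightarrow> vector_derivative \<gamma> (at t) \<noteq> 0"
proof -
  show "open I" and "\<And>t. t \<in> I \<Longrightarrow> vector_derivative \<gamma> (at t) \<noteq> 0"
    using assms unfolding local_param_def by auto
  obtain \<phi> where hom: "homeomorphism I (\<gamma> ` I) \<gamma> \<phi>" using assms unfolding local_param_def by auto
  then show "continuous_on I \<gamma>" unfolding homeomorphism_def by auto
  show "inj_on \<gamma> I" using hom by (metis homeomorphism_def inj_on_inverseI)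
  show "\<gamma> ` I \<subseteq> C" using assms unfolding local_param_def by (metis openin_imp_subset)
  obtain D where D: "\<And>t. t \<in> I \<Longrightarrow> (\<gamma> has_vector_derivative D t) (at t)" "continuous_on I D"
    using assms unfolding local_param_def C1_differentiable_on_def by auto
  have eq: "vector_derivative \<gamma> (at t) = D t" if "t \<in> I" for t
    using vector_derivative_at[OF D(1)[OF that]] .
  show "(\<gamma> has_vector_derivative vector_derivative \<gamma> (at t)) (at t)" if "t \<in> I" for t
    unfolding eq[OF that] using D(1)[OF that] .
  show "continuous_on I (\<lambda>t. vector_derivative \<gamma> (at t))"
    using D(2) eq by (simp cong: continuous_on_cong)
qed

lemma C2_local_paramD:
  assumes "C2_local_param C I \<gamma>"
  defines "v \<equiv> \<lambda>t. vector_derivative \<gamma> (at t)"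
  shows "local_param C I \<gamma>"
    "\<And>t. t \<in> I \<Longrightarrow> (v has_vector_derivative vector_derivative v (at t)) (at t)"
    "continuous_on I (\<lambda>t. vector_derivative v (at t))"
proof -
  show "local_param C I \<gamma>" using assms unfolding C2_local_param_def by auto
  have "v C1_differentiable_on I" using assms unfolding C2_local_param_def by auto
  then obtain D where D: "\<And>t. t \<in> I \<Longrightarrow> (v has_vector_derivative D t) (at t)" "continuous_on I D"
    unfolding C1_differentiable_on_def by auto
  have eq: "vector_derivative v (at t) = D t" if "t \<in> I" for t
    using vector_derivative_at[OF D(1)[OF that]] .
  show "(v has_vector_derivative vector_derivative v (at t)) (at t)" if "t \<in> I" for t
    unfolding eq[OF that] using D(1)[OF that] .
  show "continuous_on I (\<lambda>t. vector_derivative v (at t))"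
    using D(2) eq by (simp cong: continuous_on_cong)
qed

text \<open>Both parametrizations are homeomorphisms onto relatively open subsets of the curve.\<close>

lemma param_transition:
  assumes g: "local_param C I \<gamma>" and g': "local_param C I' \<gamma>'"
    and t: "t \<in> I" "t' \<in> I'" "\<gamma> t = \<gamma>' t'"
  obtains \<psi> r where "0 < r" "ball t r \<subseteq> I" "continuous_on (ball t r) \<psi>" "\<psi> ` ball t r \<subseteq> I'" "\<psi> t = t'"
    "\<And>s. s \<in> ball t r \<Longrightarrow> \<gamma>' (\<psi> s) = \<gamma> s"
proof -
  note D = local_paramD[OF g] and D' = local_paramD[OF g']
  obtain \<phi> where hom: "homeomorphism I' (\<gamma>' ` I') \<gamma>' \<phi>" using g' unfolding local_param_def by auto
  have "openin (top_of_set C) (\<gamma>' ` I')" using g' unfolding local_param_def by auto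
  then have "openin (top_of_set I) (I \<inter> \<gamma> -` (\<gamma>' ` I'))"
    using continuous_openin_preimage[OF D(2), of C] D(4) by auto
  then have "open (I \<inter> \<gamma> -` (\<gamma>' ` I'))" using D(1) by (metis openin_open_eq)
  moreover have "t \<in> I \<inter> \<gamma> -` (\<gamma>' ` I')" using t by auto
  ultimately obtain r where r: "0 < r" "ball t r \<subseteq> I \<inter> \<gamma> -` (\<gamma>' ` I')"
    using open_contains_ball by blast
  show ?thesis
  proof (rule that[of r "\<phi> \<circ> \<gamma>"])
    show "0 < r" "ball t r \<subseteq> I" using r by auto
    show "continuous_on (ball t r) (\<phi> \<circ> \<gamma>)"
    proof (rule continuous_on_compose)
      show "continuous_on (ball t r) \<gamma>" using D(2) r by (auto intro: continuous_on_subset)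
      have "\<gamma> ` ball t r \<subseteq> \<gamma>' ` I'" using r by auto
      moreover have "continuous_on (\<gamma>' ` I') \<phi>" using hom unfolding homeomorphism_def by auto
      ultimately show "continuous_on (\<gamma> ` ball t r) \<phi>" by (rule continuous_on_subset[rotated])
    qed
    show "(\<phi> \<circ> \<gamma>) ` ball t r \<subseteq> I'" using hom r unfolding homeomorphism_def by auto
    show "(\<phi> \<circ> \<gamma>) t = t'" using hom t unfolding homeomorphism_def by auto
    show "\<gamma>' ((\<phi> \<circ> \<gamma>) s) = \<gamma> s" if "s \<in> ball t r" for s
      using hom r that unfolding homeomorphism_def by auto
  qed
qed

text \<open>By l'Hospital's rule the height of the curve above its tangent is half of the second derivative
  times the square of the parameter difference. The quotient on the left is formed from the points
  of the curve and a tangent vector, which makes it comparable between parametrizations.\<close>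

lemma curvature_limit:
  fixes \<gamma> v :: "real \<Rightarrow> real \<times> real"
  assumes I: "open I" "t \<in> I" and \<gamma>: "\<And>s. s \<in> I \<Longrightarrow> (\<gamma> has_vector_derivative v s) (at s)"
    and v: "(v has_vector_derivative a) (at t)" "v t \<noteq> 0"
  shows "((\<lambda>s. cross2 (v t) (\<gamma> s - \<gamma> t) / (norm (\<gamma> s - \<gamma> t))\<^sup>2) \<longlongrightarrow> cross2 (v t) a / (2 * (norm (v t))\<^sup>2)) (at t)"
proof -
  define f where "f s = cross2 (v t) (\<gamma> s - \<gamma> t)" for s
  have quot: "((\<lambda>s. (\<gamma> s - \<gamma> t) /\<^sub>R (s - t)) \<longlongrightarrow> v t) (at t)"
    by (rule has_vector_derivative_quotient[OF \<gamma>[OF I(2)]])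
  have n: "((\<lambda>s. (norm ((\<gamma> s - \<gamma> t) /\<^sub>R (s - t)))\<^sup>2) \<longlongrightarrow> (norm (v t))\<^sup>2) (at t)"
    by (intro tendsto_intros quot)
  have df: "(f has_real_derivative cross2 (v t) (v s)) (at s)" if "s \<in> I" for s
  proof -
    have "((\<lambda>s. \<gamma> s - \<gamma> t) has_vector_derivative v s - 0) (at s)"
      using \<gamma>[OF that] by (intro derivative_intros)
    from bounded_linear.has_vector_derivative[OF bounded_linear_cross2 this]
    show ?thesis unfolding f_def by (simp add: has_real_derivative_iff_has_vector_derivative)
  qed
  have dv: "((\<lambda>s. cross2 (v t) (v s)) has_real_derivative cross2 (v t) a) (at t)"
    using bounded_linear.has_vector_derivative[OF bounded_linear_cross2 v(1)]
    by (simp add: has_real_derivative_iff_has_vector_derivative)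
  have "((\<lambda>s. (cross2 (v t) (v s) - cross2 (v t) (v t)) / (s - t)) \<longlongrightarrow> cross2 (v t) a) (at t)"
    using dv by (simp add: has_field_derivative_iff)
  moreover have "cross2 (v t) (v t) = 0" unfolding cross2_def by simp
  ultimately have "((\<lambda>s. cross2 (v t) (v s) / (s - t) / 2) \<longlongrightarrow> cross2 (v t) a / 2) (at t)"
    by (intro tendsto_divide) auto
  then have l: "((\<lambda>s. cross2 (v t) (v s) / (2 * (s - t))) \<longlongrightarrow> cross2 (v t) a / 2) (at t)"
    by (simp add: mult.commute)
  have evI: "eventually (\<lambda>s. s \<in> I) (at t)" using I by (simp add: eventually_at_in_open')
  have ne: "eventually (\<lambda>s. s \<noteq> t) (at t)" by (simp add: eventually_at_filter)
  have fq: "((\<lambda>s. f s / (s - t)\<^sup>2) \<longlongrightarrow> cross2 (v t) a / 2) (at t)"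
  proof (rule lhopital[OF _ _ _ _ _ _ l])
    have "isCont f t" using df[OF I(2)] by (rule DERIV_isCont)
    then show "(f \<longlongrightarrow> 0) (at t)" unfolding isCont_def f_def by (simp add: cross2_def)
    have "((\<lambda>s. (s - t)\<^sup>2) \<longlongrightarrow> (t - t)\<^sup>2) (at t)" by (intro tendsto_intros)
    then show "((\<lambda>s. (s - t)\<^sup>2) \<longlongrightarrow> 0) (at t)" by simp
    show "eventually (\<lambda>s. (s - t)\<^sup>2 \<noteq> 0) (at t)" using ne by eventually_elim simp
    show "eventually (\<lambda>s. 2 * (s - t) \<noteq> 0) (at t)" using ne by eventually_elim simp
    show "eventually (\<lambda>s. (f has_real_derivative cross2 (v t) (v s)) (at s)) (at t)"
      by (rule eventually_mono[OF evI df])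
    show "eventually (\<lambda>s. ((\<lambda>s. (s - t)\<^sup>2) has_real_derivative 2 * (s - t)) (at s)) (at t)"
      by (intro always_eventually allI) (auto intro!: derivative_eq_intros)
  qed
  have "((\<lambda>s. (f s / (s - t)\<^sup>2) / (norm ((\<gamma> s - \<gamma> t) /\<^sub>R (s - t)))\<^sup>2) \<longlongrightarrow> (cross2 (v t) a / 2) / (norm (v t))\<^sup>2) (at t)"
    using v(2) by (intro tendsto_divide[OF fq n]) simp
  moreover have "eventually (\<lambda>s. (f s / (s - t)\<^sup>2) / (norm ((\<gamma> s - \<gamma> t) /\<^sub>R (s - t)))\<^sup>2 =
      cross2 (v t) (\<gamma> s - \<gamma> t) / (norm (\<gamma> s - \<gamma> t))\<^sup>2) (at t)"
    using ne unfolding f_def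
    by eventually_elim (simp add: power_mult_distrib power_divide divide_simps)
  ultimately show ?thesis by (simp add: tendsto_cong)
qed

text \<open>The transition map between two parametrizations is only known to be continuous, so the chain rule
  is replaced by the limit in \<open>curvature_limit\<close>, which refers to points of the curve. The
  two tangent vectors are proportional because the chord has the same limit direction in both
  parametrizations.\<close>

lemma flat_point_invariant:
  assumes g: "C2_local_param C I \<gamma>" "t \<in> I" and g': "C2_local_param C I' \<gamma>'" "t' \<in> I'"
    and eq: "\<gamma> t = \<gamma>' t'" and flat: "param_curvature \<gamma> t = 0"
  shows "param_curvature \<gamma>' t' = 0"
proof -
  note P = C2_local_paramD[OF g(1)] and P' = C2_local_paramD[OF g'(1)]
  note D = local_paramD[OF P(1)] and D' = local_paramD[OF P'(1)]
  define v a where "v = (\<lambda>t. vector_derivative \<gamma> (at t))" "a = vector_derivative (\<lambda>s. vector_derivative \<gamma> (at s)) (at t)"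
  define v' a' where "v' = (\<lambda>t. vector_derivative \<gamma>' (at t))" "a' = vector_derivative (\<lambda>s. vector_derivative \<gamma>' (at s)) (at t')"
  have v0: "v t \<noteq> 0" "v' t' \<noteq> 0" using D(7)[OF g(2)] D'(7)[OF g'(2)] unfolding v_a_def v'_a'_def by auto
  have c0: "cross2 (v t) a = 0"
    using flat v0 unfolding param_curvature_def Let_def cross2_def v_a_def by auto
  obtain \<psi> r where \<psi>: "0 < r" "ball t r \<subseteq> I" "continuous_on (ball t r) \<psi>" "\<psi> ` ball t r \<subseteq> I'" "\<psi> t = t'"
    "\<And>s. s \<in> ball t r \<Longrightarrow> \<gamma>' (\<psi> s) = \<gamma> s"
    using param_transition[OF P(1) P'(1) g(2) g'(2) eq] by metis
  have evb: "eventually (\<lambda>s. s \<in> ball t r) (at t)" using \<psi>(1) by (intro eventually_at_in_open') auto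
  have ne: "eventually (\<lambda>s. s \<noteq> t) (at t)" by (simp add: eventually_at_filter)
  have "isCont \<psi> t" using \<psi>(1,3) by (simp add: continuous_on_eq_continuous_at)
  then have "(\<psi> \<longlongrightarrow> t') (at t)" using \<psi>(5) unfolding isCont_def by simp
  moreover have "eventually (\<lambda>s. \<psi> s \<noteq> t') (at t)"
    using evb ne
  proof eventually_elim
    case (elim s)
    then have "\<gamma> s \<noteq> \<gamma> t" using D(3) \<psi>(2) g(2) unfolding inj_on_def by blast
    then show ?case using \<psi>(6)[OF elim(1)] eq by auto
  qed
  ultimately have fl: "filterlim \<psi> (at t') (at t)" by (simp add: filterlim_at)
  have L: "((\<lambda>s. cross2 (v t) (\<gamma> s - \<gamma> t) / (norm (\<gamma> s - \<gamma> t))\<^sup>2) \<longlongrightarrow> cross2 (v t) a / (2 * (norm (v t))\<^sup>2)) (at t)"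
    unfolding v_a_def by (rule curvature_limit[OF D(1) g(2) D(5)]) (use P(2)[OF g(2)] v0 in \<open>auto simp: v_a_def\<close>)
  have "((\<lambda>s. cross2 (v' t') (\<gamma>' s - \<gamma>' t') / (norm (\<gamma>' s - \<gamma>' t'))\<^sup>2) \<longlongrightarrow> cross2 (v' t') a' / (2 * (norm (v' t'))\<^sup>2)) (at t')"
    unfolding v'_a'_def by (rule curvature_limit[OF D'(1) g'(2) D'(5)]) (use P'(2)[OF g'(2)] v0 in \<open>auto simp: v'_a'_def\<close>)
  from filterlim_compose[OF this fl]
  have "((\<lambda>s. cross2 (v' t') (\<gamma>' (\<psi> s) - \<gamma>' t') / (norm (\<gamma>' (\<psi> s) - \<gamma>' t'))\<^sup>2) \<longlongrightarrow> cross2 (v' t') a' / (2 * (norm (v' t'))\<^sup>2)) (at t)" .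
  moreover have "eventually (\<lambda>s. cross2 (v' t') (\<gamma>' (\<psi> s) - \<gamma>' t') / (norm (\<gamma>' (\<psi> s) - \<gamma>' t'))\<^sup>2
      = cross2 (v' t') (\<gamma> s - \<gamma> t) / (norm (\<gamma> s - \<gamma> t))\<^sup>2) (at t)"
    using evb by eventually_elim (simp add: \<psi>(6) eq)
  ultimately have L': "((\<lambda>s. cross2 (v' t') (\<gamma> s - \<gamma> t) / (norm (\<gamma> s - \<gamma> t))\<^sup>2) \<longlongrightarrow> cross2 (v' t') a' / (2 * (norm (v' t'))\<^sup>2)) (at t)"
    by (simp add: tendsto_cong)
  have quot: "((\<lambda>s. (\<gamma> s - \<gamma> t) /\<^sub>R (s - t)) \<longlongrightarrow> v t) (at t)"
    unfolding v_a_def by (rule has_vector_derivative_quotient[OF D(5)[OF g(2)]])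
  have c1: "((\<lambda>s. cross2 (v' t') ((\<gamma> s - \<gamma> t) /\<^sub>R (s - t))) \<longlongrightarrow> cross2 (v' t') (v t)) (at t)"
    by (rule bounded_linear.tendsto[OF bounded_linear_cross2 quot])
  have "((\<lambda>s. cross2 (v' t') (\<gamma> s - \<gamma> t) / (norm (\<gamma> s - \<gamma> t))\<^sup>2 * (norm ((\<gamma> s - \<gamma> t) /\<^sub>R (s - t)))\<^sup>2 * (s - t)) \<longlongrightarrow>
     cross2 (v' t') a' / (2 * (norm (v' t'))\<^sup>2) * (norm (v t))\<^sup>2 * (t - t)) (at t)"
    by (intro tendsto_intros L' quot)
  moreover have "eventually (\<lambda>s. cross2 (v' t') (\<gamma> s - \<gamma> t) / (norm (\<gamma> s - \<gamma> t))\<^sup>2 * (norm ((\<gamma> s - \<gamma> t) /\<^sub>R (s - t)))\<^sup>2 * (s - t)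
     = cross2 (v' t') ((\<gamma> s - \<gamma> t) /\<^sub>R (s - t))) (at t)"
    using evb ne
  proof eventually_elim
    case (elim s)
    then have "\<gamma> s \<noteq> \<gamma> t" using D(3) \<psi>(2) g(2) unfolding inj_on_def by blast
    then show ?case
    proof -
      have "norm ((\<gamma> s - \<gamma> t) /\<^sub>R (s - t)) = norm (\<gamma> s - \<gamma> t) / \<bar>s - t\<bar>" by (simp add: divide_inverse mult.commute)
      moreover have "K / N\<^sup>2 * (N / \<bar>d\<bar>)\<^sup>2 * d = inverse d * K" if "N \<noteq> 0" "d \<noteq> 0" for K N d :: real
        using that by (simp add: power_divide) (simp add: power2_eq_square field_simps)
      ultimately show ?thesis using elim \<open>\<gamma> s \<noteq> \<gamma> t\<close> by (simp add: cross2_scaleR)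
    qed
  qed
  ultimately have "((\<lambda>s. cross2 (v' t') ((\<gamma> s - \<gamma> t) /\<^sub>R (s - t))) \<longlongrightarrow> 0) (at t)"
    by (simp add: tendsto_cong)
  from tendsto_unique[OF _ c1 this] have par: "cross2 (v' t') (v t) = 0" by simp
  define lam where "lam = inner (v' t') (v t) / (norm (v t))\<^sup>2"
  have v': "v' t' = lam *\<^sub>R v t"
  proof -
    obtain x y p q where xy: "v t = (x, y)" "v' t' = (p, q)" by (metis surj_pair)
    have n: "(norm (v t))\<^sup>2 = x\<^sup>2 + y\<^sup>2" unfolding xy by (simp add: norm_Pair)
    have pos: "x\<^sup>2 + y\<^sup>2 \<noteq> 0" using v0(1) unfolding n[symmetric] by simp
    have pq: "p * y = q * x" using par unfolding xy cross2_def by simp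
    have "(p * x + q * y) * x = p * (x\<^sup>2 + y\<^sup>2)" "(p * x + q * y) * y = q * (x\<^sup>2 + y\<^sup>2)"
      using pq by algebra+
    then show ?thesis unfolding lam_def n using pos unfolding xy by (simp add: field_simps)
  qed
  have "cross2 (v' t') z = lam * cross2 (v t) z" for z unfolding v' cross2_def by (simp add: algebra_simps)
  then have "((\<lambda>s. cross2 (v' t') (\<gamma> s - \<gamma> t) / (norm (\<gamma> s - \<gamma> t))\<^sup>2) \<longlongrightarrow> lam * (cross2 (v t) a / (2 * (norm (v t))\<^sup>2))) (at t)"
    using tendsto_mult_left[OF L, of lam] by simp
  from tendsto_unique[OF _ L' this] have "cross2 (v' t') a' / (2 * (norm (v' t'))\<^sup>2) = 0" using c0 by simp
  then have "cross2 (v' t') a' = 0" using v0 by simp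
  then show ?thesis unfolding param_curvature_def Let_def cross2_def v'_a'_def by simp
qed

text \<open>If the parametrization were flat at \<open>t\<close>, so would be all others through the same point, and the
  description of the curvature would have the unique value zero.\<close>

lemma curvature_nonzero:
  assumes "C2_local_param C I \<gamma>" "t \<in> I" "curvature C (\<gamma> t) \<noteq> 0"
  defines "v \<equiv> \<lambda>t. vector_derivative \<gamma> (at t)"
  shows "cross2 (v t) (vector_derivative v (at t)) \<noteq> 0"
proof
  assume "cross2 (v t) (vector_derivative v (at t)) = 0"
  then have flat: "param_curvature \<gamma> t = 0" unfolding param_curvature_def Let_def cross2_def v_def by simp
  have "curvature C (\<gamma> t) = 0"
    unfolding curvature_def
  proof (rule the_equality)
    show "\<exists>I' \<gamma>' t'. C2_local_param C I' \<gamma>' \<and> t' \<in> I' \<and> \<gamma>' t' = \<gamma> t \<and> 0 = param_curvature \<gamma>' t'"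
      using assms flat by metis
    fix k assume "\<exists>I' \<gamma>' t'. C2_local_param C I' \<gamma>' \<and> t' \<in> I' \<and> \<gamma>' t' = \<gamma> t \<and> k = param_curvature \<gamma>' t'"
    then show "k = 0" using flat_point_invariant[OF assms(1,2)] flat by metis
  qed
  then show False using assms by simp
qed

lemma nonvanishing_bounds:
  fixes f :: "real \<Rightarrow> real"
  assumes "continuous_on S f" "connected S" "compact S" "S \<noteq> {}" "\<And>x. x \<in> S \<Longrightarrow> f x \<noteq> 0"
  obtains e m M where "e = 1 \<or> e = - 1" "0 < m" "\<And>x. x \<in> S \<Longrightarrow> m \<le> e * f x" "\<And>x. x \<in> S \<Longrightarrow> e * f x \<le> M"
proof -
  have conn: "connected (f ` S)" using assms(1,2) by (rule connected_continuous_image)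
  have sgn: "(\<forall>x\<in>S. 0 < f x) \<or> (\<forall>x\<in>S. f x < 0)"
  proof (rule ccontr)
    assume "\<not> ?thesis"
    then obtain x y where "x \<in> S" "f x < 0" "y \<in> S" "0 < f y" using assms(5) by force
    then have "0 \<in> f ` S" using connectedD_interval[OF conn, of "f x" "f y" 0] by auto
    then show False using assms(5) by auto
  qed
  obtain e :: real where e: "e = 1 \<or> e = - 1" "\<And>x. x \<in> S \<Longrightarrow> 0 < e * f x"
    using sgn by (metis mult_1 mult_minus1 neg_0_less_iff_less)
  have c: "continuous_on S (\<lambda>x. e * f x)" by (intro continuous_intros assms(1))
  obtain x where x: "x \<in> S" "\<And>y. y \<in> S \<Longrightarrow> e * f x \<le> e * f y" using continuous_attains_inf[OF assms(3,4) c] by auto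
  obtain y where y: "y \<in> S" "\<And>x. x \<in> S \<Longrightarrow> e * f x \<le> e * f y" using continuous_attains_sup[OF assms(3,4) c] by auto
  show ?thesis using that[OF e(1) e(2)[OF x(1)]] x(2) y(2) by blast
qed

lemma mvt_unordered:
  fixes f f' :: "real \<Rightarrow> real"
  assumes "connected S" "a \<in> S" "b \<in> S" "\<And>x. x \<in> S \<Longrightarrow> (f has_real_derivative f' x) (at x)"
  obtains \<sigma> where "\<sigma> \<in> S" "f b - f a = f' \<sigma> * (b - a)"
proof -
  have *: "\<exists>\<sigma>\<in>S. f b - f a = f' \<sigma> * (b - a)" if ab: "a \<in> S" "b \<in> S" "a < b" for a b
  proof -
    have sub: "{a..b} \<subseteq> S" using connected_contains_Icc[OF assms(1) ab(1,2)] .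
    have "(f has_real_derivative f' x) (at x)" if "a \<le> x" "x \<le> b" for x using assms(4) sub that by auto
    from MVT2[OF ab(3) this] obtain z where "a < z" "z < b" "f b - f a = (b - a) * f' z" by blast
    then show ?thesis using sub by (intro bexI[of _ z]) auto
  qed
  consider "a < b" | "b < a" | "a = b" by linarith
  then show ?thesis
  proof cases
    case 1
    then show ?thesis using *[OF assms(2,3)] that by blast
  next
    case 2
    then obtain \<sigma> where "\<sigma> \<in> S" "f a - f b = f' \<sigma> * (a - b)" using *[OF assms(3,2)] by blast
    then show ?thesis using that[of \<sigma>] by (simp add: algebra_simps)
  next
    case 3
    then show ?thesis using that[of a] assms by simp
  qed
qed

text \<open>The coordinates \<open>x\<close> and \<open>y\<close> are given in a parameter \<open>t\<close> that is merely \<open>C\<^sup>1\<close>, and \<open>\<psi>\<close> passes to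
  a parameter \<open>s\<close> in which the curve is \<open>C\<^sup>2\<close>. The slope is taken in the good parameter, where its
  derivative is \<open>(v1 a2 - v2 a1) / v1\<^sup>2 \<noteq> 0\<close>. Cauchy's mean value theorem in \<open>s\<close> gives the secant
  property in \<open>t\<close>, as \<open>\<psi>\<close> maps intervals to intervals. Moreover \<open>\<psi>\<close> is bi-Lipschitz, since \<open>x\<close> is so
  in both parameters.\<close>

lemma convex_arc_of_charts:
  fixes x y x' y' X0 Y0 v1 v2 a1 a2 \<psi> :: "real \<Rightarrow> real" and c \<rho> :: real
  defines "J \<equiv> cball c \<rho>"
  assumes \<rho>: "0 < \<rho>"
    and dx: "\<And>t. t \<in> J \<Longrightarrow> (x has_real_derivative x' t) (at t)" "\<And>t. t \<in> J \<Longrightarrow> (y has_real_derivative y' t) (at t)"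
    and cx: "continuous_on J x'" and reg: "\<And>t. t \<in> J \<Longrightarrow> x' t \<noteq> 0 \<or> y' t \<noteq> 0"
    and \<psi>: "continuous_on J \<psi>"
    and eq: "\<And>t. t \<in> J \<Longrightarrow> x t = X0 (\<psi> t)" "\<And>t. t \<in> J \<Longrightarrow> y t = Y0 (\<psi> t)"
    and d0: "\<And>s. s \<in> \<psi> ` J \<Longrightarrow> (X0 has_real_derivative v1 s) (at s)" "\<And>s. s \<in> \<psi> ` J \<Longrightarrow> (Y0 has_real_derivative v2 s) (at s)"
      "\<And>s. s \<in> \<psi> ` J \<Longrightarrow> (v1 has_real_derivative a1 s) (at s)" "\<And>s. s \<in> \<psi> ` J \<Longrightarrow> (v2 has_real_derivative a2 s) (at s)"
    and ca: "continuous_on (\<psi> ` J) a1" "continuous_on (\<psi> ` J) a2"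
    and nz: "\<And>s. s \<in> \<psi> ` J \<Longrightarrow> v1 s \<noteq> 0" "\<And>s. s \<in> \<psi> ` J \<Longrightarrow> v1 s * a2 s - v2 s * a1 s \<noteq> 0"
  obtains e1 e2 \<Phi> M where "e1 = 1 \<or> e1 = - 1" "e2 = 1 \<or> e2 = - 1"
    "convex_arc (\<lambda>t. e1 * x t) (\<lambda>t. e2 * y t) \<Phi> M c \<rho>"
proof -
  define S where "S = \<psi> ` J"
  have J: "connected J" "compact J" "J \<noteq> {}" unfolding J_def using \<rho> by auto
  have S: "connected S" "compact S" "S \<noteq> {}"
    unfolding S_def using J \<psi> by (auto intro: connected_continuous_image compact_continuous_image)
  have cv: "continuous_on S v1" "continuous_on S v2"
    using d0(3,4) unfolding S_def[symmetric] by (auto intro!: DERIV_isCont continuous_at_imp_continuous_on)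
  define \<Phi>0 where "\<Phi>0 s = v2 s / v1 s" for s
  define D where "D s = (v1 s * a2 s - v2 s * a1 s) / (v1 s)\<^sup>2" for s
  have d\<Phi>: "(\<Phi>0 has_real_derivative D s) (at s)" if "s \<in> S" for s
    unfolding \<Phi>0_def D_def using d0(3,4) nz(1) that unfolding S_def[symmetric]
    by (auto intro!: derivative_eq_intros simp: power2_eq_square mult_ac)
  have cD: "continuous_on S D"
    unfolding D_def using cv ca nz(1) unfolding S_def[symmetric] by (intro continuous_intros) auto
  have c\<Phi>: "continuous_on S \<Phi>0"
    unfolding \<Phi>0_def using cv nz(1) unfolding S_def[symmetric] by (intro continuous_intros) auto
  define \<Phi>1 where "\<Phi>1 t = \<Phi>0 (\<psi> t)" for t
  have c\<Phi>1: "continuous_on J \<Phi>1"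
    unfolding \<Phi>1_def using continuous_on_compose2[OF c\<Phi> \<psi>] unfolding S_def by auto
  have sec: "\<exists>\<xi>\<in>{s..t}. y t - y s = \<Phi>1 \<xi> * (x t - x s)" if st: "s \<in> J" "t \<in> J" "s \<le> t" for s t
  proof -
    have sub: "{s..t} \<subseteq> J" using connected_contains_Icc[OF J(1) st(1,2)] .
    have c2: "continuous_on {s..t} \<psi>" using \<psi> sub by (rule continuous_on_subset)
    have core: "\<exists>\<sigma>. \<sigma> \<in> closed_segment (\<psi> s) (\<psi> t) \<and> (y t - y s) * v1 \<sigma> = (x t - x s) * v2 \<sigma>"
    proof -
      have *: "\<exists>\<sigma>. \<sigma> \<in> {p..q} \<and> (Y0 q - Y0 p) * v1 \<sigma> = (X0 q - X0 p) * v2 \<sigma>" if "p \<in> S" "q \<in> S" "p < q" for p q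
      proof -
        have sub: "{p..q} \<subseteq> S" using connected_contains_Icc[OF S(1) that(1,2)] .
        have "\<exists>c>p. c < q \<and> (Y0 q - Y0 p) * v1 c = (X0 q - X0 p) * v2 c"
        proof (rule GMVT'[where f=Y0 and g=X0])
          show "p < q" by (rule that(3))
          fix z assume z: "p \<le> z" "z \<le> q"
          then have "z \<in> \<psi> ` J" using sub unfolding S_def by auto
          then show "isCont Y0 z" "isCont X0 z" using d0(1,2) by (auto intro: DERIV_isCont)
        next
          fix z assume z: "p < z" "z < q"
          then have "z \<in> {p..q}" by simp
          then have "z \<in> \<psi> ` J" using sub unfolding S_def by blast
          then show "(X0 has_real_derivative v1 z) (at z)" "(Y0 has_real_derivative v2 z) (at z)"
            using d0(1,2) by auto
        qed
        then show ?thesis by (metis atLeastAtMost_iff less_imp_le)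
      qed
      have pq: "\<psi> s \<in> S" "\<psi> t \<in> S" unfolding S_def using st by auto
      consider "\<psi> s < \<psi> t" | "\<psi> t < \<psi> s" | "\<psi> s = \<psi> t" by linarith
      then show ?thesis
      proof cases
        case 1
        then show ?thesis using *[OF pq 1] eq st by (auto simp: closed_segment_eq_real_ivl)
      next
        case 2
        then obtain \<sigma> where \<sigma>: "\<sigma> \<in> {\<psi> t..\<psi> s}" "(y s - y t) * v1 \<sigma> = (x s - x t) * v2 \<sigma>"
          using *[OF pq(2,1) 2] eq st by auto
        then have "(y t - y s) * v1 \<sigma> = (x t - x s) * v2 \<sigma>" by (simp add: algebra_simps)
        then show ?thesis using \<sigma>(1) 2 by (auto simp: closed_segment_eq_real_ivl)
      next
        case 3
        then show ?thesis using eq st by auto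
      qed
    qed
    then obtain \<sigma> where \<sigma>: "\<sigma> \<in> closed_segment (\<psi> s) (\<psi> t)" "(y t - y s) * v1 \<sigma> = (x t - x s) * v2 \<sigma>" by blast
    have "closed_segment (\<psi> s) (\<psi> t) \<subseteq> \<psi> ` {s..t}"
    proof -
      have "connected (\<psi> ` {s..t})" using c2 by (intro connected_continuous_image) auto
      then have "is_interval (\<psi> ` {s..t})" by (simp add: is_interval_connected_1)
      then have "convex (\<psi> ` {s..t})" by (rule is_interval_convex)
      then show ?thesis using st(3) by (intro closed_segment_subset) auto
    qed
    then obtain \<xi> where \<xi>: "\<xi> \<in> {s..t}" "\<sigma> = \<psi> \<xi>" using \<sigma>(1) by auto
    have "v1 \<sigma> \<noteq> 0" using nz(1) \<xi> sub by auto
    then have "y t - y s = \<Phi>1 \<xi> * (x t - x s)" using \<sigma>(2) unfolding \<Phi>1_def \<Phi>0_def \<xi>(2) by (simp add: field_simps)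
    then show ?thesis using \<xi>(1) by blast
  qed
  obtain K where K: "\<And>t. t \<in> J \<Longrightarrow> \<bar>\<Phi>1 t\<bar> \<le> K"
    using compact_imp_bounded[OF compact_continuous_image[OF c\<Phi>1 J(2)]] unfolding bounded_iff by auto
  \<comment> \<open>By the secant property \<open>\<bar>y'\<bar> \<le> K * \<bar>x'\<bar>\<close>, so \<open>x' = 0\<close> would contradict regularity.\<close>
  have x'0: "x' t \<noteq> 0" if t: "t \<in> J" for t
  proof
    assume "x' t = 0"
    have "t islimpt J"
    proof (rule connected_imp_perfect[OF J(1) t])
      have "c \<in> J" "c + \<rho> \<in> J" "c \<noteq> c + \<rho>" unfolding J_def using \<rho> by (auto simp: dist_real_def)
      then show "J \<noteq> {x}" for x by auto
    qed
    then have nt: "at t within J \<noteq> bot" by (simp add: trivial_limit_within)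
    have lx: "((\<lambda>s. (x s - x t) / (s - t)) \<longlongrightarrow> x' t) (at t within J)"
      using dx(1)[OF t] by (auto simp: has_field_derivative_iff intro: tendsto_within_subset)
    have ly: "((\<lambda>s. (y s - y t) / (s - t)) \<longlongrightarrow> y' t) (at t within J)"
      using dx(2)[OF t] by (auto simp: has_field_derivative_iff intro: tendsto_within_subset)
    have "\<bar>y' t\<bar> \<le> K * \<bar>x' t\<bar>"
    proof (rule tendsto_le[OF nt])
      show "((\<lambda>s. \<bar>(y s - y t) / (s - t)\<bar>) \<longlongrightarrow> \<bar>y' t\<bar>) (at t within J)" by (intro tendsto_intros ly)
      show "((\<lambda>s. K * \<bar>(x s - x t) / (s - t)\<bar>) \<longlongrightarrow> K * \<bar>x' t\<bar>) (at t within J)" by (intro tendsto_intros lx)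
      have "\<bar>(y s - y t) / (s - t)\<bar> \<le> K * \<bar>(x s - x t) / (s - t)\<bar>" if s: "s \<in> J" for s
      proof -
        have "\<exists>\<xi>\<in>J. \<bar>y s - y t\<bar> = \<bar>\<Phi>1 \<xi>\<bar> * \<bar>x s - x t\<bar>"
        proof (cases "s \<le> t")
          case True
          then show ?thesis using sec[OF s t True] connected_contains_Icc[OF J(1) s t]
            by (metis abs_minus_commute abs_mult subsetD)
        next
          case False
          then have "t \<le> s" by simp
          then show ?thesis using sec[OF t s] connected_contains_Icc[OF J(1) t s]
            by (metis abs_mult subsetD)
        qed
        then obtain \<xi> where "\<xi> \<in> J" "\<bar>y s - y t\<bar> = \<bar>\<Phi>1 \<xi>\<bar> * \<bar>x s - x t\<bar>" by blast
        then have "\<bar>y s - y t\<bar> \<le> K * \<bar>x s - x t\<bar>" using K by (simp add: mult_right_mono)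
        then have "\<bar>y s - y t\<bar> / \<bar>s - t\<bar> \<le> K * \<bar>x s - x t\<bar> / \<bar>s - t\<bar>" by (rule divide_right_mono) simp
        then show ?thesis by (simp add: abs_divide)
      qed
      then show "\<forall>\<^sub>F s in at t within J. \<bar>(y s - y t) / (s - t)\<bar> \<le> K * \<bar>(x s - x t) / (s - t)\<bar>"
        by (simp add: eventually_at_filter)
    qed
    then show False using reg[OF t] \<open>x' t = 0\<close> by simp
  qed
  obtain e1 m1 M1 where e1: "e1 = 1 \<or> e1 = - 1" "0 < m1" "\<And>t. t \<in> J \<Longrightarrow> m1 \<le> e1 * x' t" "\<And>t. t \<in> J \<Longrightarrow> e1 * x' t \<le> M1"
    using nonvanishing_bounds[OF cx J x'0] by blast
  obtain e0 m0 M0 where e0: "e0 = 1 \<or> e0 = - 1" "0 < m0" "\<And>t. t \<in> S \<Longrightarrow> m0 \<le> e0 * v1 t" "\<And>t. t \<in> S \<Longrightarrow> e0 * v1 t \<le> M0"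
    using nonvanishing_bounds[OF cv(1) S] nz(1) unfolding S_def[symmetric] by blast
  have D0: "D s \<noteq> 0" if "s \<in> S" for s unfolding D_def using nz that unfolding S_def[symmetric] by auto
  obtain e2 m2 M2 where e2: "e2 = 1 \<or> e2 = - 1" "0 < m2" "\<And>t. t \<in> S \<Longrightarrow> m2 \<le> e2 * D t" "\<And>t. t \<in> S \<Longrightarrow> e2 * D t \<le> M2"
    using nonvanishing_bounds[OF cD S D0] by blast
  obtain s0 where s0: "s0 \<in> S" using S(3) by auto
  obtain t0 where t0: "t0 \<in> J" using J(3) by auto
  have Mp: "0 < M1" "0 < M0" "0 < M2"
    using e1(2) e1(3,4)[OF t0] e0(2) e0(3,4)[OF s0] e2(2) e2(3,4)[OF s0] by linarith+
  have sq: "e1 * e1 = 1" "e0 * e0 = 1" "e2 * e2 = 1" using e0(1) e1(1) e2(1) by auto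
  have Xb: "m1 * (t - s) \<le> e1 * (x t - x s) \<and> e1 * (x t - x s) \<le> M1 * (t - s)" if st: "s \<in> J" "t \<in> J" "s \<le> t" for s t
  proof -
    obtain \<sigma> where "\<sigma> \<in> J" "x t - x s = x' \<sigma> * (t - s)" using mvt_unordered[OF J(1) st(1,2) dx(1)] by blast
    then show ?thesis using mult_right_mono[OF e1(3)[of \<sigma>], of "t - s"] mult_right_mono[OF e1(4)[of \<sigma>], of "t - s"] st(3)
      by (simp add: mult.assoc)
  qed
  have \<psi>b: "m1 / M0 * (t - s) \<le> e0 * e1 * (\<psi> t - \<psi> s) \<and> e0 * e1 * (\<psi> t - \<psi> s) \<le> M1 / m0 * (t - s)"
    if st: "s \<in> J" "t \<in> J" "s \<le> t" for s t
  proof -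
    have ps: "\<psi> s \<in> S" "\<psi> t \<in> S" unfolding S_def using st by auto
    obtain \<sigma> where \<sigma>: "\<sigma> \<in> S" "X0 (\<psi> t) - X0 (\<psi> s) = v1 \<sigma> * (\<psi> t - \<psi> s)"
      using mvt_unordered[OF S(1) ps] d0(1) unfolding S_def[symmetric] by blast
    define z where "z = e0 * e1 * (\<psi> t - \<psi> s)"
    have "e1 * (x t - x s) = e1 * (v1 \<sigma> * (\<psi> t - \<psi> s))" using \<sigma>(2) eq(1) st by simp
    also have "\<dots> = (e0 * e0) * (e1 * (v1 \<sigma> * (\<psi> t - \<psi> s)))" using sq by simp
    also have "\<dots> = (e0 * v1 \<sigma>) * z" unfolding z_def by (simp add: mult_ac)
    finally have xz: "e1 * (x t - x s) = (e0 * v1 \<sigma>) * z" .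
    note xb = Xb[OF st]
    have "0 \<le> m1 * (t - s)" using e1(2) st(3) by simp
    then have "0 \<le> (e0 * v1 \<sigma>) * z" using xb xz by linarith
    moreover have vp: "0 < e0 * v1 \<sigma>" using e0(2) e0(3)[OF \<sigma>(1)] by linarith
    ultimately have z0: "0 \<le> z" by (simp add: zero_le_mult_iff)
    have "(e0 * v1 \<sigma>) * z \<le> M0 * z" "m0 * z \<le> (e0 * v1 \<sigma>) * z"
      using e0(3,4)[OF \<sigma>(1)] z0 by (auto intro: mult_right_mono)
    then have "m1 * (t - s) \<le> M0 * z" "m0 * z \<le> M1 * (t - s)" using xb xz by linarith+
    then show ?thesis unfolding z_def[symmetric] using Mp e0(2) by (simp add: field_simps)
  qed
  define e where "e = e2 * e0 * e1"
  have e: "e = 1 \<or> e = - 1" unfolding e_def using e0(1) e1(1) e2(1) by auto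
  have \<Phi>b: "m2 * (m1 / M0) * (t - s) \<le> e * (\<Phi>1 t - \<Phi>1 s) \<and> e * (\<Phi>1 t - \<Phi>1 s) \<le> M2 * (M1 / m0) * (t - s)"
    if st: "s \<in> J" "t \<in> J" "s \<le> t" for s t
  proof -
    have ps: "\<psi> s \<in> S" "\<psi> t \<in> S" unfolding S_def using st by auto
    obtain \<sigma> where \<sigma>: "\<sigma> \<in> S" "\<Phi>0 (\<psi> t) - \<Phi>0 (\<psi> s) = D \<sigma> * (\<psi> t - \<psi> s)"
      using mvt_unordered[OF S(1) ps d\<Phi>] by blast
    define z where "z = e0 * e1 * (\<psi> t - \<psi> s)"
    have ez: "e * (\<Phi>1 t - \<Phi>1 s) = (e2 * D \<sigma>) * z"
      unfolding \<Phi>1_def \<sigma>(2) e_def z_def by (simp add: mult_ac)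
    note zb = \<psi>b[OF st, folded z_def]
    have z0: "0 \<le> m1 / M0 * (t - s)" using e1(2) Mp st(3) by simp
    have "m2 * (m1 / M0 * (t - s)) \<le> (e2 * D \<sigma>) * z"
      using e2(2) e2(3)[OF \<sigma>(1)] zb z0 by (intro mult_mono) auto
    moreover have "(e2 * D \<sigma>) * z \<le> M2 * (M1 / m0 * (t - s))"
      using e2(4)[OF \<sigma>(1)] zb z0 Mp by (intro mult_mono) auto
    ultimately show ?thesis unfolding ez by (simp add: mult.assoc)
  qed
  define M where "M = 1 + M1 + 1 / m1 + M2 * (M1 / m0) + 1 / (m2 * (m1 / M0)) + \<bar>K\<bar>"
  have "0 < 1 / m1" "0 < M2 * (M1 / m0)" "0 < 1 / (m2 * (m1 / M0))"
    using e1(2) e0(2) e2(2) Mp by simp_all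
  then have M: "1 \<le> M" "M1 \<le> M" "1 / m1 \<le> M" "M2 * (M1 / m0) \<le> M" "1 / (m2 * (m1 / M0)) \<le> M" "K \<le> M"
    unfolding M_def using Mp by linarith+
  have inv: "1 / M \<le> m" if "1 / m \<le> M" "0 < m" for m using that M(1) by (simp add: field_simps)
  have "convex_arc (\<lambda>t. e1 * x t) (\<lambda>t. (e * e1) * y t) (\<lambda>t. e * \<Phi>1 t) M c \<rho>"
  proof
    show "1 \<le> M" "0 < \<rho>" using M \<rho> by auto
    fix s t assume st: "s \<in> cball c \<rho>" "t \<in> cball c \<rho>" "s \<le> t"
    note st' = st[folded J_def]
    have ts: "0 \<le> t - s" using st by simp
    show "(t - s) / M \<le> e1 * x t - e1 * x s \<and> e1 * x t - e1 * x s \<le> M * (t - s)"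
    proof -
      have "(t - s) / M = 1 / M * (t - s)" "e1 * x t - e1 * x s = e1 * (x t - x s)"
        by (simp, simp only: right_diff_distrib)
      then show ?thesis
        using Xb[OF st'] mult_right_mono[OF inv[OF M(3) e1(2)] ts] mult_right_mono[OF M(2) ts] by (metis order_trans)
    qed
    have pos: "0 < m2 * (m1 / M0)" using e2(2) e1(2) Mp by simp
    show "(t - s) / M \<le> e * \<Phi>1 t - e * \<Phi>1 s \<and> e * \<Phi>1 t - e * \<Phi>1 s \<le> M * (t - s)"
    proof -
      have "(t - s) / M = 1 / M * (t - s)" "e * \<Phi>1 t - e * \<Phi>1 s = e * (\<Phi>1 t - \<Phi>1 s)"
        by (simp, simp only: right_diff_distrib)
      then show ?thesis
        using \<Phi>b[OF st'] mult_right_mono[OF inv[OF M(5) pos] ts] mult_right_mono[OF M(4) ts] by (metis order_trans)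
    qed
    obtain \<xi> where \<xi>: "\<xi> \<in> {s..t}" "y t - y s = \<Phi>1 \<xi> * (x t - x s)" using sec[OF st'] by blast
    have "e * e1 * y t - e * e1 * y s = e * e1 * (y t - y s)" by (simp add: right_diff_distrib)
    also have "\<dots> = e * \<Phi>1 \<xi> * (e1 * x t - e1 * x s)" unfolding \<xi>(2) by (simp add: algebra_simps)
    finally show "\<exists>\<xi>\<in>{s..t}. e * e1 * y t - e * e1 * y s = e * \<Phi>1 \<xi> * (e1 * x t - e1 * x s)" using \<xi>(1) by blast
  next
    fix t assume "t \<in> cball c \<rho>"
    then show "\<bar>e * \<Phi>1 t\<bar> \<le> M" using K[of t] M(6) e unfolding J_def by (auto simp: abs_mult)
  qed
  moreover have "e * e1 = 1 \<or> e * e1 = - 1" using e e1(1) by auto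
  ultimately show ?thesis using that[OF e1(1)] by blast
qed

text \<open>If \<open>f s0 = 0\<close>, the difference quotient does not vanish near \<open>s0\<close>.\<close>

lemma eventually_nonzero_at:
  fixes f :: "real \<Rightarrow> real"
  assumes "(f has_real_derivative d) (at s0)" "f s0 \<noteq> 0 \<or> d \<noteq> 0"
  shows "eventually (\<lambda>s. f s \<noteq> 0) (at s0)"
proof (cases "f s0 = 0")
  case False
  have "(f \<longlongrightarrow> f s0) (at s0)" using DERIV_isCont[OF assms(1)] unfolding isCont_def .
  then show ?thesis using False by (rule tendsto_imp_eventually_ne)
next
  case True
  then have "d \<noteq> 0" using assms(2) by simp
  have "((\<lambda>s. (f s - f s0) / (s - s0)) \<longlongrightarrow> d) (at s0)" using assms(1) by (simp add: has_field_derivative_iff)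
  then have "eventually (\<lambda>s. (f s - f s0) / (s - s0) \<noteq> 0) (at s0)" using \<open>d \<noteq> 0\<close> by (rule tendsto_imp_eventually_ne)
  then show ?thesis by eventually_elim (use True in auto)
qed

text \<open>One coordinate of the velocity may vanish at \<open>t0\<close> itself, but not both it and its derivative,
  because the curvature is nonzero; so it has no further zero close to \<open>t0\<close>.\<close>

theorem convex_arcs_near_curved_point:
  assumes C: "regular_C2_curve C" and g: "local_param C I \<gamma>" and t0: "t0 \<in> I" and \<kappa>: "curvature C (\<gamma> t0) \<noteq> 0"
  obtains r where "0 < r" "ball t0 r \<subseteq> I"
    "\<And>c \<rho>. 0 < \<rho> \<Longrightarrow> cball c \<rho> \<subseteq> ball t0 r - {t0} \<Longrightarrow>
      (\<exists>e1 e2 \<Phi> M. (e1 = 1 \<or> e1 = - 1) \<and> (e2 = 1 \<or> e2 = - 1) \<and>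
        convex_arc (\<lambda>t. e1 * fst (\<gamma> t)) (\<lambda>t. e2 * snd (\<gamma> t)) \<Phi> M c \<rho>) \<and>
      (\<exists>e1 e2 \<Phi> M. (e1 = 1 \<or> e1 = - 1) \<and> (e2 = 1 \<or> e2 = - 1) \<and>
        convex_arc (\<lambda>t. e1 * snd (\<gamma> t)) (\<lambda>t. e2 * fst (\<gamma> t)) \<Phi> M c \<rho>)"
proof -
  note D = local_paramD[OF g]
  have "\<gamma> t0 \<in> C" using D(4) t0 by auto
  then obtain I0 \<gamma>0 s0 where g0: "C2_local_param C I0 \<gamma>0" and s0: "s0 \<in> I0" "\<gamma> t0 = \<gamma>0 s0"
    using C unfolding regular_C2_curve_def by blast
  note P = C2_local_paramD[OF g0] and D0 = local_paramD[OF C2_local_paramD(1)[OF g0]]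
  define v where "v = (\<lambda>t. vector_derivative \<gamma>0 (at t))"
  define a where "a = (\<lambda>t. vector_derivative v (at t))"
  define v1 v2 a1 a2 where "v1 s = fst (v s)" "v2 s = snd (v s)" "a1 s = fst (a s)" "a2 s = snd (a s)" for s
  note defs = v1_v2_a1_a2_def
  define w where "w s = v1 s * a2 s - v2 s * a1 s" for s
  have dX: "((\<lambda>s. fst (\<gamma>0 s)) has_real_derivative v1 s) (at s)" "((\<lambda>s. snd (\<gamma>0 s)) has_real_derivative v2 s) (at s)" if "s \<in> I0" for s
    using bounded_linear.has_vector_derivative[OF bounded_linear_fst D0(5)[OF that]]
      bounded_linear.has_vector_derivative[OF bounded_linear_snd D0(5)[OF that]]
    unfolding defs v_def by (simp_all add: has_real_derivative_iff_has_vector_derivative)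
  have dv: "(v1 has_real_derivative a1 s) (at s)" "(v2 has_real_derivative a2 s) (at s)" if "s \<in> I0" for s
    using bounded_linear.has_vector_derivative[OF bounded_linear_fst P(2)[OF that]]
      bounded_linear.has_vector_derivative[OF bounded_linear_snd P(2)[OF that]]
    unfolding defs a_def v_def by (simp_all add: has_real_derivative_iff_has_vector_derivative)
  have ca: "continuous_on I0 a1" "continuous_on I0 a2"
    using P(3) unfolding defs a_def v_def by (auto intro: continuous_on_fst continuous_on_snd)
  have cv: "continuous_on I0 v1" "continuous_on I0 v2"
    using D0(6) unfolding defs v_def by (auto intro: continuous_on_fst continuous_on_snd)
  have w0: "w s0 \<noteq> 0"
    using curvature_nonzero[OF g0 s0(1)] \<kappa> s0(2) unfolding w_def defs a_def v_def cross2_def by simp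
  have cw: "continuous_on I0 w" unfolding w_def by (intro continuous_intros ca cv)
  have "eventually (\<lambda>s. w s \<noteq> 0) (at s0)"
  proof -
    have "isCont w s0" using cw D0(1) s0(1) by (simp add: continuous_on_eq_continuous_at)
    then show ?thesis using w0 unfolding isCont_def by (intro tendsto_imp_eventually_ne)
  qed
  moreover have "eventually (\<lambda>s. v1 s \<noteq> 0) (at s0)"
    by (rule eventually_nonzero_at[OF dv(1)[OF s0(1)]]) (use w0 in \<open>auto simp: w_def\<close>)
  moreover have "eventually (\<lambda>s. v2 s \<noteq> 0) (at s0)"
    by (rule eventually_nonzero_at[OF dv(2)[OF s0(1)]]) (use w0 in \<open>auto simp: w_def\<close>)
  moreover have "eventually (\<lambda>s. s \<in> I0) (at s0)" using D0(1) s0(1) by (simp add: eventually_at_in_open')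
  ultimately have "eventually (\<lambda>s. w s \<noteq> 0 \<and> v1 s \<noteq> 0 \<and> v2 s \<noteq> 0 \<and> s \<in> I0) (at s0)" by eventually_elim auto
  then obtain d where d: "0 < d" "\<And>s. s \<noteq> s0 \<Longrightarrow> dist s s0 < d \<Longrightarrow> w s \<noteq> 0 \<and> v1 s \<noteq> 0 \<and> v2 s \<noteq> 0 \<and> s \<in> I0"
    unfolding eventually_at by auto
  obtain \<psi> r1 where \<psi>: "0 < r1" "ball t0 r1 \<subseteq> I" "continuous_on (ball t0 r1) \<psi>" "\<psi> ` ball t0 r1 \<subseteq> I0" "\<psi> t0 = s0"
    "\<And>s. s \<in> ball t0 r1 \<Longrightarrow> \<gamma>0 (\<psi> s) = \<gamma> s"
    using param_transition[OF g P(1) t0 s0] by metis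
  have "isCont \<psi> t0" using \<psi>(1,3) by (simp add: continuous_on_eq_continuous_at)
  then obtain r2 where r2: "0 < r2" "\<And>t. dist t t0 < r2 \<Longrightarrow> dist (\<psi> t) s0 < d"
    using d(1) \<psi>(5) unfolding continuous_at_eps_delta dist_real_def by auto
  define r where "r = min r1 r2"
  have sub: "ball t0 r \<subseteq> ball t0 r1" unfolding r_def by auto
  define x' y' where "x' t = fst (vector_derivative \<gamma> (at t))" "y' t = snd (vector_derivative \<gamma> (at t))" for t
  have dx: "((\<lambda>t. fst (\<gamma> t)) has_real_derivative x' t) (at t)" "((\<lambda>t. snd (\<gamma> t)) has_real_derivative y' t) (at t)" if "t \<in> I" for t
    using bounded_linear.has_vector_derivative[OF bounded_linear_fst D(5)[OF that]]
      bounded_linear.has_vector_derivative[OF bounded_linear_snd D(5)[OF that]]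
    unfolding x'_y'_def by (simp_all add: has_real_derivative_iff_has_vector_derivative)
  have cx: "continuous_on I x'" "continuous_on I y'"
    using D(6) unfolding x'_y'_def by (auto intro: continuous_on_fst continuous_on_snd)
  have reg: "x' t \<noteq> 0 \<or> y' t \<noteq> 0" if "t \<in> I" for t
    using D(7)[OF that] unfolding x'_y'_def by (metis prod_eqI fst_zero snd_zero)
  show ?thesis
  proof (rule that[of r])
    show "0 < r" unfolding r_def using \<psi>(1) r2(1) by simp
    show "ball t0 r \<subseteq> I" using sub \<psi>(2) by auto
    fix c \<rho> :: real assume \<rho>: "0 < \<rho>" and J: "cball c \<rho> \<subseteq> ball t0 r - {t0}"
    have JI: "cball c \<rho> \<subseteq> I" using J sub \<psi>(2) by auto
    have Jr: "cball c \<rho> \<subseteq> ball t0 r1" using J sub by auto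
    have img: "w s \<noteq> 0 \<and> v1 s \<noteq> 0 \<and> v2 s \<noteq> 0 \<and> s \<in> I0" if "s \<in> \<psi> ` cball c \<rho>" for s
    proof -
      obtain t where t: "t \<in> cball c \<rho>" "s = \<psi> t" using \<open>s \<in> \<psi> ` cball c \<rho>\<close> by auto
      have tb: "t \<in> ball t0 r" "t \<noteq> t0" using J t by auto
      have "s \<noteq> s0"
      proof
        assume "s = s0"
        then have "\<gamma> t = \<gamma> t0" using \<psi>(6)[of t] tb(1) sub s0(2) t(2) by auto
        moreover have "t \<in> I" using JI t by auto
        ultimately show False using D(3) t0 tb(2) unfolding inj_on_def by blast
      qed
      moreover have "dist s s0 < d" unfolding t(2) using tb(1) r2(2) unfolding r_def by (auto simp: dist_commute)
      ultimately show ?thesis using d(2) by blast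
    qed
    have c\<psi>: "continuous_on (cball c \<rho>) \<psi>" using \<psi>(3) Jr by (rule continuous_on_subset)
    have sI: "\<psi> ` cball c \<rho> \<subseteq> I0" using img by blast
    have eqs: "fst (\<gamma> t) = fst (\<gamma>0 (\<psi> t))" "snd (\<gamma> t) = snd (\<gamma>0 (\<psi> t))" if "t \<in> cball c \<rho>" for t
      using \<psi>(6)[of t] Jr that by auto
    have "\<exists>e1 e2 \<Phi> M. (e1 = 1 \<or> e1 = - 1) \<and> (e2 = 1 \<or> e2 = - 1) \<and>
        convex_arc (\<lambda>t. e1 * fst (\<gamma> t)) (\<lambda>t. e2 * snd (\<gamma> t)) \<Phi> M c \<rho>"
    proof (rule convex_arc_of_charts[OF \<rho>, where x="\<lambda>t. fst (\<gamma> t)" and y="\<lambda>t. snd (\<gamma> t)" and x'=x' and y'=y'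
          and ?X0.0="\<lambda>s. fst (\<gamma>0 s)" and ?Y0.0="\<lambda>s. snd (\<gamma>0 s)" and ?v1.0=v1 and ?v2.0=v2 and ?a1.0=a1 and ?a2.0=a2 and \<psi>=\<psi>])
      show "continuous_on (cball c \<rho>) x'" using cx(1) JI by (rule continuous_on_subset)
      show "continuous_on (cball c \<rho>) \<psi>" by (rule c\<psi>)
      show "continuous_on (\<psi> ` cball c \<rho>) a1" "continuous_on (\<psi> ` cball c \<rho>) a2"
        using ca sI by (auto intro: continuous_on_subset)
      show "v1 s \<noteq> 0" "v1 s * a2 s - v2 s * a1 s \<noteq> 0" if "s \<in> \<psi> ` cball c \<rho>" for s
        using img[OF that] unfolding w_def by auto
    qed (use dx reg JI eqs dX dv sI in \<open>blast+\<close>)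
    moreover have "\<exists>e1 e2 \<Phi> M. (e1 = 1 \<or> e1 = - 1) \<and> (e2 = 1 \<or> e2 = - 1) \<and>
        convex_arc (\<lambda>t. e1 * snd (\<gamma> t)) (\<lambda>t. e2 * fst (\<gamma> t)) \<Phi> M c \<rho>"
    proof (rule convex_arc_of_charts[OF \<rho>, where x="\<lambda>t. snd (\<gamma> t)" and y="\<lambda>t. fst (\<gamma> t)" and x'=y' and y'=x'
          and ?X0.0="\<lambda>s. snd (\<gamma>0 s)" and ?Y0.0="\<lambda>s. fst (\<gamma>0 s)" and ?v1.0=v2 and ?v2.0=v1 and ?a1.0=a2 and ?a2.0=a1 and \<psi>=\<psi>])
      show "continuous_on (cball c \<rho>) y'" using cx(2) JI by (rule continuous_on_subset)
      show "continuous_on (cball c \<rho>) \<psi>" by (rule c\<psi>)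
      show "continuous_on (\<psi> ` cball c \<rho>) a1" "continuous_on (\<psi> ` cball c \<rho>) a2"
        using ca sI by (auto intro: continuous_on_subset)
      show "v2 s \<noteq> 0" "v2 s * a1 s - v1 s * a2 s \<noteq> 0" if "s \<in> \<psi> ` cball c \<rho>" for s
        using img[OF that] unfolding w_def by auto
    qed (use dx reg JI eqs dX dv sI in \<open>blast+\<close>)
    ultimately show "(\<exists>e1 e2 \<Phi> M. (e1 = 1 \<or> e1 = - 1) \<and> (e2 = 1 \<or> e2 = - 1) \<and>
        convex_arc (\<lambda>t. e1 * fst (\<gamma> t)) (\<lambda>t. e2 * snd (\<gamma> t)) \<Phi> M c \<rho>) \<and>
      (\<exists>e1 e2 \<Phi> M. (e1 = 1 \<or> e1 = - 1) \<and> (e2 = 1 \<or> e2 = - 1) \<and>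
        convex_arc (\<lambda>t. e1 * snd (\<gamma> t)) (\<lambda>t. e2 * fst (\<gamma> t)) \<Phi> M c \<rho>)" ..
  qed
qed

section \<open>Hausdorff dimension of winning sets on a curve\<close>

lemma hausdorff_measure_eq_0I:
  assumes "\<And>\<delta> \<epsilon>. 0 < \<delta> \<Longrightarrow> 0 < \<epsilon> \<Longrightarrow> \<exists>U :: nat \<Rightarrow> 'a::metric_space set. A \<subseteq> (\<Union>i. U i) \<and>
    (\<forall>i. bounded (U i) \<and> diameter (U i) \<le> \<delta>) \<and> (\<Sum>i. ennreal (diameter (U i) powr s)) \<le> ennreal \<epsilon>"
  shows "hausdorff_measure s A = 0"
proof -
  have "hausdorff_premeasure s \<delta> A \<le> 0" if "0 < \<delta>" for \<delta>
  proof (rule ennreal_le_epsilon)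
    fix \<epsilon> :: real assume "0 < \<epsilon>"
    then obtain U :: "nat \<Rightarrow> 'a set" where "A \<subseteq> (\<Union>i. U i)" "\<forall>i. bounded (U i) \<and> diameter (U i) \<le> \<delta>"
      "(\<Sum>i. ennreal (diameter (U i) powr s)) \<le> ennreal \<epsilon>" using assms[OF \<open>0 < \<delta>\<close>] by blast
    then have "hausdorff_premeasure s \<delta> A \<le> ennreal \<epsilon>"
      unfolding hausdorff_premeasure_def by (intro INF_lower2[of U] CollectI conjI)
    then show "hausdorff_premeasure s \<delta> A \<le> 0 + ennreal \<epsilon>" by simp
  qed
  then have "hausdorff_measure s A \<le> 0" unfolding hausdorff_measure_def by (intro SUP_least) auto
  then show ?thesis by simp
qed

lemma hausdorff_measure_eq_0D:
  fixes A :: "'a::metric_space set"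
  assumes "hausdorff_measure s A = 0" "0 < \<delta>" "0 < \<epsilon>"
  obtains U :: "nat \<Rightarrow> 'a set" where "A \<subseteq> (\<Union>i. U i)" "\<And>i. bounded (U i)" "\<And>i. diameter (U i) \<le> \<delta>"
    "(\<Sum>i. ennreal (diameter (U i) powr s)) < ennreal \<epsilon>"
proof -
  have "hausdorff_premeasure s \<delta> A \<le> hausdorff_measure s A"
    unfolding hausdorff_measure_def using assms(2) by (intro SUP_upper) auto
  also have "\<dots> < ennreal \<epsilon>" using assms by simp
  finally show ?thesis
    using that unfolding hausdorff_premeasure_def INF_less_iff by blast
qed

lemma hausdorff_measure_Union:
  fixes A :: "nat \<Rightarrow> 'a::metric_space set"
  assumes "\<And>n. hausdorff_measure s (A n) = 0"
  shows "hausdorff_measure s (\<Union>n. A n) = 0"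
proof (rule hausdorff_measure_eq_0I)
  fix \<delta> \<epsilon> :: real assume "0 < \<delta>" "0 < \<epsilon>"
  have "\<exists>U :: nat \<Rightarrow> 'a set. A n \<subseteq> (\<Union>i. U i) \<and> (\<forall>i. bounded (U i) \<and> diameter (U i) \<le> \<delta>) \<and>
      (\<Sum>i. ennreal (diameter (U i) powr s)) \<le> ennreal (\<epsilon> * (1 / 2) ^ Suc n)" for n
  proof -
    have "0 < \<epsilon> * (1 / 2) ^ Suc n" using \<open>0 < \<epsilon>\<close> by simp
    from hausdorff_measure_eq_0D[OF assms \<open>0 < \<delta>\<close> this, of n]
    show ?thesis by (metis less_imp_le)
  qed
  then obtain U :: "nat \<Rightarrow> nat \<Rightarrow> 'a set" where U: "\<And>n. A n \<subseteq> (\<Union>i. U n i)"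
    "\<And>n i. bounded (U n i)" "\<And>n i. diameter (U n i) \<le> \<delta>"
    "\<And>n. (\<Sum>i. ennreal (diameter (U n i) powr s)) \<le> ennreal (\<epsilon> * (1 / 2) ^ Suc n)"
    by metis
  define V where "V k = (case prod_decode k of (n, i) \<Rightarrow> U n i)" for k
  have "(\<Union>n. A n) \<subseteq> (\<Union>k. V k)"
  proof
    fix x assume "x \<in> (\<Union>n. A n)"
    then obtain n i where "x \<in> U n i" using U(1) by blast
    then have "x \<in> V (prod_encode (n, i))" unfolding V_def by simp
    then show "x \<in> (\<Union>k. V k)" by blast
  qed
  moreover have "bounded (V k) \<and> diameter (V k) \<le> \<delta>" for k
    unfolding V_def using U(2,3) by (simp split: prod.split)
  moreover have "(\<Sum>k. ennreal (diameter (V k) powr s)) \<le> ennreal \<epsilon>"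
  proof -
    have "(\<Sum>k. ennreal (diameter (V k) powr s))
      = (\<Sum>k. (\<lambda>(n, i). ennreal (diameter (U n i) powr s)) (prod_decode k))"
      unfolding V_def by (intro suminf_cong) (simp split: prod.split)
    also have "\<dots> = (\<Sum>n. \<Sum>i. ennreal (diameter (U n i) powr s))"
      by (rule suminf_ennreal_2dimen) simp
    also have "\<dots> \<le> (\<Sum>n. ennreal (\<epsilon> * (1 / 2) ^ Suc n))" by (intro suminf_le U(4)) auto
    also have "\<dots> = ennreal \<epsilon>"
    proof (rule suminf_ennreal_eq)
      show "(\<lambda>n. \<epsilon> * (1 / 2) ^ Suc n) sums \<epsilon>"
        using sums_mult[OF power_half_series, of \<epsilon>] by simp
    qed (use \<open>0 < \<epsilon>\<close> in auto)
    finally show ?thesis .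
  qed
  ultimately show "\<exists>U :: nat \<Rightarrow> 'a set. (\<Union>n. A n) \<subseteq> (\<Union>i. U i) \<and>
    (\<forall>i. bounded (U i) \<and> diameter (U i) \<le> \<delta>) \<and> (\<Sum>i. ennreal (diameter (U i) powr s)) \<le> ennreal \<epsilon>"
    by blast
qed

lemma hausdorff_measure_subset_0:
  fixes A B :: "'a::metric_space set"
  assumes "hausdorff_measure s B = 0" "A \<subseteq> B"
  shows "hausdorff_measure s A = 0"
proof (rule hausdorff_measure_eq_0I)
  fix \<delta> \<epsilon> :: real assume "0 < \<delta>" "0 < \<epsilon>"
  then obtain U :: "nat \<Rightarrow> 'a set" where U: "B \<subseteq> (\<Union>i. U i)" "\<And>i. bounded (U i)" "\<And>i. diameter (U i) \<le> \<delta>"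
    "(\<Sum>i. ennreal (diameter (U i) powr s)) < ennreal \<epsilon>" using hausdorff_measure_eq_0D[OF assms(1)] by metis
  show "\<exists>U :: nat \<Rightarrow> 'a set. A \<subseteq> (\<Union>i. U i) \<and>
    (\<forall>i. bounded (U i) \<and> diameter (U i) \<le> \<delta>) \<and> (\<Sum>i. ennreal (diameter (U i) powr s)) \<le> ennreal \<epsilon>"
    by (intro exI[of _ U] conjI allI U(2,3) order_trans[OF assms(2) U(1)] less_imp_le[OF U(4)])
qed

text \<open>Cut the interval into \<open>n\<close> equal parts: the cost \<open>n * (K / n) powr s\<close> tends to zero.\<close>

lemma hausdorff_measure_lipschitz_arc:
  fixes f :: "real \<Rightarrow> 'a::real_normed_vector"
  assumes lip: "\<And>x y. x \<in> {a..b} \<Longrightarrow> y \<in> {a..b} \<Longrightarrow> norm (f x - f y) \<le> L * \<bar>x - y\<bar>" and s: "1 < s"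
  shows "hausdorff_measure s (f ` {a..b}) = 0"
proof (rule hausdorff_measure_eq_0I)
  fix \<delta> \<epsilon> :: real assume \<delta>: "0 < \<delta>" and \<epsilon>: "0 < \<epsilon>"
  define K where "K = max 1 \<bar>L * (b - a)\<bar>"
  have K: "1 \<le> K" "L * (b - a) \<le> K" unfolding K_def by auto
  have "((\<lambda>n. real n powr (1 - s)) \<longlonglongrightarrow> 0)"
    by (rule tendsto_neg_powr[OF _ filterlim_real_sequentially]) (use s in simp)
  then have "((\<lambda>n. K powr s * real n powr (1 - s)) \<longlonglongrightarrow> K powr s * 0)" by (intro tendsto_intros)
  then have "eventually (\<lambda>n. K powr s * real n powr (1 - s) < \<epsilon>) sequentially" using \<epsilon> by (simp add: order_tendstoD(2))
  moreover have "eventually (\<lambda>n. K / \<delta> < real n) sequentially"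
    using filterlim_real_sequentially unfolding filterlim_at_top_dense by blast
  ultimately have "eventually (\<lambda>n. K powr s * real n powr (1 - s) < \<epsilon> \<and> K / \<delta> < real n) sequentially"
    by (rule eventually_conj)
  then obtain n :: nat where n: "K powr s * real n powr (1 - s) < \<epsilon>" "K / \<delta> < real n"
    by (auto simp: eventually_sequentially)
  have n0: "0 < real n" using n(2) \<delta> K by (smt (verit) divide_pos_pos)
  have Kn: "K / real n \<le> \<delta>" using n(2) n0 \<delta> by (simp add: field_simps)
  define h where "h = (b - a) / real n"
  define U where "U i = (if i < n then f ` ({a..b} \<inter> {a + real i * h..a + real (Suc i) * h}) else {})" for i
  have U: "norm (x - y) \<le> K / real n" if xy: "x \<in> U i" "y \<in> U i" for x y i
  proof -
    have i: "i < n" using xy unfolding U_def by (auto split: if_splits)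
    obtain u v where u: "u \<in> {a..b}" "u \<in> {a + real i * h..a + real (Suc i) * h}" "x = f u"
      and v: "v \<in> {a..b}" "v \<in> {a + real i * h..a + real (Suc i) * h}" "y = f v"
      using xy[unfolded U_def if_P[OF i]] by blast
    have uv: "\<bar>u - v\<bar> \<le> h" using u(2) v(2) by (auto simp: algebra_simps abs_le_iff)
    have L0: "0 \<le> L \<or> u = v"
    proof (rule ccontr)
      assume "\<not> ?thesis"
      then have "L * \<bar>u - v\<bar> < 0" by (simp add: mult_neg_pos)
      then show False using lip[OF u(1) v(1)] norm_ge_zero[of "f u - f v"] by linarith
    qed
    have "norm (x - y) \<le> L * \<bar>u - v\<bar>" unfolding u(3) v(3) by (rule lip[OF u(1) v(1)])
    also have "\<dots> \<le> max 0 (L * h)" using L0 uv by (auto intro: mult_left_mono le_max_iff_disj[THEN iffD2])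
    also have "\<dots> \<le> K / real n"
    proof -
      have "L * h \<le> K / real n" unfolding h_def using K(2) n0 by (simp add: divide_right_mono)
      then show ?thesis using K n0 by simp
    qed
    finally show ?thesis .
  qed
  have Kn0: "0 \<le> K / real n" using K n0 by simp
  have bU: "bounded (U i)" for i
  proof (cases "U i = {}")
    case False
    then obtain x where "x \<in> U i" by blast
    then show ?thesis using U[of x i] by (intro boundedI[of _ "norm x + K / real n"]) (smt (verit) norm_triangle_sub norm_minus_commute)
  qed simp
  have dU: "diameter (U i) \<le> K / real n" for i
    by (rule diameter_le) (use U Kn0 in auto)
  have "f ` {a..b} \<subseteq> (\<Union>i. U i)"
  proof
    fix y assume "y \<in> f ` {a..b}"
    then obtain t where t: "t \<in> {a..b}" "y = f t" by auto
    show "y \<in> (\<Union>i. U i)"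
    proof (cases "h = 0")
      case True
      then have "t = a" using t n0 unfolding h_def by auto
      then have "y \<in> U 0" unfolding U_def using t n0 True by auto
      then show ?thesis by blast
    next
      case False
      then have h0: "0 < h" using t n0 unfolding h_def by (auto simp: zero_less_divide_iff)
      define i where "i = (if t = b then n - 1 else nat \<lfloor>(t - a) / h\<rfloor>)"
      have nh: "real n * h = b - a" unfolding h_def using n0 by simp
      have "i < n \<and> a + real i * h \<le> t \<and> t \<le> a + real (Suc i) * h"
      proof (cases "t = b")
        case True
        then have "real (Suc i) = real n" unfolding i_def using n0 by simp
        then show ?thesis using True nh h0 n0 unfolding i_def by (auto simp: algebra_simps of_nat_diff)
      next
        case False
        then have ii: "real i = of_int \<lfloor>(t - a) / h\<rfloor>" unfolding i_def using t h0 by simp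
        have fl: "of_int \<lfloor>(t - a) / h\<rfloor> \<le> (t - a) / h" "(t - a) / h < of_int \<lfloor>(t - a) / h\<rfloor> + 1" by linarith+
        have lo: "real i * h \<le> t - a" "t - a < (real i + 1) * h" unfolding ii using fl h0 by (simp_all only: pos_le_divide_eq pos_divide_less_eq)
        have "t - a < real n * h" using nh t False by auto
        then have "real i * h < real n * h" using lo by linarith
        then have "i < n" using h0 by simp
        then show ?thesis using lo by (auto simp: algebra_simps)
      qed
      then have "y \<in> U i" unfolding U_def using t by auto
      then show ?thesis by blast
    qed
  qed
  moreover have "bounded (U i) \<and> diameter (U i) \<le> \<delta>" for i using bU dU[of i] Kn by auto
  moreover have "(\<Sum>i. ennreal (diameter (U i) powr s)) \<le> ennreal \<epsilon>"
  proof -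
    have "(\<Sum>i. ennreal (diameter (U i) powr s)) = (\<Sum>i\<in>{..<n}. ennreal (diameter (U i) powr s))"
      by (rule suminf_finite) (auto simp: U_def)
    also have "\<dots> \<le> (\<Sum>i\<in>{..<n}. ennreal ((K / real n) powr s))"
      using dU diameter_ge_0[OF bU] s by (intro sum_mono ennreal_leI powr_mono2) auto
    also have "\<dots> = ennreal (real n * (K / real n) powr s)"
      by (simp add: ennreal_mult' ennreal_of_nat_eq_real_of_nat)
    also have "real n * (K / real n) powr s = K powr s * real n powr (1 - s)"
      using K n0 by (simp add: powr_divide powr_diff)
    also have "ennreal \<dots> \<le> ennreal \<epsilon>" using n(1) by (intro ennreal_leI) simp
    finally show ?thesis .
  qed
  ultimately show "\<exists>U :: nat \<Rightarrow> 'a set. f ` {a..b} \<subseteq> (\<Union>i. U i) \<and>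
    (\<forall>i. bounded (U i) \<and> diameter (U i) \<le> \<delta>) \<and> (\<Sum>i. ennreal (diameter (U i) powr s)) \<le> ennreal \<epsilon>"
    by blast
qed

text \<open>By Lindelof's theorem countably many Lipschitz arcs cover the curve.\<close>

lemma hausdorff_measure_curve:
  assumes C: "regular_C2_curve C" and s: "1 < s"
  shows "hausdorff_measure s C = 0"
proof -
  define \<F> where "\<F> = {V. openin (top_of_set C) V \<and> hausdorff_measure s V = 0}"
  have "\<Union>\<F> = C"
  proof
    show "\<Union>\<F> \<subseteq> C" unfolding \<F>_def by (auto dest: openin_imp_subset)
    show "C \<subseteq> \<Union>\<F>"
    proof
      fix z assume "z \<in> C"
      then obtain I \<gamma> t where g: "local_param C I \<gamma>" and t: "t \<in> I" "z = \<gamma> t"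
        using C unfolding regular_C2_curve_def C2_local_param_def by blast
      note D = local_paramD[OF g]
      obtain r where r: "0 < r" "cball t r \<subseteq> I" using D(1) t open_contains_cball by blast
      have "compact ((\<lambda>t. vector_derivative \<gamma> (at t)) ` cball t r)"
        using continuous_on_subset[OF D(6) r(2)] by (intro compact_continuous_image) auto
      from compact_imp_bounded[OF this]
      obtain L where L: "\<And>x. x \<in> cball t r \<Longrightarrow> norm (vector_derivative \<gamma> (at x)) \<le> L"
        unfolding bounded_iff by blast
      have "norm (\<gamma> x - \<gamma> y) \<le> L * \<bar>x - y\<bar>" if "x \<in> {t - r..t + r}" "y \<in> {t - r..t + r}" for x y
      proof -
        have "norm (\<gamma> x - \<gamma> y) \<le> L * norm (x - y)"
        proof (rule differentiable_bound[of "cball t r" \<gamma> "\<lambda>x h. h *\<^sub>R vector_derivative \<gamma> (at x)" L])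
          show "(\<gamma> has_derivative (\<lambda>h. h *\<^sub>R vector_derivative \<gamma> (at u))) (at u within cball t r)"
            if "u \<in> cball t r" for u
            using D(5)[of u] that r(2) unfolding has_vector_derivative_def by (blast intro: has_derivative_at_withinI)
          show "onorm (\<lambda>h. h *\<^sub>R vector_derivative \<gamma> (at u)) \<le> L" if "u \<in> cball t r" for u
            using L[OF that] by (intro onorm_le) (simp add: mult.commute[of L] mult_left_mono)
          show "x \<in> cball t r" "y \<in> cball t r" using that by (auto simp: dist_real_def)
        qed simp
        then show ?thesis by simp
      qed
      then have H: "hausdorff_measure s (\<gamma> ` {t - r..t + r}) = 0"
        using s by (rule hausdorff_measure_lipschitz_arc)
      obtain \<phi> where hom: "homeomorphism I (\<gamma> ` I) \<gamma> \<phi>" using g unfolding local_param_def by auto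
      have "openin (top_of_set I) (ball t r)"
        using r D(1) by (meson ball_subset_cball open_ball open_openin_trans openin_open_eq order_trans)
      then have "openin (top_of_set (\<gamma> ` I)) (\<gamma> ` ball t r)" using homeomorphism_imp_open_map[OF hom] by blast
      moreover have "openin (top_of_set C) (\<gamma> ` I)" using g unfolding local_param_def by auto
      ultimately have "openin (top_of_set C) (\<gamma> ` ball t r)" by (rule openin_trans)
      moreover have "hausdorff_measure s (\<gamma> ` ball t r) = 0"
        by (rule hausdorff_measure_subset_0[OF H]) (auto simp: dist_real_def abs_less_iff)
      ultimately show "z \<in> \<Union>\<F>" unfolding \<F>_def using t r by auto
    qed
  qed
  moreover obtain \<F>' where "\<F>' \<subseteq> \<F>" "countable \<F>'" "\<Union>\<F>' = \<Union>\<F>"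
    using Lindelof_openin[of \<F> C] unfolding \<F>_def by blast
  ultimately have F': "\<F>' \<subseteq> \<F>" "countable \<F>'" "\<Union>\<F>' = C" by auto
  show ?thesis
  proof (cases "\<F>' = {}")
    case True
    \<comment> \<open>An empty interval, to see that the empty curve has measure zero.\<close>
    have "hausdorff_measure s (\<gamma> ` {1..0::real}) = 0" for \<gamma> :: "real \<Rightarrow> real \<times> real"
      using s by (intro hausdorff_measure_lipschitz_arc) auto
    then show ?thesis using True F' by simp
  next
    case False
    then have "C = (\<Union>n. from_nat_into \<F>' n)" using F' by (metis Sup.SUP_cong range_from_nat_into)
    moreover have "hausdorff_measure s (from_nat_into \<F>' n) = 0" for n
      using from_nat_into[OF False, of n] F'(1) unfolding \<F>_def by auto
    ultimately show ?thesis using hausdorff_measure_Union[of s "from_nat_into \<F>'"] by simp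
  qed
qed

text \<open>Every covering of \<open>A\<close> pulls back to a covering of the unit interval by intervals of length at
  most a constant times \<open>diameter (U i) powr s\<close>, and their total length is at least one.\<close>

lemma hausdorff_measure_pos:
  fixes y :: "real \<Rightarrow> 'a::metric_space"
  assumes A: "y ` {0..<1} \<subseteq> A" and K: "0 < K"
    and holder: "\<And>t t'. t \<in> {0..<1} \<Longrightarrow> t' \<in> {0..<1} \<Longrightarrow> \<bar>t - t'\<bar> \<le> K * dist (y t) (y t') powr s"
    and s: "0 < s"
  shows "hausdorff_measure s A \<noteq> 0"
proof
  assume 0: "hausdorff_measure s A = 0"
  have "0 < 1 / (2 * K)" using K by simp
  from hausdorff_measure_eq_0D[OF 0 zero_less_one this]
  obtain U :: "nat \<Rightarrow> 'a set" where U: "A \<subseteq> (\<Union>i. U i)" "\<And>i. bounded (U i)"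
    "(\<Sum>i. ennreal (diameter (U i) powr s)) < ennreal (1 / (2 * K))" by metis
  define T where "T i = {t \<in> {0..<1}. y t \<in> U i}" for i
  define c where "c i = (SOME t. t \<in> T i)" for i
  define l where "l i = K * diameter (U i) powr s" for i
  have l0: "0 \<le> l i" for i unfolding l_def using K by simp
  have T: "T i \<subseteq> cball (c i) (l i)" for i
  proof
    fix t assume t: "t \<in> T i"
    then have c: "c i \<in> T i" unfolding c_def by (rule someI)
    have "dist (y (c i)) (y t) \<le> diameter (U i)"
      using t c U(2) unfolding T_def by (intro diameter_bounded_bound) auto
    then have "K * dist (y (c i)) (y t) powr s \<le> l i"
      unfolding l_def using K s by (intro mult_left_mono powr_mono2) auto
    moreover have "\<bar>c i - t\<bar> \<le> K * dist (y (c i)) (y t) powr s"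
      using t c unfolding T_def by (intro holder) auto
    ultimately show "t \<in> cball (c i) (l i)" by (simp add: dist_real_def)
  qed
  have "{0..<1} \<subseteq> (\<Union>i. cball (c i) (l i))"
  proof
    fix t :: real assume t: "t \<in> {0..<1}"
    then obtain i where "y t \<in> U i" using A U(1) by blast
    then show "t \<in> (\<Union>i. cball (c i) (l i))" using T[of i] t unfolding T_def by blast
  qed
  then have "emeasure lborel {0..<1::real} \<le> emeasure lborel (\<Union>i. cball (c i) (l i))"
    by (rule emeasure_mono) simp
  also have "\<dots> \<le> (\<Sum>i. emeasure lborel (cball (c i) (l i)))"
    by (rule emeasure_subadditive_countably) auto
  also have "\<dots> = (\<Sum>i. ennreal (2 * K) * ennreal (diameter (U i) powr s))"
  proof (rule suminf_cong)
    fix i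
    have "emeasure lborel (cball (c i) (l i)) = ennreal (2 * l i)"
      using l0[of i] by (simp add: cball_eq_atLeastAtMost)
    then show "emeasure lborel (cball (c i) (l i)) = ennreal (2 * K) * ennreal (diameter (U i) powr s)"
      unfolding l_def using K by (simp add: ennreal_mult[symmetric] mult.assoc)
  qed
  also have "\<dots> = ennreal (2 * K) * (\<Sum>i. ennreal (diameter (U i) powr s))" by simp
  also have "\<dots> < ennreal (2 * K) * ennreal (1 / (2 * K))"
    by (rule ennreal_mult_strict_left_mono[OF U(3)]) (use K in auto)
  also have "\<dots> = 1" using K by (simp add: ennreal_mult[symmetric] flip: ennreal_1)
  finally show False by simp
qed

text \<open>With \<open>\<beta> = 2 / (5 * (N + 1))\<close> this reads \<open>1 / N \<le> \<beta> powr s\<close>: the \<open>N\<close> children of a ball, of relative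
  size \<open>\<beta>\<close>, have a total \<open>s\<close>-dimensional content at least that of the ball.\<close>

lemma exists_branching_number:
  assumes "0 < s" "s < (1::real)"
  obtains N :: nat where "1 \<le> N" "(5 * (real N + 1) / 2) powr s \<le> real N"
proof -
  define N where "N = nat \<lceil>5 powr (s / (1 - s))\<rceil>"
  have N: "5 powr (s / (1 - s)) \<le> real N" unfolding N_def by linarith
  have "1 \<le> 5 powr (s / (1 - s))" using assms by (intro ge_one_powr_ge_zero) auto
  then have N1: "1 \<le> real N" using N by simp
  have "5 powr s = (5 powr (s / (1 - s))) powr (1 - s)" using assms by (simp add: powr_powr)
  also have "\<dots> \<le> real N powr (1 - s)" using N assms by (intro powr_mono2) auto
  finally have 5: "5 powr s \<le> real N powr (1 - s)" .
  have "(5 * (real N + 1) / 2) powr s \<le> (5 * real N) powr s" using N1 assms by (intro powr_mono2) auto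
  also have "\<dots> = 5 powr s * real N powr s" by (simp add: powr_mult)
  also have "\<dots> \<le> real N powr (1 - s) * real N powr s" using 5 by (intro mult_right_mono) auto
  also have "\<dots> = real N" using N1 by (simp flip: powr_add)
  finally show ?thesis using that N1 by simp
qed

text \<open>Bob keeps \<open>N + 1\<close> candidate balls of radius \<open>\<beta> * \<rho>\<close> in store, with centres \<open>5 * \<beta> * \<rho>\<close> apart. Two of
  them are separated by \<open>3 * \<beta> * \<rho>\<close>, more than the length of the interval that Alice removes, so
  she destroys at most one and Bob has \<open>N\<close> free choices. Let him choose according to the digits of
  \<open>t\<close> in base \<open>N\<close>. If the first different digit of \<open>t\<close> and \<open>t'\<close> has index \<open>m\<close>, then
  \<open>\<bar>t - t'\<bar> \<le> 1 / N ^ m\<close>, while the outcomes are at least \<open>3 * \<beta> ^ Suc m * r\<close> apart.\<close>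

lemma exists_holder_family:
  assumes haw: "HAW_on I S" and I: "cball c r \<subseteq> I" "0 < r" and s: "0 < s" "s < 1"
  obtains x :: "real \<Rightarrow> real" and K :: real
  where "0 < K" "x ` {0..<1} \<subseteq> S \<inter> cball c r"
    "\<And>t t'. t \<in> {0..<1} \<Longrightarrow> t' \<in> {0..<1} \<Longrightarrow> \<bar>t - t'\<bar> \<le> K * \<bar>x t - x t'\<bar> powr s"
proof -
  obtain N :: nat where N: "1 \<le> N" "(5 * (real N + 1) / 2) powr s \<le> real N"
    using exists_branching_number[OF s] by blast
  define \<beta> where "\<beta> = 2 / (5 * (real N + 1))"
  have \<beta>: "0 < \<beta>" "\<beta> < 1 / 3" unfolding \<beta>_def using N(1) by (auto simp: field_simps)
  have \<beta>N: "\<beta> * (5 * real N + 2) \<le> 2" "\<beta> * (5 * (real N + 1)) = 2" unfolding \<beta>_def by (auto simp: field_simps)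
  obtain \<sigma> where \<sigma>: "legal_strategy \<beta> \<sigma>" "winning_strategy I S \<beta> \<sigma>"
    using haw \<beta> unfolding HAW_on_def by blast
  define cand where "cand b j = fst b + (real j - real N / 2) * (5 * \<beta> * snd b)" for b :: "real \<times> real" and j :: nat
  define free where "free b T j \<longleftrightarrow> cball (cand b j) (\<beta> * snd b) \<inter> T = {}" for b T j
  define bad where "bad b T = (if \<exists>j\<le>N. \<not> free b T j then SOME j. j \<le> N \<and> \<not> free b T j else N)" for b T
  \<comment> \<open>The \<open>d\<close>-th candidate after leaving out the bad one. If no candidate is hit, the last one is left out.\<close>
  define ix where "ix b T d = (if d < bad b T then d else Suc d)" for b :: "real \<times> real" and T d
  define child where "child h d = (cand (last h) (ix (last h) (hyperplane_nbhd (fst (\<sigma> h)) (snd (\<sigma> h))) d), \<beta> * snd (last h))"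
    for h and d :: nat
  define H where "H d n = rec_nat [(c, r)] (\<lambda>n h. h @ [child h (d n)]) n" for d :: "nat \<Rightarrow> nat" and n
  have H0: "H d 0 = [(c, r)]" and HS: "H d (Suc n) = H d n @ [child (H d n) (d n)]" for d n
    unfolding H_def by simp_all
  define B where "B d n = last (H d n)" for d n
  have BS: "B d (Suc n) = child (H d n) (d n)" for d n unfolding B_def HS by simp
  have B0: "B d 0 = (c, r)" for d unfolding B_def H0 by simp
  have Hmap: "map (B d) [0..<Suc n] = H d n" for d n
  proof (induction n)
    case 0
    show ?case by (simp add: B0 H0)
  next
    case (Suc n)
    have "map (B d) [0..<Suc (Suc n)] = map (B d) [0..<Suc n] @ [B d (Suc n)]" by simp
    then show ?case unfolding Suc by (simp add: BS HS)
  qed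
  have rad: "snd (B d n) = \<beta> ^ n * r" for d n
  proof (induction n)
    case (Suc n)
    have "snd (B d (Suc n)) = \<beta> * snd (B d n)" unfolding BS child_def by (simp add: B_def)
    then show ?case unfolding Suc by simp
  qed (simp add: B0)
  have radpos: "0 < snd (B d n)" for d n unfolding rad using \<beta> I by simp
  have separated: "3 * \<beta> * snd b \<le> \<bar>u - v\<bar>"
    if "u \<in> cball (cand b j) (\<beta> * snd b)" "v \<in> cball (cand b k) (\<beta> * snd b)" "j \<noteq> k" "0 < snd b" for b j k u v
  proof -
    have "1 \<le> \<bar>real j - real k\<bar>" using that(3) by linarith
    then have "1 * (5 * \<beta> * snd b) \<le> \<bar>real j - real k\<bar> * (5 * \<beta> * snd b)"
      using that(4) \<beta> by (intro mult_right_mono) auto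
    also have "\<dots> = \<bar>cand b j - cand b k\<bar>"
    proof -
      have "cand b j - cand b k = (real j - real k) * (5 * \<beta> * snd b)" unfolding cand_def by (simp add: algebra_simps)
      moreover have "\<bar>5 * \<beta> * snd b\<bar> = 5 * \<beta> * snd b" using that(4) \<beta> by simp
      ultimately show ?thesis by (metis abs_mult)
    qed
    finally show ?thesis using that(1,2) by (auto simp: dist_real_def)
  qed
  have inside: "cball (cand b j) (\<beta> * snd b) \<subseteq> cball (fst b) (snd b)" if "j \<le> N" "0 < snd b" for b j
  proof -
    have "\<bar>real j - real N / 2\<bar> \<le> real N / 2" using that(1) unfolding abs_le_iff by simp
    then have "\<bar>real j - real N / 2\<bar> * (5 * \<beta> * snd b) \<le> real N / 2 * (5 * \<beta> * snd b)"
      using \<beta> that by (intro mult_right_mono) auto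
    moreover have "\<bar>cand b j - fst b\<bar> = \<bar>real j - real N / 2\<bar> * (5 * \<beta> * snd b)"
      unfolding cand_def using \<beta> that by (simp add: abs_mult)
    moreover have "\<beta> * (5 * real N + 2) * snd b \<le> 2 * snd b" using \<beta>N(1) that by (intro mult_right_mono) auto
    ultimately have "\<bar>cand b j - fst b\<bar> + \<beta> * snd b \<le> snd b" by (simp add: algebra_simps)
    then show ?thesis by (auto simp: dist_real_def)
  qed
  have ix: "ix b T e \<le> N \<and> free b T (ix b T e)"
    if T: "T = cball p q" "q \<le> \<beta> * snd b" and e: "e < N" and b: "0 < snd b" for b T p q e
  proof -
    have uniq: "j = k" if nf: "\<not> free b T j" "\<not> free b T k" for j k
    proof (rule ccontr)
      assume "j \<noteq> k"
      obtain u v where u: "u \<in> cball (cand b j) (\<beta> * snd b)" "u \<in> T" and v: "v \<in> cball (cand b k) (\<beta> * snd b)" "v \<in> T"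
        using nf unfolding free_def by blast
      have "3 * \<beta> * snd b \<le> \<bar>u - v\<bar>" using separated u v \<open>j \<noteq> k\<close> b by blast
      moreover have "\<bar>u - v\<bar> \<le> 2 * q" using u(2) v(2) unfolding T(1) by (auto simp: dist_real_def)
      moreover have "0 < \<beta> * snd b" using \<beta> b by simp
      ultimately show False using T(2) by linarith
    qed
    have le: "ix b T e \<le> N" unfolding ix_def using e by auto
    moreover have "free b T (ix b T e)"
    proof (rule ccontr)
      assume nf: "\<not> free b T (ix b T e)"
      then have ex: "\<exists>j\<le>N. \<not> free b T j" using le by blast
      then have "bad b T = (SOME j. j \<le> N \<and> \<not> free b T j)" unfolding bad_def by simp
      then have "\<not> free b T (bad b T)" using someI_ex[OF ex] by metis
      then have "ix b T e = bad b T" using uniq[OF nf] by simp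
      then show False unfolding ix_def by (auto split: if_splits)
    qed
    ultimately show ?thesis ..
  qed
  have ix_inj: "ix b T e \<noteq> ix b T e'" if "e \<noteq> e'" for b T e e'
    using that unfolding ix_def by auto
  have play: "play_against I \<beta> \<sigma> (B d)" if d: "\<And>n. d n < N" for d
    unfolding play_against_def
  proof (intro conjI allI)
    show "0 < snd (B d 0)" "cball (fst (B d 0)) (snd (B d 0)) \<subseteq> I" using I by (simp_all add: B0)
    fix n
    define L q where "L = fst (\<sigma> (H d n))" and "q = snd (\<sigma> (H d n))"
    have "H d n \<noteq> []" using Hmap[of d n] by (metis Nil_is_map_conv upt_Suc_append zero_le append_is_Nil_conv not_Cons_self2)
    then have L: "affine_hyperplane L" "q \<le> \<beta> * snd (B d n)"
      using legal_strategyD[OF \<sigma>(1), of "H d n"] radpos[of d n] unfolding B_def L_def q_def by auto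
    then obtain p where T: "hyperplane_nbhd L q = cball p q"
      using hyperplane_nbhd_singleton unfolding affine_hyperplane_real by blast
    define b where "b = B d n"
    have i: "ix b (hyperplane_nbhd L q) (d n) \<le> N" "free b (hyperplane_nbhd L q) (ix b (hyperplane_nbhd L q) (d n))"
      using ix[OF T _ d, of b] L(2) radpos[of d n] unfolding b_def by auto
    have BSn: "B d (Suc n) = (cand b (ix b (hyperplane_nbhd L q) (d n)), \<beta> * snd b)"
      unfolding BS child_def b_def L_def q_def by (simp add: B_def)
    have "cball (cand b (ix b (hyperplane_nbhd L q) (d n))) (\<beta> * snd b) \<subseteq> cball (fst b) (snd b) - hyperplane_nbhd L q"
      using inside[OF i(1)] radpos[of d n] i(2) unfolding free_def b_def by blast
    moreover have "\<sigma> (map (B d) [0..<Suc n]) = (L, q)" unfolding Hmap L_def q_def by simp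
    ultimately show "let (L, r) = \<sigma> (map (B d) [0..<Suc n]) in
        \<beta> * snd (B d n) \<le> snd (B d (Suc n)) \<and>
        cball (fst (B d (Suc n))) (snd (B d (Suc n))) \<subseteq> cball (fst (B d n)) (snd (B d n)) - hyperplane_nbhd L r"
      unfolding BSn b_def by (simp add: Let_def)
  qed
  have out: "\<exists>x. x \<in> S \<and> (\<forall>n. x \<in> cball (fst (B d n)) (snd (B d n)))" if d: "\<And>n. d n < N" for d
  proof -
    have "(\<lambda>n. \<beta> ^ n * r) \<longlonglongrightarrow> 0 * r" using \<beta> by (intro tendsto_mult LIMSEQ_power_zero tendsto_const) auto
    then have "(\<lambda>n. snd (B d n)) \<longlonglongrightarrow> 0" unfolding rad by simp
    moreover have "play_against I \<beta> \<sigma> (B d)" using d by (rule play)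
    ultimately have "(\<Inter>n. cball (fst (B d n)) (snd (B d n))) \<inter> S \<noteq> {}"
      using \<sigma>(2) unfolding winning_strategy_def by (elim allE[of _ "B d"] impE)
    then show ?thesis by blast
  qed
  define digit where "digit t n = nat (\<lfloor>real N ^ Suc n * t\<rfloor> mod int N)" for t n
  have digit: "digit t n < N" for t n unfolding digit_def using N(1) by (simp add: nat_less_iff)
  define x where "x t = (SOME z. z \<in> S \<and> (\<forall>n. z \<in> cball (fst (B (digit t) n)) (snd (B (digit t) n))))" for t
  have x: "x t \<in> S" "x t \<in> cball (fst (B (digit t) n)) (snd (B (digit t) n))" for t n
    using someI_ex[OF out[of "digit t", OF digit]] unfolding x_def by blast+
  have agree: "H d n = H d' n" if "\<And>i. i < n \<Longrightarrow> d i = d' i" for d d' n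
    using that by (induction n) (simp_all add: H0 HS)
  define K where "K = (1 / (3 * \<beta> * r)) powr s"
  have b3: "0 < 3 * \<beta> * r" using \<beta> I by simp
  have holder: "\<bar>t - t'\<bar> \<le> K * \<bar>x t - x t'\<bar> powr s" if t: "t \<in> {0..<1}" "t' \<in> {0..<1}" "t < t'" for t t'
  proof -
    have N2: "1 < real N"
    proof (rule ccontr)
      assume "\<not> ?thesis"
      then have "N = 1" using N(1) by simp
      then have "5 powr s \<le> 1" using N(2) by simp
      then show False using s by (metis powr_zero_eq_one powr_less_cancel_iff not_le one_less_numeral_iff semiring_norm(77) zero_neq_numeral)
    qed
    define fl where "fl n y = \<lfloor>real N ^ n * y\<rfloor>" for n y
    have "\<exists>n. fl n t \<noteq> fl n t'"
    proof -
      obtain n where "1 / (t' - t) < real N ^ n" using real_arch_pow[OF N2] by blast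
      then have "1 < real N ^ n * (t' - t)" using t(3) by (simp add: field_simps)
      then have "fl n t \<noteq> fl n t'" unfolding fl_def by (simp add: right_diff_distrib) linarith
      then show ?thesis ..
    qed
    then obtain n where n: "fl n t \<noteq> fl n t'" and min: "\<And>i. i < n \<Longrightarrow> fl i t = fl i t'"
      using exists_least_iff[of "\<lambda>n. fl n t \<noteq> fl n t'"] by blast
    have "\<lfloor>t\<rfloor> = 0" "\<lfloor>t'\<rfloor> = 0" using t by (auto simp: floor_eq_iff)
    then have "fl 0 t = fl 0 t'" unfolding fl_def by simp
    then obtain m where m: "n = Suc m" using n by (cases n) auto
    have step: "fl (Suc m) y = int N * fl m y + fl (Suc m) y mod int N" for y
    proof -
      have "fl m y = fl (Suc m) y div int N"
      proof -
        have "real N ^ m * y = (real N ^ Suc m * y) / real_of_int (int N)" using N2 by simp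
        then show ?thesis unfolding fl_def using floor_divide_real_eq_div[of "int N" "real N ^ Suc m * y"] by simp
      qed
      then show ?thesis by simp
    qed
    have "fl (Suc m) t mod int N \<noteq> fl (Suc m) t' mod int N"
      using n min[of m] step[of t] step[of t'] unfolding m by auto
    moreover have "0 \<le> fl (Suc m) y mod int N" for y using N(1) by simp
    ultimately have dm: "digit t m \<noteq> digit t' m" unfolding digit_def fl_def by (metis nat_eq_iff2 nat_0_le)
    have "digit t i = digit t' i" if "i < m" for i
      using min[of "Suc i"] that unfolding digit_def fl_def m by simp
    then have same: "H (digit t) m = H (digit t') m" by (rule agree)
    define b T where "b = last (H (digit t) m)"
      and "T = hyperplane_nbhd (fst (\<sigma> (H (digit t) m))) (snd (\<sigma> (H (digit t) m)))"
    have bm: "snd b = \<beta> ^ m * r" using rad[of "digit t" m] unfolding b_def B_def .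
    have xa: "x t \<in> cball (cand b (ix b T (digit t m))) (\<beta> * snd b)"
      using x(2)[of t "Suc m"] unfolding BS child_def b_def T_def by simp
    have xb: "x t' \<in> cball (cand b (ix b T (digit t' m))) (\<beta> * snd b)"
      using x(2)[of t' "Suc m"] unfolding BS child_def b_def T_def same by simp
    have sep: "3 * \<beta> * (\<beta> ^ m * r) \<le> \<bar>x t - x t'\<bar>"
      unfolding bm[symmetric] using radpos[of "digit t" m] unfolding B_def b_def[symmetric]
      by (rule separated[OF xa xb ix_inj[OF dm]])
    have "real N ^ m * (t' - t) < 1" using min[of m] unfolding fl_def m by (simp add: right_diff_distrib) linarith
    then have "t' - t \<le> 1 / real N ^ m" using N2 by (simp add: field_simps)
    also have "\<dots> \<le> (\<beta> powr s) ^ m"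
    proof -
      have "\<beta> = 1 / (5 * (real N + 1) / 2)" unfolding \<beta>_def by simp
      then have "\<beta> powr s = 1 / (5 * (real N + 1) / 2) powr s" by (simp add: powr_divide)
      moreover have "0 < 5 * (real N + 1) / 2" by simp
      then have "0 < (5 * (real N + 1) / 2) powr s" by (metis less_irrefl powr_gt_zero)
      then have "1 / real N \<le> 1 / (5 * (real N + 1) / 2) powr s" using N(2) by (intro frac_le) auto
      ultimately have "1 / real N \<le> \<beta> powr s" by simp
      then have "(1 / real N) ^ m \<le> (\<beta> powr s) ^ m" by (rule power_mono) simp
      then show ?thesis by (simp add: power_one_over)
    qed
    also have "\<dots> = (\<beta> ^ m) powr s" using \<beta> by (simp add: powr_realpow[symmetric] powr_powr mult.commute)
    also have "\<dots> = K * (3 * \<beta> * (\<beta> ^ m * r)) powr s"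
    proof -
      have "1 / (3 * \<beta> * r) * (3 * \<beta> * (\<beta> ^ m * r)) = \<beta> ^ m" using \<beta>(1) I(2) by simp
      then show ?thesis unfolding K_def by (metis powr_mult)
    qed
    also have "\<dots> \<le> K * \<bar>x t - x t'\<bar> powr s"
      using sep s b3 \<beta> I unfolding K_def by (intro mult_left_mono powr_mono2) auto
    finally show ?thesis using t(3) by simp
  qed
  show ?thesis
  proof (rule that)
    show "0 < K" unfolding K_def using \<beta>(1) I(2) by simp
    show "x ` {0..<1} \<subseteq> S \<inter> cball c r" using x(1) x(2)[of _ 0] unfolding B0 by auto
    show "\<bar>t - t'\<bar> \<le> K * \<bar>x t - x t'\<bar> powr s" if "t \<in> {0..<1}" "t' \<in> {0..<1}" for t t'
      using holder[of t t'] holder[of t' t] that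
      by (cases t t' rule: linorder_cases) (auto simp: abs_minus_commute)
  qed
qed

text \<open>Apply the mean value theorem to the component of \<open>\<gamma>\<close> in the direction of its velocity at \<open>t0\<close>.\<close>

lemma param_lower_lipschitz:
  assumes g: "local_param C I \<gamma>" and t: "t0 \<in> I"
  obtains r m where "0 < r" "0 < m" "cball t0 r \<subseteq> I"
    "\<And>x y. x \<in> cball t0 r \<Longrightarrow> y \<in> cball t0 r \<Longrightarrow> m * \<bar>x - y\<bar> \<le> dist (\<gamma> x) (\<gamma> y)"
proof -
  note D = local_paramD[OF g]
  define v where "v = vector_derivative \<gamma> (at t0)"
  have v: "v \<noteq> 0" unfolding v_def using D(7)[OF t] .
  define f where "f u = v \<bullet> vector_derivative \<gamma> (at u)" for u
  have "continuous_on I f" unfolding f_def by (intro continuous_intros D(6))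
  then have "isCont f t0" using D(1) t by (simp add: continuous_on_eq_continuous_at)
  moreover have "v \<bullet> v / 2 < f t0" unfolding f_def v_def[symmetric] using v by simp
  ultimately have "eventually (\<lambda>u. v \<bullet> v / 2 < f u) (at t0)" unfolding isCont_def by (rule order_tendstoD)
  then obtain e where e: "0 < e" "\<And>u. dist u t0 < e \<Longrightarrow> v \<bullet> v / 2 < f u"
    using \<open>v \<bullet> v / 2 < f t0\<close> unfolding eventually_at by (metis dist_self UNIV_I)
  obtain r0 where r0: "0 < r0" "cball t0 r0 \<subseteq> I" using D(1) t open_contains_cball by blast
  define r where "r = min (e / 2) r0"
  have r: "0 < r" "cball t0 r \<subseteq> I" "\<And>u. u \<in> cball t0 r \<Longrightarrow> v \<bullet> v / 2 < f u"
    unfolding r_def using e r0 by (auto simp: dist_commute)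
  have low: "norm v / 2 * \<bar>x - y\<bar> \<le> dist (\<gamma> x) (\<gamma> y)" if "x \<in> cball t0 r" "y \<in> cball t0 r" "x < y" for x y
  proof -
    have sub: "u \<in> cball t0 r" if "x \<le> u" "u \<le> y" for u
      using that \<open>x \<in> cball t0 r\<close> \<open>y \<in> cball t0 r\<close> by (auto simp: dist_real_def abs_le_iff)
    have "\<exists>z>x. z < y \<and> v \<bullet> \<gamma> y - v \<bullet> \<gamma> x = (y - x) * f z"
    proof (rule MVT2[OF that(3)])
      fix u assume "x \<le> u" "u \<le> y"
      then have "(\<gamma> has_vector_derivative vector_derivative \<gamma> (at u)) (at u)" using D(5) sub r(2) by blast
      then show "((\<lambda>u. v \<bullet> \<gamma> u) has_real_derivative f u) (at u)"
        unfolding has_real_derivative_iff_has_vector_derivative f_def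
        by (rule bounded_linear.has_vector_derivative[OF bounded_linear_inner_right])
    qed
    then obtain z where z: "x < z" "z < y" "v \<bullet> \<gamma> y - v \<bullet> \<gamma> x = (y - x) * f z" by blast
    have "norm v * (norm v / 2 * (y - x)) = (y - x) * (v \<bullet> v / 2)" by (simp add: power2_norm_eq_inner[symmetric] power2_eq_square)
    also have "\<dots> \<le> (y - x) * f z" using r(3)[OF sub[of z]] z that(3) by (intro mult_left_mono) auto
    also have "\<dots> = v \<bullet> (\<gamma> y - \<gamma> x)" using z(3) by (simp add: inner_diff_right)
    also have "\<dots> \<le> norm v * norm (\<gamma> y - \<gamma> x)" by (rule norm_cauchy_schwarz)
    finally have "norm v / 2 * (y - x) \<le> norm (\<gamma> y - \<gamma> x)" using v by simp
    then show ?thesis using that(3) by (simp add: dist_norm norm_minus_commute)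
  qed
  show ?thesis
  proof (rule that[OF r(1) _ r(2), of "norm v / 2"])
    show "0 < norm v / 2" using v by simp
    show "norm v / 2 * \<bar>x - y\<bar> \<le> dist (\<gamma> x) (\<gamma> y)" if "x \<in> cball t0 r" "y \<in> cball t0 r" for x y
      using low[of x y] low[of y x] that
      by (cases x y rule: linorder_cases) (auto simp: abs_minus_commute dist_commute)
  qed
qed

text \<open>A chart around a point of \<open>A\<close> transports the Hoelder family of the chart space to the curve.\<close>

theorem hausdorff_dim_winning_on_arc:
  assumes C: "regular_C2_curve C" and S: "absolutely_winning_on C S" and A: "openin (top_of_set C) A" "A \<noteq> {}"
  shows "hausdorff_dim (S \<inter> A) = 1"
proof -
  have AC: "A \<subseteq> C" using A(1) by (rule openin_imp_subset)
  have lower: "hausdorff_measure s (S \<inter> A) \<noteq> 0" if s: "0 < s" "s < 1" for s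
  proof -
    obtain z where z: "z \<in> A" using A(2) by blast
    then obtain I \<gamma> t0 where g: "local_param C I \<gamma>" and t0: "t0 \<in> I" "z = \<gamma> t0"
      using C AC unfolding regular_C2_curve_def C2_local_param_def by blast
    note D = local_paramD[OF g]
    obtain r1 m where r1: "0 < r1" "0 < m" "cball t0 r1 \<subseteq> I"
      "\<And>x y. x \<in> cball t0 r1 \<Longrightarrow> y \<in> cball t0 r1 \<Longrightarrow> m * \<bar>x - y\<bar> \<le> dist (\<gamma> x) (\<gamma> y)"
      using param_lower_lipschitz[OF g t0(1)] by metis
    have "openin (top_of_set I) (I \<inter> \<gamma> -` A)"
      using continuous_openin_preimage[OF D(2), of C A] D(4) A(1) by auto
    then have "open (I \<inter> \<gamma> -` A)" using D(1) by (metis openin_open_eq)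
    moreover have "t0 \<in> I \<inter> \<gamma> -` A" using t0 z by simp
    ultimately obtain r2 where r2: "0 < r2" "cball t0 r2 \<subseteq> I \<inter> \<gamma> -` A" using open_contains_cball by blast
    define r where "r = min r1 r2"
    have r: "0 < r" "cball t0 r \<subseteq> cball t0 r1" "cball t0 r \<subseteq> cball t0 r2" unfolding r_def using r1 r2 by auto
    obtain \<phi> where hom: "homeomorphism I (\<gamma> ` I) \<gamma> \<phi>" using g unfolding local_param_def by auto
    have \<phi>I: "\<phi> ` (\<gamma> ` I) = I" using hom unfolding homeomorphism_def by auto
    have "C1_chart C (\<gamma> ` I) \<phi>"
      unfolding C1_chart_def \<phi>I using homeomorphism_symD[OF hom] g by blast
    then have haw: "HAW_on I (\<phi> ` (S \<inter> \<gamma> ` I))" using S \<phi>I unfolding absolutely_winning_on_def by metis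
    have "cball t0 r \<subseteq> I" using r r1 by blast
    from exists_holder_family[OF haw this r(1) s]
    obtain x K where x: "0 < K" "x ` {0..<1} \<subseteq> \<phi> ` (S \<inter> \<gamma> ` I) \<inter> cball t0 r"
      "\<And>t t'. t \<in> {0..<1} \<Longrightarrow> t' \<in> {0..<1} \<Longrightarrow> \<bar>t - t'\<bar> \<le> K * \<bar>x t - x t'\<bar> powr s" by metis
    have m1: "0 < (1 / m) powr s" using r1(2) by simp
    show ?thesis
    proof (rule hausdorff_measure_pos[of "\<gamma> \<circ> x" _ "K * (1 / m) powr s"])
      show "(\<gamma> \<circ> x) ` {0..<1} \<subseteq> S \<inter> A"
      proof
        fix w assume "w \<in> (\<gamma> \<circ> x) ` {0..<1}"
        then obtain t where t: "w = \<gamma> (x t)" "t \<in> {0..<1}" by auto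
        then have xt: "x t \<in> \<phi> ` (S \<inter> \<gamma> ` I)" "x t \<in> cball t0 r" using x(2) by blast+
        then obtain p where "p \<in> S" "p \<in> \<gamma> ` I" "x t = \<phi> p" by auto
        moreover from this have "\<gamma> (\<phi> p) = p" using hom unfolding homeomorphism_def by auto
        ultimately have "w \<in> S" unfolding t(1) by simp
        moreover have "w \<in> A" unfolding t(1) using xt(2) r(3) r2(2) by blast
        ultimately show "w \<in> S \<inter> A" ..
      qed
      show "0 < K * (1 / m) powr s" using x(1) m1 by simp
      show "\<bar>t - t'\<bar> \<le> K * (1 / m) powr s * dist ((\<gamma> \<circ> x) t) ((\<gamma> \<circ> x) t') powr s"
        if t: "t \<in> {0..<1}" "t' \<in> {0..<1}" for t t'
      proof -
        have "x t \<in> cball t0 r1" "x t' \<in> cball t0 r1" using x(2) t r by blast+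
        then have "m * \<bar>x t - x t'\<bar> \<le> dist (\<gamma> (x t)) (\<gamma> (x t'))" by (rule r1(4))
        then have "\<bar>x t - x t'\<bar> \<le> 1 / m * dist (\<gamma> (x t)) (\<gamma> (x t'))" using r1(2) by (simp add: field_simps)
        then have "\<bar>x t - x t'\<bar> powr s \<le> (1 / m * dist (\<gamma> (x t)) (\<gamma> (x t'))) powr s"
          using s by (intro powr_mono2) auto
        also have "\<dots> = (1 / m) powr s * dist (\<gamma> (x t)) (\<gamma> (x t')) powr s" using r1(2) by (intro powr_mult)
        finally have "K * \<bar>x t - x t'\<bar> powr s \<le> K * ((1 / m) powr s * dist (\<gamma> (x t)) (\<gamma> (x t')) powr s)"
          using x(1) by (intro mult_left_mono) auto
        then show ?thesis using x(3)[OF t] by (simp add: mult.assoc)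
      qed
    qed (use s in simp)
  qed
  have upper: "hausdorff_measure s (S \<inter> A) = 0" if "1 < s" for s
    using hausdorff_measure_subset_0[OF hausdorff_measure_curve[OF C that]] AC by blast
  show ?thesis
    unfolding hausdorff_dim_def
  proof (rule antisym)
    show "(INF s\<in>{s. 0 < s \<and> hausdorff_measure s (S \<inter> A) = 0}. ereal s) \<le> 1"
    proof (rule ereal_le_epsilon2)
      fix e :: real assume "0 < e"
      then have "(INF s\<in>{s. 0 < s \<and> hausdorff_measure s (S \<inter> A) = 0}. ereal s) \<le> ereal (1 + e)"
        using upper[of "1 + e"] by (intro INF_lower) simp
      then show "(INF s\<in>{s. 0 < s \<and> hausdorff_measure s (S \<inter> A) = 0}. ereal s) \<le> 1 + ereal e"
        by (simp add: one_ereal_def)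
    qed
    show "1 \<le> (INF s\<in>{s. 0 < s \<and> hausdorff_measure s (S \<inter> A) = 0}. ereal s)"
    proof (rule INF_greatest)
      fix s assume "s \<in> {s. 0 < s \<and> hausdorff_measure s (S \<inter> A) = 0}"
      then have "1 \<le> s" using lower[of s] by force
      then show "1 \<le> ereal s" by (simp add: one_ereal_def)
    qed
  qed
qed

section \<open>From lines to rational points\<close>

text \<open>Suppose that the product is smaller, and let \<open>e = sqrt (\<delta> / (q Q))\<close>. If \<open>w = q Y - P2\<close> is large, then
  \<open>u = q X - P1\<close> is at most \<open>e / 2\<close> and the vertical line \<open>q x = P1\<close> is too close. Otherwise the
  pigeonhole principle gives a line through the point \<open>(P1 / q, P2 / q)\<close> whose value at \<open>t\<close> is
  \<open>(G u + b (w - \<Phi> u)) / q\<close>; the bounds \<open>A\<close> for \<open>G\<close> and \<open>B\<close> for \<open>b\<close>, with \<open>A * B = 2 q\<close>, are balanced such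
  that this is at most a constant times \<open>e\<close>. Both for nearly tangent and for transversal lines this
  contradicts the assumed repulsion when \<open>\<delta>\<close> is small.\<close>

lemma (in convex_arc) product_ge_of_repelled:
  assumes rep: "repels_lines \<tau> cF c \<sigma> t" and t: "t \<in> cball c0 r0"
    and pos: "0 < \<tau>" "\<tau> < 1" "0 < cF" "0 < c"
    and \<sigma>: "\<And>l. 0 < \<sigma> l" "\<And>l. 2 ^ l \<le> C * Q \<Longrightarrow> 2 ^ l \<le> \<sigma> l ^ 208 * (C * Q)" and C: "8 \<le> \<tau> * C"
    and \<delta>: "0 < \<delta>" "\<delta> \<le> 1" "16 * (2 * M + 3)\<^sup>2 * \<delta> \<le> cF\<^sup>2" "(2 * M + 3) ^ 16 * 8 ^ 15 * C * \<delta> \<le> c ^ 208"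
    and q: "1 \<le> q" "real q \<le> Q"
    and le: "\<bar>real q * X t - of_int P1\<bar> \<le> \<bar>real q * Y t - of_int P2\<bar>"
  shows "\<delta> \<le> Q * (\<bar>real q * X t - of_int P1\<bar> * \<bar>real q * Y t - of_int P2\<bar>)"
proof (rule ccontr)
  define u w where "u = real q * X t - of_int P1" and "w = real q * Y t - of_int P2"
  define K where "K = 2 * M + 3"
  assume "\<not> ?thesis"
  then have small: "Q * (\<bar>u\<bar> * \<bar>w\<bar>) < \<delta>" unfolding u_def w_def by simp
  have uw: "\<bar>u\<bar> \<le> \<bar>w\<bar>" using le unfolding u_def w_def .
  have q0: "0 < real q" and Q1: "1 \<le> Q" using q by auto
  have K5: "5 \<le> K" unfolding K_def using M by simp
  have C0: "0 < C" using C pos(1) by (smt (verit) mult_nonneg_nonpos)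
  define e where "e = sqrt (\<delta> / (real q * Q))"
  have e0: "0 < e" unfolding e_def using \<delta>(1) q0 Q1 by simp
  have e2: "e * e * (real q * Q) = \<delta>" unfolding e_def using \<delta>(1) q0 Q1 by simp
  have prod: "\<bar>u\<bar> * \<bar>w\<bar> < real q * (e * e)"
  proof -
    have "Q * (\<bar>u\<bar> * \<bar>w\<bar>) < Q * (real q * (e * e))" using small e2 by (simp add: mult_ac)
    then show ?thesis using Q1 by simp
  qed
  have \<Phi>t: "\<bar>\<Phi> t\<bar> \<le> M" using \<Phi>_bound[OF t] .
  \<comment> \<open>For transversal lines the scale \<open>p\<close> is at most \<open>8 * q\<close>. Raising the repulsion to the sixteenth power
    gives \<open>c ^ 208 * p < (p * K * e) ^ 16 * C * Q\<close>, in which \<open>\<tau> < 1\<close> has been used; and \<open>p \<le> 8 * q\<close> together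
    with \<open>q \<le> Q\<close> bounds the right-hand side.\<close>
  have steep: "False" if ab: "a \<noteq> 0 \<or> b \<noteq> 0" and F: "\<bar>F a b d t\<bar> \<le> K * e"
    and G: "\<tau> < \<bar>G a b t\<bar>" "\<bar>G a b t\<bar> * max 1 \<bar>real_of_int b\<bar> \<le> 2 * real q" for a b d
  proof -
    obtain l where l: "\<tau> * 2 ^ l \<le> 4 * \<bar>G a b t\<bar> * max 1 \<bar>real_of_int b\<bar>"
      "(c * \<sigma> l) ^ 13 < \<tau> * 2 ^ l * \<bar>F a b d t\<bar>"
      using rep ab G(1) unfolding repels_lines_def by blast
    define p where "p = \<tau> * 2 ^ l"
    have p0: "0 < p" unfolding p_def using pos by simp
    have p8: "p \<le> 8 * real q" unfolding p_def using l(1) G(2) by linarith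
    have "\<tau> * 2 ^ l \<le> \<tau> * (C * Q)"
    proof -
      have "p \<le> 8 * Q" using p8 q(2) by simp
      also have "\<dots> \<le> \<tau> * C * Q" using C Q1 by (intro mult_right_mono) auto
      finally show ?thesis unfolding p_def by (simp add: mult.assoc)
    qed
    then have lQ: "2 ^ l \<le> C * Q" using pos(1) by simp
    have "c ^ 208 * p \<le> c ^ 208 * (1 * 2 ^ l)"
      unfolding p_def using pos by (intro mult_left_mono mult_right_mono) auto
    also have "\<dots> \<le> c ^ 208 * (\<sigma> l ^ 208 * (C * Q))" using \<sigma>(2)[OF lQ] pos by (intro mult_left_mono) auto
    also have "\<dots> = ((c * \<sigma> l) ^ 13) ^ 16 * (C * Q)" by (simp add: power_mult_distrib power_mult[symmetric])
    also have "\<dots> < (p * (K * e)) ^ 16 * (C * Q)"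
    proof (rule mult_strict_right_mono)
      have "p * \<bar>F a b d t\<bar> \<le> p * (K * e)" using F p0 by (intro mult_left_mono) auto
      then have "(c * \<sigma> l) ^ 13 < p * (K * e)" using l(2) unfolding p_def by linarith
      then show "((c * \<sigma> l) ^ 13) ^ 16 < (p * (K * e)) ^ 16"
        using pos(4) \<sigma>(1)[of l] by (intro power_strict_mono) auto
      show "0 < C * Q" using C0 Q1 by simp
    qed
    also have "\<dots> = p ^ 15 * (K ^ 16 * (e * e) ^ 8 * (C * Q)) * p"
    proof -
      have "p ^ 16 = p ^ 15 * p" "e ^ 16 = (e * e) ^ 8"
        by (simp_all add: power_mult_distrib flip: power_Suc2 power_add)
      then show ?thesis by (simp only: power_mult_distrib mult_ac)
    qed
    finally have "c ^ 208 < p ^ 15 * (K ^ 16 * (e * e) ^ 8 * (C * Q))" using p0 by simp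
    also have "\<dots> \<le> (8 * real q) ^ 15 * (K ^ 16 * (e * e) ^ 8 * (C * Q))"
      using p8 p0 C0 Q1 by (intro mult_right_mono power_mono) auto
    finally have "c ^ 208 * (real q * Q) ^ 8 < (8 * real q) ^ 15 * (K ^ 16 * (e * e) ^ 8 * (C * Q)) * (real q * Q) ^ 8"
      using q0 Q1 by (intro mult_strict_right_mono) auto
    also have "\<dots> = 8 ^ 15 * real q ^ 15 * K ^ 16 * (e * e * (real q * Q)) ^ 8 * C * Q"
      by (simp add: power_mult_distrib mult_ac)
    also have "\<dots> = K ^ 16 * 8 ^ 15 * C * \<delta> ^ 8 * (real q ^ 15 * Q)" unfolding e2 by (simp add: mult_ac)
    also have "\<dots> \<le> K ^ 16 * 8 ^ 15 * C * \<delta> * (real q * Q) ^ 8"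
    proof (rule mult_mono)
      have "\<delta> ^ 8 \<le> \<delta>" using \<delta>(1,2) power_decreasing[of 1 8 \<delta>] by simp
      then show "K ^ 16 * 8 ^ 15 * C * \<delta> ^ 8 \<le> K ^ 16 * 8 ^ 15 * C * \<delta>" using C0 K5 by (intro mult_left_mono) auto
      have "real q ^ 15 * Q = real q ^ 8 * (real q ^ 7 * Q)" by (simp flip: power_add mult.assoc)
      also have "\<dots> \<le> real q ^ 8 * (Q ^ 7 * Q)" using q Q1 by (intro mult_left_mono mult_right_mono power_mono) auto
      also have "\<dots> = (real q * Q) ^ 8" by (simp add: power_mult_distrib power_Suc2[symmetric])
      finally show "real q ^ 15 * Q \<le> (real q * Q) ^ 8" .
      show "0 \<le> K ^ 16 * 8 ^ 15 * C * \<delta>" using C0 K5 \<delta>(1) by simp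
      show "0 \<le> real q ^ 15 * Q" using q0 Q1 by simp
    qed
    finally have "c ^ 208 < K ^ 16 * 8 ^ 15 * C * \<delta>" using q0 Q1 by (simp only: mult_less_cancel_right_pos zero_less_power mult_pos_pos)
    then show False using \<delta>(4) unfolding K_def by linarith
  qed
  show False
  proof (cases "2 * real q * e \<le> \<bar>w\<bar>")
    case True
    have "\<bar>u\<bar> * (2 * real q * e) \<le> \<bar>u\<bar> * \<bar>w\<bar>" using True by (intro mult_left_mono) auto
    then have "real q * e * (2 * \<bar>u\<bar>) < real q * e * e" using prod by (simp add: mult_ac)
    then have "2 * \<bar>u\<bar> < e" using q0 e0 by simp
    moreover have "1 * e \<le> K * e" using e0 K5 by (intro mult_right_mono) auto
    ultimately have "\<bar>u\<bar> \<le> K * e" by linarith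
    then have "\<bar>F (int q) 0 (- P1) t\<bar> \<le> K * e" unfolding F_def u_def by simp
    then show False
      by (rule steep[rotated]) (use q q0 pos in \<open>auto simp: G_def\<close>)
  next
    case False
    \<comment> \<open>The second entry guarantees \<open>B \<le> 2 * sqrt q\<close>, which is what nearly tangent lines need; it also covers
      \<open>w = 0\<close>.\<close>
    define W where "W = max \<bar>w\<bar> (e * sqrt (real q))"
    have sq: "1 \<le> sqrt (real q)" "sqrt (real q) * sqrt (real q) = real q" using q by auto
    have sqq: "sqrt (real q) \<le> real q"
      using mult_left_mono[OF sq(1), of "sqrt (real q)"] sq by simp
    have eW: "0 < e * sqrt (real q)" "e * sqrt (real q) \<le> 2 * real q * e"
    proof -
      show "0 < e * sqrt (real q)" using e0 sq by simp
      have "e * sqrt (real q) \<le> e * (2 * real q)" using sqq q0 e0 by (intro mult_left_mono) auto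
      then show "e * sqrt (real q) \<le> 2 * real q * e" by (simp add: mult_ac)
    qed
    have W: "0 < W" "\<bar>w\<bar> \<le> W" "e * sqrt (real q) \<le> W" "W \<le> 2 * real q * e"
      unfolding W_def using eW False by auto
    define A B where "A = W / e" and "B = 2 * real q * e / W"
    have A0: "0 < A" and B1: "1 \<le> B" unfolding A_def B_def using W e0 by auto
    have AB: "A * B = 2 * real q" unfolding A_def B_def using W e0 by simp
    obtain a b where ab: "a \<noteq> 0 \<or> b \<noteq> 0" "\<bar>real_of_int b\<bar> \<le> B" "\<bar>real_of_int a + of_int b * \<Phi> t\<bar> \<le> A"
      "int q dvd a * P1 + b * P2"
      using exists_small_combination[where q = "int q" and A = A and B = B and ?P1.0 = P1 and ?P2.0 = P2 and \<phi> = "\<Phi> t"] A0 B1 AB q by auto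
    obtain d where d: "a * P1 + b * P2 = int q * d" using ab(4) by blast
    have G: "\<bar>G a b t\<bar> \<le> A" unfolding G_def using ab(3) .
    have qF: "real q * F a b (- d) t = G a b t * u + of_int b * (w - \<Phi> t * u)"
    proof -
      have "real_of_int (a * P1 + b * P2) = real q * of_int d" unfolding d by simp
      then show ?thesis unfolding F_def G_def u_def w_def by (simp add: algebra_simps)
    qed
    have Au: "A * \<bar>u\<bar> \<le> real q * e"
    proof -
      have "W * \<bar>u\<bar> \<le> real q * (e * e)"
      proof (cases "W = \<bar>w\<bar>")
        case True
        then show ?thesis using prod by (simp add: mult.commute)
      next
        case False
        then have W': "W = e * sqrt (real q)" unfolding W_def by (auto simp: max_def split: if_splits)
        have "\<bar>u\<bar> \<le> W" using uw W by linarith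
        then have "W * \<bar>u\<bar> \<le> W * W" using W by (intro mult_left_mono) auto
        also have "\<dots> = (sqrt (real q) * sqrt (real q)) * (e * e)" unfolding W' by (simp add: mult_ac)
        finally show ?thesis unfolding sq(2) .
      qed
      then have "W * \<bar>u\<bar> / e \<le> real q * (e * e) / e" using e0 by (intro divide_right_mono) auto
      then show ?thesis unfolding A_def using e0 by simp
    qed
    have Bw: "B * \<bar>w\<bar> \<le> 2 * real q * e"
    proof -
      have "B * \<bar>w\<bar> \<le> B * W" using W B1 by (intro mult_left_mono) auto
      then show ?thesis unfolding B_def using W by simp
    qed
    have "real q * \<bar>F a b (- d) t\<bar> = \<bar>G a b t * u + of_int b * (w - \<Phi> t * u)\<bar>"
      using qF q0 by (metis abs_mult abs_of_pos)
    also have "\<dots> \<le> \<bar>G a b t\<bar> * \<bar>u\<bar> + \<bar>real_of_int b\<bar> * \<bar>w - \<Phi> t * u\<bar>"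
      by (metis abs_mult abs_triangle_ineq)
    also have "\<dots> \<le> A * \<bar>u\<bar> + B * ((M + 1) * \<bar>w\<bar>)"
    proof (intro add_mono mult_mono)
      have "\<bar>w - \<Phi> t * u\<bar> \<le> \<bar>w\<bar> + \<bar>\<Phi> t\<bar> * \<bar>u\<bar>" by (metis abs_mult abs_triangle_ineq4)
      also have "\<bar>\<Phi> t\<bar> * \<bar>u\<bar> \<le> M * \<bar>w\<bar>" using \<Phi>t uw by (intro mult_mono) auto
      finally show "\<bar>w - \<Phi> t * u\<bar> \<le> (M + 1) * \<bar>w\<bar>" by (simp add: algebra_simps)
    qed (use G ab A0 B1 in auto)
    also have "\<dots> = A * \<bar>u\<bar> + (M + 1) * (B * \<bar>w\<bar>)" by (simp add: mult_ac)
    also have "\<dots> \<le> real q * e + (M + 1) * (2 * real q * e)"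
      using Au Bw M by (intro add_mono mult_left_mono) auto
    also have "\<dots> = real q * (K * e)" unfolding K_def by (simp add: algebra_simps)
    finally have FK: "\<bar>F a b (- d) t\<bar> \<le> K * e" using q0 by simp
    show False
    proof (cases "\<bar>G a b t\<bar> \<le> \<tau>")
      case True
      then have "cF < 2 * \<bar>real_of_int b\<bar> * \<bar>F a b (- d) t\<bar>"
        using rep ab(1) unfolding repels_lines_def by blast
      also have "\<dots> \<le> 2 * B * (K * e)" using ab(2) FK B1 by (intro mult_mono) auto
      also have "\<dots> \<le> 2 * (2 * sqrt (real q)) * (K * e)"
      proof -
        have "B \<le> 2 * real q * e / (e * sqrt (real q))" unfolding B_def using W eW e0 by (intro divide_left_mono) auto
        also have "\<dots> = 2 * (sqrt (real q) * sqrt (real q)) / sqrt (real q)" using e0 by (simp add: sq(2))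
        also have "\<dots> = 2 * sqrt (real q)"
        proof -
          have "2 * (z * z) / z = 2 * z" if "z \<noteq> 0" for z :: real using that by simp
          from this[of "sqrt (real q)"] show ?thesis using sq(1) by linarith
        qed
        finally show ?thesis using K5 e0 by (intro mult_right_mono mult_left_mono) auto
      qed
      finally have c1: "cF < 4 * K * (sqrt (real q) * e)" by (simp add: mult_ac)
      have "cF * cF < (4 * K * (sqrt (real q) * e)) * (4 * K * (sqrt (real q) * e))"
        using c1 pos(3) by (intro mult_strict_mono) linarith+
      also have "\<dots> = 16 * K\<^sup>2 * ((sqrt (real q) * sqrt (real q)) * (e * e))" by (simp add: power2_eq_square mult_ac)
      also have "\<dots> = 16 * K\<^sup>2 * (e * e * real q)" unfolding sq(2) by simp
      also have "\<dots> \<le> 16 * K\<^sup>2 * \<delta>"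
      proof -
        have "e * e * real q * 1 \<le> e * e * real q * Q" using e0 q0 Q1 by (intro mult_left_mono) auto
        then show ?thesis using e2 by (intro mult_left_mono) (auto simp: mult.assoc)
      qed
      finally show False using \<delta>(3) unfolding K_def by (simp add: power2_eq_square)
    next
      case G\<tau>: False
      have "\<bar>G a b t\<bar> * max 1 \<bar>real_of_int b\<bar> \<le> A * B"
        using G ab(2) A0 B1 by (intro mult_mono) auto
      then show False using steep[OF ab(1) FK] G\<tau> AB by simp
    qed
  qed
qed

lemma dist_int_attained: "\<exists>P::int. dist_int x = \<bar>x - of_int P\<bar>"
proof -
  obtain p where "p \<in> \<int>" "infdist x \<int> = dist x p"
    using infdist_attains_inf[OF closed_Ints, of x] by (metis Ints_0 empty_iff)
  then show ?thesis unfolding dist_int_def by (auto simp: Ints_def dist_real_def)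
qed

lemma dist_int_minus: "dist_int (- x) = dist_int x"
proof -
  have "dist_int (- x) \<le> dist_int x" for x
  proof -
    obtain P where P: "dist_int x = \<bar>x - of_int P\<bar>" using dist_int_attained by blast
    have "dist_int (- x) \<le> dist (- x) (of_int (- P))" unfolding dist_int_def by (intro infdist_le) auto
    then show ?thesis unfolding P by (simp add: dist_real_def abs_minus_commute)
  qed
  from this[of x] this[of "- x"] show ?thesis by simp
qed

lemma min_product_geI:
  assumes "1 \<le> Q" and "\<And>q. 1 \<le> q \<Longrightarrow> real q \<le> Q \<Longrightarrow> \<delta> \<le> Q * (dist_int (real q * fst z) * dist_int (real q * snd z))"
  shows "\<delta> \<le> Q * min_product z Q"
proof -
  have "{q. 1 \<le> q \<and> real q \<le> Q} \<subseteq> {..nat \<lceil>Q\<rceil>}" by (auto simp: le_nat_iff) linarith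
  then have "finite {q. 1 \<le> q \<and> real q \<le> Q}" by (rule finite_subset) simp
  moreover have "1 \<in> {q. 1 \<le> q \<and> real q \<le> Q}" using assms(1) by simp
  ultimately have "min_product z Q \<in> (\<lambda>q::nat. dist_int (real q * fst z) * dist_int (real q * snd z)) ` {q. 1 \<le> q \<and> real q \<le> Q}"
    unfolding min_product_def by (intro Min_in) auto
  then show ?thesis using assms(2) by auto
qed

lemma E_seq_set_subset_E_set:
  assumes "filterlim Q at_top sequentially"
  shows "E_seq_set Q \<subseteq> E_set"
proof
  fix z assume "z \<in> E_seq_set Q"
  then obtain x where x: "0 < x" "x < liminf (\<lambda>m. ereal (Q m * min_product z (Q m)))"
    unfolding E_seq_set_def using dense[of "0::ereal"] by blast
  show "z \<in> E_set"
  proof (rule ccontr)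
    assume "z \<notin> E_set"
    then have "Limsup at_top (\<lambda>Q. ereal (Q * min_product z Q)) < x" unfolding E_set_def using x(1) by (simp add: not_less)
    then have "eventually (\<lambda>Q. ereal (Q * min_product z Q) < x) at_top" by (rule Limsup_lessD)
    then have "eventually (\<lambda>m. ereal (Q m * min_product z (Q m)) < x) sequentially"
      using assms unfolding filterlim_iff by blast
    moreover have "eventually (\<lambda>m. x < ereal (Q m * min_product z (Q m))) sequentially" using less_LiminfD[OF x(2)] .
    ultimately have "eventually (\<lambda>m::nat. False) sequentially" by eventually_elim simp
    then show False by simp
  qed
qed

lemma E_seq_setI:
  assumes "0 < \<delta>" "\<And>m. m0 \<le> m \<Longrightarrow> \<delta> \<le> Q m * min_product z (Q m)"
  shows "z \<in> E_seq_set Q"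
proof -
  have "ereal \<delta> \<le> liminf (\<lambda>m. ereal (Q m * min_product z (Q m)))"
    by (intro Liminf_bounded eventually_sequentiallyI[of m0]) (use assms(2) in simp)
  then show ?thesis unfolding E_seq_set_def using assms(1) by (auto intro: less_le_trans[of _ "ereal \<delta>"])
qed

text \<open>The larger of the two distances to integers plays the role of \<open>w\<close> above. Which one is larger
  depends on \<open>q\<close>, so Alice avoids the dangerous parameters of the arc and of the arc with exchanged
  coordinates at the same time.\<close>

lemma convex_arc_wins:
  fixes Q :: "nat \<Rightarrow> real" and \<gamma> :: "real \<Rightarrow> real \<times> real"
  assumes Q: "strict_mono Q" "\<And>m. 0 < Q m" "filterlim Q at_top sequentially"
      "\<exists>\<tau>>1. 0 < (INF m. Q (Suc m) / Q m powr \<tau>)"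
    and \<beta>: "0 < \<beta>" "\<beta> < 2 / 3"
    and signs: "e1 = 1 \<or> e1 = - 1" "e2 = 1 \<or> e2 = - 1" "e1' = 1 \<or> e1' = - 1" "e2' = 1 \<or> e2' = - 1"
    and arc: "convex_arc (\<lambda>t. e1 * fst (\<gamma> t)) (\<lambda>t. e2 * snd (\<gamma> t)) \<Phi> M c \<rho>"
    and arc': "convex_arc (\<lambda>t. e1' * snd (\<gamma> t)) (\<lambda>t. e2' * fst (\<gamma> t)) \<Phi>' M' c \<rho>"
  shows "wins_from \<beta> {t. \<gamma> t \<in> E_seq_set Q} (c, \<rho>)"
proof -
  interpret A: convex_arc "\<lambda>t. e1 * fst (\<gamma> t)" "\<lambda>t. e2 * snd (\<gamma> t)" \<Phi> M c \<rho> by (rule arc)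
  interpret A': convex_arc "\<lambda>t. e1' * snd (\<gamma> t)" "\<lambda>t. e2' * fst (\<gamma> t)" \<Phi>' M' c \<rho> by (rule arc')
  \<comment> \<open>The exponent with \<open>\<beta> powr g = 2 / 3\<close>.\<close>
  define g where "g = ln (2 / 3) / ln \<beta>"
  have \<beta>1: "\<beta> < 1" using \<beta> by simp
  have g: "0 < g" "\<beta> powr g = 2 / 3"
    unfolding g_def powr_def using \<beta> by (auto intro: divide_neg_neg)
  obtain \<tau> cF where sys: "0 < \<tau>" "\<tau> < 1" "0 < cF"
    "\<And>\<sigma>. slow_profile g \<sigma> \<Longrightarrow> \<exists>(DX :: danger \<Rightarrow> real set) rad eps k. 0 < k \<and>
      danger_system \<beta> g (1 / 24) c \<rho> DX rad eps \<and> (\<forall>t. t \<notin> (\<Union>i. DX i) \<longrightarrow> A.repels_lines \<tau> cF k \<sigma> t)"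
    using A.exists_danger_system[OF \<beta>(1) \<beta>1 g(1)] by metis
  obtain \<tau>' cF' where sys': "0 < \<tau>'" "\<tau>' < 1" "0 < cF'"
    "\<And>\<sigma>. slow_profile g \<sigma> \<Longrightarrow> \<exists>(DX :: danger \<Rightarrow> real set) rad eps k. 0 < k \<and>
      danger_system \<beta> g (1 / 24) c \<rho> DX rad eps \<and> (\<forall>t. t \<notin> (\<Union>i. DX i) \<longrightarrow> A'.repels_lines \<tau>' cF' k \<sigma> t)"
    using A'.exists_danger_system[OF \<beta>(1) \<beta>1 g(1)] by metis
  \<comment> \<open>The scales of lines that come from \<open>q \<le> Q m\<close> satisfy \<open>2 ^ l \<le> 8 * q / \<tau> \<le> C * Q m\<close>.\<close>
  define C where "C = max (8 / \<tau>) (8 / \<tau>')"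
  have C: "0 < C" "8 \<le> \<tau> * C" "8 \<le> \<tau>' * C"
  proof -
    have *: "8 / \<tau> \<le> C" "8 / \<tau>' \<le> C" unfolding C_def by auto
    then show "8 \<le> \<tau> * C" "8 \<le> \<tau>' * C" using sys(1) sys'(1) by (simp_all add: field_simps)
    show "0 < C" using *(1) sys(1) by (smt (verit) divide_pos_pos)
  qed
  obtain \<sigma> m0 where prof: "slow_profile g \<sigma>"
    and \<sigma>Q: "\<And>m l. m0 \<le> m \<Longrightarrow> 2 ^ l \<le> C * Q m \<Longrightarrow> 2 ^ l \<le> \<sigma> l ^ 208 * (C * Q m)" and Q1: "\<And>m. m0 \<le> m \<Longrightarrow> 1 \<le> Q m"
    using exists_profile[OF Q C(1)] g(1) by metis
  have \<sigma>0: "0 < \<sigma> l" for l using prof unfolding slow_profile_def by blast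
  obtain DX :: "danger \<Rightarrow> real set" and rad eps k where D: "0 < k" "danger_system \<beta> g (1 / 24) c \<rho> DX rad eps"
    "\<And>t. t \<notin> (\<Union>i. DX i) \<Longrightarrow> A.repels_lines \<tau> cF k \<sigma> t" using sys(4)[OF prof] by blast
  obtain DX' :: "danger \<Rightarrow> real set" and rad' eps' k' where D': "0 < k'" "danger_system \<beta> g (1 / 24) c \<rho> DX' rad' eps'"
    "\<And>t. t \<notin> (\<Union>i. DX' i) \<Longrightarrow> A'.repels_lines \<tau>' cF' k' \<sigma> t" using sys'(4)[OF prof] by blast
  have "danger_system \<beta> g (1 / 12) c \<rho> (case_sum DX DX') (case_sum rad rad') (case_sum eps eps')"
    using danger_system_Plus[OF D(2) D'(2)] by simp
  then have "wins_from \<beta> (- (\<Union>i. case_sum DX DX' i)) (c, \<rho>)"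
    by (rule wins_from_danger_system[OF \<beta>(1) \<beta>1 g A.r0])
  then show ?thesis
  proof (rule wins_from_mono, intro subsetI CollectI)
    fix t assume t: "t \<in> - (\<Union>i. case_sum DX DX' i) \<inter> cball (fst (c, \<rho>)) (snd (c, \<rho>))"
    have "t \<notin> (\<Union>i. DX i)" "t \<notin> (\<Union>i. DX' i)" and tb: "t \<in> cball c \<rho>"
      using t by (force dest: spec[of _ "Inl _"] spec[of _ "Inr _"])+
    then have rep: "A.repels_lines \<tau> cF k \<sigma> t" and rep': "A'.repels_lines \<tau>' cF' k' \<sigma> t" using D(3) D'(3) by blast+
    define \<delta> where "\<delta> = Min {1, cF\<^sup>2 / (16 * (2 * M + 3)\<^sup>2), k ^ 208 / ((2 * M + 3) ^ 16 * 8 ^ 15 * C),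
      cF'\<^sup>2 / (16 * (2 * M' + 3)\<^sup>2), k' ^ 208 / ((2 * M' + 3) ^ 16 * 8 ^ 15 * C)}"
    have Mp: "0 < 2 * M + 3" "0 < 2 * M' + 3" using A.M A'.M by auto
    have \<delta>0: "0 < \<delta>" unfolding \<delta>_def using sys(3) sys'(3) D(1) D'(1) C(1) Mp by simp
    have b: "x * \<delta> \<le> y" if "\<delta> \<le> y / x" "0 < x" for x y using that by (simp add: field_simps)
    have \<delta>: "\<delta> \<le> 1" "16 * (2 * M + 3)\<^sup>2 * \<delta> \<le> cF\<^sup>2" "(2 * M + 3) ^ 16 * 8 ^ 15 * C * \<delta> \<le> k ^ 208"
      "16 * (2 * M' + 3)\<^sup>2 * \<delta> \<le> cF'\<^sup>2" "(2 * M' + 3) ^ 16 * 8 ^ 15 * C * \<delta> \<le> k' ^ 208"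
    proof -
      show "\<delta> \<le> 1" unfolding \<delta>_def by (intro Min_le) auto
    qed (rule b, force simp: \<delta>_def intro: Min_le, use Mp C in simp)+
    show "\<gamma> t \<in> E_seq_set Q"
    proof (rule E_seq_setI[OF \<delta>0])
      fix m assume m: "m0 \<le> m"
      show "\<delta> \<le> Q m * min_product (\<gamma> t) (Q m)"
      proof (rule min_product_geI[OF Q1[OF m]])
        fix q :: nat assume q: "1 \<le> q" "real q \<le> Q m"
        have sgn: "dist_int (real q * (e * z)) = dist_int (real q * z)" if "e = 1 \<or> e = - 1" for e z :: real
          using that dist_int_minus[of "real q * z"] by auto
        show "\<delta> \<le> Q m * (dist_int (real q * fst (\<gamma> t)) * dist_int (real q * snd (\<gamma> t)))"
        proof (cases "dist_int (real q * fst (\<gamma> t)) \<le> dist_int (real q * snd (\<gamma> t))")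
          case True
          obtain P1 where P1: "dist_int (real q * (e1 * fst (\<gamma> t))) = \<bar>real q * (e1 * fst (\<gamma> t)) - of_int P1\<bar>"
            using dist_int_attained by blast
          obtain P2 where P2: "dist_int (real q * (e2 * snd (\<gamma> t))) = \<bar>real q * (e2 * snd (\<gamma> t)) - of_int P2\<bar>"
            using dist_int_attained by blast
          have "\<delta> \<le> Q m * (\<bar>real q * (e1 * fst (\<gamma> t)) - of_int P1\<bar> * \<bar>real q * (e2 * snd (\<gamma> t)) - of_int P2\<bar>)"
            by (rule A.product_ge_of_repelled[OF rep tb sys(1-3) D(1) \<sigma>0 \<sigma>Q[OF m] C(2) \<delta>0 \<delta>(1-3) q])
              (use True in \<open>auto simp: P1[symmetric] P2[symmetric] sgn signs\<close>)
          then show ?thesis by (simp add: P1[symmetric] P2[symmetric] sgn signs)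
        next
          case False
          obtain P1 where P1: "dist_int (real q * (e1' * snd (\<gamma> t))) = \<bar>real q * (e1' * snd (\<gamma> t)) - of_int P1\<bar>"
            using dist_int_attained by blast
          obtain P2 where P2: "dist_int (real q * (e2' * fst (\<gamma> t))) = \<bar>real q * (e2' * fst (\<gamma> t)) - of_int P2\<bar>"
            using dist_int_attained by blast
          have "\<delta> \<le> Q m * (\<bar>real q * (e1' * snd (\<gamma> t)) - of_int P1\<bar> * \<bar>real q * (e2' * fst (\<gamma> t)) - of_int P2\<bar>)"
            by (rule A'.product_ge_of_repelled[OF rep' tb sys'(1-3) D'(1) \<sigma>0 \<sigma>Q[OF m] C(3) \<delta>0 \<delta>(1,4,5) q])
              (use False in \<open>auto simp: P1[symmetric] P2[symmetric] sgn signs\<close>)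
          then show ?thesis by (simp add: P1[symmetric] P2[symmetric] sgn signs mult.commute)
        qed
      qed
    qed
  qed
qed

text \<open>A chart of the curve need not be twice differentiable, so the game is played in the chart
  space while the convexity comes from a \<open>C\<^sup>2\<close> parametrization near the limit point.\<close>

lemma absolutely_winning_on_superset:
  fixes Q :: "nat \<Rightarrow> real" and C S :: "(real \<times> real) set"
  assumes Q: "strict_mono Q" "\<And>m. 0 < Q m" "filterlim Q at_top sequentially"
      "\<exists>\<tau>>1. 0 < (INF m. Q (Suc m) / Q m powr \<tau>)"
    and C: "regular_C2_curve C" and curved: "absolutely_winning_on C {z \<in> C. curvature C z \<noteq> 0}"
    and S: "E_seq_set Q \<subseteq> S"
  shows "absolutely_winning_on C (S \<inter> C)"
  unfolding absolutely_winning_on_def HAW_on_def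
proof (intro allI impI)
  fix U \<phi> and \<beta> :: real
  assume chart: "C1_chart C U \<phi>" and \<beta>: "0 < \<beta> \<and> \<beta> < 1 / 3"
  define I where "I = \<phi> ` U"
  obtain \<gamma> where hom: "homeomorphism U I \<phi> \<gamma>" and g: "local_param C I \<gamma>"
    using chart unfolding C1_chart_def I_def by blast
  note D = local_paramD[OF g]
  have inv: "\<And>t. t \<in> I \<Longrightarrow> \<phi> (\<gamma> t) = t" "\<And>z. z \<in> U \<Longrightarrow> \<gamma> (\<phi> z) = z" "\<gamma> ` I = U"
    using hom unfolding homeomorphism_def by auto
  obtain \<sigma> where \<sigma>: "legal_strategy \<beta> \<sigma>" "winning_strategy I (\<phi> ` ({z \<in> C. curvature C z \<noteq> 0} \<inter> U)) \<beta> \<sigma>"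
    using curved chart \<beta> unfolding absolutely_winning_on_def HAW_on_def I_def by blast
  show "\<exists>\<sigma>. legal_strategy \<beta> \<sigma> \<and> winning_strategy (\<phi> ` U) (\<phi> ` (S \<inter> C \<inter> U)) \<beta> \<sigma>"
    unfolding I_def[symmetric]
  proof (rule winning_strategy_reach[OF \<sigma>(1)])
    show "0 < \<beta>" using \<beta> by simp
    fix B :: "nat \<Rightarrow> real \<times> real"
    assume play: "play_against I \<beta> \<sigma> B" and lim: "(\<lambda>n. snd (B n)) \<longlonglongrightarrow> 0"
    have "(\<Inter>n. cball (fst (B n)) (snd (B n))) \<inter> \<phi> ` ({z \<in> C. curvature C z \<noteq> 0} \<inter> U) \<noteq> {}"
      using \<sigma>(2) play lim unfolding winning_strategy_def by simp
    then obtain z where z: "z \<in> U" "curvature C z \<noteq> 0" "\<phi> z \<in> (\<Inter>n. cball (fst (B n)) (snd (B n)))" by blast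
    then have zB: "\<phi> z \<in> cball (fst (B n)) (snd (B n))" for n by blast
    define t0 where "t0 = \<phi> z"
    have t0: "t0 \<in> I" "curvature C (\<gamma> t0) \<noteq> 0" unfolding t0_def I_def using z inv(2) by auto
    obtain r where r: "0 < r" "ball t0 r \<subseteq> I"
      and arcs: "\<And>c \<rho>. 0 < \<rho> \<Longrightarrow> cball c \<rho> \<subseteq> ball t0 r - {t0} \<Longrightarrow>
        (\<exists>e1 e2 \<Phi> M. (e1 = 1 \<or> e1 = - 1) \<and> (e2 = 1 \<or> e2 = - 1) \<and>
          convex_arc (\<lambda>t. e1 * fst (\<gamma> t)) (\<lambda>t. e2 * snd (\<gamma> t)) \<Phi> M c \<rho>) \<and>
        (\<exists>e1 e2 \<Phi> M. (e1 = 1 \<or> e1 = - 1) \<and> (e2 = 1 \<or> e2 = - 1) \<and>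
          convex_arc (\<lambda>t. e1 * snd (\<gamma> t)) (\<lambda>t. e2 * fst (\<gamma> t)) \<Phi> M c \<rho>)"
      using convex_arcs_near_curved_point[OF C g t0] by blast
    have "eventually (\<lambda>n. snd (B n) < r / 2) sequentially" by (rule order_tendstoD(2)[OF lim]) (use r(1) in simp)
    then obtain n where n: "snd (B n) < r / 2" by (auto simp: eventually_sequentially)
    have Bn: "cball (fst (B n)) (snd (B n)) \<subseteq> ball t0 r"
    proof
      fix x assume "x \<in> cball (fst (B n)) (snd (B n))"
      then show "x \<in> ball t0 r" using zB[of n] n unfolding t0_def[symmetric] by (auto simp: dist_real_def)
    qed
    have "wins_from \<beta> (\<phi> ` (S \<inter> C \<inter> U)) (fst (B n), snd (B n))"
    proof (rule wins_from_delete_point[where t = t0])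
      show "0 < \<beta>" "\<beta> < 1" using \<beta> by auto
      fix c \<rho> :: real assume \<rho>: "0 < \<rho>" "cball c \<rho> \<subseteq> cball (fst (B n)) (snd (B n)) - {t0}"
      then have sub: "cball c \<rho> \<subseteq> ball t0 r - {t0}" using Bn by blast
      have "wins_from \<beta> {t. \<gamma> t \<in> E_seq_set Q} (c, \<rho>)"
        using arcs[OF \<rho>(1) sub] convex_arc_wins[OF Q, of \<beta>] \<beta> by (elim conjE exE) auto
      then show "wins_from \<beta> (\<phi> ` (S \<inter> C \<inter> U)) (c, \<rho>)"
      proof (rule wins_from_mono, intro subsetI)
        fix t assume "t \<in> {t. \<gamma> t \<in> E_seq_set Q} \<inter> cball (fst (c, \<rho>)) (snd (c, \<rho>))"
        then have "\<gamma> t \<in> S" "t \<in> I" using S sub r(2) by auto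
        then have "\<gamma> t \<in> S \<inter> C \<inter> U" "t = \<phi> (\<gamma> t)" using D(4) inv by auto
        then show "t \<in> \<phi> ` (S \<inter> C \<inter> U)" by blast
      qed
    qed
    then show "\<exists>n. wins_from \<beta> (\<phi> ` (S \<inter> C \<inter> U)) (B n)" by auto
  qed
qed

theorem theorem1p7:
  fixes Q :: "nat \<Rightarrow> real" and C :: "(real \<times> real) set"
  assumes "strict_mono Q" and "\<And>m. 0 < Q m" and "1 < Q 0"
    and "filterlim Q at_top sequentially"
    and "\<exists>\<tau>>1. 0 < (INF m. Q (Suc m) / Q m powr \<tau>)"
    and "regular_C2_curve C"
    and "absolutely_winning_on C {z \<in> C. curvature C z \<noteq> 0}"
  shows "absolutely_winning_on C (E_set \<inter> C) \<and>
    absolutely_winning_on C (E_seq_set Q \<inter> C) \<and>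
    (\<forall>A. open_arc C A \<longrightarrow>
      hausdorff_dim (E_set \<inter> C \<inter> A) = 1 \<and> hausdorff_dim (E_seq_set Q \<inter> C \<inter> A) = 1)"
proof -
  have E: "absolutely_winning_on C (E_set \<inter> C)"
    by (rule absolutely_winning_on_superset[OF assms(1,2,4-7) E_seq_set_subset_E_set[OF assms(4)]])
  have Eseq: "absolutely_winning_on C (E_seq_set Q \<inter> C)"
    by (rule absolutely_winning_on_superset[OF assms(1,2,4-7) order_refl])
  have arc: "openin (top_of_set C) A \<and> A \<noteq> {}" if A: "open_arc C A" for A
  proof
    show "openin (top_of_set C) A" using A unfolding open_arc_def by blast
    have "A homeomorphic {0<..<1::real}" using A unfolding open_arc_def by blast
    then show "A \<noteq> {}" using homeomorphic_empty by fastforce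
  qed
  show ?thesis
    using E Eseq arc hausdorff_dim_winning_on_arc[OF assms(6) E] hausdorff_dim_winning_on_arc[OF assms(6) Eseq] by blast
qed

end
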